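(* Let $\Omega\subset\mathbb{R}^d$, $d\ge 1$, be a bounded Lipschitz domain, let $\mathcal{R}_\Omega$ be the reachable set of the heat equation on $\Omega$, and let $\mathcal{E}(\Omega)=\{x+\mathrm{i}y\in\mathbb{C}^d : x\in\Omega,\ y\in\mathbb{R}^d,\ |y|<\mathrm{dist}(x,\partial\Omega)\}$. Then $$\mathcal{R}_\Omega\subset\mathcal{O}(\mathcal{E}(\Omega)),$$ i.e. every $v\in\mathcal{R}_\Omega$ is the restriction to $\Omega$ of a holomorphic function on $\mathcal{E}(\Omega)$. Moreover, the domain $\mathcal{E}(\Omega)$ is optimal in the following sense: for every $p\in\mathbb{C}^d\setminus\overline{\mathcal{E}(\Omega)}$ there exists a function $u\in\mathcal{R}_\Omega$ which does not have an analytic extension to a connected open subset of $\mathbb{C}^d$ containing $p$ and $\Omega$.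
   Context: A domain is a non-empty open connected set. A bounded Lipschitz domain is a bounded domain whose boundary is locally congruent to the graph of a Lipschitz function on $\mathbb{R}^{d-1}$, with $\Omega$ located on exactly one side of it. $\mathbb{R}^d$ is regarded as a subset of $\mathbb{C}^d$, and $|\cdot|$ is the Euclidean norm. Function spaces. For $T>0$ put $Q=(0,T)\times\Omega$ and $\Sigma=(0,T)\times\partial\Omega$. For $r,s\ge0$, $H^{r,s}(\mathbb{R}\times\mathbb{R}^d)=L^2(\mathbb{R};H^r(\mathbb{R}^d))\cap H^s(\mathbb{R};L^2(\mathbb{R}^d))$; $H^{r,s}(Q)$ is the space of restrictions of its elements to $Q$ with the quotient norm. For $0\le r\le1$, $H^{r,s}(\mathbb{R}\times\partial\Omega)$ and $H^{r,s}(\Sigma)$ are defined analogously. There is a continuous trace map $\gamma:u\mapsto u|_\Sigma$ from $H^{1,1/2}(Q)$ to $H^{1/2,1/4}(\Sigma)$. An element $u\in H^{1,1/2}(Q)$ with $(\partial_t-\Delta)u\in L^2(Q)$ lies in $C([0,T],H^{-1}(\Omega))$, so $u|_{t=0}$ makes sense. Reachable set. For $u_0\in H^1_0(\Omega)$ and $h\in H^{1/2,1/4}(\Sigma)$ the problem $\partial_tu=\Delta u$ in $Q$, $u|_{t=0}=u_0$ in $\Omega$, $\gamma u=h$ on $\Sigma$ has a unique solution $u\in H^{1,1/2}(Q)$, and it is in $C^\infty((0,T]\times\Omega)$. Define $\mathcal{R}_\Omega(T,u_0)\subset C^\infty(\Omega)$ as the set of functions $v$ on $\Omega$ with $v(x)=u(T,x)$,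 where $u$ solves this problem for some $h\in H^{1/2,1/4}(\Sigma)$. By null-controllability $\mathcal{R}_\Omega(T,u_0)=\mathcal{R}_\Omega(T,0)$, and this set does not depend on $T>0$. The reachable set is $\mathcal{R}_\Omega:=\mathcal{R}_\Omega(T,0)$ for some (hence all) $T>0$. Holomorphic functions. For open $U\subset\mathbb{C}^d$, $\mathcal{O}(U)$ is the set of holomorphic functions on $U$. A function in $\mathcal{O}(\mathcal{E}(\Omega))$ is determined by its restriction to $\Omega$, and $\mathcal{O}(\mathcal{E}(\Omega))$ is viewed in this way as a subset of $C^\infty(\Omega)$. *)

theory Defs
  imports "HOL-Analysis.Analysis"
begin

section \<open>Bounded Lipschitz domains\<close>

text \<open>
  Up to a rigid motion, the graph of a function on \<open>\<real>\<^sup>d\<^sup>-\<^sup>1\<close> is the set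
  \<open>{y. y \<bullet> e = g (y - (y \<bullet> e) e)}\<close>, where \<open>e\<close> is a unit vector and \<open>g\<close> is a function on the
  hyperplane orthogonal to \<open>e\<close>.  For \<open>d = 1\<close> the hyperplane is \<open>{0}\<close>.
\<close>

definition bounded_lipschitz_domain :: "(real^'n::finite) set \<Rightarrow> bool" where
  "bounded_lipschitz_domain \<Omega> \<longleftrightarrow>
     \<Omega> \<noteq> {} \<and> open \<Omega> \<and> connected \<Omega> \<and> bounded \<Omega> \<and>
     (\<forall>x\<in>frontier \<Omega>. \<exists>V e L. \<exists>g :: real^'n \<Rightarrow> real.
        open V \<and> x \<in> V \<and> norm e = 1 \<and> L-lipschitz_on {y. y \<bullet> e = 0} g \<and>
        \<Omega> \<inter> V = {y \<in> V. g (y - (y \<bullet> e) *\<^sub>R e) < y \<bullet> e} \<and>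
        frontier \<Omega> \<inter> V = {y \<in> V. y \<bullet> e = g (y - (y \<bullet> e) *\<^sub>R e)})"

section \<open>Smooth functions and test functions\<close>

definition dderiv ::
  "'a::euclidean_space \<Rightarrow> ('a \<Rightarrow> 'b::real_normed_vector) \<Rightarrow> 'a \<Rightarrow> 'b" where
  "dderiv v f = (\<lambda>x. frechet_derivative f (at x) v)"

primrec Ck_on ::
  "nat \<Rightarrow> 'a::euclidean_space set \<Rightarrow> ('a \<Rightarrow> 'b::real_normed_vector) \<Rightarrow> bool" where
  "Ck_on 0 W f \<longleftrightarrow> continuous_on W f"
| "Ck_on (Suc k) W f \<longleftrightarrow>
     (\<forall>x\<in>W. f differentiable (at x)) \<and> (\<forall>b\<in>Basis. Ck_on k W (dderiv b f))"

text \<open>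
  On a set that is not open, a smooth function is one that extends smoothly to an open
  neighbourhood.  On \<open>(0,T] \<times> \<Omega>\<close> this means that all derivatives extend continuously up to
  \<open>t = T\<close> (Seeley's extension theorem).
\<close>

definition smooth_on ::
  "'a::euclidean_space set \<Rightarrow> ('a \<Rightarrow> 'b::real_normed_vector) \<Rightarrow> bool" where
  "smooth_on S f \<longleftrightarrow>
     (\<exists>W g. open W \<and> S \<subseteq> W \<and> (\<forall>k. Ck_on k W g) \<and> (\<forall>x\<in>S. g x = f x))"

definition test_function :: "'a::euclidean_space set \<Rightarrow> ('a \<Rightarrow> complex) \<Rightarrow> bool" where
  "test_function U \<phi> \<longleftrightarrow>
     smooth_on UNIV \<phi> \<and> (\<exists>K. compact K \<and> K \<subseteq> U \<and> (\<forall>x. x \<notin> K \<longrightarrow> \<phi> x = 0))"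

section \<open>Sobolev spaces on space-time\<close>

text \<open>
  All Sobolev norms are given by their squares with values in \<open>[0,\<infinity>]\<close>; the space consists of
  the measurable functions for which the value is finite.  The domain carries no
  identification of functions that agree almost everywhere.
\<close>

definition weak_gradient ::
  "(real^'n::finite \<Rightarrow> complex) \<Rightarrow> (real^'n \<Rightarrow> complex^'n) \<Rightarrow> bool" where
  "weak_gradient f G \<longleftrightarrow> G \<in> borel_measurable borel \<and>
     (\<forall>\<phi> i. test_function UNIV \<phi> \<longrightarrow>
        (LINT x|lborel. f x * dderiv (axis i 1) \<phi> x) = - (LINT x|lborel. G x $ i * \<phi> x))"

definition H1_sq :: "(real^'n::finite \<Rightarrow> complex) \<Rightarrow> ennreal" where
  "H1_sq f = (INF G\<in>{G. weak_gradient f G}.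
     \<integral>\<^sup>+x. ennreal ((cmod (f x))\<^sup>2 + (norm (G x))\<^sup>2) \<partial>lborel)"

text \<open>
  Sobolev--Slobodeckij norm of \<open>H\<^sup>s(\<real>; L\<^sup>2(M))\<close>, \<open>0 < s < 1\<close>.  The measure \<open>M\<close> is Lebesgue
  measure on \<open>\<real>\<^sup>d\<close> or the surface measure on \<open>\<partial>\<Omega>\<close>.
\<close>

definition Hs_L2_sq :: "real \<Rightarrow> 'a measure \<Rightarrow> (real \<times> 'a \<Rightarrow> complex) \<Rightarrow> ennreal" where
  "Hs_L2_sq s M u =
     (\<integral>\<^sup>+t. \<integral>\<^sup>+x. ennreal ((cmod (u (t, x)))\<^sup>2) \<partial>M \<partial>lborel) +
     (\<integral>\<^sup>+t. \<integral>\<^sup>+t'. \<integral>\<^sup>+x.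
        ennreal ((cmod (u (t, x) - u (t', x)))\<^sup>2 / \<bar>t - t'\<bar> powr (1 + 2 * s)) \<partial>M \<partial>lborel \<partial>lborel)"

text \<open>\<open>H\<^sup>1\<^sup>,\<^sup>s(\<real> \<times> \<real>\<^sup>d) = L\<^sup>2(\<real>; H\<^sup>1(\<real>\<^sup>d)) \<inter> H\<^sup>s(\<real>; L\<^sup>2(\<real>\<^sup>d))\<close>\<close>

definition H1s_sq :: "real \<Rightarrow> (real \<times> (real^'n::finite) \<Rightarrow> complex) \<Rightarrow> ennreal" where
  "H1s_sq s u = (\<integral>\<^sup>+t. H1_sq (\<lambda>x. u (t, x)) \<partial>lborel) + Hs_L2_sq s lborel u"

definition cyl :: "real \<Rightarrow> 'a set \<Rightarrow> (real \<times> 'a) set" where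
  "cyl T \<Omega> = {0<..<T} \<times> \<Omega>"

text \<open>The quotient norm of \<open>H\<^sup>1\<^sup>,\<^sup>s(Q)\<close>; the value is \<open>\<infinity>\<close> if there is no extension.\<close>

definition H1s_Q_sq ::
  "real \<Rightarrow> real \<Rightarrow> (real^'n::finite) set \<Rightarrow> (real \<times> (real^'n) \<Rightarrow> complex) \<Rightarrow> ennreal" where
  "H1s_Q_sq s T \<Omega> u =
     (INF w\<in>{w \<in> borel_measurable borel. AE z in lborel. z \<in> cyl T \<Omega> \<longrightarrow> w z = u z}. H1s_sq s w)"

definition H1s_Q ::
  "real \<Rightarrow> real \<Rightarrow> (real^'n::finite) set \<Rightarrow> (real \<times> (real^'n) \<Rightarrow> complex) set" where
  "H1s_Q s T \<Omega> = {u. H1s_Q_sq s T \<Omega> u < \<infinity>}"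

section \<open>Sobolev spaces on the lateral boundary\<close>

text \<open>
  The \<open>k\<close>-dimensional Hausdorff measure, normalised so as to be surface measure.  The empty
  set is treated separately because \<open>diameter {} ^ 0 = 1\<close>.
\<close>

definition hausdorff_pre :: "nat \<Rightarrow> real \<Rightarrow> 'a::metric_space set \<Rightarrow> ennreal" where
  "hausdorff_pre k \<delta> A =
     (INF C\<in>{C :: nat \<Rightarrow> 'a set. A \<subseteq> (\<Union>i. C i) \<and> (\<forall>i. bounded (C i) \<and> diameter (C i) \<le> \<delta>)}.
        \<Sum>i. if C i = {} then 0 else ennreal (unit_ball_vol (real k) * (diameter (C i) / 2) ^ k))"

definition hausdorff_measure :: "nat \<Rightarrow> 'a::metric_space measure" where
  "hausdorff_measure k =
     measure_of UNIV (sets borel) (\<lambda>A. SUP \<delta>\<in>{0<..}. hausdorff_pre k \<delta> A)"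

definition surface_measure :: "(real^'n::finite) set \<Rightarrow> (real^'n) measure" where
  "surface_measure \<Omega> = restrict_space (hausdorff_measure (CARD('n) - 1)) (frontier \<Omega>)"

text \<open>
  Sobolev--Slobodeckij norm of \<open>H\<^sup>r(\<partial>\<Omega>)\<close>, \<open>0 < r < 1\<close>; the boundary has dimension \<open>d - 1\<close>.
\<close>

definition Hr_bd_sq ::
  "real \<Rightarrow> (real^'n::finite) set \<Rightarrow> (real^'n \<Rightarrow> complex) \<Rightarrow> ennreal" where
  "Hr_bd_sq r \<Omega> f =
     (\<integral>\<^sup>+x. ennreal ((cmod (f x))\<^sup>2) \<partial>surface_measure \<Omega>) +
     (\<integral>\<^sup>+x. \<integral>\<^sup>+y.
        ennreal ((cmod (f x - f y))\<^sup>2 / norm (x - y) powr (real CARD('n) - 1 + 2 * r))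
        \<partial>surface_measure \<Omega> \<partial>surface_measure \<Omega>)"

definition Hrs_bd_sq ::
  "real \<Rightarrow> real \<Rightarrow> (real^'n::finite) set \<Rightarrow> (real \<times> (real^'n) \<Rightarrow> complex) \<Rightarrow> ennreal" where
  "Hrs_bd_sq r s \<Omega> h =
     (\<integral>\<^sup>+t. Hr_bd_sq r \<Omega> (\<lambda>x. h (t, x)) \<partial>lborel) + Hs_L2_sq s (surface_measure \<Omega>) h"

definition Hrs_Sigma_sq ::
  "real \<Rightarrow> real \<Rightarrow> real \<Rightarrow> (real^'n::finite) set \<Rightarrow> (real \<times> (real^'n) \<Rightarrow> complex) \<Rightarrow> ennreal" where
  "Hrs_Sigma_sq r s T \<Omega> h =
     (INF k\<in>{k \<in> borel_measurable (lborel \<Otimes>\<^sub>M surface_measure \<Omega>).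
               AE t in lborel. AE x in surface_measure \<Omega>. 0 < t \<and> t < T \<longrightarrow> k (t, x) = h (t, x)}.
        Hrs_bd_sq r s \<Omega> k)"

definition Hrs_Sigma ::
  "real \<Rightarrow> real \<Rightarrow> real \<Rightarrow> (real^'n::finite) set \<Rightarrow> (real \<times> (real^'n) \<Rightarrow> complex) set" where
  "Hrs_Sigma r s T \<Omega> = {h. Hrs_Sigma_sq r s T \<Omega> h < \<infinity>}"

text \<open>
  The graph of the trace map \<open>\<gamma>\<close> from \<open>H\<^sup>1\<^sup>,\<^sup>1\<^sup>/\<^sup>2(Q)\<close> to \<open>H\<^sup>1\<^sup>/\<^sup>2\<^sup>,\<^sup>1\<^sup>/\<^sup>4(\<Sigma>)\<close>: the continuous extension of the
  restriction map, defined on the restrictions to \<open>Q\<close> of functions in \<open>C\<^sub>c\<^sup>\<infinity>(\<real> \<times> \<real>\<^sup>d)\<close>, which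
  are dense.
\<close>

definition is_trace ::
  "real \<Rightarrow> (real^'n::finite) set \<Rightarrow> (real \<times> (real^'n) \<Rightarrow> complex) \<Rightarrow> (real \<times> (real^'n) \<Rightarrow> complex) \<Rightarrow> bool"
  where
  "is_trace T \<Omega> u h \<longleftrightarrow>
     (\<exists>\<Phi> :: nat \<Rightarrow> real \<times> (real^'n) \<Rightarrow> complex.
        (\<forall>n. test_function UNIV (\<Phi> n)) \<and>
        (\<lambda>n. H1s_Q_sq (1/2) T \<Omega> (\<lambda>z. \<Phi> n z - u z)) \<longlonglongrightarrow> 0 \<and>
        (\<lambda>n. Hrs_Sigma_sq (1/2) (1/4) T \<Omega> (\<lambda>z. \<Phi> n z - h z)) \<longlonglongrightarrow> 0)"

section \<open>The heat equation and the reachable set\<close>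

text \<open>\<open>\<partial>\<^sub>t u = \<Delta> u\<close> in the sense of distributions on \<open>Q\<close>\<close>

definition heat_equation ::
  "real \<Rightarrow> (real^'n::finite) set \<Rightarrow> (real \<times> (real^'n) \<Rightarrow> complex) \<Rightarrow> bool" where
  "heat_equation T \<Omega> u \<longleftrightarrow>
     (\<forall>\<phi>. test_function (cyl T \<Omega>) \<phi> \<longrightarrow>
        (LINT z:cyl T \<Omega>|lebesgue. u z * - dderiv (1, 0) \<phi> z) =
        (LINT z:cyl T \<Omega>|lebesgue.
           u z * (\<Sum>i\<in>UNIV. dderiv (0, axis i 1) (dderiv (0, axis i 1) \<phi>) z)))"

text \<open>The norm of \<open>H\<^sup>-\<^sup>1(\<Omega>)\<close>, the dual of \<open>H\<^sup>1\<^sub>0(\<Omega>)\<close>, in which \<open>C\<^sub>c\<^sup>\<infinity>(\<Omega>)\<close> is dense.\<close>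

definition Hm1_norm :: "(real^'n::finite) set \<Rightarrow> (real^'n \<Rightarrow> complex) \<Rightarrow> ennreal" where
  "Hm1_norm \<Omega> f =
     (SUP \<phi>\<in>{\<phi>. test_function \<Omega> \<phi> \<and> H1_sq \<phi> \<le> 1}.
        ennreal (cmod (LINT x:\<Omega>|lebesgue. f x * \<phi> x)))"

text \<open>
  \<open>u|\<^sub>t\<^sub>=\<^sub>0 = u\<^sub>0\<close>, where \<open>u\<close> is an almost everywhere defined representative of an element of
  \<open>C([0,T], H\<^sup>-\<^sup>1(\<Omega>))\<close>.
\<close>

definition initial_value ::
  "(real^'n::finite) set \<Rightarrow> (real \<times> (real^'n) \<Rightarrow> complex) \<Rightarrow> (real^'n \<Rightarrow> complex) \<Rightarrow> bool" where
  "initial_value \<Omega> u u0 \<longleftrightarrow>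
     (\<forall>\<epsilon>>0. \<exists>\<delta>>0. AE t in lborel. 0 < t \<and> t < \<delta> \<longrightarrow>
        Hm1_norm \<Omega> (\<lambda>x. u (t, x) - u0 x) \<le> ennreal \<epsilon>)"

definition heat_solution ::
  "real \<Rightarrow> (real^'n::finite) set \<Rightarrow> (real^'n \<Rightarrow> complex) \<Rightarrow> (real \<times> (real^'n) \<Rightarrow> complex) \<Rightarrow>
   (real \<times> (real^'n) \<Rightarrow> complex) \<Rightarrow> bool" where
  "heat_solution T \<Omega> u0 h u \<longleftrightarrow>
     u \<in> H1s_Q (1/2) T \<Omega> \<and> heat_equation T \<Omega> u \<and> initial_value \<Omega> u u0 \<and> is_trace T \<Omega> u h"

text \<open>
  The solution is an equivalence class; smoothness on \<open>(0,T] \<times> \<Omega>\<close> selects the representative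
  for which \<open>u(T, x)\<close> is meaningful.  Only the values of \<open>v\<close> on \<open>\<Omega>\<close> matter.
\<close>

definition reachable_from ::
  "real \<Rightarrow> (real^'n::finite) set \<Rightarrow> (real^'n \<Rightarrow> complex) \<Rightarrow> (real^'n \<Rightarrow> complex) set" where
  "reachable_from T \<Omega> u0 =
     {v. \<exists>h\<in>Hrs_Sigma (1/2) (1/4) T \<Omega>. \<exists>u.
           heat_solution T \<Omega> u0 h u \<and> smooth_on ({0<..T} \<times> \<Omega>) u \<and> (\<forall>x\<in>\<Omega>. v x = u (T, x))}"

text \<open>
  The set does not depend on \<open>T > 0\<close>, but this is a theorem (null-controllability), so the time
  is kept as a parameter.
\<close>

definition reachable_set :: "real \<Rightarrow> (real^'n::finite) set \<Rightarrow> (real^'n \<Rightarrow> complex) set" where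
  "reachable_set T \<Omega> = reachable_from T \<Omega> (\<lambda>x. 0)"

section \<open>Holomorphic functions of several variables\<close>

definition cvec :: "real^'n \<Rightarrow> real^'n \<Rightarrow> complex^'n" where
  "cvec x y = (\<chi> i. Complex (x $ i) (y $ i))"

definition holomorphic_on_n :: "(complex^'n::finite \<Rightarrow> complex) \<Rightarrow> (complex^'n) set \<Rightarrow> bool" where
  "holomorphic_on_n f U \<longleftrightarrow>
     (\<forall>z\<in>U. \<exists>L. (f has_derivative L) (at z) \<and> (\<forall>c w. L (c *s w) = c * L w))"

text \<open>
  \<open>O(U)\<close> for an open set \<open>U\<close> containing \<open>\<Omega>\<close>, viewed as a set of functions on \<open>\<Omega>\<close>
\<close>

definition holo_restrictions ::
  "(real^'n::finite) set \<Rightarrow> (complex^'n) set \<Rightarrow> (real^'n \<Rightarrow> complex) set" where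
  "holo_restrictions \<Omega> U = {v. \<exists>f. holomorphic_on_n f U \<and> (\<forall>x\<in>\<Omega>. v x = f (cvec x 0))}"

definition E_dom :: "(real^'n::finite) set \<Rightarrow> (complex^'n) set" where
  "E_dom \<Omega> = {z. \<exists>x y. z = cvec x y \<and> x \<in> \<Omega> \<and> norm y < infdist x (frontier \<Omega>)}"

end

theory Submission
  imports Defs "HOL-Complex_Analysis.Complex_Analysis" "HOL-Real_Asymp.Real_Asymp"
begin

text \<open>
  Extension: near \<open>x0 \<in> \<Omega>\<close> choose a cutoff \<open>\<psi>\<close> in space that is 1 on \<open>|y - x0| < \<rho>1\<close> and 0 on
  \<open>|y - x0| > \<rho>2\<close>, where \<open>\<rho>2 < dist(x0, \<partial>\<Omega>)\<close>. Testing the equation against \<open>\<psi>(y)\<close> times the backward heat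
  kernel \<open>G(T - s, y - x)\<close> represents \<open>u(T, x)\<close> as the integral of \<open>u\<close> against
  \<open>\<Delta>\<psi> G + 2 \<nabla>\<psi> \<cdot> \<nabla>G\<close>; there is no contribution from \<open>t = 0\<close> because \<open>u\<close> vanishes there. This integrand
  lives on the annulus \<open>\<rho>1 \<le> |y - x0| \<le> \<rho>2\<close>, where \<open>Re (\<Sum>i. (z i - y i)\<^sup>2) > 0\<close> as long as
  \<open>|Re z - x0| + |Im z| < \<rho>1\<close>. Hence one may replace \<open>x\<close> by such complex \<open>z\<close>, and these sets
  exhaust \<open>E(\<Omega>)\<close>.

  Optimality: a point \<open>p\<close> outside the closure of \<open>E(\<Omega>)\<close> admits a pole \<open>y0\<close> outside the closure of \<open>\<Omega>\<close> with
  \<open>|Re p - y0| \<le> |Im p|\<close>. Heat kernels with pole \<open>y0\<close>, released at the times \<open>T - 1/(4 k!)\<close> and suitably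
  weighted, add up at time \<open>T\<close> to \<open>\<Sum>k. exp (- k! |x - y0|\<^sup>2)\<close>. The holomorphic function \<open>\<Sum>k. exp (- k! w)\<close>
  of \<open>w\<close> has the imaginary axis as natural boundary, so the sum does not extend across the cone
  \<open>Re (\<Sum>i. (z i - y0 i)\<^sup>2) = 0\<close>, which separates \<open>p\<close> from \<open>\<Omega>\<close>.
\<close>

section \<open>Calculus of \<open>Ck\<close> functions\<close>

text \<open>The obstacle in the first half is regularity: u has an initial value only in the H^(-1)
  sense, and the kernel with pole (T, x) is singular exactly where u is evaluated, so it is not an
  admissible test function. Plateaus in time vanishing near 0 and T repair this. Two limits follow:
  near T the kernel is an approximate identity, against u continuous up to T; near 0 it is smooth,
  so that the H^(-1) condition applies. On the annulus nothing is singular, even at time T. In the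
  second half no boundary value problem is solved: as y0 has positive distance from \<Omega>,
  kernels with pole y0 can be truncated near the pole without being changed on the cylinder, so u is
  a test function on space-time and its own boundary datum. Factorials are used because k! times a
  rational is eventually an integer, which gives blow-up at a dense set of points of the imaginary
  axis. The Lipschitz condition bounds the surface measure, so that this datum has finite boundary
  norm, and provides points outside the closure of \<Omega> near every frontier point.\<close>

declare Ck_on.simps(2) [simp del]

lemma dderiv_eq: "(f has_derivative f') (at x) \<Longrightarrow> dderiv v f x = f' v"
  unfolding dderiv_def using frechet_derivative_at by metis

lemma dderiv_has_derivative:
  "f differentiable (at x) \<Longrightarrow> (f has_derivative (\<lambda>v. dderiv v f x)) (at x)"
  unfolding dderiv_def by (simp add: frechet_derivative_works)

lemma has_derivative_cong_open:
  assumes "open W" "x \<in> W" "\<And>y. y \<in> W \<Longrightarrow> f y = g y"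
  shows "(f has_derivative f') (at x) \<longleftrightarrow> (g has_derivative f') (at x)"
  using assms by (metis has_derivative_transform_within_open)

lemma dderiv_cong_open:
  assumes "open W" "x \<in> W" "\<And>y. y \<in> W \<Longrightarrow> f y = g y"
  shows "dderiv v f x = dderiv v g x"
  unfolding dderiv_def frechet_derivative_def using has_derivative_cong_open[OF assms] by simp

lemma differentiable_cong_open:
  assumes "open W" "x \<in> W" "\<And>y. y \<in> W \<Longrightarrow> f y = g y"
  shows "f differentiable (at x) \<longleftrightarrow> g differentiable (at x)"
  unfolding differentiable_def using has_derivative_cong_open[OF assms] by simp

lemma Ck_on_cong:
  assumes "open W" "\<And>y. y \<in> W \<Longrightarrow> f y = g y"
  shows "Ck_on k W f \<longleftrightarrow> Ck_on k W g"
  using assms(2)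
proof (induction k arbitrary: f g)
  case 0 then show ?case by (simp cong: continuous_on_cong)
next
  case (Suc k)
  have "Ck_on k W (dderiv b f) \<longleftrightarrow> Ck_on k W (dderiv b g)" for b
    by (rule Suc.IH, rule dderiv_cong_open[OF \<open>open W\<close>]) (use Suc.prems in auto)
  moreover have "f differentiable (at x) \<longleftrightarrow> g differentiable (at x)" if "x \<in> W" for x
    by (rule differentiable_cong_open[OF \<open>open W\<close> that]) (use Suc.prems in auto)
  ultimately show ?case by (simp add: Ck_on.simps(2))
qed

lemma Ck_on_subset: "Ck_on k W f \<Longrightarrow> V \<subseteq> W \<Longrightarrow> Ck_on k V f"
  by (induction k arbitrary: f) (auto simp: Ck_on.simps(2) intro: continuous_on_subset)

lemma Ck_on_continuous: "Ck_on k W f \<Longrightarrow> continuous_on W f"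
  by (cases k) (auto simp: Ck_on.simps(2) continuous_at_imp_continuous_on differentiable_imp_continuous_within)

lemma Ck_on_SucD: "Ck_on (Suc k) W f \<Longrightarrow> Ck_on k W f"
proof (induction k arbitrary: f)
  case 0 then show ?case using Ck_on_continuous[OF 0] by simp
next
  case (Suc k) then show ?case by (simp add: Ck_on.simps(2))
qed

lemma Ck_on_SucI:
  assumes "open W" "\<And>x. x \<in> W \<Longrightarrow> (f has_derivative f' x) (at x)"
    and "\<And>b. b \<in> Basis \<Longrightarrow> Ck_on k W (\<lambda>x. f' x b)"
  shows "Ck_on (Suc k) W f"
proof -
  have "Ck_on k W (dderiv b f)" if "b \<in> Basis" for b
    using Ck_on_cong[OF \<open>open W\<close>, of "dderiv b f" "\<lambda>x. f' x b"] assms(3)[OF that] dderiv_eq[OF assms(2)]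
    by simp
  then show ?thesis using assms(2) by (auto simp: differentiable_def Ck_on.simps(2))
qed

lemma Ck_on_Suc_dest:
  assumes "Ck_on (Suc k) W f"
  shows "\<And>x. x \<in> W \<Longrightarrow> f differentiable (at x)"
    and "\<And>x. x \<in> W \<Longrightarrow> (f has_derivative (\<lambda>v. dderiv v f x)) (at x)"
    and "\<And>b. b \<in> Basis \<Longrightarrow> Ck_on k W (dderiv b f)"
  using assms dderiv_has_derivative by (auto simp: Ck_on.simps(2))

lemma Ck_on_const: "open W \<Longrightarrow> Ck_on k W (\<lambda>x. c)"
proof (induction k arbitrary: c)
  case (Suc k)
  then show ?case by (intro Ck_on_SucI) (auto intro!: derivative_eq_intros)
qed simp

lemma Ck_on_bounded_linear:
  assumes "open W" "bounded_linear f" shows "Ck_on k W f"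
proof (cases k)
  case 0 then show ?thesis using assms(2) by (simp add: linear_continuous_on)
next
  case (Suc j)
  then show ?thesis
    using assms by (auto intro!: Ck_on_SucI[where f'="\<lambda>_. f"] Ck_on_const bounded_linear_imp_has_derivative)
qed

lemma Ck_on_add:
  assumes "open W" "Ck_on k W f" "Ck_on k W g" shows "Ck_on k W (\<lambda>x. f x + g x)"
  using assms(2,3)
proof (induction k arbitrary: f g)
  case (Suc k)
  show ?case
    using Suc.prems
    by (intro Ck_on_SucI[OF \<open>open W\<close>, where f'="\<lambda>x v. dderiv v f x + dderiv v g x"])
       (auto intro!: has_derivative_add Ck_on_Suc_dest Suc.IH)
qed (simp add: continuous_on_add)

lemma Ck_on_sum:
  assumes "open W" "\<And>i. i \<in> I \<Longrightarrow> Ck_on k W (f i)" shows "Ck_on k W (\<lambda>x. \<Sum>i\<in>I. f i x)"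
  using assms(2)
  by (induction I rule: infinite_finite_induct) (auto intro: Ck_on_const Ck_on_add assms(1))

lemma Ck_on_bilinear:
  assumes "bounded_bilinear P" "open W" "Ck_on k W f" "Ck_on k W g"
  shows "Ck_on k W (\<lambda>x. P (f x) (g x))"
  using assms(3,4)
proof (induction k arbitrary: f g)
  case 0 then show ?case using assms(1) by (simp add: bounded_bilinear.continuous_on)
next
  case (Suc k)
  have k: "Ck_on k W f" "Ck_on k W g" using Suc.prems Ck_on_SucD by auto
  show ?case
    using Suc.prems k
    by (intro Ck_on_SucI[OF \<open>open W\<close>, where f'="\<lambda>x v. P (f x) (dderiv v g x) + P (dderiv v f x) (g x)"])
       (auto intro!: Ck_on_add assms(2) bounded_bilinear.FDERIV[OF assms(1)] Ck_on_Suc_dest Suc.IH)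
qed

lemmas Ck_on_scaleR = Ck_on_bilinear[OF bounded_bilinear_scaleR]
lemmas Ck_on_mult = Ck_on_bilinear[OF bounded_bilinear_mult]
lemmas Ck_on_inner = Ck_on_bilinear[OF bounded_bilinear_inner]

lemma Ck_on_linear_comp:
  assumes "bounded_linear L" "open W" "Ck_on k W f"
  shows "Ck_on k W (\<lambda>x. L (f x))"
  using assms(3)
proof (induction k arbitrary: f)
  case 0 then show ?case using assms(1) by (simp add: bounded_linear.continuous_on)
next
  case (Suc k)
  then show ?case
    by (intro Ck_on_SucI[OF \<open>open W\<close>, where f'="\<lambda>x v. L (dderiv v f x)"])
       (auto intro!: bounded_linear.has_derivative[OF assms(1)] Ck_on_Suc_dest)
qed

lemma linear_euclidean_sum:
  fixes F :: "'a::euclidean_space \<Rightarrow> 'b::real_vector"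
  assumes "linear F" shows "F w = (\<Sum>b\<in>Basis. (w \<bullet> b) *\<^sub>R F b)"
proof -
  have "F w = F (\<Sum>b\<in>Basis. (w \<bullet> b) *\<^sub>R b)" by (simp add: euclidean_representation)
  also have "\<dots> = (\<Sum>b\<in>Basis. (w \<bullet> b) *\<^sub>R F b)"
    using assms by (simp add: linear_sum linear_scale)
  finally show ?thesis .
qed

text \<open>\<open>Ck_on\<close> only records derivatives along \<open>Basis\<close>; linearity of
  the derivative writes any other direction as a combination of these with constant
  coefficients.\<close>

lemma Ck_on_dderiv:
  assumes W: "open W" and f: "Ck_on (Suc k) W f" shows "Ck_on k W (dderiv v f)"
proof -
  let ?g = "\<lambda>x. \<Sum>b\<in>Basis. (v \<bullet> b) *\<^sub>R dderiv b f x"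
  have eq: "dderiv v f x = ?g x" if "x \<in> W" for x
    by (rule linear_euclidean_sum[of "\<lambda>v. dderiv v f x"], rule bounded_linear.linear,
        rule has_derivative_bounded_linear, rule Ck_on_Suc_dest(2)[OF f that])
  have "Ck_on k W ?g"
    by (intro Ck_on_sum[OF W] Ck_on_scaleR[OF W] Ck_on_const[OF W] Ck_on_Suc_dest(3)[OF f])
  then show ?thesis
    by (subst Ck_on_cong[OF W eq])
qed

text \<open>The chain rule is expanded in \<open>Basis\<close> of the intermediate space, so that
  only partial derivatives of \<open>f\<close> appear. Each of them is composed with the same
  \<open>g\<close>, hence the induction generalises over \<open>f\<close> alone.\<close>

lemma Ck_on_compose:
  fixes f :: "'b::euclidean_space \<Rightarrow> 'c::real_normed_vector" and g :: "'a::euclidean_space \<Rightarrow> 'b"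
  assumes "open V" "open W" "g ` W \<subseteq> V" "Ck_on k V f" "Ck_on k W g"
  shows "Ck_on k W (\<lambda>x. f (g x))"
  using assms(4,5)
proof (induction k arbitrary: f)
  case 0 then show ?case using assms(3) by (auto intro: continuous_on_compose2)
next
  case (Suc k)
  have k: "Ck_on k W g" using Suc.prems Ck_on_SucD by auto
  have d: "((\<lambda>x. f (g x)) has_derivative (\<lambda>v. \<Sum>c\<in>Basis. (dderiv v g x \<bullet> c) *\<^sub>R dderiv c f (g x))) (at x)"
    if "x \<in> W" for x
  proof -
    have f: "(f has_derivative (\<lambda>v. dderiv v f (g x))) (at (g x))"
      using Suc.prems that assms(3) by (intro Ck_on_Suc_dest) auto
    have g: "(g has_derivative (\<lambda>v. dderiv v g x)) (at x)"
      using Suc.prems that by (intro Ck_on_Suc_dest) auto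
    have "linear (\<lambda>v. dderiv v f (g x))"
      using f has_derivative_bounded_linear bounded_linear.linear by blast
    then have eq: "dderiv w f (g x) = (\<Sum>c\<in>Basis. (w \<bullet> c) *\<^sub>R dderiv c f (g x))" for w
      using linear_euclidean_sum[of "\<lambda>v. dderiv v f (g x)" w] by blast
    show ?thesis using has_derivative_compose[OF g f] by (simp flip: eq)
  qed
  show ?case
    using Suc.prems k
    by (intro Ck_on_SucI[OF \<open>open W\<close> d] Ck_on_sum Ck_on_scaleR Suc.IH assms
        Ck_on_inner Ck_on_const Ck_on_Suc_dest) auto
qed

lemma Ck_on_uminus: "open W \<Longrightarrow> Ck_on k W f \<Longrightarrow> Ck_on k W (\<lambda>x. - f x)"
  by (rule Ck_on_linear_comp) (auto intro: bounded_linear_minus[OF bounded_linear_ident])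

lemma Ck_on_inverse:
  fixes f :: "'a::euclidean_space \<Rightarrow> real"
  assumes "open W" "\<And>x. x \<in> W \<Longrightarrow> f x \<noteq> 0" "Ck_on k W f"
  shows "Ck_on k W (\<lambda>x. inverse (f x))"
  using assms(3)
proof (induction k)
  case 0 then show ?case using assms(2) by (auto intro!: continuous_on_inverse)
next
  case (Suc k)
  then have "Ck_on k W f" using Ck_on_SucD by blast
  then show ?case
    using Suc assms(2)
    by (intro Ck_on_SucI[OF \<open>open W\<close>, where f'="\<lambda>x v. - (inverse (f x) * dderiv v f x * inverse (f x))"])
       (auto intro!: Ck_on_uminus Ck_on_mult assms(1) Suc.IH derivative_eq_intros Ck_on_Suc_dest)
qed

section \<open>Heat kernels, cutoffs and test functions\<close>

text \<open>
  For \<open>a = d/2\<close> this is the heat kernel up to the factor \<open>(4 \<pi>)\<^sup>-\<^sup>d\<^sup>/\<^sup>2\<close>. Allowing every exponent makes the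
  family closed under differentiation up to polynomial factors.
\<close>

definition hk :: "real \<Rightarrow> real \<times> 'a::euclidean_space \<Rightarrow> real" where
  "hk a p = (if fst p > 0 then fst p powr - a * exp (- (snd p \<bullet> snd p) / (4 * fst p)) else 0)"

definition hk_deriv :: "real \<Rightarrow> real \<times> 'a::euclidean_space \<Rightarrow> real \<times> 'a \<Rightarrow> real" where
  "hk_deriv a p v = fst v * (- a * hk (a + 1) p + (snd p \<bullet> snd p) / 4 * hk (a + 2) p)
     - (snd p \<bullet> snd v) / 2 * hk (a + 1) p"

text \<open>As s tends to 0 from the right, exp (- r / (b s)) beats every negative power of s. The
  rate s^2 is chosen because a quadratic bound forces differentiability with derivative 0 at time
  0.\<close>

lemma powr_exp_small:
  fixes r a b :: real
  assumes "r > 0" "b > 0"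
  shows "\<exists>\<delta>>0. \<forall>s. 0 < s \<and> s < \<delta> \<longrightarrow> s powr a * exp (- r / (b * s)) \<le> s\<^sup>2"
proof -
  have "((\<lambda>s::real. s powr (a - 2) * exp (- r / (b * s))) \<longlongrightarrow> 0) (at_right 0)"
    using assms by real_asymp
  then have "\<forall>\<^sub>F s in at_right 0. s powr (a - 2) * exp (- r / (b * s)) < 1"
    by (rule order_tendstoD) simp
  then obtain \<delta> where \<delta>: "\<delta> > 0" "\<And>s. 0 < s \<Longrightarrow> s < \<delta> \<Longrightarrow> s powr (a - 2) * exp (- r / (b * s)) < 1"
    by (auto simp: eventually_at_right_field)
  have "s powr a * exp (- r / (b * s)) \<le> s\<^sup>2" if s: "0 < s" "s < \<delta>" for s
  proof -
    have "s powr a = s\<^sup>2 * s powr (a - 2)"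
      using s by (simp add: powr_diff powr_numeral)
    then show ?thesis using \<delta>(2)[OF s] s
      by (smt (verit, best) mult.assoc mult_left_le zero_le_power2)
  qed
  then show ?thesis using \<delta> by blast
qed

text \<open>For positive and for negative times this is calculus; the content is the gluing at s = 0
  with x nonzero, where the kernel is flat. Only the origin of space-time is singular.\<close>

lemma hk_has_derivative:
  fixes p :: "real \<times> 'a::euclidean_space"
  assumes "p \<noteq> 0"
  shows "(hk a has_derivative hk_deriv a p) (at p)"
proof -
  obtain s x where p: "p = (s, x)" by fastforce
  consider "s > 0" | "s < 0" | "s = 0" "x \<noteq> 0" using assms p by (force simp: zero_prod_def)
  then show ?thesis
  proof cases
    case 1
    have "((\<lambda>p. fst p powr - a * exp (- (snd p \<bullet> snd p) / (4 * fst p))) has_derivative hk_deriv a p) (at p)"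
      using 1 unfolding p
      by (auto intro!: derivative_eq_intros simp: fun_eq_iff hk_deriv_def hk_def)
        (simp_all add: inner_commute powr_diff powr_add powr_minus field_simps powr_numeral power2_eq_square)
    moreover have "open {p::real \<times> 'a. fst p > 0}"
      by (intro open_Collect_less continuous_intros)
    ultimately show ?thesis
      by (rule has_derivative_transform_within_open) (use 1 p in \<open>auto simp: hk_def\<close>)
  next
    case 2
    have "((\<lambda>p. 0) has_derivative hk_deriv a p) (at p)"
      using 2 unfolding p
      by (auto intro!: derivative_eq_intros simp: fun_eq_iff hk_deriv_def hk_def)
    moreover have "open {p::real \<times> 'a. fst p < 0}"
      by (intro open_Collect_less continuous_intros)
    ultimately show ?thesis
      by (rule has_derivative_transform_within_open) (use 2 p in \<open>auto simp: hk_def\<close>)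
  next
    case 3
    \<comment> \<open>Points within norm x / 2 of p keep a spatial part of length at least norm x /
      2, so the exponent is bounded by - r / (4 s) uniformly there.\<close>
    define r where "r = (norm x / 2)\<^sup>2"
    have "r > 0" using 3 by (simp add: r_def)
    then obtain \<delta> where \<delta>: "\<delta> > 0" "\<And>s. 0 < s \<Longrightarrow> s < \<delta> \<Longrightarrow> s powr - a * exp (- r / (4 * s)) \<le> s\<^sup>2"
      using powr_exp_small[of r 4 "-a"] by auto
    have le: "\<bar>hk a q\<bar> \<le> (norm (q - p))\<^sup>2" if "norm (q - p) < min \<delta> (norm x / 2)" for q
    proof (cases "fst q > 0")
      case True
      have q: "\<bar>fst q\<bar> \<le> norm (q - p)" "norm (snd q - x) \<le> norm (q - p)"
        using norm_fst_le[of "fst (q - p)" "snd (q - p)"] norm_snd_le[of "snd (q - p)" "fst (q - p)"]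
        by (metis p 3(1) fst_conv snd_conv fst_diff snd_diff diff_zero prod.collapse real_norm_def)+
      have "norm x - norm (snd q - x) \<le> norm (snd q)"
        by (metis norm_minus_commute norm_triangle_ineq2 diff_le_eq le_diff_eq add.commute)
      then have "norm x / 2 \<le> norm (snd q)" using q that by linarith
      then have "r \<le> snd q \<bullet> snd q"
        by (simp add: r_def dot_square_norm power_mono)
      then have "- (snd q \<bullet> snd q) / (4 * fst q) \<le> - r / (4 * fst q)"
        using True by (simp add: field_simps)
      then have "hk a q \<le> fst q powr - a * exp (- r / (4 * fst q))"
        unfolding hk_def using True by (simp add: mult_left_mono)
      also have "\<dots> \<le> (fst q)\<^sup>2" using \<delta>(2) True q that by auto
      also have "\<dots> \<le> (norm (q - p))\<^sup>2" using q True by (simp add: power_mono)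
      finally show ?thesis using True by (simp add: hk_def)
    qed (simp add: hk_def)
    have "((\<lambda>q. norm (hk a q - hk a p - 0) / norm (q - p)) \<longlongrightarrow> 0) (at p)"
    proof (rule tendsto_sandwich[OF _ _ tendsto_const])
      show "\<forall>\<^sub>F q in at p. norm (hk a q - hk a p - 0) / norm (q - p) \<le> norm (q - p)"
        unfolding eventually_at
      proof (intro exI[of _ "min \<delta> (norm x / 2)"] conjI ballI impI)
        fix q assume "q \<noteq> p \<and> dist q p < min \<delta> (norm x / 2)"
        then show "norm (hk a q - hk a p - 0) / norm (q - p) \<le> norm (q - p)"
          using le[of q] by (simp add: dist_norm field_simps power2_eq_square hk_def p 3)
      qed (use \<delta> 3 in auto)
      show "((\<lambda>q. norm (q - p)) \<longlongrightarrow> 0) (at p)"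
        using LIM_offset_zero_iff tendsto_norm_zero[OF LIM_zero[OF tendsto_ident_at]] by blast
    qed auto
    then have "(hk a has_derivative (\<lambda>_. 0)) (at p)"
      unfolding has_derivative_at_alt[THEN sym] has_derivative_iff_norm by (simp add: has_derivative_iff_norm)
    moreover have "hk_deriv a p = (\<lambda>_. 0)" using 3 by (auto simp: hk_deriv_def hk_def p)
    ultimately show ?thesis by simp
  qed
qed

text \<open>\<open>hk_deriv\<close> is a combination of \<open>hk (a + 1)\<close> and
  \<open>hk (a + 2)\<close> with coefficients polynomial in p, so the induction has to range over
  all exponents.\<close>

lemma Ck_on_hk: "Ck_on k (- {0}) (hk a :: real \<times> 'a::euclidean_space \<Rightarrow> real)"
proof (induction k arbitrary: a)
  case 0
  show ?case
    by (auto intro!: continuous_at_imp_continuous_on has_derivative_continuous hk_has_derivative)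
next
  case (Suc k)
  have [simp]: "open (- {0::real \<times> 'a})" by auto
  have fst: "Ck_on k (- {0::real \<times> 'a}) (\<lambda>p. snd p)"
    by (intro Ck_on_bounded_linear bounded_linear_snd) auto
  have "Ck_on k (- {0}) (\<lambda>p::real \<times> 'a. fst v * (- a * hk (a + 1) p + (1/4) * (snd p \<bullet> snd p) * hk (a + 2) p)
     + (-1/2) * (snd p \<bullet> snd v) * hk (a + 1) p)" for v :: "real \<times> 'a"
    using Suc fst by (intro Ck_on_add Ck_on_mult Ck_on_const Ck_on_inner) auto
  then have "Ck_on k (- {0}) (\<lambda>p. hk_deriv a p v)" for v :: "real \<times> 'a"
    by (simp add: hk_deriv_def)
  then show ?case
    using hk_has_derivative by (intro Ck_on_SucI[where f'="hk_deriv a"]) auto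
qed

lemma dderiv_hk: "p \<noteq> 0 \<Longrightarrow> dderiv v (hk a) p = hk_deriv a p v"
  by (rule dderiv_eq[OF hk_has_derivative])

text \<open>Serves to patch truncated kernels: one open set omits the singular point, and on the
  other the truncated kernel vanishes identically.\<close>

lemma Ck_on_Un:
  assumes "open V" "open W" "Ck_on k V f" "Ck_on k W f" shows "Ck_on k (V \<union> W) f"
  using assms(3,4)
proof (induction k arbitrary: f)
  case 0 then show ?case using assms by (simp add: continuous_on_open_Un)
next
  case (Suc k) then show ?case by (auto simp: Ck_on.simps(2))
qed

lemma Ck_on_affine:
  fixes L :: "'a::euclidean_space \<Rightarrow> 'b::real_normed_vector"
  assumes "open W" "bounded_linear L" shows "Ck_on k W (\<lambda>x. c + L x)"
  by (intro Ck_on_add Ck_on_const Ck_on_bounded_linear assms)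

text \<open>\<open>hk 0 (s, 1)\<close> is exp (- 1 / (4 s)) for positive s and 0 otherwise, the
  classical smooth function that is flat at 0. The step is b(s) / (b(s) + b(1 - s)), whose
  denominator never vanishes.\<close>

lemma smooth_step:
  obtains \<theta> :: "real \<Rightarrow> real" where "\<And>k. Ck_on k UNIV \<theta>" "\<And>s. s \<le> 0 \<Longrightarrow> \<theta> s = 0" "\<And>s. 1 \<le> s \<Longrightarrow> \<theta> s = 1"
    "\<And>s. 0 \<le> \<theta> s" "\<And>s. \<theta> s \<le> 1"
proof -
  define b where "b s = hk 0 (s, 1::real)" for s
  define \<theta> where "\<theta> s = b s * inverse (b s + b (1 - s))" for s
  have b: "Ck_on k UNIV b" for k
    unfolding b_def
  proof (rule Ck_on_compose[where V="- {0}", OF _ _ _ Ck_on_hk])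
    have "Ck_on k UNIV (\<lambda>s::real. (0, 1::real) + (s, 0))"
      by (intro Ck_on_affine) (auto intro!: bounded_linear_Pair bounded_linear_ident bounded_linear_zero)
    then show "Ck_on k UNIV (\<lambda>s::real. (s, 1::real))" by simp
  qed (auto simp: zero_prod_def)
  have b1: "Ck_on k UNIV (\<lambda>s. b (1 - s))" for k
  proof (rule Ck_on_compose[where V=UNIV, OF _ _ _ b])
    have "Ck_on k UNIV (\<lambda>s::real. 1 + (- s))"
      by (intro Ck_on_affine) (auto intro!: bounded_linear_minus bounded_linear_ident)
    then show "Ck_on k UNIV (\<lambda>s::real. 1 - s)" by simp
  qed auto
  have b0: "b s \<ge> 0" "b s > 0 \<longleftrightarrow> s > 0" for s by (auto simp: b_def hk_def)
  have pos: "b s + b (1 - s) > 0" for s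
  proof (cases "s > 0")
    case True then show ?thesis using b0[of s] b0(1)[of "1 - s"] by linarith
  next
    case False then show ?thesis using b0[of "1-s"] b0(1)[of "s"] by linarith
  qed
  show thesis
  proof (rule that[of \<theta>])
    show "Ck_on k UNIV \<theta>" for k
      unfolding \<theta>_def using pos
      by (intro Ck_on_mult Ck_on_inverse Ck_on_add b b1) (auto simp: less_le)
    show "\<theta> s = 0" if "s \<le> 0" for s using b0[of s] that by (simp add: \<theta>_def less_le)
    show "\<theta> s = 1" if "1 \<le> s" for s
    proof -
      have "b (1 - s) = 0" "b s > 0" using b0[of "1-s"] b0[of s] that by (auto simp: less_le)
      then show ?thesis by (simp add: \<theta>_def)
    qed
    show "0 \<le> \<theta> s" for s using b0 pos[of s] by (simp add: \<theta>_def)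
    show "\<theta> s \<le> 1" for s using b0(1)[of "1 - s"] pos[of s] by (simp add: \<theta>_def field_simps)
  qed
qed

text \<open>The step is applied to an affine function of the squared distance rather than of the
  distance, which keeps the composite smooth at the centre.\<close>

lemma smooth_bump:
  fixes x0 :: "'a::euclidean_space"
  assumes "0 \<le> r1" "r1 < r2"
  obtains \<psi> :: "'a \<Rightarrow> real" where "\<And>k. Ck_on k UNIV \<psi>"
    "\<And>y. norm (y - x0) \<le> r1 \<Longrightarrow> \<psi> y = 1" "\<And>y. r2 \<le> norm (y - x0) \<Longrightarrow> \<psi> y = 0"
proof -
  obtain \<theta> :: "real \<Rightarrow> real" where \<theta>: "\<And>k. Ck_on k UNIV \<theta>" "\<And>s. s \<le> 0 \<Longrightarrow> \<theta> s = 0" "\<And>s. 1 \<le> s \<Longrightarrow> \<theta> s = 1"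
    using smooth_step by metis
  define d where "d = inverse (r2\<^sup>2 - r1\<^sup>2)"
  have d: "r2\<^sup>2 - r1\<^sup>2 > 0" using assms by (simp add: power_strict_mono)
  then have d': "d > 0" by (simp add: d_def)
  define g where "g y = d * (r2\<^sup>2 + - ((- x0 + y) \<bullet> (- x0 + y)))" for y
  have g: "g y = d * (r2\<^sup>2 - (norm (y - x0))\<^sup>2)" for y
    by (simp add: g_def dot_square_norm)
  have lin: "Ck_on k UNIV (\<lambda>y. - x0 + y)" for k
    by (intro Ck_on_affine bounded_linear_ident) auto
  have "Ck_on k UNIV g" for k
    unfolding g_def by (intro Ck_on_mult Ck_on_add Ck_on_const Ck_on_uminus Ck_on_inner lin) auto
  then have 1: "Ck_on k UNIV (\<lambda>y. \<theta> (g y))" for k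
    by (intro Ck_on_compose[where V=UNIV, OF _ _ _ \<theta>(1)]) auto
  have 2: "g y \<ge> 1" if "norm (y - x0) \<le> r1" for y
  proof -
    have "(norm (y - x0))\<^sup>2 \<le> r1\<^sup>2" using that by (simp add: power_mono)
    then have "d * (r2\<^sup>2 - r1\<^sup>2) \<le> g y" unfolding g using d' by (intro mult_left_mono) auto
    then show ?thesis using d by (simp add: d_def)
  qed
  have 3: "g y \<le> 0" if "r2 \<le> norm (y - x0)" for y
  proof -
    have "r2\<^sup>2 \<le> (norm (y - x0))\<^sup>2" using that assms by (simp add: power_mono)
    then show ?thesis unfolding g using d' by (simp add: mult_le_0_iff)
  qed
  show thesis using that[OF 1] 2 3 \<theta> by blast
qed

section \<open>Test functions: closure under derivatives, bounds and Lipschitz continuity\<close>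

lemma smooth_on_UNIV: "smooth_on UNIV f \<longleftrightarrow> (\<forall>k. Ck_on k UNIV f)"
proof
  assume "smooth_on UNIV f"
  then obtain g where "\<forall>k. Ck_on k UNIV g" "\<forall>x. g x = f x"
    unfolding smooth_on_def by (metis UNIV_I top.extremum_uniqueI)
  then show "\<forall>k. Ck_on k UNIV f" by (metis ext)
qed (auto simp: smooth_on_def)

lemma test_functionI:
  assumes "\<And>k. Ck_on k UNIV f" "compact K" "K \<subseteq> U" "\<And>x. x \<notin> K \<Longrightarrow> f x = 0"
  shows "test_function U f"
  using assms unfolding test_function_def smooth_on_UNIV by blast

lemma dderiv_zero_open:
  assumes "open W" "x \<in> W" "\<And>y. y \<in> W \<Longrightarrow> f y = c" shows "dderiv v f x = 0"
proof -
  have "dderiv v f x = dderiv v (\<lambda>_. c) x" by (rule dderiv_cong_open[OF assms])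
  also have "\<dots> = 0" by (rule dderiv_eq) simp
  finally show ?thesis .
qed

lemma test_function_Ck: "test_function U f \<Longrightarrow> Ck_on k UNIV f"
  by (simp add: test_function_def smooth_on_UNIV)

lemma test_function_supportE:
  assumes "test_function U f"
  obtains K where "compact K" "K \<subseteq> U" "\<And>x. x \<notin> K \<Longrightarrow> f x = 0" "\<And>v x. x \<notin> K \<Longrightarrow> dderiv v f x = 0"
proof -
  obtain K where K: "compact K" "K \<subseteq> U" "\<And>x. x \<notin> K \<Longrightarrow> f x = 0"
    using assms unfolding test_function_def by blast
  have "dderiv v f x = 0" if "x \<notin> K" for v x
    by (rule dderiv_zero_open[of "- K"]) (use K that in \<open>auto simp: compact_imp_closed\<close>)
  then show thesis using that K by blast
qed

lemma test_function_dderiv: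
  assumes "test_function U f" shows "test_function U (dderiv v f)"
proof -
  obtain K where "compact K" "K \<subseteq> U" "\<And>v x. x \<notin> K \<Longrightarrow> dderiv v f x = 0"
    using assms by (rule test_function_supportE) blast
  then show ?thesis
    using Ck_on_dderiv[OF open_UNIV test_function_Ck[OF assms]] by (intro test_functionI) auto
qed

lemma test_function_bounded:
  assumes "test_function U f" obtains M where "M > 0" "\<And>x. cmod (f x) \<le> M"
proof -
  obtain K where K: "compact K" "\<And>x. x \<notin> K \<Longrightarrow> f x = 0"
    using assms by (rule test_function_supportE) blast
  have "continuous_on K f"
    using Ck_on_continuous[OF test_function_Ck[OF assms]] continuous_on_subset by blast
  then have "bounded (f ` K)" using K compact_continuous_image compact_imp_bounded by blast
  then obtain M where M: "M > 0" "\<forall>y\<in>f ` K. norm y \<le> M" using bounded_pos by blast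
  then have "cmod (f x) \<le> M" for x using K by (cases "x \<in> K") auto
  then show thesis using that M by blast
qed

lemma test_function_has_derivative:
  "test_function U f \<Longrightarrow> (f has_derivative (\<lambda>v. dderiv v f x)) (at x)"
  by (rule Ck_on_Suc_dest(2)[OF test_function_Ck]) auto

lemma test_function_continuous: "test_function U f \<Longrightarrow> continuous_on S f"
  using Ck_on_continuous[OF test_function_Ck] continuous_on_subset by blast

lemma test_function_measurable: "test_function U f \<Longrightarrow> f \<in> borel_measurable borel"
  by (intro borel_measurable_continuous_onI test_function_continuous)

lemma dderiv_bounded:
  assumes "test_function U f"
  obtains M where "M > 0" "\<And>x v. cmod (dderiv v f x) \<le> M * norm v"
proof -
  have "\<forall>b. \<exists>M>0. \<forall>x. cmod (dderiv b f x) \<le> M"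
    using test_function_bounded[OF test_function_dderiv[OF assms]] by metis
  then obtain M where M: "\<And>b. M b > 0" "\<And>b x. cmod (dderiv b f x) \<le> M b" by metis
  have "cmod (dderiv v f x) \<le> (\<Sum>b\<in>Basis. M b) * norm v" for x v
  proof -
    have "dderiv v f x = (\<Sum>b\<in>Basis. (v \<bullet> b) *\<^sub>R dderiv b f x)"
      by (rule linear_euclidean_sum[of "\<lambda>v. dderiv v f x"], rule bounded_linear.linear,
        rule has_derivative_bounded_linear, rule test_function_has_derivative[OF assms])
    also have "cmod \<dots> \<le> (\<Sum>b\<in>Basis. norm v * M b)"
      by (rule sum_norm_le) (auto intro!: mult_mono M Basis_le_norm)
    finally show ?thesis by (simp add: sum_distrib_left mult.commute)
  qed
  moreover have "(\<Sum>b\<in>Basis. M b) > 0" by (rule sum_pos) (auto simp: M)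
  ultimately show thesis using that by blast
qed

lemma test_function_lipschitz:
  assumes "test_function U f"
  obtains L where "L > 0" "\<And>x y. cmod (f x - f y) \<le> L * norm (x - y)"
proof -
  obtain M where M: "M > 0" "\<And>x v. cmod (dderiv v f x) \<le> M * norm v"
    using dderiv_bounded[OF assms] by blast
  have "cmod (f x - f y) \<le> M * norm (x - y)" for x y
    by (rule differentiable_bound[of UNIV f "\<lambda>x v. dderiv v f x"])
       (auto intro!: test_function_has_derivative[OF assms] onorm_le M)
  then show thesis using that M by blast
qed

section \<open>Differentiation under the integral\<close>

lemma has_derivative_directional:
  fixes f :: "'a::real_normed_vector \<Rightarrow> 'b::real_normed_vector"
  assumes "(f has_derivative D) (at x)"
  shows "((\<lambda>h. (f (x + h *\<^sub>R v) - f x) /\<^sub>R h) \<longlongrightarrow> D v) (at 0)"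
proof -
  have lin: "linear D" using assms has_derivative_bounded_linear bounded_linear.linear by blast
  have "((\<lambda>h. f (x + h *\<^sub>R v)) has_derivative (\<lambda>h. D (h *\<^sub>R v))) (at 0)"
  proof (rule has_derivative_compose[where f="\<lambda>h. x + h *\<^sub>R v" and g=f])
    show "((\<lambda>h. x + h *\<^sub>R v) has_derivative (\<lambda>h. h *\<^sub>R v)) (at 0)"
      by (auto intro!: derivative_eq_intros)
    show "(f has_derivative D) (at (x + 0 *\<^sub>R v))" using assms by simp
  qed
  then have "((\<lambda>h. norm (f (x + h *\<^sub>R v) - f x - h *\<^sub>R D v) / norm h) \<longlongrightarrow> 0) (at 0)"
    by (simp add: has_derivative_iff_norm linear_scale[OF lin])
  then have "((\<lambda>h. norm ((f (x + h *\<^sub>R v) - f x) /\<^sub>R h - D v)) \<longlongrightarrow> 0) (at 0)"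
  proof (rule Lim_transform_eventually)
    show "\<forall>\<^sub>F h in at 0. norm (f (x + h *\<^sub>R v) - f x - h *\<^sub>R D v) / norm h = norm ((f (x + h *\<^sub>R v) - f x) /\<^sub>R h - D v)"
      unfolding eventually_at
    proof (intro exI[of _ 1] conjI ballI impI)
      fix h :: real assume "h \<noteq> 0 \<and> dist h 0 < 1"
      then have "(f (x + h *\<^sub>R v) - f x) /\<^sub>R h - D v = (f (x + h *\<^sub>R v) - f x - h *\<^sub>R D v) /\<^sub>R h"
        by (simp add: scaleR_diff_right)
      then show "norm (f (x + h *\<^sub>R v) - f x - h *\<^sub>R D v) / norm h = norm ((f (x + h *\<^sub>R v) - f x) /\<^sub>R h - D v)"
        by (simp add: divide_inverse mult.commute)
    qed simp
  qed
  then show ?thesis by (rule LIM_zero_cancel[OF tendsto_norm_zero_cancel])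
qed

text \<open>Dominated convergence for the remainder of the difference quotient: the mean value
  inequality on the ball turns the bound \<open>B\<close> on the derivatives into the majorant 2 B.
  Measurability of the derivative is derived too, as it is a limit of difference quotients. The
  measure is arbitrary, so that counting measure (series) and Lebesgue measure are both
  covered.\<close>

lemma has_derivative_integral:
  fixes k :: "'a::euclidean_space \<Rightarrow> 'w \<Rightarrow> 'b::{banach, second_countable_topology}"
  assumes r: "r > 0"
    and int: "\<And>x. x \<in> ball x0 r \<Longrightarrow> integrable M (k x)"
    and der: "\<And>x w. x \<in> ball x0 r \<Longrightarrow> w \<in> space M \<Longrightarrow> ((\<lambda>x. k x w) has_derivative k' x w) (at x)"
    and bd: "\<And>x w v. x \<in> ball x0 r \<Longrightarrow> w \<in> space M \<Longrightarrow> norm (k' x w v) \<le> B w * norm v"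
    and B: "integrable M B"
  shows "((\<lambda>x. \<integral>w. k x w \<partial>M) has_derivative (\<lambda>v. \<integral>w. k' x0 w v \<partial>M)) (at x0)" (is ?thesis1)
    and "integrable M (\<lambda>w. k' x0 w v)"
proof -
  have x0: "x0 \<in> ball x0 r" using r by simp
  have int': "integrable M (\<lambda>w. k' x0 w v)" for v
  proof -
    \<comment> \<open>Small enough that x0 + t v stays in the ball for 0 < t \<le> c, so all
      difference quotients below are measurable.\<close>
    define c where "c = r / (2 * (1 + norm v))"
    define t where "t n = c * inverse (real (Suc n))" for n
    have nv: "1 + norm v > 0" using norm_ge_zero[of v] by linarith
    have c: "c > 0" "c * norm v < r"
      using r nv by (auto simp: c_def field_simps intro!: add_nonneg_pos)
    have t0: "t n > 0" for n using c by (simp add: t_def)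
    have tlim: "t \<longlonglongrightarrow> 0"
      unfolding t_def by (rule tendsto_mult_right_zero[OF LIMSEQ_inverse_real_of_nat])
    have tin: "x0 + t n *\<^sub>R v \<in> ball x0 r" for n
    proof -
      have "t n \<le> c * 1"
        unfolding t_def using c by (intro mult_left_mono) (auto simp: field_simps)
      then have "t n * norm v \<le> c * norm v" by (intro mult_right_mono) auto
      also have "\<dots> < r" by (rule c)
      finally show ?thesis using t0[of n] by (simp add: dist_norm)
    qed
    have "(\<lambda>w. k' x0 w v) \<in> borel_measurable M"
    proof (rule borel_measurable_LIMSEQ_metric)
      show "(\<lambda>w. (k (x0 + t n *\<^sub>R v) w - k x0 w) /\<^sub>R t n) \<in> borel_measurable M" for n
        using int[OF tin] int[OF x0] by (intro borel_measurable_scaleR borel_measurable_diff) auto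
      fix w assume w: "w \<in> space M"
      have "((\<lambda>h. (k (x0 + h *\<^sub>R v) w - k x0 w) /\<^sub>R h) \<longlongrightarrow> k' x0 w v) (at 0)"
        by (rule has_derivative_directional[OF der[OF x0 w]])
      moreover have "filterlim t (at 0) sequentially"
        using tlim t0 by (auto simp: filterlim_at less_imp_neq[symmetric])
      ultimately show "(\<lambda>n. (k (x0 + t n *\<^sub>R v) w - k x0 w) /\<^sub>R t n) \<longlonglongrightarrow> k' x0 w v"
        by (rule filterlim_compose)
    qed
    moreover have "AE w in M. norm (k' x0 w v) \<le> norm (B w * norm v)"
      by (intro AE_I2 order_trans[OF bd[OF x0]]) auto
    ultimately show ?thesis using Bochner_Integration.integrable_bound[OF integrable_mult_left[OF B]] by blast
  qed
  then show "integrable M (\<lambda>w. k' x0 w v)" .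
  have lin: "linear (k' x0 w)" if "w \<in> space M" for w
    by (rule bounded_linear.linear[OF has_derivative_bounded_linear[OF der[OF x0 that]]])
  have bl: "bounded_linear (\<lambda>v. \<integral>w. k' x0 w v \<partial>M)"
  proof (rule bounded_linear_intro[of _ "\<integral>w. B w \<partial>M"])
    fix u v
    have "(\<integral>w. k' x0 w (u + v) \<partial>M) = (\<integral>w. k' x0 w u + k' x0 w v \<partial>M)"
      by (intro Bochner_Integration.integral_cong) (auto simp: linear_add[OF lin])
    then show "(\<integral>w. k' x0 w (u + v) \<partial>M) = (\<integral>w. k' x0 w u \<partial>M) + (\<integral>w. k' x0 w v \<partial>M)"
      by (simp add: int')
  next
    fix c v
    have "(\<integral>w. k' x0 w (c *\<^sub>R v) \<partial>M) = (\<integral>w. c *\<^sub>R k' x0 w v \<partial>M)"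
      by (intro Bochner_Integration.integral_cong) (auto simp: linear_scale[OF lin])
    then show "(\<integral>w. k' x0 w (c *\<^sub>R v) \<partial>M) = c *\<^sub>R (\<integral>w. k' x0 w v \<partial>M)"
      by simp
  next
    fix v
    have "norm (\<integral>w. k' x0 w v \<partial>M) \<le> (\<integral>w. B w * norm v \<partial>M)"
      by (rule order_trans[OF integral_norm_bound Bochner_Integration.integral_mono]) (use int' B bd[OF x0] in auto)
    then show "norm (\<integral>w. k' x0 w v \<partial>M) \<le> norm v * (\<integral>w. B w \<partial>M)" by (simp add: mult.commute)
  qed
  have lip: "norm (k x w - k x0 w) \<le> B w * norm (x - x0)" if "x \<in> ball x0 r" "w \<in> space M" for x w
  proof (rule differentiable_bound[OF convex_ball])
    show "((\<lambda>x. k x w) has_derivative k' y w) (at y within ball x0 r)" if "y \<in> ball x0 r" for y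
      by (rule has_derivative_at_withinI[OF der]) fact+
    show "onorm (k' y w) \<le> B w" if "y \<in> ball x0 r" for y
      by (rule onorm_le, rule bd) fact+
  qed (fact x0 that)+
  have "((\<lambda>x. norm ((\<integral>w. k x w \<partial>M) - (\<integral>w. k x0 w \<partial>M) - (\<integral>w. k' x0 w (x - x0) \<partial>M)) / norm (x - x0)) \<longlongrightarrow> 0) (at x0)"
    unfolding tendsto_at_iff_sequentially
  proof (intro allI impI)
    fix X assume X: "\<forall>i. X i \<in> UNIV - {x0}" "X \<longlonglongrightarrow> x0"
    then have ne: "X i \<noteq> x0" for i by auto
    have "\<forall>\<^sub>F i in sequentially. X i \<in> ball x0 r"
      using X(2) r by (simp add: dist_commute tendsto_iff)
    then obtain N where "\<forall>n\<ge>N. X n \<in> ball x0 r"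
      unfolding eventually_sequentially by blast
    then have N: "X (i + N) \<in> ball x0 r" for i by simp
    define Y where "Y i = X (i + N)" for i
    have Y: "Y \<longlonglongrightarrow> x0" "Y i \<noteq> x0" "Y i \<in> ball x0 r" for i
      using LIMSEQ_ignore_initial_segment[OF X(2), of N] ne N unfolding Y_def by auto
    let ?s = "\<lambda>i w. (k (Y i) w - k x0 w - k' x0 w (Y i - x0)) /\<^sub>R norm (Y i - x0)"
    have lim: "(\<lambda>i. \<integral>w. ?s i w \<partial>M) \<longlonglongrightarrow> (\<integral>w. 0 \<partial>M)"
    proof (rule integral_dominated_convergence[where w="\<lambda>w. 2 * B w"])
      show "AE w in M. (\<lambda>i. ?s i w) \<longlonglongrightarrow> 0"
      proof (rule AE_I2)
        fix w assume "w \<in> space M"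
        then have "((\<lambda>x. norm (k x w - k x0 w - k' x0 w (x - x0)) / norm (x - x0)) \<longlongrightarrow> 0) (at x0)"
          using der[OF x0] by (simp add: has_derivative_iff_norm)
        then have "(\<lambda>i. norm (k (Y i) w - k x0 w - k' x0 w (Y i - x0)) / norm (Y i - x0)) \<longlonglongrightarrow> 0"
          using Y unfolding tendsto_at_iff_sequentially comp_def by blast
        then have "(\<lambda>i. norm (?s i w)) \<longlonglongrightarrow> 0" by (simp add: divide_inverse mult.commute)
        then show "(\<lambda>i. ?s i w) \<longlonglongrightarrow> 0" by (rule tendsto_norm_zero_cancel)
      qed
      show "AE w in M. norm (?s i w) \<le> 2 * B w" for i
      proof (rule AE_I2)
        fix w assume w: "w \<in> space M"
        have "norm (k (Y i) w - k x0 w - k' x0 w (Y i - x0)) \<le> B w * norm (Y i - x0) + B w * norm (Y i - x0)"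
          by (rule order_trans[OF norm_triangle_ineq4 add_mono]) (use lip bd x0 Y w in auto)
        then have "norm (k (Y i) w - k x0 w - k' x0 w (Y i - x0)) / norm (Y i - x0) \<le> 2 * B w"
          using Y(2)[of i] by (subst pos_divide_le_eq) auto
        then show "norm (?s i w) \<le> 2 * B w" by (simp only: norm_scaleR) (simp add: divide_inverse mult.commute)
      qed
    qed (use int Y int' x0 B in auto)
    have eq: "(\<integral>w. ?s i w \<partial>M) = ((\<integral>w. k (Y i) w \<partial>M) - (\<integral>w. k x0 w \<partial>M) - (\<integral>w. k' x0 w (Y i - x0) \<partial>M)) /\<^sub>R norm (Y i - x0)" for i
      using int Y int' x0 by simp
    have "(\<lambda>i. norm (((\<integral>w. k (Y i) w \<partial>M) - (\<integral>w. k x0 w \<partial>M) - (\<integral>w. k' x0 w (Y i - x0) \<partial>M)) /\<^sub>R norm (Y i - x0))) \<longlonglongrightarrow> 0"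
      using tendsto_norm[OF lim] by (simp only: eq Bochner_Integration.integral_zero norm_zero)
    then have "(\<lambda>i. norm ((\<integral>w. k (Y i) w \<partial>M) - (\<integral>w. k x0 w \<partial>M) - (\<integral>w. k' x0 w (Y i - x0) \<partial>M)) / norm (Y i - x0)) \<longlonglongrightarrow> 0"
      by (simp add: divide_inverse mult.commute)
    then show "((\<lambda>x. norm ((\<integral>w. k x w \<partial>M) - (\<integral>w. k x0 w \<partial>M) - (\<integral>w. k' x0 w (x - x0) \<partial>M)) / norm (x - x0)) \<circ> X) \<longlonglongrightarrow> 0"
      unfolding Y_def comp_def by (rule LIMSEQ_offset)
  qed
  then show ?thesis1 using bl by (simp add: has_derivative_iff_norm)
qed

section \<open>Integration by parts for test functions\<close>

lemma test_function_integrable: 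
  fixes f :: "'a::euclidean_space \<Rightarrow> complex"
  assumes "test_function U f" shows "integrable lborel f"
proof -
  obtain K where K: "compact K" "\<And>x. x \<notin> K \<Longrightarrow> f x = 0"
    using assms by (rule test_function_supportE) blast
  have "integrable lborel (\<lambda>x. indicator K x *\<^sub>R f x)"
    by (rule borel_integrable_compact[OF K(1) test_function_continuous[OF assms]])
  moreover have "(\<lambda>x. indicator K x *\<^sub>R f x) = f" using K by (auto simp: indicator_def)
  ultimately show ?thesis by simp
qed

lemma linear_dderiv: "test_function U f \<Longrightarrow> linear (\<lambda>v. dderiv v f x)"
  by (rule bounded_linear.linear[OF has_derivative_bounded_linear[OF test_function_has_derivative]])

text \<open>Translation invariance: the integral of x \<mapsto> f (s b + x) is constant in s, and
  its derivative at s = 0 is the integral in question. This handles every direction b at once,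
  without splitting the space into coordinates.\<close>

lemma integral_dderiv_zero:
  fixes f :: "'a::euclidean_space \<Rightarrow> complex"
  assumes f: "test_function U f" shows "(\<integral>x. dderiv b f x \<partial>lborel) = 0"
proof -
  obtain K where K: "compact K" "\<And>x. x \<notin> K \<Longrightarrow> f x = 0" "\<And>v x. x \<notin> K \<Longrightarrow> dderiv v f x = 0"
    using f by (rule test_function_supportE) blast
  obtain R where R: "\<And>x. x \<in> K \<Longrightarrow> norm x \<le> R"
    using compact_imp_bounded[OF K(1)] by (auto simp: bounded_iff)
  obtain M where M: "M > 0" "\<And>x. cmod (dderiv b f x) \<le> M"
    using test_function_bounded[OF test_function_dderiv[OF f]] by blast
  have tr: "integrable lborel (\<lambda>x. f (s *\<^sub>R b + x))" "(\<integral>x. f (s *\<^sub>R b + x) \<partial>lborel) = (\<integral>x. f x \<partial>lborel)" for s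
  proof -
    note [measurable] = test_function_measurable[OF f]
    have "integrable (distr lborel borel ((+) (s *\<^sub>R b))) f" "(\<integral>x. f x \<partial>distr lborel borel ((+) (s *\<^sub>R b))) = (\<integral>x. f x \<partial>lborel)"
      using test_function_integrable[OF f] by (simp_all add: lborel_distr_plus)
    then show "integrable lborel (\<lambda>x. f (s *\<^sub>R b + x))" "(\<integral>x. f (s *\<^sub>R b + x) \<partial>lborel) = (\<integral>x. f x \<partial>lborel)"
      by (auto simp: integrable_distr_eq integral_distr)
  qed
  \<comment> \<open>Translations by s b with |s| < 1 move the support by at most norm b, so one ball
    contains all the translated supports.\<close>
  let ?B = "\<lambda>x::'a. M * indicator (cball 0 (R + norm b)) x"
  have der: "((\<lambda>s. \<integral>x. f (s *\<^sub>R b + x) \<partial>lborel) has_derivative (\<lambda>v. \<integral>x. v *\<^sub>R dderiv b f (0 *\<^sub>R b + x) \<partial>lborel)) (at 0)"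
  proof (rule has_derivative_integral[where r=1 and B="?B" and k="\<lambda>s x. f (s *\<^sub>R b + x)" and k'="\<lambda>s x v. v *\<^sub>R dderiv b f (s *\<^sub>R b + x)"])
    fix s :: real and x :: 'a assume s: "s \<in> ball 0 1"
    have lin: "linear (\<lambda>v. dderiv v f (s *\<^sub>R b + x))"
      by (rule linear_dderiv[OF f])
    have "((\<lambda>s. f (s *\<^sub>R b + x)) has_derivative (\<lambda>v. dderiv (v *\<^sub>R b) f (s *\<^sub>R b + x))) (at s)"
      by (rule has_derivative_compose[where f="\<lambda>s. s *\<^sub>R b + x", OF _ test_function_has_derivative[OF f]])
         (auto intro!: derivative_eq_intros)
    then show "((\<lambda>s. f (s *\<^sub>R b + x)) has_derivative (\<lambda>v. v *\<^sub>R dderiv b f (s *\<^sub>R b + x))) (at s)"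
      using linear_scale[OF lin] by simp
    show "norm (v *\<^sub>R dderiv b f (s *\<^sub>R b + x)) \<le> ?B x * norm v" for v
    proof (cases "s *\<^sub>R b + x \<in> K")
      case True
      have "norm x = norm ((s *\<^sub>R b + x) - s *\<^sub>R b)" by simp
      also have "\<dots> \<le> norm (s *\<^sub>R b + x) + norm (s *\<^sub>R b)" by (rule norm_triangle_ineq4)
      also have "\<dots> \<le> R + norm b" using R[OF True] s by (simp add: add_mono mult_left_le_one_le)
      finally show ?thesis using mult_left_mono[OF M(2)[of "s *\<^sub>R b + x"], of "\<bar>v\<bar>"] by (simp add: mult.commute)
    qed (use K M in auto)
  next
    show "integrable lborel ?B"
      by (intro integrable_mult_right integrable_real_indicator emeasure_bounded_finite) auto
  qed (use tr in auto)
  have "((\<lambda>s. \<integral>x. f (s *\<^sub>R b + x) \<partial>lborel) has_derivative (\<lambda>v. 0)) (at 0)"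
    by (simp add: tr)
  from fun_cong[OF has_derivative_unique[OF der this], of 1]
  have "(\<integral>x. 1 *\<^sub>R dderiv b f (0 *\<^sub>R b + x) \<partial>lborel) = 0" .
  then show ?thesis by simp
qed

lemma test_function_mult:
  fixes f g :: "'a::euclidean_space \<Rightarrow> complex"
  assumes "test_function U f" "test_function V g"
  shows "test_function U (\<lambda>x. f x * g x)"
proof -
  obtain K where K: "compact K" "K \<subseteq> U" "\<And>x. x \<notin> K \<Longrightarrow> f x = 0"
    using assms(1) by (rule test_function_supportE) blast
  show ?thesis
    by (rule test_functionI[OF Ck_on_mult[OF open_UNIV test_function_Ck[OF assms(1)] test_function_Ck[OF assms(2)]] K(1,2)])
       (simp add: K(3))
qed

lemma integration_by_parts:
  fixes f g :: "'a::euclidean_space \<Rightarrow> complex"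
  assumes f: "test_function U f" and g: "test_function V g"
  shows "(\<integral>x. f x * dderiv b g x \<partial>lborel) = - (\<integral>x. dderiv b f x * g x \<partial>lborel)"
proof -
  have "dderiv b (\<lambda>x. f x * g x) x = f x * dderiv b g x + dderiv b f x * g x" for x
    by (rule dderiv_eq) (auto intro!: has_derivative_mult test_function_has_derivative[OF f] test_function_has_derivative[OF g])
  then have "0 = (\<integral>x. f x * dderiv b g x + dderiv b f x * g x \<partial>lborel)"
    by (simp only: integral_dderiv_zero[OF test_function_mult[OF f g], of b, symmetric])
  also have "\<dots> = (\<integral>x. f x * dderiv b g x \<partial>lborel) + (\<integral>x. dderiv b f x * g x \<partial>lborel)"
    by (intro Bochner_Integration.integral_add test_function_integrable[OF test_function_mult[OF f test_function_dderiv[OF g]]]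
        test_function_integrable[OF test_function_mult[OF test_function_dderiv[OF f] g]])
  finally show ?thesis by (simp add: eq_neg_iff_add_eq_0)
qed

text \<open>
  A series written as an integral over counting measure, so that it can be differentiated
  termwise by \<open>has_derivative_integral\<close>.
\<close>

definition superpose :: "(nat \<Rightarrow> real) \<Rightarrow> (nat \<Rightarrow> 'a) \<Rightarrow> ('a::euclidean_space \<Rightarrow> complex) \<Rightarrow> 'a \<Rightarrow> complex" where
  "superpose c p f z = (\<integral>j. c j *\<^sub>R f (z - p j) \<partial>count_space UNIV)"

lemma superpose_summable:
  assumes c: "summable (\<lambda>j. \<bar>c j\<bar>)" and f: "test_function U f"
  shows "integrable (count_space UNIV) (\<lambda>j. c j *\<^sub>R f (z - p j))"
proof -
  obtain M where M: "M > 0" "\<And>x. cmod (f x) \<le> M" using test_function_bounded[OF f] by blast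
  show ?thesis
    unfolding integrable_count_space_nat_iff
    by (rule summable_comparison_test'[OF summable_mult2[OF c, of M], of 0])
       (auto intro!: mult_left_mono M)
qed

lemma superpose_has_derivative:
  assumes c: "summable (\<lambda>j. \<bar>c j\<bar>)" and f: "test_function U f"
  shows "(superpose c p f has_derivative (\<lambda>v. superpose c p (dderiv v f) z)) (at z)"
proof -
  obtain M where M: "M > 0" "\<And>x v. cmod (dderiv v f x) \<le> M * norm v" using dderiv_bounded[OF f] by blast
  show ?thesis
    unfolding superpose_def[abs_def]
  proof (rule has_derivative_integral[where r=1 and B="\<lambda>j. M * \<bar>c j\<bar>"])
    fix x :: 'a and j :: nat
    have "((\<lambda>z. f (z - p j)) has_derivative (\<lambda>v. dderiv v f (x - p j))) (at x)"
      by (rule has_derivative_compose[where f="\<lambda>z. z - p j", OF _ test_function_has_derivative[OF f]])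
         (auto intro!: derivative_eq_intros)
    then show "((\<lambda>z. c j *\<^sub>R f (z - p j)) has_derivative (\<lambda>v. c j *\<^sub>R dderiv v f (x - p j))) (at x)"
      by (rule has_derivative_scaleR_right)
    show "norm (c j *\<^sub>R dderiv v f (x - p j)) \<le> M * \<bar>c j\<bar> * norm v" for v
      using mult_left_mono[OF M(2)[of v "x - p j"], of "\<bar>c j\<bar>"] by (simp add: mult_ac)
  next
    show "integrable (count_space UNIV) (\<lambda>j. M * \<bar>c j\<bar>)"
      using c by (intro integrable_mult_right) (simp add: integrable_count_space_nat_iff)
  qed (auto intro: superpose_summable[OF c f])
qed

lemma dderiv_superpose:
  assumes "summable (\<lambda>j. \<bar>c j\<bar>)" "test_function U f"
  shows "dderiv v (superpose c p f) = superpose c p (dderiv v f)"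
  using dderiv_eq[OF superpose_has_derivative[OF assms]] by auto

lemma Ck_on_superpose:
  assumes c: "summable (\<lambda>j. \<bar>c j\<bar>)" and "test_function U f"
  shows "Ck_on k UNIV (superpose c p f)"
  using assms(2)
proof (induction k arbitrary: f)
  case 0
  then show ?case using has_derivative_continuous[OF superpose_has_derivative[OF c 0]]
    by (auto intro!: continuous_at_imp_continuous_on)
next
  case (Suc k)
  then show ?case
    by (intro Ck_on_SucI[OF open_UNIV superpose_has_derivative[OF c Suc.prems]]) (auto intro: test_function_dderiv)
qed

lemma test_function_superpose:
  assumes c: "summable (\<lambda>j. \<bar>c j\<bar>)" and f: "test_function UNIV f" and p: "bounded (range p)"
  shows "test_function UNIV (superpose c p f)"
proof -
  obtain K where K: "compact K" "\<And>x. x \<notin> K \<Longrightarrow> f x = 0"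
    using f by (rule test_function_supportE) blast
  obtain R where R: "\<And>x. x \<in> K \<Longrightarrow> norm x \<le> R"
    using compact_imp_bounded[OF K(1)] by (auto simp: bounded_iff)
  obtain P where P: "\<And>j. norm (p j) \<le> P" using p by (auto simp: bounded_iff)
  have "superpose c p f z = 0" if "z \<notin> cball 0 (R + P)" for z
  proof -
    have "f (z - p j) = 0" for j
    proof (rule K(2), rule notI)
      assume "z - p j \<in> K"
      then have "norm (z - p j) \<le> R" by (rule R)
      then show False using that P[of j] norm_triangle_ineq2[of z "p j"] by auto
    qed
    then show ?thesis by (simp add: superpose_def)
  qed
  then show ?thesis by (intro test_functionI[where K="cball 0 (R + P)", OF Ck_on_superpose[OF c f]]) auto
qed

section \<open>Sobolev norms of test functions\<close>

lemma dderiv_slice: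
  fixes \<Phi> :: "real \<times> (real^'n::finite) \<Rightarrow> complex"
  assumes "\<Phi> differentiable (at (t, x))"
  shows "dderiv v (\<lambda>x. \<Phi> (t, x)) x = dderiv (0, v) \<Phi> (t, x)"
proof (rule dderiv_eq)
  show "((\<lambda>x. \<Phi> (t, x)) has_derivative (\<lambda>v. dderiv (0, v) \<Phi> (t, x))) (at x)"
    by (rule has_derivative_compose[where f="\<lambda>x. (t, x)", OF _ dderiv_has_derivative[OF assms]])
       (auto intro!: derivative_eq_intros)
qed

lemma Ck_on_slice:
  fixes \<Phi> :: "real \<times> 'a::euclidean_space \<Rightarrow> 'b::real_normed_vector"
  assumes "Ck_on k UNIV \<Phi>" shows "Ck_on k UNIV (\<lambda>x. \<Phi> (t, x))"
proof (rule Ck_on_compose[OF open_UNIV open_UNIV subset_UNIV assms])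
  have "Ck_on k UNIV (\<lambda>x::'a. (t, 0) + (0, x))"
    by (intro Ck_on_affine) (auto intro!: bounded_linear_Pair bounded_linear_ident bounded_linear_zero)
  then show "Ck_on k UNIV (\<lambda>x::'a. (t, x))" by simp
qed

lemma test_function_slice:
  fixes \<Phi> :: "real \<times> 'a::euclidean_space \<Rightarrow> complex"
  assumes "test_function UNIV \<Phi>" shows "test_function UNIV (\<lambda>x. \<Phi> (t, x))"
proof -
  obtain K where K: "compact K" "\<And>z. z \<notin> K \<Longrightarrow> \<Phi> z = 0"
    using assms by (rule test_function_supportE) blast
  show ?thesis
  proof (rule test_functionI[where K="snd ` K"])
    show "compact (snd ` K)" using K by (intro compact_continuous_image continuous_intros)
    show "\<Phi> (t, x) = 0" if "x \<notin> snd ` K" for x by (rule K(2)) (use that in force)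
  qed (auto intro: Ck_on_slice test_function_Ck[OF assms])
qed

lemma weak_gradient_test:
  fixes f :: "real^'n::finite \<Rightarrow> complex"
  assumes f: "test_function UNIV f"
  shows "weak_gradient f (\<lambda>x. vec_lambda (\<lambda>i. dderiv (axis i 1) f x))"
  unfolding weak_gradient_def
proof (intro conjI allI impI)
  show "(\<lambda>x. vec_lambda (\<lambda>i. dderiv (axis i 1) f x)) \<in> borel_measurable borel"
    by (intro borel_measurable_continuous_onI continuous_on_vec_lambda
        test_function_continuous[OF test_function_dderiv[OF f]])
  show "(LINT x|lborel. f x * dderiv (axis i 1) \<phi> x) =
         - (LINT x|lborel. vec_lambda (\<lambda>i. dderiv (axis i 1) f x) $ i * \<phi> x)" if "test_function UNIV \<phi>" for \<phi> i
    using integration_by_parts[OF f that] by simp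
qed

lemma H1_sq_le:
  fixes f :: "real^'n::finite \<Rightarrow> complex"
  assumes "test_function UNIV f"
  shows "H1_sq f \<le> (\<integral>\<^sup>+x. ennreal ((cmod (f x))\<^sup>2 + (norm (vec_lambda (\<lambda>i. dderiv (axis i 1) f x) :: complex^'n))\<^sup>2) \<partial>lborel)"
  unfolding H1_sq_def using weak_gradient_test[OF assms] by (intro INF_lower2[OF _ order_refl]) auto

lemma norm_vec_lambda_le:
  fixes g :: "'n::finite \<Rightarrow> complex"
  assumes "\<And>i. cmod (g i) \<le> M"
  shows "norm (vec_lambda g :: complex^'n) \<le> real CARD('n) * M"
proof -
  have "norm (vec_lambda g :: complex^'n) \<le> (\<Sum>i\<in>UNIV. norm ((vec_lambda g :: complex^'n) $ i))"
    unfolding norm_vec_def by (rule L2_set_le_sum) auto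
  also have "\<dots> \<le> (\<Sum>i\<in>(UNIV::'n set). M)" by (intro sum_mono) (use assms in auto)
  finally show ?thesis by simp
qed

lemma H1_sq_bound:
  fixes f :: "real^'n::finite \<Rightarrow> complex"
  assumes "test_function UNIV f" "\<And>x. cmod (f x) \<le> M * indicator B x"
    "\<And>i x. cmod (dderiv (axis i 1) f x) \<le> M * indicator B x" "B \<in> sets borel"
  shows "H1_sq f \<le> ennreal (M\<^sup>2 + (real CARD('n) * M)\<^sup>2) * emeasure lborel B"
proof -
  have "H1_sq f \<le> (\<integral>\<^sup>+x. ennreal (M\<^sup>2 + (real CARD('n) * M)\<^sup>2) * indicator B x \<partial>lborel)"
  proof (rule order_trans[OF H1_sq_le[OF assms(1)] nn_integral_mono])
    fix x
    have 1: "norm (vec_lambda (\<lambda>i. dderiv (axis i 1) f x) :: complex^'n) \<le> real CARD('n) * (M * indicator B x)"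
      by (rule norm_vec_lambda_le) (use assms in auto)
    show "ennreal ((cmod (f x))\<^sup>2 + (norm (vec_lambda (\<lambda>i. dderiv (axis i 1) f x) :: complex^'n))\<^sup>2)
       \<le> ennreal (M\<^sup>2 + (real CARD('n) * M)\<^sup>2) * indicator B x"
    proof (cases "x \<in> B")
      case True
      have "(cmod (f x))\<^sup>2 \<le> M\<^sup>2" using assms(2)[of x] True by (intro power_mono) auto
      moreover have "(norm (vec_lambda (\<lambda>i. dderiv (axis i 1) f x) :: complex^'n))\<^sup>2 \<le> (real CARD('n) * M)\<^sup>2"
        using 1 True by (intro power_mono) auto
      ultimately show ?thesis using True by (simp add: ennreal_leI add_mono del: ennreal_plus)
    qed (use 1 assms(2)[of x] in auto)
  qed
  also have "\<dots> = ennreal (M\<^sup>2 + (real CARD('n) * M)\<^sup>2) * emeasure lborel B"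
    using assms(4) by (simp add: nn_integral_cmult_indicator)
  finally show ?thesis .
qed

text \<open>The majorant for fractional seminorms in time: the singularity at 0 is capped at 1, and
  a > 1 gives the decay. With a = 2 it also dominates a Gaussian.\<close>

lemma nn_integral_powr_tail:
  fixes a :: real assumes a: "a > 1"
  shows "(\<integral>\<^sup>+r. ennreal (if \<bar>r\<bar> \<le> 1 then 1 else \<bar>r\<bar> powr - a) \<partial>lborel) < \<infinity>"
proof -
  have tail: "(\<integral>\<^sup>+r. ennreal (r powr - a) * indicator {1..} r \<partial>lborel) = ennreal (0 - (- (1 powr (1 - a)) / (a - 1)))"
  proof (rule nn_integral_FTC_atLeast[where F="\<lambda>r. - (r powr (1 - a)) / (a - 1)"])
    show "DERIV (\<lambda>r. - (r powr (1 - a)) / (a - 1)) r :> r powr - a" if "1 \<le> r" for r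
    proof -
      have d: "DERIV (\<lambda>r. r powr (1 - a)) r :> (1 - a) * r powr (1 - a - 1)"
        using that by (intro has_real_derivative_powr) auto
      have "- ((1 - a) * r powr (1 - a - 1)) = (a - 1) * r powr - a" by (simp add: algebra_simps)
      then have "- ((1 - a) * r powr (1 - a - 1)) / (a - 1) = r powr - a" using a by (simp only:) simp
      then show ?thesis by (rule DERIV_cong[OF DERIV_cdivide[OF DERIV_minus[OF d]]])
    qed
    show "((\<lambda>r. - (r powr (1 - a)) / (a - 1)) \<longlongrightarrow> 0) at_top"
      using a by real_asymp
  qed auto
  have tail': "(\<integral>\<^sup>+r. ennreal ((-r) powr - a) * indicator {1..} (-r) \<partial>lborel) = (\<integral>\<^sup>+r. ennreal (r powr - a) * indicator {1..} r \<partial>lborel)"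
    by (subst (2) nn_integral_real_affine[where c="-1" and t=0]) auto
  have "(\<integral>\<^sup>+r. ennreal (if \<bar>r\<bar> \<le> 1 then 1 else \<bar>r\<bar> powr - a) \<partial>lborel)
     \<le> (\<integral>\<^sup>+r. indicator {-1..1} r + (ennreal (r powr - a) * indicator {1..} r + ennreal ((-r) powr - a) * indicator {1..} (-r)) \<partial>lborel)"
    by (intro nn_integral_mono) (auto simp: indicator_def abs_if split: if_splits)
  also have "\<dots> = 2 + (ennreal (1 / (a - 1)) + ennreal (1 / (a - 1)))"
    by (subst nn_integral_add, simp, simp, subst nn_integral_add, simp, simp) (simp add: tail tail')
  also have "\<dots> < \<infinity>" by (simp add: ennreal_add_less_top)
  finally show ?thesis .
qed

text \<open>The quotient is bounded by a function of the gap r = |t - t'| alone. For r \<le> 1 the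
  Lipschitz bound gives L^2 r^2 / r^(1 + 2 s) \<le> L^2, which is where s \<le> 1/2 enters; for
  larger gaps the sup bound leaves the integrable tail r^(- 1 - 2 s). \<open>M\<close> is general so
  as to cover both space and the lateral boundary.\<close>

lemma Hs_L2_sq_finite:
  fixes f :: "real \<times> 'a \<Rightarrow> complex"
  assumes s: "0 < s" "s \<le> 1/2"
    and bd: "\<And>t x. x \<in> space M \<Longrightarrow> cmod (f (t, x)) \<le> b * indicator {-R..R} t * indicator B x"
    and lip: "\<And>t t' x. x \<in> space M \<Longrightarrow> cmod (f (t, x) - f (t', x)) \<le> L * \<bar>t - t'\<bar>"
    and pos: "b \<ge> 0" "L \<ge> 0" "R \<ge> 0"
    and B: "B \<in> sets M" "emeasure M B < \<infinity>"
  shows "Hs_L2_sq s M f < \<infinity>"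
proof -
  define w where "w r = ennreal (if \<bar>r\<bar> \<le> 1 then 1 else \<bar>r\<bar> powr - (1 + 2 * s))" for r
  have [measurable]: "w \<in> borel_measurable borel" unfolding w_def by measurable
  define I where "I = (\<integral>\<^sup>+r. w r \<partial>lborel)"
  have I: "I < \<infinity>" unfolding I_def w_def using nn_integral_powr_tail[of "1 + 2 * s"] s by simp
  define C where "C = L\<^sup>2 + (2 * b)\<^sup>2"
  have C: "C \<ge> 0" by (simp add: C_def)
  have [measurable]: "B \<in> sets M" by (rule B)
  have pt: "ennreal ((cmod (f (t, x) - f (t', x)))\<^sup>2 / \<bar>t - t'\<bar> powr (1 + 2 * s))
     \<le> ennreal C * w (t - t') * (indicator {-R..R} t + indicator {-R..R} t') * indicator B x" if x: "x \<in> space M" for t t' x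
  proof (cases "f (t, x) = f (t', x)")
    case False
    have "x \<in> B"
    proof (rule ccontr)
      assume "x \<notin> B"
      then show False using bd[OF x, of t] bd[OF x, of t'] False by simp
    qed
    moreover have "t \<in> {-R..R} \<or> t' \<in> {-R..R}"
    proof (rule ccontr)
      assume "\<not> (t \<in> {-R..R} \<or> t' \<in> {-R..R})"
      then show False using bd[OF x, of t] bd[OF x, of t'] False by simp
    qed
    \<comment> \<open>A nonzero difference needs x in \<open>B\<close> and one of the two times in
      the window; adding the two indicators splits the double integral into two symmetric
      ones.\<close>
    ultimately have 1: "(1::ennreal) \<le> (indicator {-R..R} t + indicator {-R..R} t') * indicator B x"
      by (auto simp: indicator_def)
    have "t \<noteq> t'" using False by auto
    define r where "r = \<bar>t - t'\<bar>"
    have r: "r > 0" using \<open>t \<noteq> t'\<close> by (simp add: r_def)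
    have "(cmod (f (t, x) - f (t', x)))\<^sup>2 / r powr (1 + 2 * s) \<le> C * (if r \<le> 1 then 1 else r powr - (1 + 2 * s))"
    proof (cases "r \<le> 1")
      case True
      have "(cmod (f (t, x) - f (t', x)))\<^sup>2 \<le> (L * r)\<^sup>2"
        unfolding r_def by (intro power_mono lip[OF x]) auto
      also have "\<dots> = L\<^sup>2 * r powr 2" using r by (simp add: power_mult_distrib powr_numeral)
      also have "\<dots> \<le> L\<^sup>2 * r powr (1 + 2 * s)"
        using r True s by (intro mult_left_mono powr_mono') auto
      also have "\<dots> \<le> C * r powr (1 + 2 * s)" unfolding C_def by (intro mult_right_mono) auto
      finally show ?thesis using True r by (simp add: field_simps)
    next
      case False
      have "cmod (f (t, x) - f (t', x)) \<le> b + b"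
      proof (rule order_trans[OF norm_triangle_ineq4 add_mono])
        show "cmod (f (t, x)) \<le> b" "cmod (f (t', x)) \<le> b"
          using pos by (intro order_trans[OF bd[OF x]]; simp split: split_indicator)+
      qed
      then have "(cmod (f (t, x) - f (t', x)))\<^sup>2 \<le> (2 * b)\<^sup>2" by (intro power_mono) auto
      also have "\<dots> \<le> C" unfolding C_def by simp
      finally have "(cmod (f (t, x) - f (t', x)))\<^sup>2 / r powr (1 + 2 * s) \<le> C / r powr (1 + 2 * s)"
        by (intro divide_right_mono) auto
      then show ?thesis using False powr_minus[of r "1 + 2 * s"] by (simp only: if_False divide_inverse)
    qed
    then have "ennreal ((cmod (f (t, x) - f (t', x)))\<^sup>2 / \<bar>t - t'\<bar> powr (1 + 2 * s)) \<le> ennreal C * w (t - t')"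
      unfolding r_def w_def by (subst ennreal_mult[symmetric]) (auto intro!: ennreal_leI simp: C)
    also have "\<dots> = ennreal C * w (t - t') * 1" by simp
    also have "\<dots> \<le> ennreal C * w (t - t') * ((indicator {-R..R} t + indicator {-R..R} t') * indicator B x)"
      by (intro mult_left_mono 1) simp
    finally show ?thesis by (simp add: mult.assoc)
  qed simp
  have "(\<integral>\<^sup>+t. \<integral>\<^sup>+t'. \<integral>\<^sup>+x. ennreal ((cmod (f (t, x) - f (t', x)))\<^sup>2 / \<bar>t - t'\<bar> powr (1 + 2 * s)) \<partial>M \<partial>lborel \<partial>lborel)
     \<le> (\<integral>\<^sup>+t. \<integral>\<^sup>+t'. \<integral>\<^sup>+x. ennreal C * w (t - t') * (indicator {-R..R} t + indicator {-R..R} t') * indicator B x \<partial>M \<partial>lborel \<partial>lborel)"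
    by (intro nn_integral_mono pt)
  also have "\<dots> = (\<integral>\<^sup>+t. \<integral>\<^sup>+t'. (ennreal C * emeasure M B) * (w (t - t') * indicator {-R..R} t + w (t - t') * indicator {-R..R} t') \<partial>lborel \<partial>lborel)"
    by (intro nn_integral_cong) (simp only: nn_integral_cmult_indicator[OF B(1)], simp add: algebra_simps)
  also have "\<dots> = ennreal C * emeasure M B * ((\<integral>\<^sup>+t. \<integral>\<^sup>+t'. w (t - t') * indicator {-R..R} t \<partial>lborel \<partial>lborel)
      + (\<integral>\<^sup>+t. \<integral>\<^sup>+t'. w (t - t') * indicator {-R..R} t' \<partial>lborel \<partial>lborel))"
    by (simp add: nn_integral_cmult nn_integral_add)
  also have "(\<integral>\<^sup>+t. \<integral>\<^sup>+t'. w (t - t') * indicator {-R..R} t' \<partial>lborel \<partial>lborel) = (\<integral>\<^sup>+t'. \<integral>\<^sup>+t. w (t - t') * indicator {-R..R} t' \<partial>lborel \<partial>lborel)"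
    by (rule lborel_pair.Fubini'[symmetric]) measurable
  also have "(\<integral>\<^sup>+t'. \<integral>\<^sup>+t. w (t - t') * indicator {-R..R} t' \<partial>lborel \<partial>lborel) = I * ennreal (2 * R)"
  proof -
    have "(\<integral>\<^sup>+t. w (t - t') \<partial>lborel) = I" for t'
      unfolding I_def by (subst (2) nn_integral_real_affine[where c=1 and t="-t'"]) auto
    then show ?thesis using pos by (simp add: nn_integral_multc nn_integral_cmult)
  qed
  also have "(\<integral>\<^sup>+t. \<integral>\<^sup>+t'. w (t - t') * indicator {-R..R} t \<partial>lborel \<partial>lborel) = I * ennreal (2 * R)"
  proof -
    have "(\<integral>\<^sup>+t'. w (t - t') \<partial>lborel) = I" for t
      unfolding I_def by (subst (2) nn_integral_real_affine[where c="-1" and t=t]) auto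
    then show ?thesis using pos by (simp add: nn_integral_multc nn_integral_cmult)
  qed
  also have "ennreal C * emeasure M B * (I * ennreal (2 * R) + I * ennreal (2 * R)) < \<infinity>"
    using I B by (simp add: ennreal_mult_less_top ennreal_add_less_top)
  finally have 2: "(\<integral>\<^sup>+t. \<integral>\<^sup>+t'. \<integral>\<^sup>+x. ennreal ((cmod (f (t, x) - f (t', x)))\<^sup>2 / \<bar>t - t'\<bar> powr (1 + 2 * s)) \<partial>M \<partial>lborel \<partial>lborel) < \<infinity>" .
  have "(\<integral>\<^sup>+t. \<integral>\<^sup>+x. ennreal ((cmod (f (t, x)))\<^sup>2) \<partial>M \<partial>lborel)
     \<le> (\<integral>\<^sup>+t. \<integral>\<^sup>+x. ennreal (b\<^sup>2) * indicator {-R..R} t * indicator B x \<partial>M \<partial>lborel)"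
  proof (intro nn_integral_mono)
    fix t x assume x: "x \<in> space M"
    have "(cmod (f (t, x)))\<^sup>2 \<le> (b * indicator {-R..R} t * indicator B x)\<^sup>2"
      using bd[OF x] by (intro power_mono) auto
    then show "ennreal ((cmod (f (t, x)))\<^sup>2) \<le> ennreal (b\<^sup>2) * indicator {-R..R} t * indicator B x"
      by (auto simp: indicator_def split: if_splits intro: ennreal_leI)
  qed
  also have "\<dots> = ennreal (b\<^sup>2) * emeasure M B * ennreal (2 * R)"
    using pos by (simp add: nn_integral_cmult_indicator nn_integral_multc nn_integral_cmult mult_ac)
  also have "\<dots> < \<infinity>" using B by (simp add: ennreal_mult_less_top)
  finally show ?thesis using 2 by (simp add: Hs_L2_sq_def)
qed

lemma test_function_boxE:
  fixes \<Phi> :: "real \<times> (real^'n::finite) \<Rightarrow> complex"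
  assumes \<Phi>: "test_function UNIV \<Phi>"
  obtains M R where "M > 0" "R > 0"
    "\<And>t x. cmod (\<Phi> (t, x)) \<le> M * indicator {-R..R} t * indicator (cball 0 R) x"
    "\<And>t x i. cmod (dderiv (axis i 1) (\<lambda>x. \<Phi> (t, x)) x) \<le> M * indicator {-R..R} t * indicator (cball 0 R) x"
    "\<And>t t' x. cmod (\<Phi> (t, x) - \<Phi> (t', x)) \<le> M * \<bar>t - t'\<bar>"
    "\<And>t x x'. cmod (\<Phi> (t, x) - \<Phi> (t, x')) \<le> M * norm (x - x')"
proof -
  obtain K where K: "compact K" "\<And>z. z \<notin> K \<Longrightarrow> \<Phi> z = 0" "\<And>v z. z \<notin> K \<Longrightarrow> dderiv v \<Phi> z = 0"
    using \<Phi> by (rule test_function_supportE) blast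
  obtain R0 where R0: "\<And>z. z \<in> K \<Longrightarrow> norm z \<le> R0"
    using compact_imp_bounded[OF K(1)] by (auto simp: bounded_iff)
  define R where "R = max 1 R0"
  have out: "(t, x) \<notin> K" if "\<not> (t \<in> {-R..R} \<and> x \<in> cball 0 R)" for t x
  proof
    assume "(t, x) \<in> K"
    then have "norm (t, x) \<le> R" using R0 R_def by fastforce
    then have "\<bar>t\<bar> \<le> R" "norm x \<le> R" using norm_fst_le[of t x] norm_snd_le[of x t] by auto
    then show False using that by auto
  qed
  obtain M1 where M1: "M1 > 0" "\<And>z. cmod (\<Phi> z) \<le> M1" using test_function_bounded[OF \<Phi>] by blast
  obtain M2 where M2: "M2 > 0" "\<And>z v. cmod (dderiv v \<Phi> z) \<le> M2 * norm v" using dderiv_bounded[OF \<Phi>] by blast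
  obtain M3 where M3: "M3 > 0" "\<And>z z'. cmod (\<Phi> z - \<Phi> z') \<le> M3 * norm (z - z')" using test_function_lipschitz[OF \<Phi>] by blast
  define M where "M = M1 + M2 + M3"
  have M: "M > 0" "M1 \<le> M" "M2 \<le> M" "M3 \<le> M" using M1(1) M2(1) M3(1) by (auto simp: M_def)
  show thesis
  proof (rule that[OF M(1), of R])
    show "R > 0" by (simp add: R_def)
    show "cmod (\<Phi> (t, x)) \<le> M * indicator {-R..R} t * indicator (cball 0 R) x" for t x
      using K(2)[OF out[of t x]] order_trans[OF M1(2)[of "(t, x)"] M(2)] by (cases "t \<in> {-R..R} \<and> x \<in> cball 0 R") auto
    show "cmod (dderiv (axis i 1) (\<lambda>x. \<Phi> (t, x)) x) \<le> M * indicator {-R..R} t * indicator (cball 0 R) x" for t x i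
    proof -
      have eq: "dderiv (axis i 1) (\<lambda>x. \<Phi> (t, x)) x = dderiv (0, axis i 1) \<Phi> (t, x)"
        by (rule dderiv_slice) (use test_function_has_derivative[OF \<Phi>] in \<open>auto simp: differentiable_def\<close>)
      have "cmod (dderiv (0, axis i 1) \<Phi> (t, x)) \<le> M"
        using order_trans[OF M2(2)[of "(0, axis i 1)" "(t, x)"], of M] M by simp
      then show ?thesis unfolding eq
        using K(3)[OF out[of t x]] by (cases "t \<in> {-R..R} \<and> x \<in> cball 0 R") auto
    qed
    show "cmod (\<Phi> (t, x) - \<Phi> (t', x)) \<le> M * \<bar>t - t'\<bar>" for t t' x
      using order_trans[OF M3(2)[of "(t, x)" "(t', x)"] mult_right_mono[OF M(4)]] by simp
    show "cmod (\<Phi> (t, x) - \<Phi> (t, x')) \<le> M * norm (x - x')" for t x x'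
      using order_trans[OF M3(2)[of "(t, x)" "(t, x')"] mult_right_mono[OF M(4)]] by simp
  qed
qed

lemma H1s_sq_test_finite:
  fixes \<Phi> :: "real \<times> (real^'n::finite) \<Rightarrow> complex"
  assumes \<Phi>: "test_function UNIV \<Phi>"
  shows "H1s_sq (1/2) \<Phi> < \<infinity>"
proof -
  obtain M R where MR: "M > 0" "R > 0"
    "\<And>t x. cmod (\<Phi> (t, x)) \<le> M * indicator {-R..R} t * indicator (cball 0 R) x"
    "\<And>t x i. cmod (dderiv (axis i 1) (\<lambda>x. \<Phi> (t, x)) x) \<le> M * indicator {-R..R} t * indicator (cball 0 R) x"
    "\<And>t t' x. cmod (\<Phi> (t, x) - \<Phi> (t', x)) \<le> M * \<bar>t - t'\<bar>"
    using test_function_boxE[OF \<Phi>] by metis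
  have fin: "emeasure lborel (cball (0::real^'n) R) < \<infinity>"
    by (rule emeasure_bounded_finite) simp
  have "Hs_L2_sq (1/2) lborel \<Phi> < \<infinity>"
    by (rule Hs_L2_sq_finite[where b=M and R=R and L=M and B="cball 0 R"]) (use MR fin in auto)
  moreover have "(\<integral>\<^sup>+t. H1_sq (\<lambda>x. \<Phi> (t, x)) \<partial>lborel) < \<infinity>"
  proof -
    let ?A = "ennreal (M\<^sup>2 + (real CARD('n) * M)\<^sup>2) * emeasure lborel (cball (0::real^'n) R)"
    have "H1_sq (\<lambda>x. \<Phi> (t, x)) \<le> ?A * indicator {-R..R} t" for t
    proof (cases "t \<in> {-R..R}")
      case True
      have "H1_sq (\<lambda>x. \<Phi> (t, x)) \<le> ?A"
      proof (rule H1_sq_bound[OF test_function_slice[OF \<Phi>]])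
        show "cmod (\<Phi> (t, x)) \<le> M * indicator (cball 0 R) x" for x
          using MR(3)[of t x] True by simp
        show "cmod (dderiv (axis i 1) (\<lambda>x. \<Phi> (t, x)) x) \<le> M * indicator (cball 0 R) x" for i x
          using MR(4)[where t=t and x=x and i=i] True by simp
      qed simp
      then show ?thesis using True by simp
    next
      case False
      have "H1_sq (\<lambda>x. \<Phi> (t, x)) \<le> ennreal (0\<^sup>2 + (real CARD('n) * 0)\<^sup>2) * emeasure lborel (cball (0::real^'n) R)"
      proof (rule H1_sq_bound[OF test_function_slice[OF \<Phi>]])
        show "cmod (\<Phi> (t, x)) \<le> 0 * indicator (cball 0 R) x" for x
          using MR(3)[of t x] False by simp
        show "cmod (dderiv (axis i 1) (\<lambda>x. \<Phi> (t, x)) x) \<le> 0 * indicator (cball 0 R) x" for i x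
          using MR(4)[where t=t and x=x and i=i] False by simp
      qed simp
      then show ?thesis using False by simp
    qed
    then have "(\<integral>\<^sup>+t. H1_sq (\<lambda>x. \<Phi> (t, x)) \<partial>lborel) \<le> (\<integral>\<^sup>+t. ?A * indicator {-R..R} t \<partial>lborel)"
      by (rule nn_integral_mono)
    also have "\<dots> = ?A * ennreal (2 * R)" using MR by (simp add: nn_integral_cmult_indicator)
    also have "\<dots> < \<infinity>" using fin by (simp add: ennreal_mult_less_top)
    finally show ?thesis .
  qed
  ultimately show ?thesis by (simp add: H1s_sq_def)
qed

lemma H1s_Q_test:
  assumes \<Phi>: "test_function UNIV \<Phi>" shows "\<Phi> \<in> H1s_Q (1/2) T \<Omega>"
proof -
  have "H1s_Q_sq (1/2) T \<Omega> \<Phi> \<le> H1s_sq (1/2) \<Phi>"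
    unfolding H1s_Q_sq_def by (intro INF_lower2[OF _ order_refl]) (use test_function_measurable[OF \<Phi>] in auto)
  then show ?thesis using H1s_sq_test_finite[OF \<Phi>] by (simp add: H1s_Q_def)
qed

section \<open>The surface measure\<close>

lemma hausdorff_sets [simp]: "sets (hausdorff_measure k :: 'a::metric_space measure) = sets borel"
  "space (hausdorff_measure k :: 'a measure) = UNIV"
proof -
  have "sigma_sets UNIV (sets (borel::'a measure)) = sets borel"
    using sets.sigma_sets_eq[of "borel::'a measure"] by simp
  then show "sets (hausdorff_measure k :: 'a::metric_space measure) = sets borel"
    "space (hausdorff_measure k :: 'a measure) = UNIV"
    unfolding hausdorff_measure_def by (simp_all add: space_measure_of_conv)
qed

text \<open>
  That the right-hand side is a measure on the Borel sets is not needed: otherwise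
  \<open>measure_of\<close> yields the zero measure, and the inequality still holds.
\<close>

lemma emeasure_hausdorff_le:
  "emeasure (hausdorff_measure k) A \<le> (SUP \<delta>\<in>{0<..}. hausdorff_pre k \<delta> A)"
  unfolding hausdorff_measure_def by (subst emeasure_measure_of_conv) auto

text \<open>The finite cover is continued by empty sets. These cost nothing because
  \<open>hausdorff_pre\<close> treats them separately, which matters for k = 0, where every nonempty
  piece costs a full unit.\<close>

lemma hausdorff_pre_le:
  fixes S :: "'i \<Rightarrow> 'a::metric_space set"
  assumes fin: "finite I" and cov: "A \<subseteq> (\<Union>i\<in>I. S i)"
    and S: "\<And>i. i \<in> I \<Longrightarrow> bounded (S i) \<and> diameter (S i) \<le> d" and d: "0 \<le> d" "d \<le> \<delta>"
  shows "hausdorff_pre k \<delta> A \<le> of_nat (card I) * ennreal (unit_ball_vol (real k) * (d / 2) ^ k)"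
proof -
  obtain e where e: "bij_betw e {..<card I} I"
    using ex_bij_betw_nat_finite[OF fin] by (auto simp: atLeast0LessThan)
  define C where "C i = (if i < card I then S (e i) else {})" for i
  have eI: "e i \<in> I" if "i < card I" for i using e that by (auto simp: bij_betw_def)
  have "(\<Union>i\<in>e ` {..<card I}. S i) = (\<Union>i<card I. S (e i))" by auto
  then have "(\<Union>i\<in>I. S i) = (\<Union>i<card I. S (e i))" using bij_betw_imp_surj_on[OF e] by simp
  then have cov': "A \<subseteq> (\<Union>i. C i)" using cov by (fastforce simp: C_def)
  have C: "bounded (C i) \<and> diameter (C i) \<le> d" for i
    using S[OF eI] d by (auto simp: C_def)
  have "hausdorff_pre k \<delta> A \<le> (\<Sum>i. if C i = {} then 0 else ennreal (unit_ball_vol (real k) * (diameter (C i) / 2) ^ k))"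
    unfolding hausdorff_pre_def using cov' C d by (intro INF_lower) (auto intro: order_trans)
  also have "\<dots> = (\<Sum>i<card I. if C i = {} then 0 else ennreal (unit_ball_vol (real k) * (diameter (C i) / 2) ^ k))"
    by (rule suminf_finite) (auto simp: C_def)
  also have "\<dots> \<le> (\<Sum>i<card I. ennreal (unit_ball_vol (real k) * (d / 2) ^ k))"
    using C by (intro sum_mono) (auto intro!: ennreal_leI mult_left_mono power_mono divide_right_mono simp: diameter_ge_0)
  finally show ?thesis by simp
qed

text \<open>A grid argument. On the graph, distances are at most 1 + L times those of the
  projections to the hyperplane orthogonal to \<open>e\<close>; so grid cells of side r / N in k = d
  - 1 orthonormal coordinates pull back to pieces of diameter at most (1 + L) k r / N. At most (2 N
  + 1)^k cells occur, and (2 N + 1) / N \<le> 3 makes the total cost independent of N and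
  proportional to r^k.\<close>

lemma hausdorff_graph_le:
  fixes e :: "real^'n::finite" and g :: "real^'n \<Rightarrow> real"
  assumes e: "norm e = 1" and g: "L-lipschitz_on {y. y \<bullet> e = 0} g" and r: "r > 0"
    and A: "A \<subseteq> {y. y \<bullet> e = g (y - (y \<bullet> e) *\<^sub>R e)}" "A \<subseteq> cball x r"
  shows "emeasure (hausdorff_measure (CARD('n) - 1)) A
    \<le> ennreal (unit_ball_vol (real (CARD('n) - 1)) * (3 * (1 + L) * real (CARD('n) - 1) / 2) ^ (CARD('n) - 1) * r ^ (CARD('n) - 1))"
proof -
  define k where "k = CARD('n) - 1"
  have L: "L \<ge> 0" using g by (simp add: lipschitz_on_def)
  define P where "P y = y - (y \<bullet> e) *\<^sub>R e" for y
  have ee: "e \<bullet> e = 1" using e by (simp add: dot_square_norm)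
  have P: "P y \<bullet> e = 0" for y by (simp add: P_def inner_diff_left ee)
  let ?H = "{y. y \<bullet> e = 0}"
  have sub: "subspace ?H" by (auto simp: subspace_def inner_add_left)
  \<comment> \<open>An orthonormal basis of the hyperplane supplies the grid coordinates; in
    dimension 1 it is empty.\<close>
  obtain B where B: "B \<subseteq> ?H" "pairwise orthogonal B" "\<And>b. b \<in> B \<Longrightarrow> norm b = 1" "independent B" "card B = dim ?H" "span B = ?H"
    using orthonormal_basis_subspace[OF sub] by metis
  have "dim {y. e \<bullet> y = 0} = DIM(real^'n) - 1" using e by (intro dim_hyperplane) auto
  then have cB: "card B = k" using B(5) by (simp add: k_def inner_commute)
  have finB: "finite B" using B(4) by (rule independent_imp_finite)
  have normH: "norm v \<le> (\<Sum>b\<in>B. \<bar>b \<bullet> v\<bar>)" if "v \<in> ?H" for v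
  proof -
    have "(\<Sum>b\<in>B. (v \<bullet> b) *\<^sub>R b) = v"
      using orthonormal_basis_expand[OF B(2) B(3) _ finB, of v] that B(6) by auto
    then have "norm v = norm (\<Sum>b\<in>B. (v \<bullet> b) *\<^sub>R b)" by simp
    also have "\<dots> \<le> (\<Sum>b\<in>B. norm ((v \<bullet> b) *\<^sub>R b))" by (rule norm_sum)
    also have "\<dots> = (\<Sum>b\<in>B. \<bar>b \<bullet> v\<bar>)" using B(3) by (intro sum.cong) (auto simp: inner_commute)
    finally show ?thesis .
  qed
  have bP: "b \<bullet> P y = b \<bullet> y" if "b \<in> B" for b y
    using B(1) that by (auto simp: P_def inner_diff_right)
  have dec: "y = P y + g (P y) *\<^sub>R e" if "y \<in> A" for y
  proof -
    have "y \<bullet> e = g (P y)" using A(1) that by (auto simp: P_def)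
    then show ?thesis by (simp add: P_def)
  qed
  have gl: "\<bar>g (P y) - g (P y')\<bar> \<le> L * norm (P y - P y')" for y y'
    using lipschitz_onD[OF g, of "P y" "P y'"] P by (simp add: dist_norm)
  have diff: "norm (y - y') \<le> (1 + L) * (\<Sum>b\<in>B. \<bar>b \<bullet> (y - y')\<bar>)" if "y \<in> A" "y' \<in> A" for y y'
  proof -
    have "y - y' = (P y - P y') + (g (P y) - g (P y')) *\<^sub>R e"
      using dec[OF that(1)] dec[OF that(2)] by (simp add: algebra_simps)
    then have "norm (y - y') \<le> norm (P y - P y') + \<bar>g (P y) - g (P y')\<bar>"
      using norm_triangle_ineq[of "P y - P y'" "(g (P y) - g (P y')) *\<^sub>R e"] e by simp
    also have "\<dots> \<le> (1 + L) * norm (P y - P y')" using gl[of y y'] by (simp add: algebra_simps)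
    also have "\<dots> \<le> (1 + L) * (\<Sum>b\<in>B. \<bar>b \<bullet> (P y - P y')\<bar>)"
      using L P by (intro mult_left_mono normH) (auto simp: inner_diff_left)
    also have "(\<Sum>b\<in>B. \<bar>b \<bullet> (P y - P y')\<bar>) = (\<Sum>b\<in>B. \<bar>b \<bullet> (y - y')\<bar>)"
      by (intro sum.cong) (auto simp: inner_diff_right bP)
    finally show ?thesis .
  qed
  define K where "K = unit_ball_vol (real k) * (3 * (1 + L) * real k / 2) ^ k * r ^ k"
  have pre: "hausdorff_pre k \<delta> A \<le> ennreal K" if \<delta>: "\<delta> > 0" for \<delta>
  proof -
    \<comment> \<open>The bound for the diameter of a piece when N = 1; dividing by a large N brings
      it below \<delta>.\<close>
    define c where "c = (1 + L) * real k * r"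
    have c: "c \<ge> 0" using L r by (simp add: c_def)
    obtain N0 :: nat where N0: "c / \<delta> < real N0" using reals_Archimedean2 by blast
    define N where "N = max 1 N0"
    have N: "N \<ge> 1" "c / \<delta> \<le> real N" using N0 by (auto simp: N_def)
    define d where "d = c / real N"
    have d: "0 \<le> d" "d \<le> \<delta>" using N c \<delta> by (auto simp: d_def field_simps)
    \<comment> \<open>The grid cell of y, one integer per basis vector. Since y lies within r of x,
      each index is between - N and N, both ends included, hence 2 N + 1 values.\<close>
    define ix where "ix y = (\<lambda>b\<in>B. \<lfloor>real N * (b \<bullet> (y - x)) / r\<rfloor>)" for y
    define I where "I = (B \<rightarrow>\<^sub>E {- int N..int N})"
    have finI: "finite I" unfolding I_def by (intro finite_PiE finB) auto
    have cI: "card I = (2 * N + 1) ^ k"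
    proof -
      have "card {- int N..int N} = 2 * N + 1" by simp
      then show ?thesis unfolding I_def by (simp add: card_PiE finB cB)
    qed
    have ixI: "ix y \<in> I" if "y \<in> A" for y
    proof -
      have "real_of_int (- int N) \<le> real N * (b \<bullet> (y - x)) / r \<and> real N * (b \<bullet> (y - x)) / r \<le> real_of_int (int N)" if b: "b \<in> B" for b
      proof -
        have "\<bar>b \<bullet> (y - x)\<bar> \<le> norm b * norm (y - x)" by (rule Cauchy_Schwarz_ineq2)
        also have "\<dots> \<le> r" using A(2) \<open>y \<in> A\<close> B(3)[OF b] by (auto simp: dist_norm norm_minus_commute)
        finally have 1: "\<bar>b \<bullet> (y - x)\<bar> / r \<le> 1" using r by simp
        have "\<bar>real N * (b \<bullet> (y - x)) / r\<bar> = real N * (\<bar>b \<bullet> (y - x)\<bar> / r)" using r by (simp add: abs_mult)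
        also have "\<dots> \<le> real N * 1" by (intro mult_left_mono 1) simp
        finally have "\<bar>real N * (b \<bullet> (y - x)) / r\<bar> \<le> real N" by (simp only: mult_1_right)
        then show ?thesis unfolding abs_le_iff of_int_minus of_int_of_nat_eq by linarith
      qed
      then have "real_of_int (- int N) \<le> real N * (b \<bullet> (y - x)) / r" "real N * (b \<bullet> (y - x)) / r \<le> real_of_int (int N)" if "b \<in> B" for b
        using that by blast+
      then have "\<lfloor>real N * (b \<bullet> (y - x)) / r\<rfloor> \<in> {- int N..int N}" if "b \<in> B" for b
        using floor_mono[of "real_of_int (- int N)" "real N * (b \<bullet> (y - x)) / r"]
          floor_mono[of "real N * (b \<bullet> (y - x)) / r" "real_of_int (int N)"] that by (simp only: floor_of_int atLeastAtMost_iff) 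
      then show ?thesis by (auto simp: I_def ix_def)
    qed
    define S where "S \<phi> = {y \<in> A. ix y = \<phi>}" for \<phi>
    have "hausdorff_pre k \<delta> A \<le> of_nat (card I) * ennreal (unit_ball_vol (real k) * (d / 2) ^ k)"
    proof (rule hausdorff_pre_le[OF finI _ _ d])
      show "A \<subseteq> (\<Union>\<phi>\<in>I. S \<phi>)" using ixI by (auto simp: S_def)
      fix \<phi>
      have bS: "bounded (S \<phi>)" using A(2) by (intro bounded_subset[OF bounded_cball]) (auto simp: S_def)
      have "dist y y' \<le> d" if "y \<in> S \<phi>" "y' \<in> S \<phi>" for y y'
      proof -
        have le: "\<bar>b \<bullet> (y - y')\<bar> \<le> r / real N" if b: "b \<in> B" for b
        proof -
          have "ix y b = ix y' b" using \<open>y \<in> S \<phi>\<close> \<open>y' \<in> S \<phi>\<close> by (simp add: S_def)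
          then have "\<lfloor>real N * (b \<bullet> (y - x)) / r\<rfloor> = \<lfloor>real N * (b \<bullet> (y' - x)) / r\<rfloor>"
            using b by (simp add: ix_def)
          then have "\<bar>real N * (b \<bullet> (y - x)) / r - real N * (b \<bullet> (y' - x)) / r\<bar> \<le> 1" by linarith
          moreover have "real N * (b \<bullet> (y - x)) / r - real N * (b \<bullet> (y' - x)) / r = real N / r * (b \<bullet> (y - y'))"
            by (simp add: inner_diff_right diff_divide_distrib algebra_simps)
          ultimately have "\<bar>real N / r * (b \<bullet> (y - y'))\<bar> \<le> 1" by simp
          then have "real N / r * \<bar>b \<bullet> (y - y')\<bar> \<le> 1" using r by (simp add: abs_mult)
          then show ?thesis using r N by (simp add: field_simps)
        qed
        have "dist y y' \<le> (1 + L) * (\<Sum>b\<in>B. \<bar>b \<bullet> (y - y')\<bar>)"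
          using diff that by (simp add: S_def dist_norm)
        also have "\<dots> \<le> (1 + L) * (\<Sum>b\<in>B. r / real N)" using L by (intro mult_left_mono sum_mono le) auto
        also have "\<dots> = d" by (simp add: d_def c_def cB)
        finally show ?thesis .
      qed
      then have "diameter (S \<phi>) \<le> d" using d by (intro diameter_le) (auto simp: dist_norm)
      then show "bounded (S \<phi>) \<and> diameter (S \<phi>) \<le> d" using bS by simp
    qed
    also have "\<dots> = ennreal (real ((2 * N + 1) ^ k) * (unit_ball_vol (real k) * (d / 2) ^ k))"
      unfolding cI ennreal_of_nat_eq_real_of_nat by (subst ennreal_mult') auto
    also have "\<dots> \<le> ennreal K"
    proof (rule ennreal_leI)
      have "real (2 * N + 1) * (d / 2) = ((2 * real N + 1) / real N) * (c / 2)" using N by (simp add: d_def field_simps)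
      also have "\<dots> \<le> 3 * (c / 2)" using N c by (intro mult_right_mono) (auto simp: field_simps)
      finally have "(real (2 * N + 1) * (d / 2)) ^ k \<le> (3 * (c / 2)) ^ k" using d by (intro power_mono) auto
      then have "unit_ball_vol (real k) * (real (2 * N + 1) * (d / 2)) ^ k \<le> unit_ball_vol (real k) * (3 * (c / 2)) ^ k"
        by (intro mult_left_mono) auto
      also have "(3 * (c / 2)) ^ k = (3 * (1 + L) * real k / 2) ^ k * r ^ k"
        unfolding power_mult_distrib[symmetric] c_def by (simp add: mult_ac)
      finally have "unit_ball_vol (real k) * (real (2 * N + 1) * (d / 2)) ^ k \<le> K"
        unfolding K_def mult.assoc .
      moreover have "unit_ball_vol (real k) * (real (2 * N + 1) * (d / 2)) ^ k = real ((2 * N + 1) ^ k) * (unit_ball_vol (real k) * (d / 2) ^ k)"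
        unfolding power_mult_distrib of_nat_power by (simp only: mult_ac)
      ultimately show "real ((2 * N + 1) ^ k) * (unit_ball_vol (real k) * (d / 2) ^ k) \<le> K" by (simp only:)
    qed
    finally show ?thesis .
  qed
  have "emeasure (hausdorff_measure k) A \<le> (SUP \<delta>\<in>{0<..}. hausdorff_pre k \<delta> A)" by (rule emeasure_hausdorff_le)
  also have "\<dots> \<le> ennreal K" by (intro SUP_least pre) auto
  finally show ?thesis by (simp add: K_def k_def)
qed

section \<open>Growth of the surface measure and the boundary norm of test functions\<close>

lemma surface_sets:
  "space (surface_measure \<Omega>) = frontier \<Omega>"
  "sets (surface_measure \<Omega>) = sets (restrict_space borel (frontier \<Omega>))"
  unfolding surface_measure_def by (auto simp: space_restrict_space sets_restrict_space)

text \<open>The frontier is compact, so finitely many graph charts cover it; adding their constants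
  gives one bound for all centres and radii.\<close>

lemma surface_measure_ball:
  fixes \<Omega> :: "(real^'n::finite) set"
  assumes "bounded_lipschitz_domain \<Omega>"
  obtains C where "C \<ge> 0"
    "\<And>x r. r > 0 \<Longrightarrow> emeasure (surface_measure \<Omega>) (frontier \<Omega> \<inter> cball x r) \<le> ennreal (C * r ^ (CARD('n) - 1))"
proof -
  define k where "k = CARD('n) - 1"
  have bd: "bounded \<Omega>" and loc: "\<forall>x\<in>frontier \<Omega>. \<exists>V e L. \<exists>g :: real^'n \<Rightarrow> real.
        open V \<and> x \<in> V \<and> norm e = 1 \<and> L-lipschitz_on {y. y \<bullet> e = 0} g \<and>
        \<Omega> \<inter> V = {y \<in> V. g (y - (y \<bullet> e) *\<^sub>R e) < y \<bullet> e} \<and>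
        frontier \<Omega> \<inter> V = {y \<in> V. y \<bullet> e = g (y - (y \<bullet> e) *\<^sub>R e)}"
    using assms unfolding bounded_lipschitz_domain_def by auto
  have comp: "compact (frontier \<Omega>)" using bd by (rule compact_frontier_bounded)
  have "\<exists>V C. open V \<and> x \<in> V \<and> C \<ge> 0 \<and> (\<forall>z r. r > 0 \<longrightarrow>
      emeasure (hausdorff_measure k) (frontier \<Omega> \<inter> V \<inter> cball z r) \<le> ennreal (C * r ^ k))" if x: "x \<in> frontier \<Omega>" for x
  proof -
    obtain V e L g where V: "open V" "x \<in> V" "norm e = 1" "L-lipschitz_on {y. y \<bullet> e = 0} g"
      "frontier \<Omega> \<inter> V = {y \<in> V. y \<bullet> e = g (y - (y \<bullet> e) *\<^sub>R e)}" using bspec[OF loc x] by blast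
    let ?C = "unit_ball_vol (real k) * (3 * (1 + L) * real k / 2) ^ k"
    have "?C \<ge> 0" using V(4) by (simp add: lipschitz_on_def)
    moreover have "emeasure (hausdorff_measure k) (frontier \<Omega> \<inter> V \<inter> cball z r) \<le> ennreal (?C * r ^ k)" if "r > 0" for z r
      unfolding k_def by (rule hausdorff_graph_le[OF V(3,4) that, of _ z]) (use V(5) in auto)
    ultimately show ?thesis using V(1,2) by blast
  qed
  then obtain V C where VC: "\<And>x. x \<in> frontier \<Omega> \<Longrightarrow> open (V x) \<and> x \<in> V x \<and> C x \<ge> 0 \<and> (\<forall>z r. r > 0 \<longrightarrow>
      emeasure (hausdorff_measure k) (frontier \<Omega> \<inter> V x \<inter> cball z r) \<le> ennreal (C x * r ^ k))"
    by metis
  obtain F where F: "F \<subseteq> frontier \<Omega>" "finite F" "frontier \<Omega> \<subseteq> (\<Union>x\<in>F. V x)"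
    using compactE_image[OF comp, of "frontier \<Omega>" V] VC by blast
  have "emeasure (surface_measure \<Omega>) (frontier \<Omega> \<inter> cball z r) \<le> ennreal ((\<Sum>x\<in>F. C x) * r ^ k)" if r: "r > 0" for z r
  proof -
    have "emeasure (surface_measure \<Omega>) (frontier \<Omega> \<inter> cball z r) = emeasure (hausdorff_measure k) (frontier \<Omega> \<inter> cball z r)"
      unfolding surface_measure_def k_def by (rule emeasure_restrict_space) auto
    also have "\<dots> = emeasure (hausdorff_measure k) (\<Union>x\<in>F. frontier \<Omega> \<inter> V x \<inter> cball z r)"
      by (rule arg_cong[where f="emeasure _"]) (use F in blast)
    also have "\<dots> \<le> (\<Sum>x\<in>F. emeasure (hausdorff_measure k) (frontier \<Omega> \<inter> V x \<inter> cball z r))"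
    proof (rule emeasure_subadditive_finite[OF F(2)])
      show "(\<lambda>x. frontier \<Omega> \<inter> V x \<inter> cball z r) ` F \<subseteq> sets (hausdorff_measure k)"
      proof safe
        fix x assume "x \<in> F"
        then have "open (V x)" using VC F(1) by blast
        then have "frontier \<Omega> \<inter> V x \<inter> cball z r \<in> sets borel"
          by (intro sets.Int borel_open borel_closed frontier_closed closed_cball)
        then show "frontier \<Omega> \<inter> V x \<inter> cball z r \<in> sets (hausdorff_measure k)" by simp
      qed
    qed
    also have "\<dots> \<le> (\<Sum>x\<in>F. ennreal (C x * r ^ k))" using VC F(1) r by (intro sum_mono) blast
    also have "\<dots> = ennreal (\<Sum>x\<in>F. C x * r ^ k)" using VC F(1) r by (intro sum_ennreal) (auto intro!: mult_nonneg_nonneg)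
    finally show ?thesis unfolding sum_distrib_right .
  qed
  moreover have "(\<Sum>x\<in>F. C x) \<ge> 0" using VC F(1) by (intro sum_nonneg) auto
  ultimately show thesis using that[of "\<Sum>x\<in>F. C x"] unfolding k_def by blast
qed

text \<open>Dyadic decomposition around x. Where norm (x - y) lies between q / 2 and q, the
  integrand is at most M^2 q^2 / (q / 2)^d, and the set has measure at most C q^(d - 1); the product
  is 2^d C M^2 q, a geometric series for q = D / 2^j. The exponent d in the kernel is d - 1 + 2 r
  with r = 1/2.\<close>

lemma surface_kernel_bound:
  fixes \<Omega> :: "(real^'n::finite) set"
  assumes \<Omega>: "bounded_lipschitz_domain \<Omega>"
  obtains A where "A < \<infinity>" "\<And>(f :: real^'n \<Rightarrow> complex) M x. (\<And>x y. cmod (f x - f y) \<le> M * norm (x - y)) \<Longrightarrow> M \<ge> 0 \<Longrightarrow> x \<in> frontier \<Omega> \<Longrightarrow>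
     (\<integral>\<^sup>+y. ennreal ((cmod (f x - f y))\<^sup>2 / norm (x - y) powr real CARD('n)) \<partial>surface_measure \<Omega>) \<le> ennreal (M\<^sup>2) * A"
proof -
  obtain C where C: "C \<ge> 0"
    "\<And>x r. r > 0 \<Longrightarrow> emeasure (surface_measure \<Omega>) (frontier \<Omega> \<inter> cball x r) \<le> ennreal (C * r ^ (CARD('n) - 1))"
    using surface_measure_ball[OF \<Omega>] by blast
  have "bounded (frontier \<Omega>)" by (rule compact_imp_bounded[OF compact_frontier_bounded]) (use \<Omega> in \<open>simp add: bounded_lipschitz_domain_def\<close>)
  then obtain R where R: "R > 0" "\<And>x. x \<in> frontier \<Omega> \<Longrightarrow> norm x \<le> R" by (auto simp: bounded_pos)
  \<comment> \<open>Bounds the diameter of the frontier, so that the shells with outer radii D / 2^j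
    exhaust it up to the point x.\<close>
  define D where "D = 2 * R"
  have D: "D > 0" "\<And>x y. x \<in> frontier \<Omega> \<Longrightarrow> y \<in> frontier \<Omega> \<Longrightarrow> norm (x - y) \<le> D"
    using R order_trans[OF norm_triangle_ineq4 add_mono[OF R(2) R(2)]] by (auto simp: D_def)
  define q where "q j = D / 2 ^ j" for j :: nat
  have q: "q j > 0" for j using D by (simp add: q_def)
  define A where "A = (\<Sum>j. ennreal (2 ^ CARD('n) * C * q j))"
  have "A < \<infinity>"
  proof -
    have sq: "summable (\<lambda>j. 2 ^ CARD('n) * C * q j)"
      unfolding q_def divide_inverse power_inverse[symmetric] by (intro summable_mult summable_geometric) auto
    then have "A = ennreal (\<Sum>j. 2 ^ CARD('n) * C * q j)" unfolding A_def
      using C(1) q by (intro suminf_ennreal2) (auto intro!: mult_nonneg_nonneg less_imp_le[OF q])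
    then show ?thesis by simp
  qed
  moreover have "(\<integral>\<^sup>+y. ennreal ((cmod (f x - f y))\<^sup>2 / norm (x - y) powr real CARD('n)) \<partial>surface_measure \<Omega>) \<le> ennreal (M\<^sup>2) * A"
    if f: "\<And>x y. cmod (f x - f y) \<le> M * norm (x - y)" "M \<ge> 0" and x: "x \<in> frontier \<Omega>" for f :: "real^'n \<Rightarrow> complex" and M x
  proof -
    have meas: "frontier \<Omega> \<inter> cball x r \<in> sets (surface_measure \<Omega>)" for r
      unfolding surface_sets by (auto simp: sets_restrict_space)
    let ?a = "\<lambda>j. (q j)\<^sup>2 / (q j / 2) ^ CARD('n)"
    have a: "?a j \<ge> 0" for j using q[of j] by simp
    have pt: "ennreal ((cmod (f x - f y))\<^sup>2 / norm (x - y) powr real CARD('n))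
       \<le> ennreal (M\<^sup>2) * (\<Sum>j. ennreal (?a j) * indicator (frontier \<Omega> \<inter> cball x (q j)) y)" if y: "y \<in> frontier \<Omega>" for y
    proof (cases "x = y")
      case False
      define r where "r = norm (x - y)"
      have r: "r > 0" "r \<le> D" using False D(2)[OF x y] by (auto simp: r_def)
      have "\<exists>j. q (Suc j) < r"
      proof -
        obtain j where "D / r < 2 ^ j" using real_arch_pow[of 2 "D / r"] by auto
        then have "q j < r" using r by (simp add: q_def field_simps)
        moreover have "q (Suc j) \<le> q j" using q[of j] by (simp add: q_def)
        ultimately show ?thesis by (intro exI[of _ j]) linarith
      qed
      \<comment> \<open>The shell of y: minimality of j supplies the upper bound r \<le> q
        j.\<close>
      define j where "j = (LEAST j. q (Suc j) < r)"
      have j1: "q (Suc j) < r" unfolding j_def using \<open>\<exists>j. q (Suc j) < r\<close> by (rule LeastI_ex)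
      have j2: "r \<le> q j"
      proof (cases j)
        case 0 then show ?thesis using r by (simp add: q_def)
      next
        case (Suc i)
        then have "\<not> q (Suc i) < r" using not_less_Least[of i "\<lambda>j. q (Suc j) < r"] j_def by simp
        then show ?thesis using Suc by simp
      qed
      have "(cmod (f x - f y))\<^sup>2 / norm (x - y) powr real CARD('n) = (cmod (f x - f y))\<^sup>2 / r ^ CARD('n)"
        using r by (simp add: powr_realpow r_def)
      also have "\<dots> \<le> (M * q j)\<^sup>2 / (q j / 2) ^ CARD('n)"
      proof (rule frac_le)
        show "(cmod (f x - f y))\<^sup>2 \<le> (M * q j)\<^sup>2"
          by (intro power_mono order_trans[OF f(1)] mult_left_mono) (use j2 f r_def in auto)
        show "(q j / 2) ^ CARD('n) \<le> r ^ CARD('n)"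
          using j1 q[of j] by (intro power_mono) (auto simp: q_def mult.commute)
      qed (use q[of j] in auto)
      also have "\<dots> = M\<^sup>2 * ?a j" by (simp add: power_mult_distrib)
      finally have "ennreal ((cmod (f x - f y))\<^sup>2 / norm (x - y) powr real CARD('n)) \<le> ennreal (M\<^sup>2) * (ennreal (?a j) * indicator (frontier \<Omega> \<inter> cball x (q j)) y)"
        using y j2 a[of j] by (simp add: r_def dist_norm ennreal_mult[symmetric] ennreal_leI)
      also have "ennreal (?a j) * indicator (frontier \<Omega> \<inter> cball x (q j)) y \<le> (\<Sum>j. ennreal (?a j) * indicator (frontier \<Omega> \<inter> cball x (q j)) y)"
      proof -
        have "h j \<le> suminf h" for h :: "nat \<Rightarrow> ennreal" using sum_le_suminf[of h "{j}"] by simp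
        then show ?thesis .
      qed
      finally show ?thesis by (simp add: mult_left_mono)
    qed simp
    have "(\<integral>\<^sup>+y. ennreal ((cmod (f x - f y))\<^sup>2 / norm (x - y) powr real CARD('n)) \<partial>surface_measure \<Omega>)
       \<le> (\<integral>\<^sup>+y. ennreal (M\<^sup>2) * (\<Sum>j. ennreal (?a j) * indicator (frontier \<Omega> \<inter> cball x (q j)) y) \<partial>surface_measure \<Omega>)"
      by (intro nn_integral_mono pt) (simp add: surface_sets)
    also have "\<dots> = ennreal (M\<^sup>2) * (\<Sum>j. ennreal (?a j) * emeasure (surface_measure \<Omega>) (frontier \<Omega> \<inter> cball x (q j)))"
      using meas by (subst nn_integral_cmult) (auto simp: nn_integral_suminf nn_integral_cmult_indicator)
    also have "\<dots> \<le> ennreal (M\<^sup>2) * A"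
    proof (intro mult_left_mono)
      show "(\<Sum>j. ennreal (?a j) * emeasure (surface_measure \<Omega>) (frontier \<Omega> \<inter> cball x (q j))) \<le> A"
        unfolding A_def
      proof (rule suminf_le)
        fix j
        have "ennreal (?a j) * emeasure (surface_measure \<Omega>) (frontier \<Omega> \<inter> cball x (q j)) \<le> ennreal (?a j) * ennreal (C * q j ^ (CARD('n) - 1))"
          by (intro mult_left_mono C q) simp
        also have "\<dots> = ennreal (?a j * (C * q j ^ (CARD('n) - 1)))"
          using a[of j] by (subst ennreal_mult') auto
        also have "?a j * (C * q j ^ (CARD('n) - 1)) = 2 ^ CARD('n) * C * q j"
        proof -
          obtain m where m: "CARD('n) = Suc m" using not0_implies_Suc[of "CARD('n)"] by auto
          show ?thesis using q[of j] by (simp add: m power_divide power2_eq_square field_simps)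
        qed
        finally show "ennreal (?a j) * emeasure (surface_measure \<Omega>) (frontier \<Omega> \<inter> cball x (q j)) \<le> ennreal (2 ^ CARD('n) * C * q j)" .
      qed auto
    qed simp
    finally show ?thesis .
  qed
  ultimately show thesis by (rule that)
qed

lemma Hrs_Sigma_sq_test:
  fixes \<Phi> :: "real \<times> (real^'n::finite) \<Rightarrow> complex"
  assumes \<Omega>: "bounded_lipschitz_domain \<Omega>" and \<Phi>: "test_function UNIV \<Phi>"
  shows "Hrs_Sigma_sq (1/2) (1/4) T \<Omega> \<Phi> < \<infinity>"
proof -
  let ?S = "surface_measure \<Omega>"
  obtain M R where MR: "M > 0" "R > 0"
    "\<And>t x. cmod (\<Phi> (t, x)) \<le> M * indicator {-R..R} t * indicator (cball 0 R) x"
    "\<And>t t' x. cmod (\<Phi> (t, x) - \<Phi> (t', x)) \<le> M * \<bar>t - t'\<bar>"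
    "\<And>t x x'. cmod (\<Phi> (t, x) - \<Phi> (t, x')) \<le> M * norm (x - x')"
    using test_function_boxE[OF \<Phi>] by metis
  have le1: "cmod (\<Phi> (t, x)) \<le> M * indicator {-R..R} t" for t x
    by (rule order_trans[OF MR(3)]) (use MR(1) in \<open>simp split: split_indicator\<close>)
  have fin: "emeasure ?S (frontier \<Omega>) < \<infinity>"
  proof -
    obtain C where "C \<ge> 0" and C: "\<And>x r. r > 0 \<Longrightarrow> emeasure ?S (frontier \<Omega> \<inter> cball x r) \<le> ennreal (C * r ^ (CARD('n) - 1))"
      apply (rule surface_measure_ball[OF \<Omega>]) subgoal premises p for C by (rule that) (rule p; blast)+ done
    have "bounded (frontier \<Omega>)"
      by (rule compact_imp_bounded[OF compact_frontier_bounded]) (use \<Omega> in \<open>simp add: bounded_lipschitz_domain_def\<close>)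
    then obtain r where r: "r > 0" "\<forall>x\<in>frontier \<Omega>. norm x \<le> r" unfolding bounded_pos by blast
    then have "frontier \<Omega> \<inter> cball 0 r = frontier \<Omega>" by auto
    then show ?thesis using C[OF r(1), of 0] by (simp add: order_le_less_trans)
  qed
  have fr: "frontier \<Omega> \<in> sets ?S" using sets.top[of ?S] by (simp add: surface_sets)
  have "Hs_L2_sq (1/4) ?S \<Phi> < \<infinity>"
    by (rule Hs_L2_sq_finite[where b=M and R=R and L=M and B="frontier \<Omega>"])
       (use MR(1,2,4) le1 fin fr in \<open>auto simp: surface_sets\<close>)
  moreover have "(\<integral>\<^sup>+t. Hr_bd_sq (1/2) \<Omega> (\<lambda>x. \<Phi> (t, x)) \<partial>lborel) < \<infinity>"
  proof -
    obtain A where A: "A < \<infinity>" "\<And>(f :: real^'n \<Rightarrow> complex) M x. (\<And>x y. cmod (f x - f y) \<le> M * norm (x - y)) \<Longrightarrow> M \<ge> 0 \<Longrightarrow> x \<in> frontier \<Omega> \<Longrightarrow>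
     (\<integral>\<^sup>+y. ennreal ((cmod (f x - f y))\<^sup>2 / norm (x - y) powr real CARD('n)) \<partial>?S) \<le> ennreal (M\<^sup>2) * A"
      apply (rule surface_kernel_bound[OF \<Omega>]) subgoal premises p for A by (rule that) (rule p; blast)+ done
    let ?K = "ennreal (M\<^sup>2) * emeasure ?S (frontier \<Omega>) + ennreal (M\<^sup>2) * A * emeasure ?S (frontier \<Omega>)"
    have "Hr_bd_sq (1/2) \<Omega> (\<lambda>x. \<Phi> (t, x)) \<le> ?K * indicator {-R..R} t" for t
    proof (cases "t \<in> {-R..R}")
      case True
      have "(\<integral>\<^sup>+x. ennreal ((cmod (\<Phi> (t, x)))\<^sup>2) \<partial>?S) \<le> (\<integral>\<^sup>+x. ennreal (M\<^sup>2) \<partial>?S)"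
      proof (intro nn_integral_mono ennreal_leI power_mono)
        show "cmod (\<Phi> (t, x)) \<le> M" for x using le1[of t x] True by simp
      qed simp
      moreover have "(\<integral>\<^sup>+x. \<integral>\<^sup>+y. ennreal ((cmod (\<Phi> (t, x) - \<Phi> (t, y)))\<^sup>2 / norm (x - y) powr real CARD('n)) \<partial>?S \<partial>?S)
         \<le> (\<integral>\<^sup>+x. ennreal (M\<^sup>2) * A \<partial>?S)"
        using MR(1) by (intro nn_integral_mono A(2) MR(5)) (simp_all add: surface_sets)
      ultimately show ?thesis using True by (simp add: Hr_bd_sq_def surface_sets add_mono)
    next
      case False
      then have "\<Phi> (t, x) = 0" for x using le1[of t x] by simp
      then show ?thesis by (simp add: Hr_bd_sq_def)
    qed
    then have "(\<integral>\<^sup>+t. Hr_bd_sq (1/2) \<Omega> (\<lambda>x. \<Phi> (t, x)) \<partial>lborel) \<le> (\<integral>\<^sup>+t. ?K * indicator {-R..R} t \<partial>lborel)"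
      by (rule nn_integral_mono)
    also have "\<dots> = ?K * ennreal (2 * R)" using MR(2) by (simp add: nn_integral_cmult_indicator)
    also have "\<dots> < \<infinity>" using fin A(1) by (simp add: ennreal_mult_less_top)
    finally show ?thesis .
  qed
  ultimately have 1: "Hrs_bd_sq (1/2) (1/4) \<Omega> \<Phi> < \<infinity>" by (simp add: Hrs_bd_sq_def)
  have meas: "\<Phi> \<in> borel_measurable (lborel \<Otimes>\<^sub>M ?S)"
  proof -
    have "(\<lambda>x. x) \<in> ?S \<rightarrow>\<^sub>M borel" unfolding surface_measure_def
      by (intro measurable_restrict_space1) (auto simp: measurable_def)
    then have "(\<lambda>p. (fst p, snd p)) \<in> (lborel \<Otimes>\<^sub>M ?S) \<rightarrow>\<^sub>M borel \<Otimes>\<^sub>M borel"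
      by (intro measurable_Pair measurable_compose[OF measurable_snd] measurable_compose[OF measurable_fst]) auto
    then have "(\<lambda>p. \<Phi> (fst p, snd p)) \<in> borel_measurable (lborel \<Otimes>\<^sub>M ?S)"
      by (rule measurable_compose) (use test_function_measurable[OF \<Phi>] in \<open>simp add: borel_prod\<close>)
    then show ?thesis by simp
  qed
  have "Hrs_Sigma_sq (1/2) (1/4) T \<Omega> \<Phi> \<le> Hrs_bd_sq (1/2) (1/4) \<Omega> \<Phi>"
    unfolding Hrs_Sigma_sq_def using meas by (intro INF_lower) simp
  then show ?thesis using 1 by simp
qed

section \<open>Test functions as heat solutions\<close>

lemma Hs_L2_sq_zero: "Hs_L2_sq s M (\<lambda>z. 0) = 0"
  by (simp add: Hs_L2_sq_def)

lemma test_function_zero: "test_function U (\<lambda>z. 0)"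
  by (rule test_functionI[of _ "{}"]) (auto intro: Ck_on_const)

text \<open>The constant approximating sequence works, since both error norms are then norms of the
  zero function.\<close>

lemma is_trace_test:
  fixes u :: "real \<times> (real^'n::finite) \<Rightarrow> complex"
  assumes "test_function UNIV u"
  shows "is_trace T \<Omega> u u"
proof -
  have "H1_sq (\<lambda>x::real^'n. 0) = 0"
    using H1_sq_bound[OF test_function_zero, of 0 "{}::(real^'n) set"] dderiv_zero_open[OF open_UNIV UNIV_I, of "\<lambda>x::real^'n. 0::complex" 0]
    by simp
  then have "H1s_sq (1/2) (\<lambda>z::real \<times> (real^'n). 0) = 0" by (simp add: H1s_sq_def Hs_L2_sq_zero)
  moreover have "H1s_Q_sq (1/2) T \<Omega> (\<lambda>z::real \<times> (real^'n). 0) \<le> H1s_sq (1/2) (\<lambda>z::real \<times> (real^'n). 0)"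
    unfolding H1s_Q_sq_def by (rule INF_lower) simp
  ultimately have 1: "H1s_Q_sq (1/2) T \<Omega> (\<lambda>z::real \<times> (real^'n). 0) = 0" by simp
  have "Hrs_bd_sq (1/2) (1/4) \<Omega> (\<lambda>z::real \<times> (real^'n). 0) = 0" by (simp add: Hrs_bd_sq_def Hr_bd_sq_def Hs_L2_sq_zero)
  moreover have "Hrs_Sigma_sq (1/2) (1/4) T \<Omega> (\<lambda>z::real \<times> (real^'n). 0) \<le> Hrs_bd_sq (1/2) (1/4) \<Omega> (\<lambda>z::real \<times> (real^'n). 0)"
    unfolding Hrs_Sigma_sq_def by (rule INF_lower) simp
  ultimately have 2: "Hrs_Sigma_sq (1/2) (1/4) T \<Omega> (\<lambda>z::real \<times> (real^'n). 0) = 0" by simp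
  show ?thesis unfolding is_trace_def
    by (rule exI[of _ "\<lambda>n. u"]) (simp add: assms 1 2)
qed

lemma set_integral_cyl:
  fixes f :: "'a::euclidean_space \<Rightarrow> complex"
  assumes "f \<in> borel_measurable borel" "\<And>z. z \<notin> S \<Longrightarrow> f z = 0"
  shows "(LINT z:S|lebesgue. f z) = (\<integral>z. f z \<partial>lborel)"
proof -
  have "(LINT z:S|lebesgue. f z) = (\<integral>z. f z \<partial>lebesgue)"
    unfolding set_lebesgue_integral_def using assms(2)
    by (intro Bochner_Integration.integral_cong) (auto split: split_indicator)
  then show ?thesis using assms(1) by (simp add: integral_completion)
qed

text \<open>The test function vanishes off the cylinder, so the integrals extend to all of
  space-time. There one integration by parts in time and two in each space variable move the
  derivatives to \<open>u\<close>, and the pointwise equation is called upon only inside the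
  cylinder.\<close>

lemma heat_equation_test:
  fixes u :: "real \<times> (real^'n::finite) \<Rightarrow> complex"
  assumes u: "test_function UNIV u"
    and heat: "\<And>z. z \<in> cyl T \<Omega> \<Longrightarrow> dderiv (1, 0) u z = (\<Sum>i\<in>UNIV. dderiv (0, axis i 1) (dderiv (0, axis i 1) u) z)"
  shows "heat_equation T \<Omega> u"
  unfolding heat_equation_def
proof (intro allI impI)
  fix \<phi> assume \<phi>: "test_function (cyl T \<Omega>) \<phi>"
  let ?e = "\<lambda>i::'n. (0::real, axis i (1::real))"
  have d1: "test_function (cyl T \<Omega>) (dderiv v \<phi>)" for v by (rule test_function_dderiv[OF \<phi>])
  have d2: "test_function (cyl T \<Omega>) (dderiv w (dderiv v \<phi>))" for v w by (rule test_function_dderiv[OF d1])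
  have off: "z \<notin> cyl T \<Omega> \<Longrightarrow> g z = 0" if "test_function (cyl T \<Omega>) g" for g and z
    using that unfolding test_function_def by blast
  note meas = test_function_measurable[OF u] test_function_measurable[OF d1] test_function_measurable[OF d2]
  have "(LINT z:cyl T \<Omega>|lebesgue. u z * - dderiv (1, 0) \<phi> z) = (\<integral>z. u z * - dderiv (1, 0) \<phi> z \<partial>lborel)"
    by (rule set_integral_cyl) (use off[OF d1] in \<open>auto intro!: borel_measurable_times borel_measurable_uminus meas\<close>)
  also have "\<dots> = (\<integral>z. dderiv (1, 0) u z * \<phi> z \<partial>lborel)"
    using integration_by_parts[OF u \<phi>, of "(1, 0)"] by simp
  also have "\<dots> = (\<integral>z. (\<Sum>i\<in>UNIV. dderiv (?e i) (dderiv (?e i) u) z * \<phi> z) \<partial>lborel)"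
  proof (intro Bochner_Integration.integral_cong refl)
    fix z show "dderiv (1, 0) u z * \<phi> z = (\<Sum>i\<in>UNIV. dderiv (?e i) (dderiv (?e i) u) z * \<phi> z)"
      using heat[of z] off[OF \<phi>, of z] by (cases "z \<in> cyl T \<Omega>") (auto simp: sum_distrib_right)
  qed
  also have "\<dots> = (\<Sum>i\<in>UNIV. \<integral>z. dderiv (?e i) (dderiv (?e i) u) z * \<phi> z \<partial>lborel)"
    by (intro Bochner_Integration.integral_sum test_function_integrable[OF test_function_mult[OF test_function_dderiv[OF test_function_dderiv[OF u]] \<phi>]])
  also have "\<dots> = (\<Sum>i\<in>UNIV. \<integral>z. u z * dderiv (?e i) (dderiv (?e i) \<phi>) z \<partial>lborel)"
  proof (intro sum.cong refl)
    fix i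
    have "(\<integral>z. dderiv (?e i) (dderiv (?e i) u) z * \<phi> z \<partial>lborel) = - (\<integral>z. dderiv (?e i) u z * dderiv (?e i) \<phi> z \<partial>lborel)"
      using integration_by_parts[OF test_function_dderiv[OF u] \<phi>, of "?e i" "?e i"] by simp
    also have "\<dots> = (\<integral>z. u z * dderiv (?e i) (dderiv (?e i) \<phi>) z \<partial>lborel)"
      using integration_by_parts[OF u d1, of "?e i" "?e i"] by simp
    finally show "(\<integral>z. dderiv (?e i) (dderiv (?e i) u) z * \<phi> z \<partial>lborel) = (\<integral>z. u z * dderiv (?e i) (dderiv (?e i) \<phi>) z \<partial>lborel)" .
  qed
  also have "\<dots> = (\<integral>z. (\<Sum>i\<in>UNIV. u z * dderiv (?e i) (dderiv (?e i) \<phi>) z) \<partial>lborel)"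
    by (intro Bochner_Integration.integral_sum[symmetric] test_function_integrable[OF test_function_mult[OF u d2]])
  also have "\<dots> = (\<integral>z. u z * (\<Sum>i\<in>UNIV. dderiv (?e i) (dderiv (?e i) \<phi>) z) \<partial>lborel)"
    by (simp add: sum_distrib_left)
  also have "\<dots> = (LINT z:cyl T \<Omega>|lebesgue. u z * (\<Sum>i\<in>UNIV. dderiv (?e i) (dderiv (?e i) \<phi>) z))"
    by (rule set_integral_cyl[symmetric]) (use off[OF d2] in \<open>auto intro!: borel_measurable_times borel_measurable_sum meas\<close>)
  finally show "(LINT z:cyl T \<Omega>|lebesgue. u z * - dderiv (1, 0) \<phi> z) =
        (LINT z:cyl T \<Omega>|lebesgue. u z * (\<Sum>i\<in>UNIV. dderiv (?e i) (dderiv (?e i) \<phi>) z))" .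
qed

section \<open>The heat kernel solves the heat equation\<close>

lemma dderiv_hk_axis:
  fixes p :: "real \<times> (real^'n::finite)"
  assumes p: "p \<noteq> 0"
  shows "dderiv (0, axis i 1) (hk a) p = - (snd p $ i) / 2 * hk (a + 1) p"
    and "dderiv (0, axis i 1) (dderiv (0, axis i 1) (hk a)) p
      = - 1 / 2 * hk (a + 1) p + (snd p $ i)\<^sup>2 / 4 * hk (a + 2) p"
    and "dderiv (1, 0) (hk a) p = - a * hk (a + 1) p + (snd p \<bullet> snd p) / 4 * hk (a + 2) p"
proof -
  have 1: "dderiv (0, axis i 1) (hk a) q = - (snd q $ i) / 2 * hk (a + 1) q" if "q \<in> - {0}" for q :: "real \<times> (real^'n)" and a
    using that by (simp add: dderiv_hk hk_deriv_def inner_axis)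
  show "dderiv (0, axis i 1) (hk a) p = - (snd p $ i) / 2 * hk (a + 1) p" using p by (intro 1) simp
  have o: "open (- {0::real \<times> (real^'n)})" by auto
  have "dderiv (0, axis i 1) (dderiv (0, axis i 1) (hk a)) p = dderiv (0, axis i 1) (\<lambda>q. (- 1/2) * ((snd q \<bullet> axis i 1) * hk (a + 1) q)) p"
    by (rule dderiv_cong_open[OF o]) (use p 1 in \<open>auto simp: inner_axis\<close>)
  also have "\<dots> = (- 1/2) * ((snd p \<bullet> axis i 1) * hk_deriv (a + 1) p (0, axis i 1) + (snd (0::real, axis i (1::real)) \<bullet> axis i 1) * hk (a + 1) p)"
    by (rule dderiv_eq) (auto intro!: derivative_eq_intros hk_has_derivative[OF p])
  also have "\<dots> = - 1 / 2 * hk (a + 1) p + (snd p $ i)\<^sup>2 / 4 * hk (a + 2) p"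
    by (simp add: hk_deriv_def inner_axis power2_eq_square algebra_simps)
  finally show "dderiv (0, axis i 1) (dderiv (0, axis i 1) (hk a)) p
      = - 1 / 2 * hk (a + 1) p + (snd p $ i)\<^sup>2 / 4 * hk (a + 2) p" .
  show "dderiv (1, 0) (hk a) p = - a * hk (a + 1) p + (snd p \<bullet> snd p) / 4 * hk (a + 2) p"
    using p by (simp add: dderiv_hk hk_deriv_def)
qed

text \<open>The \<open>hk (a + 2)\<close> terms match for every a. The \<open>hk (a + 1)\<close>
  terms have coefficient - a in time and - 1/2 for each of the d coordinates, which singles out a =
  d / 2.\<close>

lemma hk_heat:
  fixes p :: "real \<times> (real^'n::finite)"
  assumes p: "p \<noteq> 0"
  shows "dderiv (1, 0) (hk (real CARD('n) / 2)) p
    = (\<Sum>i\<in>UNIV. dderiv (0, axis i 1) (dderiv (0, axis i 1) (hk (real CARD('n) / 2))) p)"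
proof -
  have "(snd p \<bullet> snd p) = (\<Sum>i\<in>UNIV. (snd p $ i)\<^sup>2)" by (simp add: inner_vec_def power2_eq_square)
  then show ?thesis
    by (simp add: dderiv_hk_axis[OF p] sum.distrib sum_subtractf sum_distrib_right[symmetric] sum_divide_distrib[symmetric])
qed

lemma dderiv_of_real:
  fixes f :: "'a::euclidean_space \<Rightarrow> real"
  assumes "f differentiable (at x)"
  shows "dderiv v (\<lambda>x. complex_of_real (f x)) x = complex_of_real (dderiv v f x)"
  by (rule dderiv_eq) (intro has_derivative_of_real dderiv_has_derivative assms)

lemma dderiv_of_real2:
  fixes f :: "'a::euclidean_space \<Rightarrow> real"
  assumes "open W" "x \<in> W" "Ck_on (Suc (Suc 0)) W f"
  shows "dderiv w (dderiv v (\<lambda>x. complex_of_real (f x))) x = complex_of_real (dderiv w (dderiv v f) x)"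
proof -
  have "dderiv w (dderiv v (\<lambda>x. complex_of_real (f x))) x = dderiv w (\<lambda>x. complex_of_real (dderiv v f x)) x"
    by (rule dderiv_cong_open[OF assms(1,2)], rule dderiv_of_real, rule Ck_on_Suc_dest(1)[OF assms(3)])
  also have "\<dots> = complex_of_real (dderiv w (dderiv v f) x)"
    by (rule dderiv_of_real, rule Ck_on_Suc_dest(1)[OF Ck_on_dderiv[OF assms(1,3)] assms(2)])
  finally show ?thesis .
qed

lemma dderiv2_cong_open:
  assumes "open W" "x \<in> W" "\<And>y. y \<in> W \<Longrightarrow> f y = g y"
  shows "dderiv w (dderiv v f) x = dderiv w (dderiv v g) x"
  by (rule dderiv_cong_open[OF assms(1,2)], rule dderiv_cong_open[OF assms(1)]) (use assms in auto)

text \<open>Every displacement from a pole (T - \<sigma> j, y0) to a point of the cylinder falls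
  into one bounded region whose spatial part avoids the origin. The kernel is truncated outside that
  region, which makes the superposition a genuine test function; it then serves as solution and as
  boundary datum at once.\<close>

lemma reachable_lacunary:
  fixes \<Omega> :: "(real^'n::finite) set"
  assumes \<Omega>: "bounded_lipschitz_domain \<Omega>" and T: "T > 0" and y0: "y0 \<notin> closure \<Omega>"
  obtains K :: nat where
    "(\<lambda>x. \<Sum>j. exp (- (fact (j + K) * of_real ((norm (x - y0))\<^sup>2)))) \<in> reachable_set T \<Omega>"
proof -
  obtain \<rho> where \<rho>: "\<rho> > 0" "\<And>x. x \<in> \<Omega> \<Longrightarrow> \<rho> < norm (x - y0)"
  proof -
    have "open (- closure \<Omega>)" by auto
    then obtain e where e: "e > 0" "ball y0 e \<subseteq> - closure \<Omega>" using y0 openE by blast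
    have "e / 2 < norm (x - y0)" if "x \<in> \<Omega>" for x
    proof (rule ccontr)
      assume "\<not> ?thesis"
      then have "x \<in> ball y0 e" using e by (simp add: dist_norm norm_minus_commute)
      then show False using e that closure_subset by blast
    qed
    then show thesis using that[of "e/2"] e by simp
  qed
  obtain R where R: "R > \<rho>" "\<And>x. x \<in> \<Omega> \<Longrightarrow> norm (x - y0) < R"
  proof -
    have "bounded \<Omega>" using \<Omega> by (simp add: bounded_lipschitz_domain_def)
    then obtain r where r: "\<forall>x\<in>\<Omega>. norm x \<le> r" by (auto simp: bounded_iff)
    have "norm (x - y0) < max \<rho> (r + norm y0) + 1" if "x \<in> \<Omega>" for x
      using norm_triangle_ineq4[of x y0] r that by fastforce
    then show thesis using that[of "max \<rho> (r + norm y0) + 1"] by auto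
  qed
  define d where "d = real CARD('n) / 2"
  have d: "d > 0" by (simp add: d_def)
  \<comment> \<open>The cutoffs: 1 - a removes a neighbourhood of the pole, b localises in space and
    c in time. On the set \<open>Z\<close> below the product of the three is 1.\<close>
  obtain a :: "real^'n \<Rightarrow> real" where a: "\<And>k. Ck_on k UNIV a" "\<And>y. norm y \<le> \<rho> / 2 \<Longrightarrow> a y = 1" "\<And>y. \<rho> \<le> norm y \<Longrightarrow> a y = 0"
    using smooth_bump[of "\<rho>/2" \<rho> 0] \<rho>(1) by auto
  obtain b :: "real^'n \<Rightarrow> real" where b: "\<And>k. Ck_on k UNIV b" "\<And>y. norm y \<le> R \<Longrightarrow> b y = 1" "\<And>y. R + 1 \<le> norm y \<Longrightarrow> b y = 0"
    using smooth_bump[of R "R+1" 0] R(1) \<rho>(1) by auto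
  obtain c :: "real \<Rightarrow> real" where c: "\<And>k. Ck_on k UNIV c" "\<And>y. \<bar>y\<bar> \<le> 2 * T \<Longrightarrow> c y = 1" "\<And>y. 3 * T \<le> \<bar>y\<bar> \<Longrightarrow> c y = 0"
    using smooth_bump[of "2*T" "3*T" "0::real", unfolded diff_zero real_norm_def] T by auto
  define G where "G z = (c (fst z) * ((1 + - a (snd z)) * b (snd z))) * hk d z" for z :: "real \<times> (real^'n)"
  define \<Psi> where "\<Psi> z = complex_of_real (G z)" for z
  have cut: "Ck_on k UNIV (\<lambda>z::real \<times> (real^'n). c (fst z) * ((1 + - a (snd z)) * b (snd z)))" for k
  proof -
    have f: "Ck_on k UNIV (fst :: real \<times> (real^'n) \<Rightarrow> real)" "Ck_on k UNIV (snd :: real \<times> (real^'n) \<Rightarrow> real^'n)"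
      by (intro Ck_on_bounded_linear bounded_linear_fst bounded_linear_snd open_UNIV)+
    show ?thesis
      by (intro Ck_on_mult Ck_on_add Ck_on_const Ck_on_uminus open_UNIV
          Ck_on_compose[OF open_UNIV open_UNIV subset_UNIV c(1) f(1)]
          Ck_on_compose[OF open_UNIV open_UNIV subset_UNIV a(1) f(2)]
          Ck_on_compose[OF open_UNIV open_UNIV subset_UNIV b(1) f(2)])
  qed
  have G: "Ck_on k UNIV G" for k
  proof -
    \<comment> \<open>Away from the origin of space-time the kernel is smooth; where the spatial
      part is small, 1 - a vanishes. Together the two open sets are everything.\<close>
    let ?V = "- {0::real \<times> (real^'n)}" and ?W = "{z::real \<times> (real^'n). norm (snd z) < \<rho> / 2}"
    have o: "open ?V" "open ?W" by (auto intro!: open_Collect_less continuous_intros)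
    have "Ck_on k ?V G" unfolding G_def
      by (intro Ck_on_mult o Ck_on_hk Ck_on_subset[OF cut]) auto
    moreover have "Ck_on k ?W G"
      using Ck_on_cong[OF o(2), of G "\<lambda>_. 0" k] Ck_on_const[OF o(2), of k 0] a(2) by (simp add: G_def)
    ultimately have "Ck_on k (?V \<union> ?W) G" by (rule Ck_on_Un[OF o])
    moreover have "?V \<union> ?W = UNIV" using \<rho>(1) by auto
    ultimately show ?thesis by simp
  qed
  have \<Psi>: "test_function UNIV \<Psi>"
  proof (rule test_functionI[where K="cball 0 (3 * T) \<times> cball 0 (R + 1)"])
    show "Ck_on k UNIV \<Psi>" for k unfolding \<Psi>_def
      by (rule Ck_on_linear_comp[OF bounded_linear_of_real open_UNIV G])
    show "\<Psi> z = 0" if "z \<notin> cball 0 (3 * T) \<times> cball 0 (R + 1)" for z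
    proof -
      have "3 * T \<le> \<bar>fst z\<bar> \<or> R + 1 \<le> norm (snd z)" using that by (cases z) auto
      then show ?thesis using c(3)[of "fst z"] b(3)[of "snd z"] by (auto simp: \<Psi>_def G_def)
    qed
  qed (auto intro: compact_Times)
  define Z where "Z = {z::real \<times> (real^'n). \<bar>fst z\<bar> < 2 * T} \<inter> {z. \<rho> < norm (snd z)} \<inter> {z. norm (snd z) < R}"
  have oZ: "open Z" unfolding Z_def by (intro open_Int open_Collect_less continuous_intros)
  have \<Psi>Z: "\<Psi> z = complex_of_real (hk d z)" if "z \<in> Z" for z
    using that a(3)[of "snd z"] b(2)[of "snd z"] c(2)[of "fst z"] by (simp add: \<Psi>_def G_def Z_def)
  have heat: "dderiv (1, 0) \<Psi> z = (\<Sum>i\<in>UNIV. dderiv (0, axis i 1) (dderiv (0, axis i 1) \<Psi>) z)" if z: "z \<in> Z" for z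
  proof -
    have z0: "z \<noteq> 0" "z \<in> - {0}" using z \<rho>(1) by (auto simp: Z_def)
    have oV: "open (- {0::real \<times> (real^'n)})" by auto
    have "dderiv (1, 0) \<Psi> z = dderiv (1, 0) (\<lambda>z. complex_of_real (hk d z)) z"
      by (rule dderiv_cong_open[OF oZ z \<Psi>Z])
    also have "\<dots> = complex_of_real (dderiv (1, 0) (hk d) z)"
      by (rule dderiv_of_real) (use hk_has_derivative[OF z0(1)] in \<open>auto simp: differentiable_def\<close>)
    also have "dderiv (1, 0) (hk d) z = (\<Sum>i\<in>UNIV. dderiv (0, axis i 1) (dderiv (0, axis i 1) (hk d)) z)"
      unfolding d_def by (rule hk_heat[OF z0(1)])
    also have "complex_of_real \<dots> = (\<Sum>i\<in>UNIV. dderiv (0, axis i 1) (dderiv (0, axis i 1) (\<lambda>z. complex_of_real (hk d z))) z)"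
      by (simp add: dderiv_of_real2[OF oV z0(2) Ck_on_hk])
    also have "\<dots> = (\<Sum>i\<in>UNIV. dderiv (0, axis i 1) (dderiv (0, axis i 1) \<Psi>) z)"
      by (intro sum.cong refl dderiv2_cong_open[OF oZ z]) (simp add: \<Psi>Z)
    finally show ?thesis .
  qed
  \<comment> \<open>(j + K)! > 1 / (2 T) puts every release time T - \<sigma> j after T / 2, so that
    u vanishes before T / 2 and the initial condition holds trivially. K \<ge> 1 gives 2^j \<le> (j
    + K)! for the convergence.\<close>
  obtain K0 :: nat where K0: "1 / (2 * T) < real K0" using reals_Archimedean2 by blast
  define K where "K = max 1 K0"
  have K: "K \<ge> 1" "1 / (2 * T) < real K" using K0 by (auto simp: K_def)
  define \<sigma> :: "nat \<Rightarrow> real" where "\<sigma> j = 1 / (4 * fact (j + K))" for j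
  have \<sigma>: "\<sigma> j > 0" "\<sigma> j < T / 2" for j
  proof -
    show "\<sigma> j > 0" by (simp add: \<sigma>_def)
    have "real K \<le> real (fact (j + K))" using fact_ge_self[of "j + K"] by (simp only: of_nat_le_iff)
    then have "1 / (2 * T) < fact (j + K)" using K by (simp only: of_nat_fact)
    then show "\<sigma> j < T / 2" using T by (simp add: \<sigma>_def field_simps)
  qed
  have pow: "(2::real) ^ j \<le> fact (j + K)" for j
  proof (induction j)
    case 0 show ?case using fact_ge_1[of K, where 'a=real] by simp
  next
    case (Suc j)
    have "2 * (2::real) ^ j \<le> real (Suc (j + K)) * fact (j + K)"
      by (rule mult_mono) (use Suc K in auto)
    then show ?case by simp
  qed
  \<comment> \<open>These weights cancel the prefactor \<sigma>^(- d) that the kernel has at time T,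
    d being half the dimension, and they are dominated by a geometric series.\<close>
  define w where "w j = \<sigma> j powr d" for j
  have w: "summable (\<lambda>j. \<bar>w j\<bar>)"
  proof (rule summable_comparison_test'[of "\<lambda>j. ((1/2) powr d) ^ j" 0])
    have "(1/2::real) powr d < 1 powr d" using d by (intro powr_less_mono2) auto
    then show "summable (\<lambda>j. ((1/2::real) powr d) ^ j)" by (intro summable_geometric) simp
    fix j :: nat
    have "(2::real) ^ j \<le> 4 * fact (j + K)" using pow[of j] fact_gt_zero[of "j + K", where 'a=real] by linarith
    then have "\<sigma> j \<le> 1 / 2 ^ j" unfolding \<sigma>_def by (intro divide_left_mono) auto
    then have "w j \<le> (1 / 2 ^ j) powr d" unfolding w_def using \<sigma>(1)[of j] d by (intro powr_mono2) auto
    also have "1 / 2 ^ j = (1/2::real) powr real j" by (simp add: powr_realpow power_divide)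
    also have "((1/2::real) powr real j) powr d = ((1/2) powr d) ^ j"
      by (simp add: powr_powr powr_realpow[symmetric] mult.commute)
    finally show "norm \<bar>w j\<bar> \<le> ((1/2) powr d) ^ j" by (simp add: w_def)
  qed
  define p where "p j = (T - \<sigma> j, y0)" for j
  have p: "bounded (range p)"
  proof -
    have "norm (p j) \<le> T + norm y0" for j
      unfolding p_def using \<sigma>[of j] T by (intro order_trans[OF norm_Pair_le]) auto
    then show ?thesis by (auto simp: bounded_iff)
  qed
  define u where "u = superpose w p \<Psi>"
  have u: "test_function UNIV u" unfolding u_def by (rule test_function_superpose[OF w \<Psi> p])
  have "heat_equation T \<Omega> u"
  proof (rule heat_equation_test[OF u])
    fix z assume z: "z \<in> cyl T \<Omega>"
    have zZ: "z - p j \<in> Z" for j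
    proof -
      obtain t x where tx: "z = (t, x)" "0 < t" "t < T" "x \<in> \<Omega>" using z by (auto simp: cyl_def)
      then show ?thesis using \<rho>(2)[OF tx(4)] R(2)[OF tx(4)] \<sigma>[of j] T by (simp add: Z_def p_def abs_less_iff)
    qed
    have "dderiv (1, 0) u z = superpose w p (dderiv (1, 0) \<Psi>) z"
      unfolding u_def by (simp add: dderiv_superpose[OF w \<Psi>])
    also have "\<dots> = (\<integral>j. (\<Sum>i\<in>UNIV. w j *\<^sub>R dderiv (0, axis i 1) (dderiv (0, axis i 1) \<Psi>) (z - p j)) \<partial>count_space UNIV)"
      unfolding superpose_def by (simp add: heat[OF zZ] scaleR_sum_right)
    also have "\<dots> = (\<Sum>i\<in>UNIV. superpose w p (dderiv (0, axis i 1) (dderiv (0, axis i 1) \<Psi>)) z)"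
      unfolding superpose_def
      by (intro Bochner_Integration.integral_sum superpose_summable[OF w test_function_dderiv[OF test_function_dderiv[OF \<Psi>]]])
    also have "\<dots> = (\<Sum>i\<in>UNIV. dderiv (0, axis i 1) (dderiv (0, axis i 1) u) z)"
      unfolding u_def by (simp add: dderiv_superpose[OF w \<Psi>] dderiv_superpose[OF w test_function_dderiv[OF \<Psi>]])
    finally show "dderiv (1, 0) u z = (\<Sum>i\<in>UNIV. dderiv (0, axis i 1) (dderiv (0, axis i 1) u) z)" .
  qed
  moreover have "initial_value \<Omega> u (\<lambda>x. 0)"
    unfolding initial_value_def
  proof (intro allI impI)
    fix \<epsilon> :: real assume "\<epsilon> > 0"
    have "u (t, x) = 0" if "t < T / 2" for t x
    proof -
      have "\<Psi> ((t, x) - p j) = 0" for j using \<sigma>[of j] that by (simp add: p_def \<Psi>_def G_def hk_def)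
      then show ?thesis by (simp add: u_def superpose_def)
    qed
    then have "Hm1_norm \<Omega> (\<lambda>x. u (t, x) - 0) \<le> ennreal \<epsilon>" if "t < T / 2" for t
      unfolding Hm1_norm_def using that by (intro SUP_least) simp
    then show "\<exists>\<delta>>0. AE t in lborel. 0 < t \<and> t < \<delta> \<longrightarrow> Hm1_norm \<Omega> (\<lambda>x. u (t, x) - 0) \<le> ennreal \<epsilon>"
      using T by (intro exI[of _ "T/2"]) auto
  qed
  ultimately have "heat_solution T \<Omega> (\<lambda>x. 0) u u"
    using H1s_Q_test[OF u] is_trace_test[OF u] by (simp add: heat_solution_def)
  moreover have "smooth_on ({0<..T} \<times> \<Omega>) u"
    unfolding smooth_on_def using test_function_Ck[OF u] by (intro exI[of _ UNIV] exI[of _ u]) auto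
  moreover have "u \<in> Hrs_Sigma (1/2) (1/4) T \<Omega>"
    using Hrs_Sigma_sq_test[OF \<Omega> u] by (simp add: Hrs_Sigma_def)
  moreover have "(\<Sum>j. exp (- (fact (j + K) * of_real ((norm (x - y0))\<^sup>2)))) = u (T, x)" if x: "x \<in> \<Omega>" for x
  proof -
    have "w j *\<^sub>R \<Psi> ((T, x) - p j) = exp (- (fact (j + K) * of_real ((norm (x - y0))\<^sup>2)))" for j
    proof -
      have "(T, x) - p j = (\<sigma> j, x - y0)" by (simp add: p_def)
      moreover have "(\<sigma> j, x - y0) \<in> Z" using \<rho>(2)[OF x] R(2)[OF x] \<sigma>[of j] T by (simp add: Z_def)
      ultimately have "w j *\<^sub>R \<Psi> ((T, x) - p j) = of_real (w j * hk d (\<sigma> j, x - y0))"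
        by (simp add: \<Psi>Z scaleR_conv_of_real)
      also have "w j * hk d (\<sigma> j, x - y0) = exp (- ((norm (x - y0))\<^sup>2) / (4 * \<sigma> j))"
        using \<sigma>(1)[of j] by (simp add: w_def hk_def powr_minus dot_square_norm)
      also have "- ((norm (x - y0))\<^sup>2) / (4 * \<sigma> j) = - (fact (j + K) * (norm (x - y0))\<^sup>2)"
        by (simp add: \<sigma>_def)
      also have "complex_of_real (exp (- (fact (j + K) * (norm (x - y0))\<^sup>2))) = exp (- (fact (j + K) * of_real ((norm (x - y0))\<^sup>2)))"
        by (simp add: exp_of_real[symmetric])
      finally show ?thesis .
    qed
    then show ?thesis
      using integral_count_space_nat[OF superpose_summable[OF w \<Psi>, of "(T, x)" p]] by (simp add: u_def superpose_def)
  qed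
  ultimately have "(\<lambda>x. \<Sum>j. exp (- (fact (j + K) * of_real ((norm (x - y0))\<^sup>2)))) \<in> reachable_set T \<Omega>"
    unfolding reachable_set_def reachable_from_def by blast
  then show thesis by (rule that)
qed

section \<open>Holomorphy on complex lines and lacunary series\<close>

text \<open>
  Holomorphy along complex lines suffices for the identity theorems on convex sets,
  which reduces them to one variable.
\<close>

definition line_holo :: "(complex^'n::finite \<Rightarrow> complex) \<Rightarrow> (complex^'n) set \<Rightarrow> bool" where
  "line_holo f U \<longleftrightarrow> (\<forall>a b S. open S \<and> (\<forall>w\<in>S. a + w *s b \<in> U) \<longrightarrow> (\<lambda>w. f (a + w *s b)) holomorphic_on S)"

lemma line_holoD:
  "line_holo f U \<Longrightarrow> open S \<Longrightarrow> (\<And>w. w \<in> S \<Longrightarrow> a + w *s b \<in> U) \<Longrightarrow> (\<lambda>w. f (a + w *s b)) holomorphic_on S"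
  unfolding line_holo_def by simp

lemma bounded_linear_vector_smult: "bounded_linear (\<lambda>w::complex. w *s (b::complex^'n::finite))"
  by (rule linear_conv_bounded_linear[THEN iffD1])
     (auto intro!: linearI simp: vec_eq_iff algebra_simps)

lemma line_holo_holomorphic:
  assumes "holomorphic_on_n f U" shows "line_holo f U"
  unfolding line_holo_def
proof (intro allI impI)
  fix a b :: "complex^'a" and S assume S: "open S \<and> (\<forall>w\<in>S. a + w *s b \<in> U)"
  have "(\<lambda>w. f (a + w *s b)) field_differentiable (at w)" if "w \<in> S" for w
  proof -
    have "a + w *s b \<in> U" using S that by simp
    then have "\<exists>L. (f has_derivative L) (at (a + w *s b)) \<and> (\<forall>c v. L (c *s v) = c * L v)"
      by (rule bspec[OF assms[unfolded holomorphic_on_n_def]])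
    then obtain L where L: "(f has_derivative L) (at (a + w *s b))" "\<forall>c v. L (c *s v) = c * L v"
      by (elim exE conjE)
    have "((\<lambda>w. a + w *s b) has_derivative (\<lambda>h. 0 + h *s b)) (at w)"
      by (intro has_derivative_add has_derivative_const bounded_linear_imp_has_derivative bounded_linear_vector_smult)
    from has_derivative_compose[OF this L(1)]
    have "((\<lambda>w. f (a + w *s b)) has_derivative (\<lambda>h. h * L b)) (at w)" by (simp only: L(2) add_0)
    moreover have "(\<lambda>h. h * L b) = (*) (L b)" by (rule ext) (rule mult.commute)
    ultimately show ?thesis
      unfolding field_differentiable_def has_field_derivative_def by (intro exI[of _ "L b"]) simp
  qed
  then show "(\<lambda>w. f (a + w *s b)) holomorphic_on S"
    by (simp add: holomorphic_on_def field_differentiable_at_within)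
qed

text \<open>One-variable analytic continuation on the set S of parameters w with a + w b in C, which
  is convex because C is, hence connected. The real parameters near 0 accumulate at 0.\<close>

lemma line_identity:
  assumes C: "convex C" "open C" and f: "line_holo f C" and g: "line_holo g C"
    and r: "r > 0" "\<And>t::real. \<bar>t\<bar> < r \<Longrightarrow> a + of_real t *s b \<in> C \<Longrightarrow> f (a + of_real t *s b) = g (a + of_real t *s b)"
    and a: "a \<in> C" and z: "a + w *s b \<in> C"
  shows "f (a + w *s b) = g (a + w *s b)"
proof -
  define S where "S = {w. a + w *s b \<in> C}"
  have cont: "continuous_on UNIV (\<lambda>w. a + w *s b)"
    by (intro continuous_on_add continuous_on_const linear_continuous_on bounded_linear_vector_smult)
  have S: "open S"
    using open_vimage[OF C(2) cont] by (simp add: S_def vimage_def)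
  have "convex S" unfolding convex_alt
  proof (intro ballI allI impI)
    fix x y and u :: real assume xy: "x \<in> S" "y \<in> S" "0 \<le> u \<and> u \<le> 1"
    have "a + ((1 - u) *\<^sub>R x + u *\<^sub>R y) *s b = (1 - u) *\<^sub>R (a + x *s b) + u *\<^sub>R (a + y *s b)"
      by (simp add: vec_eq_iff, simp add: scaleR_conv_of_real algebra_simps)
    also have "\<dots> \<in> C" using C(1) xy unfolding convex_alt S_def by blast
    finally show "(1 - u) *\<^sub>R x + u *\<^sub>R y \<in> S" by (simp add: S_def)
  qed
  then have conn: "connected S" by (rule convex_connected)
  have 0: "0 \<in> S" using a by (simp add: S_def)
  obtain e where e: "e > 0" "ball 0 e \<subseteq> S" using S 0 openE by blast
  define U where "U = complex_of_real ` {t. \<bar>t\<bar> < min r e}"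
  have US: "U \<subseteq> S" using e(2) by (auto simp: U_def)
  have h: "(\<lambda>w. f (a + w *s b) - g (a + w *s b)) holomorphic_on S"
    by (intro holomorphic_on_diff line_holoD[OF f S] line_holoD[OF g S]) (simp_all add: S_def)
  have lim: "0 islimpt U"
    unfolding islimpt_approachable
  proof (intro allI impI)
    fix d :: real assume d: "d > 0"
    then obtain t where "0 < t" "t < min (min r e) d" using r e(1) dense[of 0 "min (min r e) d"] by auto
    then show "\<exists>x'\<in>U. x' \<noteq> 0 \<and> dist x' 0 < d"
      by (intro bexI[of _ "complex_of_real t"]) (auto simp: U_def)
  qed
  have zero: "f (a + w *s b) - g (a + w *s b) = 0" if "w \<in> U" for w
    using that r(2) US by (auto simp: U_def S_def)
  have "w \<in> S" using z by (simp add: S_def)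
  from analytic_continuation[OF h S conn US 0 lim zero this]
  have "f (a + w *s b) - g (a + w *s b) = 0" .
  then show ?thesis by simp
qed

lemma cvec_line: "cvec x y = cvec x 0 + \<i> *s cvec y 0"
  "cvec x 0 + of_real t *s cvec y 0 = cvec (x + t *\<^sub>R y) 0"
  by (simp_all add: cvec_def vec_eq_iff complex_eq_iff)

text \<open>The point x + i y lies on the complex line through x in direction y, at the parameter i.
  Real parameters on that line give real points, where the functions agree by assumption.\<close>

lemma identity_real_points:
  assumes C: "convex C" "open C" and f: "line_holo f C" and g: "line_holo g C"
    and eq: "\<And>x. cvec x 0 \<in> C \<Longrightarrow> f (cvec x 0) = g (cvec x 0)"
    and z: "cvec x 0 \<in> C" "cvec x y \<in> C"
  shows "f (cvec x y) = g (cvec x y)"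
proof -
  have "f (cvec x 0 + \<i> *s cvec y 0) = g (cvec x 0 + \<i> *s cvec y 0)"
    by (rule line_identity[OF C f g zero_less_one]) (use eq z in \<open>simp_all add: cvec_line(2) cvec_line(1)[symmetric]\<close>)
  then show ?thesis by (simp only: cvec_line(1)[symmetric])
qed

text \<open>On the complex line through a and z, a short real segment around a stays in the ball of
  agreement. Dividing r by 1 + norm b instead of norm b includes the case z = a.\<close>

lemma identity_open:
  assumes C: "convex C" "open C" and f: "line_holo f C" and g: "line_holo g C"
    and eq: "r > 0" "\<And>z. z \<in> ball a r \<Longrightarrow> f z = g z" and a: "a \<in> C" and z: "z \<in> C"
  shows "f z = g z"
proof -
  define b where "b = z - a"
  have zb: "z = a + 1 *s b" by (simp add: b_def)
  show ?thesis
    unfolding zb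
  proof (rule line_identity[OF C f g _ _ a])
    show "r / (1 + norm b) > 0" using eq by (simp add: add_pos_nonneg)
    fix t :: real assume t: "\<bar>t\<bar> < r / (1 + norm b)"
    have "norm (of_real t *s b) = \<bar>t\<bar> * norm b"
    proof -
      have "of_real t *s b = t *\<^sub>R b" by (simp add: vec_eq_iff, simp add: scaleR_conv_of_real)
      then show ?thesis by simp
    qed
    also have "\<dots> \<le> \<bar>t\<bar> * (1 + norm b)" by (intro mult_left_mono) auto
    also have "\<dots> < r" using t by (simp add: pos_less_divide_eq add_pos_nonneg)
    finally show "f (a + of_real t *s b) = g (a + of_real t *s b)"
      by (intro eq) (simp add: dist_norm)
  qed (use z zb in simp)
qed

section \<open>The lacunary series and its blow-up at the imaginary axis\<close>

definition lac :: "nat \<Rightarrow> complex \<Rightarrow> complex" where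
  "lac K w = (\<Sum>j. exp (- (fact (j + K) * w)))"

text \<open>Since (j + K)! \<ge> j, a geometric series dominates uniformly on each half plane Re w
  \<ge> \<delta>, which yields locally uniform convergence.\<close>

lemma norm_lac_term:
  assumes "\<delta> > 0" "\<delta> \<le> Re w" shows "norm (exp (- (fact (j + K) * w))) \<le> exp (- \<delta>) ^ j"
proof -
  have "real j \<le> real (fact (j + K))" using fact_ge_self[of "j + K"] by (simp only: of_nat_le_iff)
  then have "real j \<le> fact (j + K)" by (simp only: of_nat_fact)
  then have "real j * \<delta> \<le> fact (j + K) * Re w" using assms by (intro mult_mono) auto
  moreover have "Re (fact (j + K) * w) = fact (j + K) * Re w"
  proof -
    have "(fact (j + K) :: complex) = of_real (fact (j + K))" by simp
    then show ?thesis by (simp only: times_complex.simps Re_complex_of_real Im_complex_of_real mult_zero_left diff_zero)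
  qed
  ultimately have "norm (exp (- (fact (j + K) * w))) \<le> exp (- (real j * \<delta>))" by simp
  also have "\<dots> = exp (- \<delta>) ^ j" by (simp add: exp_of_nat_mult[symmetric])
  finally show ?thesis .
qed

lemma summable_lac:
  assumes "Re w > 0" shows "summable (\<lambda>j. exp (- (fact (j + K) * w)))"
  by (rule summable_comparison_test'[of "\<lambda>j. exp (- Re w) ^ j" 0])
     (use assms norm_lac_term in \<open>auto intro!: summable_geometric\<close>)

lemma lac_holomorphic: "lac K holomorphic_on {w. Re w > 0}"
proof (rule holomorphic_uniform_sequence[where f="\<lambda>n w. \<Sum>j<n. exp (- (fact (j + K) * w))"])
  show "open {w. Re w > 0}" by (simp add: open_halfspace_Re_gt)
  show "(\<lambda>w. \<Sum>j<n. exp (- (fact (j + K) * w))) holomorphic_on {w. Re w > 0}" for n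
    by (intro holomorphic_intros)
  fix w assume w: "w \<in> {w. Re w > 0}"
  define d where "d = Re w / 2"
  have d: "d > 0" using w by (simp add: d_def)
  have in_d: "d \<le> Re z" if "z \<in> cball w d" for z
    using abs_Re_le_cmod[of "w - z"] that by (simp add: dist_norm d_def abs_le_iff)
  have "uniform_limit (cball w d) (\<lambda>n z. \<Sum>j<n. exp (- (fact (j + K) * z))) (lac K) sequentially"
    unfolding lac_def
  proof (rule Weierstrass_m_test)
    show "norm (exp (- (fact (n + K) * z))) \<le> exp (- d) ^ n" if "z \<in> cball w d" for n z
      by (rule norm_lac_term[OF d in_d[OF that]])
    show "summable (\<lambda>n. exp (- d) ^ n)" using d by (intro summable_geometric) simp
  qed
  then show "\<exists>d>0. cball w d \<subseteq> {w. Re w > 0} \<and> uniform_limit (cball w d) (\<lambda>n z. \<Sum>j<n. exp (- (fact (j + K) * z))) (lac K) sequentially"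
    using d in_d by (intro exI[of _ d]) force
qed

text \<open>
  For \<open>k \<ge> b\<close> the number \<open>k! a/b\<close> is an integer, so all but finitely many terms are the
  positive numbers \<open>exp (- k! \<epsilon>)\<close>.
\<close>

lemma lac_blowup:
  fixes a b :: int
  assumes b: "b > 0"
  shows "\<forall>\<^sub>F \<epsilon> in at_right 0. M < norm (lac K (of_real \<epsilon> + 2 * of_real pi * \<i> * (of_int a / of_int b)))"
proof -
  define N where "N = nat b"
  \<comment> \<open>Each of m tail terms tends to 1 as \<epsilon> tends to 0, while the N initial
    terms have modulus at most 1; so m has to exceed M + N, here with 1 to spare.\<close>
  obtain m :: nat where m: "M + real N + 1 < real m" using reals_Archimedean2 by blast
  define s where "s \<epsilon> = (\<Sum>j<m. exp (- (fact (j + N + K) * \<epsilon>)))" for \<epsilon> :: real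
  have "(s \<longlongrightarrow> s 0) (at_right 0)" unfolding s_def
    by (intro tendsto_intros)
  moreover have "s 0 = real m" by (simp add: s_def)
  ultimately have "\<forall>\<^sub>F \<epsilon> in at_right 0. M + real N + 1 < s \<epsilon>" using m by (intro order_tendstoD) auto
  moreover have "\<forall>\<^sub>F \<epsilon> in at_right 0. (0::real) < \<epsilon>" by (rule eventually_at_right_less)
  ultimately show ?thesis
  proof eventually_elim
    fix \<epsilon> :: real assume s: "M + real N + 1 < s \<epsilon>" and \<epsilon>: "\<epsilon> > 0"
    define w where "w = of_real \<epsilon> + 2 * of_real pi * \<i> * (of_int a / of_int b)"
    have Rew: "Re w = \<epsilon>"
    proof -
      have "(of_int a / of_int b :: complex) = of_real (of_int a / of_int b)" by simp
      then show ?thesis unfolding w_def by (simp only:) simp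
    qed
    define t where "t j = exp (- (fact (j + K) * w))" for j
    have sm: "summable t" unfolding t_def using Rew \<epsilon> by (intro summable_lac) simp
    have t: "t (j + N) = of_real (exp (- (fact (j + N + K) * \<epsilon>)))" for j
    proof -
      have "N dvd fact (j + N + K)" using b by (intro dvd_fact) (auto simp: N_def)
      then obtain q where q: "fact (j + N + K) = N * q" by (auto simp: dvd_def)
      have f: "(fact (j + N + K) :: complex) = of_int b * of_nat q"
      proof -
        have "(fact (j + N + K) :: complex) = of_nat (fact (j + N + K))" by simp
        also have "\<dots> = of_nat N * of_nat q" by (simp only: q of_nat_mult)
        also have "of_nat N = (of_int b :: complex)" using b by (simp add: N_def)
        finally show ?thesis .
      qed
      have "- (fact (j + N + K) * w) = - (fact (j + N + K) * of_real \<epsilon>) + 2 * of_real pi * \<i> * of_int (- (a * int q))"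
        using b unfolding w_def distrib_left minus_add_distrib f by (simp add: field_simps)
      then have "t (j + N) = exp (- (fact (j + N + K) * of_real \<epsilon>)) * exp (2 * of_real pi * \<i> * of_int (- (a * int q)))"
        unfolding t_def by (simp only: exp_add)
      also have "exp (2 * of_real pi * \<i> * of_int (- (a * int q))) = 1"
        unfolding exp_eq_1 by (intro conjI exI[of _ "- (a * int q)"]) simp_all
      finally show ?thesis by (simp add: exp_of_real[symmetric])
    qed
    have "lac K w = (\<Sum>j. t (j + N)) + (\<Sum>j<N. t j)"
      unfolding lac_def t_def[symmetric] by (rule suminf_split_initial_segment[OF sm])
    have sm2: "summable (\<lambda>j. exp (- (fact (j + N + K) * \<epsilon>)))"
    proof -
      have "summable (\<lambda>j. t (j + N))" using sm by (simp only: summable_iff_shift)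
      then show ?thesis unfolding t summable_of_real_iff .
    qed
    have "(\<Sum>j. t (j + N)) = of_real (\<Sum>j. exp (- (fact (j + N + K) * \<epsilon>)))"
      unfolding t by (rule suminf_of_real[OF sm2, symmetric])
    moreover have "s \<epsilon> \<le> (\<Sum>j. exp (- (fact (j + N + K) * \<epsilon>)))"
      unfolding s_def by (rule sum_le_suminf[OF sm2]) auto
    ultimately have 1: "s \<epsilon> \<le> norm (\<Sum>j. t (j + N))" by simp
    have "norm (\<Sum>j<N. t j) \<le> (\<Sum>j<N. 1)"
    proof (rule sum_norm_le)
      fix j
      have "norm (t j) \<le> exp (- \<epsilon>) ^ j" unfolding t_def using Rew \<epsilon> by (intro norm_lac_term) auto
      also have "\<dots> \<le> 1" using \<epsilon> by (intro power_le_one) auto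
      finally show "norm (t j) \<le> 1" .
    qed
    then have "norm (\<Sum>j. t (j + N)) - real N \<le> norm (lac K w)"
      unfolding \<open>lac K w = _\<close> using norm_diff_ineq[of "\<Sum>j. t (j + N)" "\<Sum>j<N. t j"] by simp
    then show "M < norm (lac K (of_real \<epsilon> + 2 * of_real pi * \<i> * (of_int a / of_int b)))"
      using 1 s unfolding w_def[symmetric] by linarith
  qed
qed

section \<open>Real and imaginary parts, and the complexified squared distance\<close>

lemma cvec_Re_Im: "z = cvec (\<chi> i. Re (z $ i)) (\<chi> i. Im (z $ i))"
  by (simp add: cvec_def vec_eq_iff)

lemma cvec_cases:
  obtains x y where "z = cvec x y"
  using cvec_Re_Im that by blast

lemma cvec_diff: "cvec x y - cvec x' y' = cvec (x - x') (y - y')"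
  by (simp add: cvec_def vec_eq_iff complex_eq_iff)

lemma norm_cvec: "norm (cvec x y) = sqrt ((norm x)\<^sup>2 + (norm y)\<^sup>2)"
proof -
  have "(\<Sum>i\<in>UNIV. (cmod (Complex (x $ i) (y $ i)))\<^sup>2) = (norm x)\<^sup>2 + (norm y)\<^sup>2"
    by (simp add: cmod_power2 sum.distrib norm_vec_def L2_set_def sum_nonneg)
  then show ?thesis by (simp add: cvec_def norm_vec_def L2_set_def)
qed

lemma norm_cvec_ge: "norm x \<le> norm (cvec x y)" "norm y \<le> norm (cvec x y)"
  and norm_cvec_le: "norm (cvec x y) \<le> norm x + norm y"
  by (simp_all add: norm_cvec real_le_rsqrt sqrt_sum_squares_le_sum)

text \<open>The holomorphic extension of the squared distance to the real point y. The condition Re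
  (qf y z) \<le> 0 says |Re z - y| \<le> |Im z|, a cone with vertex y.\<close>

definition qf :: "real^'n::finite \<Rightarrow> complex^'n \<Rightarrow> complex" where
  "qf y z = (\<Sum>i\<in>UNIV. (z $ i - of_real (y $ i))\<^sup>2)"

lemma norm_sq_cart: "(norm x)\<^sup>2 = (\<Sum>i\<in>UNIV. (x $ i)\<^sup>2)" for x :: "real^'n::finite"
  by (simp add: norm_vec_def L2_set_def sum_nonneg)

lemma qf_cvec:
  "Re (qf y (cvec a b)) = (norm (a - y))\<^sup>2 - (norm b)\<^sup>2" "Im (qf y (cvec a b)) = 2 * ((a - y) \<bullet> b)"
  by (simp_all add: qf_def cvec_def norm_sq_cart Re_power2 Im_power2 sum_subtractf inner_vec_def sum_distrib_left mult.assoc)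
    (simp add: algebra_simps)

lemma continuous_on_qf [continuous_intros]: "continuous_on S g \<Longrightarrow> continuous_on S (\<lambda>x. qf y (g x))"
  unfolding qf_def by (intro continuous_intros)

text \<open>Homogeneity under complex dilations about the vertex; this is how a point with a
  prescribed value of \<open>qf\<close> is produced in the continuation argument.\<close>

lemma qf_scale: "qf y (cvec y 0 + c *s (z - cvec y 0)) = c\<^sup>2 * qf y z"
proof -
  have "cvec y 0 $ i = of_real (y $ i)" for i by (simp add: cvec_def complex_eq_iff)
  then show ?thesis by (simp add: qf_def sum_distrib_left power_mult_distrib right_diff_distrib[symmetric])
qed

lemma qf_real: "qf y (cvec x 0) = of_real ((norm (x - y))\<^sup>2)"
  by (simp add: complex_eq_iff qf_cvec)

lemma line_holo_subset: "line_holo f U \<Longrightarrow> V \<subseteq> U \<Longrightarrow> line_holo f V"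
  unfolding line_holo_def by (meson subsetD)

lemma line_holo_lac_qf: "line_holo (\<lambda>z. lac K (qf y z)) {z. Re (qf y z) > 0}"
  unfolding line_holo_def
proof (intro allI impI)
  fix a b :: "complex^'a" and S assume S: "open S \<and> (\<forall>w\<in>S. a + w *s b \<in> {z. Re (qf y z) > 0})"
  have "(\<lambda>w. qf y (a + w *s b)) holomorphic_on S"
    unfolding qf_def by (simp, intro holomorphic_intros)
  from holomorphic_on_compose_gen[OF this lac_holomorphic, of K] S
  show "(\<lambda>w. lac K (qf y (a + w *s b))) holomorphic_on S" by (auto simp: o_def)
qed

lemma connected_subset_clopen:
  assumes C: "connected C" "C \<inter> A \<noteq> {}" and A: "open A" "C \<inter> closure A \<subseteq> A"
  shows "C \<subseteq> A"
proof -
  have "openin (top_of_set C) (C \<inter> A)" using A(1) by (simp add: openin_open_Int)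
  moreover have "C \<inter> A = C \<inter> closure A" using A(2) closure_subset[of A] by blast
  then have "closedin (top_of_set C) (C \<inter> A)" by (simp add: closedin_closed_Int)
  ultimately have "C \<inter> A = {} \<or> C \<inter> A = C" using C(1) by (simp add: connected_clopen)
  then show ?thesis using C(2) by blast
qed

text \<open>
  Let \<open>A\<close> be the set of points near which \<open>f\<close> agrees with the lacunary function. It is open and relatively closed in
  \<open>W\<close> intersected with \<open>Re (qf y0 z) > 0\<close>, so connectedness of \<open>W\<close> forces its closure to meet the cone
  \<open>Re (qf y0 z) \<le> 0\<close> inside \<open>W\<close>. Moving from \<open>A\<close> to a point of the cone with nonzero \<open>Im (qf y0 z)\<close>
  contradicts \<open>lac_blowup\<close>.
\<close>

lemma no_extension_across_cone:
  fixes \<Omega> :: "(real^'n::finite) set" and f :: "complex^'n \<Rightarrow> complex"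
  assumes \<Omega>: "open \<Omega>" "\<Omega> \<noteq> {}" "y0 \<notin> \<Omega>"
    and W: "open W" "connected W" "p \<in> W" "\<And>x. x \<in> \<Omega> \<Longrightarrow> cvec x 0 \<in> W"
    and p: "Re (qf y0 p) \<le> 0"
    and f: "holomorphic_on_n f W" "\<And>x. x \<in> \<Omega> \<Longrightarrow> f (cvec x 0) = lac K (of_real ((norm (x - y0))\<^sup>2))"
  shows False
proof -
  define V where "V z = lac K (qf y0 z)" for z
  define D where "D = {z. Re (qf y0 z) > 0}"
  have D: "open D" unfolding D_def by (intro open_Collect_less continuous_intros)
  have WD: "open (W \<inter> D)" using W(1) D by blast
  have lf: "line_holo f (W \<inter> D)"
    by (rule line_holo_subset[OF line_holo_holomorphic[OF f(1)]]) blast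
  have lV: "line_holo V (W \<inter> D)"
    unfolding V_def[abs_def] by (rule line_holo_subset[OF line_holo_lac_qf]) (auto simp: D_def)
  define A where "A = {z. \<exists>r>0. ball z r \<subseteq> W \<inter> D \<and> (\<forall>z'\<in>ball z r. f z' = V z')}"
  have AWD: "A \<subseteq> W \<inter> D" unfolding A_def by (auto dest!: subsetD[where c="_::complex^'n"] centre_in_ball[THEN iffD2])
  have fV: "f z = V z" if "z \<in> A" for z using that by (auto simp: A_def)
  have oA: "open A"
    unfolding open_contains_ball
  proof
    fix z assume "z \<in> A"
    then obtain r where r: "r > 0" "ball z r \<subseteq> W \<inter> D" "\<forall>z'\<in>ball z r. f z' = V z'" unfolding A_def by blast
    have "z' \<in> A" if z': "z' \<in> ball z r" for z'
    proof -
      obtain r' where "r' > 0" "ball z' r' \<subseteq> ball z r" using openE[OF open_ball z'] by blast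
      then show ?thesis using r unfolding A_def by blast
    qed
    then show "\<exists>e>0. ball z e \<subseteq> A" using r(1) by blast
  qed
  \<comment> \<open>Agreement near one point of a convex open part of the domain spreads over all of
    that part, by the identity theorem on complex lines.\<close>
  have ext: "z \<in> A" if C: "convex C" "open C" "C \<subseteq> W \<inter> D" and a: "a \<in> A" "a \<in> C" and z: "z \<in> C" for C a z
  proof -
    obtain r where r: "r > 0" "\<And>z'. z' \<in> ball a r \<Longrightarrow> f z' = V z'" using a(1) unfolding A_def by blast
    have eq: "f z' = V z'" if "z' \<in> C" for z'
      by (rule identity_open[OF C(1,2) line_holo_subset[OF lf C(3)] line_holo_subset[OF lV C(3)] r a(2) that])
    obtain e where "e > 0" "ball z e \<subseteq> C" using openE[OF C(2) z] by blast
    then show ?thesis using eq C(3) unfolding A_def by blast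
  qed
  have closed: "z \<in> A" if z: "z \<in> W \<inter> D" "z \<in> closure A" for z
  proof -
    obtain e where e: "e > 0" "ball z e \<subseteq> W \<inter> D" using openE[OF WD z(1)] by blast
    obtain a where a: "a \<in> A" "dist a z < e" using z(2) e(1) unfolding closure_approachable by blast
    show ?thesis by (rule ext[OF convex_ball open_ball e(2) a(1)]) (use a e in \<open>auto simp: dist_commute\<close>)
  qed
  have Aconn: "C \<subseteq> A" if "connected C" "C \<subseteq> W \<inter> D" "C \<inter> A \<noteq> {}" for C
    by (rule connected_subset_clopen[OF that(1,3) oA]) (use closed that(2) in blast)
  \<comment> \<open>f and V are known to agree only at real points of \<Omega>; in a small complex
    ball around one of these the real points determine both functions.\<close>
  have "A \<noteq> {}"
  proof -
    obtain x where x: "x \<in> \<Omega>" using \<Omega>(2) by blast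
    then have "x \<noteq> y0" using \<Omega>(3) by auto
    then have "cvec x 0 \<in> W \<inter> D" using W(4)[OF x] by (simp add: D_def qf_real)
    then obtain r1 where r1: "r1 > 0" "ball (cvec x 0) r1 \<subseteq> W \<inter> D" using openE[OF WD] by blast
    obtain r2 where r2: "r2 > 0" "ball x r2 \<subseteq> \<Omega>" using openE[OF \<Omega>(1) x] by blast
    define r where "r = min r1 r2"
    have r: "r > 0" "ball (cvec x 0) r \<subseteq> W \<inter> D" "ball x r \<subseteq> \<Omega>" using r1 r2 unfolding r_def by auto
    have "f z = V z" if z: "z \<in> ball (cvec x 0) r" for z
    proof -
      obtain a b where ab: "z = cvec a b" by (rule cvec_cases)
      have "norm (cvec (x - a) (0 - b)) < r" using z by (simp add: ab dist_norm cvec_diff)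
      then have "norm (x - a) < r" using norm_cvec_ge(1)[of "x - a" "0 - b"] by linarith
      then have in1: "cvec a 0 \<in> ball (cvec x 0) r" by (simp add: dist_norm cvec_diff norm_cvec)
      show ?thesis unfolding ab
      proof (rule identity_real_points[OF convex_ball open_ball line_holo_subset[OF lf r(2)] line_holo_subset[OF lV r(2)] _ in1])
        show "cvec a b \<in> ball (cvec x 0) r" using z ab by simp
        fix t assume "cvec t 0 \<in> ball (cvec x 0) r"
        then have "t \<in> ball x r" by (simp add: dist_norm cvec_diff norm_cvec)
        then have "t \<in> \<Omega>" using r(3) by blast
        then show "f (cvec t 0) = V (cvec t 0)" by (simp add: f(2) V_def qf_real)
      qed
    qed
    then have "cvec x 0 \<in> A" using r unfolding A_def by blast
    then show ?thesis by blast
  qed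
  \<comment> \<open>Otherwise A would be relatively closed in W, thus all of W, although p is in W
    and outside D.\<close>
  obtain q0 where q0: "q0 \<in> W" "q0 \<in> closure A" "q0 \<notin> D"
  proof -
    have "\<not> W \<inter> closure A \<subseteq> A"
    proof
      assume "W \<inter> closure A \<subseteq> A"
      moreover have "W \<inter> A \<noteq> {}" using AWD \<open>A \<noteq> {}\<close> by blast
      ultimately have "W \<subseteq> A" using connected_subset_clopen[OF W(2) _ oA] by blast
      then show False using AWD W(3) p by (auto simp: D_def)
    qed
    then show thesis using that closed by blast
  qed
  obtain e where e: "e > 0" "ball q0 e \<subseteq> W" using openE[OF W(1) q0(1)] by blast
  obtain xq yq where q0eq: "q0 = cvec xq yq" by (rule cvec_cases)
  have q0le: "norm (xq - y0) \<le> norm yq"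
    using q0(3) by (simp add: D_def q0eq qf_cvec not_less abs_le_square_iff[symmetric])
  \<comment> \<open>The margins: the real and imaginary parts of the starting point each differ from
    those of q0 by less than e / 4, so |X| - |Y| < e / 2 and the stretched path stays within 3 e / 4
    of q0, inside W.\<close>
  have "e / 4 > 0" using e by simp
  then obtain z1 where z1: "z1 \<in> A" "dist z1 q0 < e / 4" using q0(2) unfolding closure_approachable by blast
  obtain x1 yy where z1eq: "z1 = cvec x1 yy" by (rule cvec_cases)
  define X where "X = x1 - y0"
  have "z1 \<in> D" using z1(1) AWD by blast
  then have X0: "X \<noteq> 0" by (auto simp: D_def z1eq qf_cvec X_def)
  \<comment> \<open>The end of the path must have nonzero Im \<open>qf\<close>, that is X \<bullet>
    Y nonzero. If the product vanishes, the imaginary part is moved slightly in the direction X,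
    inside the open set A.\<close>
  obtain Y where Y: "cvec x1 Y \<in> A" "dist (cvec x1 Y) q0 < e / 4" "X \<bullet> Y \<noteq> 0"
  proof (cases "X \<bullet> yy = 0")
    case False then show thesis using that z1 z1eq by blast
  next
    case True
    have "open (A \<inter> ball q0 (e / 4))" using oA by blast
    moreover have "z1 \<in> A \<inter> ball q0 (e / 4)" using z1 by (simp add: dist_commute)
    ultimately obtain r where r: "r > 0" "ball z1 r \<subseteq> A \<inter> ball q0 (e / 4)" by (meson openE)
    define \<eta> where "\<eta> = r / (2 * norm X)"
    have \<eta>: "\<eta> > 0" "\<eta> * norm X < r" using r X0 by (auto simp: \<eta>_def)
    have "cvec x1 (yy + \<eta> *\<^sub>R X) \<in> ball z1 r" using \<eta> by (simp add: z1eq dist_norm cvec_diff norm_cvec)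
    then have "cvec x1 (yy + \<eta> *\<^sub>R X) \<in> A \<inter> ball q0 (e / 4)" using r(2) by blast
    moreover have "X \<bullet> (yy + \<eta> *\<^sub>R X) \<noteq> 0" using True \<eta> X0 by (simp add: inner_add_right)
    ultimately show thesis using that[of "yy + \<eta> *\<^sub>R X"] by (simp add: dist_commute)
  qed
  have Y0: "norm Y > 0" using Y(3) by auto
  have XY: "norm Y < norm X"
  proof -
    have "cvec x1 Y \<in> D" using Y(1) AWD by blast
    then have "(norm Y)\<^sup>2 < (norm X)\<^sup>2" by (simp add: D_def qf_cvec X_def)
    then show ?thesis by (rule power_less_imp_less_base) simp
  qed
  \<comment> \<open>Stretching the imaginary part from Y to s Y lowers Re \<open>qf\<close>, which
    reaches 0 exactly at s = |X| / |Y|.\<close>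
  define s0 where "s0 = norm X / norm Y"
  have s0: "s0 > 1" "s0 * norm Y = norm X" using XY Y0 by (auto simp: s0_def)
  define zz where "zz s = cvec x1 (s *\<^sub>R Y)" for s :: real
  have zzc: "continuous_on S zz" for S
  proof -
    have "zz s = cvec x1 0 + s *\<^sub>R cvec 0 Y" for s by (simp add: zz_def cvec_def vec_eq_iff complex_eq_iff)
    then show ?thesis by (simp add: continuous_intros)
  qed
  have zzW: "zz s \<in> W" if s: "1 \<le> s" "s \<le> s0" for s
  proof -
    have d: "norm (cvec (x1 - xq) (Y - yq)) < e / 4" using Y(2) by (simp add: q0eq dist_norm cvec_diff)
    then have d1: "norm (x1 - xq) < e / 4" "norm (Y - yq) < e / 4"
      using norm_cvec_ge(1)[of "x1 - xq" "Y - yq"] norm_cvec_ge(2)[of "Y - yq" "x1 - xq"] by linarith+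
    have "norm X \<le> norm (xq - y0) + norm (x1 - xq)" using norm_triangle_ineq[of "xq - y0" "x1 - xq"] by (simp add: X_def)
    moreover have "norm yq \<le> norm Y + norm (Y - yq)" using norm_triangle_ineq4[of Y "Y - yq"] by simp
    ultimately have XY2: "norm X - norm Y < e / 2" using d1 q0le by linarith
    have "dist (zz s) (cvec x1 Y) = \<bar>s - 1\<bar> * norm Y"
    proof -
      have "zz s - cvec x1 Y = cvec 0 ((s - 1) *\<^sub>R Y)" by (simp add: zz_def cvec_diff algebra_simps)
      then show ?thesis by (simp add: dist_norm norm_cvec)
    qed
    also have "\<dots> \<le> (s0 - 1) * norm Y" using s by (intro mult_right_mono) auto
    also have "\<dots> = norm X - norm Y" using s0 by (simp add: algebra_simps)
    finally have "dist (zz s) q0 < e" using XY2 Y(2) dist_triangle[of "zz s" q0 "cvec x1 Y"] e(1) by linarith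
    then show ?thesis using e(2) by (auto simp: dist_commute)
  qed
  have Req: "Re (qf y0 (zz s)) = (norm X)\<^sup>2 - (s * norm Y)\<^sup>2" "Im (qf y0 (zz s)) = 2 * s * (X \<bullet> Y)" for s
    by (simp_all add: zz_def qf_cvec X_def power_mult_distrib)
  have zzD: "zz s \<in> D" if s: "1 \<le> s" "s < s0" for s
  proof -
    have "s * norm Y < norm X" using mult_strict_right_mono[OF s(2) Y0] s0(2) by simp
    then have "(s * norm Y)\<^sup>2 < (norm X)\<^sup>2" using s by (intro power_strict_mono) auto
    then show ?thesis by (simp add: D_def Req)
  qed
  have zzA: "zz s \<in> A" if s: "1 \<le> s" "s < s0" for s
  proof -
    have "zz ` {1..s} \<subseteq> A"
    proof (rule Aconn)
      show "connected (zz ` {1..s})" by (intro connected_continuous_image zzc) auto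
      show "zz ` {1..s} \<subseteq> W \<inter> D" using zzW zzD s by auto
      have "zz 1 \<in> A" using Y(1) by (simp add: zz_def)
      then show "zz ` {1..s} \<inter> A \<noteq> {}" using s by force
    qed
    then show ?thesis using s by auto
  qed
  define w where "w s = qf y0 (zz s)" for s
  have wc: "continuous_on S w" for S unfolding w_def[abs_def] by (intro continuous_intros zzc)
  define \<beta> where "\<beta> = 2 * s0 * (X \<bullet> Y)"
  have w0: "w s0 = Complex 0 \<beta>" by (simp add: w_def complex_eq_iff Req s0 \<beta>_def)
  have \<beta>: "\<beta> \<noteq> 0" using s0 Y(3) by (simp add: \<beta>_def)
  have w00: "w s0 \<noteq> 0" using \<beta> by (simp add: w0 complex_eq_iff)
  let ?Y0 = "cvec y0 0"
  \<comment> \<open>Dilating zz s about y0 by a square root of \<omega> / w s gives a point with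
    \<open>qf\<close> equal to \<omega>. At (w s0, s0) the quotient is 1, away from the branch cut,
    so the map is continuous nearby and takes the value zz s0 in W there.\<close>
  define \<Theta> where "\<Theta> pp = ?Y0 + csqrt (fst pp / w (snd pp)) *s (zz (snd pp) - ?Y0)" for pp :: "complex \<times> real"
  define P where "P = {pp :: complex \<times> real. w (snd pp) \<noteq> 0 \<and> fst pp / w (snd pp) \<notin> \<real>\<^sub>\<le>\<^sub>0}"
  have rat: "continuous_on {pp. w (snd pp) \<noteq> 0} (\<lambda>pp. fst pp / w (snd pp))"
    by (intro continuous_intros continuous_on_compose2[OF wc[of UNIV]]) auto
  have oP: "open P"
  proof -
    have "open {pp::complex \<times> real. w (snd pp) \<noteq> 0}"
      by (intro open_Collect_neq continuous_intros continuous_on_compose2[OF wc[of UNIV]]) auto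
    from continuous_open_preimage[OF rat this, of "- \<real>\<^sub>\<le>\<^sub>0"]
    have "open ({pp. w (snd pp) \<noteq> 0} \<inter> (\<lambda>pp. fst pp / w (snd pp)) -` (- \<real>\<^sub>\<le>\<^sub>0))" by (simp add: open_Compl closed_nonpos_Reals_complex)
    also have "\<dots> = P" by (auto simp: P_def)
    finally show ?thesis .
  qed
  have \<Theta>c: "continuous_on P \<Theta>"
  proof -
    have "continuous_on (- \<real>\<^sub>\<le>\<^sub>0) csqrt"
      by (intro continuous_at_imp_continuous_on ballI continuous_at_csqrt) auto
    then have "continuous_on P (\<lambda>pp. csqrt (fst pp / w (snd pp)))"
      by (rule continuous_on_compose2[OF _ continuous_on_subset[OF rat]]) (auto simp: P_def)
    moreover have "continuous_on P (\<lambda>pp. zz (snd pp))"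
      by (intro continuous_on_compose2[OF zzc[of UNIV]] continuous_intros) auto
    ultimately show ?thesis
      unfolding \<Theta>_def[abs_def] vector_scalar_mult_def by (intro continuous_intros)
  qed
  have "open (P \<inter> \<Theta> -` W)" by (rule continuous_open_preimage[OF \<Theta>c oP W(1)])
  moreover have "(w s0, s0) \<in> P \<inter> \<Theta> -` W"
    using zzW[of s0] s0 w00 by (simp add: P_def \<Theta>_def)
  ultimately obtain \<delta> where \<delta>: "\<delta> > 0" "ball (w s0, s0) \<delta> \<subseteq> P \<inter> \<Theta> -` W" by (meson openE)
  have near: "(\<omega>, s) \<in> P \<and> \<Theta> (\<omega>, s) \<in> W" if "dist \<omega> (w s0) < \<delta> / 2" "\<bar>s - s0\<bar> < \<delta> / 2" for \<omega> s
  proof -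
    have "dist (w s0, s0) (\<omega>, s) \<le> dist (w s0) \<omega> + dist s0 s"
      unfolding dist_Pair_Pair by (rule sqrt_sum_squares_le_sum) auto
    also have "\<dots> < \<delta>" using that abs_minus_commute[of s s0] dist_commute[of \<omega> "w s0"] by (simp add: dist_real_def)
    finally have "(\<omega>, s) \<in> ball (w s0, s0) \<delta>" by simp
    then show ?thesis using \<delta>(2) by blast
  qed
  \<comment> \<open>Freezing s slightly below s0: zz s is still in A and w s lies in the right half
    plane, while \<omega> may range over a whole ball around the imaginary number w s0.\<close>
  obtain s where s: "1 < s" "s < s0" "\<bar>s - s0\<bar> < \<delta> / 2" "dist (w s) (w s0) < \<delta> / 2"
  proof -
    have "\<delta> / 2 > 0" using \<delta> by simp
    then obtain d where d: "d > 0" "\<And>s. dist s s0 < d \<Longrightarrow> dist (w s) (w s0) < \<delta> / 2"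
      using wc[of UNIV, unfolded continuous_on_iff, rule_format, OF UNIV_I, of "\<delta> / 2" s0] by auto
    let ?m = "max 1 (s0 - min d (\<delta> / 2))"
    have "?m < s0" using s0 d \<delta> by auto
    then obtain s where "?m < s" "s < s0" using dense by blast
    then show thesis using that[of s] d(2)[of s] by (auto simp: dist_real_def)
  qed
  define g where "g \<omega> = \<Theta> (\<omega>, s)" for \<omega>
  define B where "B = ball (w s0) (\<delta> / 2)"
  have gP: "(\<omega>, s) \<in> P" "g \<omega> \<in> W" if "\<omega> \<in> B" for \<omega>
    using near[of \<omega> s] that s by (auto simp: B_def g_def dist_commute)
  have gc: "continuous_on B g"
    unfolding g_def by (rule continuous_on_compose2[OF \<Theta>c]) (auto intro!: continuous_intros gP)
  have ws: "w s \<noteq> 0" using gP(1)[of "w s0"] \<delta> by (simp add: B_def P_def)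
  have qg: "qf y0 (g \<omega>) = \<omega>" for \<omega>
    unfolding g_def \<Theta>_def qf_scale using ws by (simp add: w_def)
  \<comment> \<open>A half ball is connected and contains w s, which is mapped to zz s in A; so the
    whole image lies in A, where f equals the lacunary function.\<close>
  define H where "H = B \<inter> {\<omega>. Re \<omega> > 0}"
  have gA: "g ` H \<subseteq> A"
  proof (rule Aconn)
    have "convex H" unfolding H_def B_def by (intro convex_Int convex_ball convex_halfspace_Re_gt)
    then show "connected (g ` H)"
      by (intro connected_continuous_image continuous_on_subset[OF gc] convex_connected) (auto simp: H_def)
    show "g ` H \<subseteq> W \<inter> D" using gP(2) by (auto simp: H_def D_def qg)
    have "w s \<in> H" using s zzD[of s] by (auto simp: H_def B_def D_def w_def dist_commute)
    moreover have "g (w s) \<in> A" using zzA[of s] s ws by (simp add: g_def \<Theta>_def)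
    ultimately show "g ` H \<inter> A \<noteq> {}" by blast
  qed
  have fl: "f (g \<omega>) = lac K \<omega>" if "\<omega> \<in> H" for \<omega>
    using fV[of "g \<omega>"] gA that by (auto simp: V_def qg)
  \<comment> \<open>The blow-up is available at 2 \<pi> i times a rational; one such point lies
    within \<delta> / 2 of w s0 on the imaginary axis.\<close>
  obtain r where r: "r \<in> \<rat>" "\<beta> / (2 * pi) < r" "r < (\<beta> + \<delta> / 2) / (2 * pi)"
    using Rats_dense_in_real[of "\<beta> / (2 * pi)" "(\<beta> + \<delta> / 2) / (2 * pi)"] \<delta>(1) by (auto simp: divide_strict_right_mono)
  obtain a b :: int where ab: "b > 0" "r = of_int a / of_int b" using Rats_cases'[OF r(1)] by blast
  define \<omega>1 where "\<omega>1 = 2 * of_real pi * \<i> * (of_int a / of_int b)"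
  have \<omega>1: "\<omega>1 = Complex 0 (2 * pi * r)"
  proof -
    have "(of_int a / of_int b :: complex) = of_real r" by (simp add: ab)
    then show ?thesis unfolding \<omega>1_def by (simp only:) (simp add: complex_eq_iff)
  qed
  have \<omega>1B: "\<omega>1 \<in> B"
  proof -
    have "w s0 - \<omega>1 = Complex 0 (\<beta> - 2 * pi * r)" by (simp add: w0 \<omega>1 complex_eq_iff)
    then have "dist (w s0) \<omega>1 = \<bar>\<beta> - 2 * pi * r\<bar>" by (simp add: dist_norm complex_norm)
    also have "\<dots> < \<delta> / 2" using r(2,3) by (simp add: field_simps abs_less_iff)
    finally show ?thesis by (simp add: B_def)
  qed
  have oB: "open B" by (simp add: B_def)
  \<comment> \<open>f composed with g is continuous at \<omega>1, hence bounded nearby; approached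
    from the right half plane it equals the lacunary function, which is unbounded there.\<close>
  have "isCont g \<omega>1" using gc \<omega>1B oB by (simp add: continuous_on_eq_continuous_at)
  moreover have "isCont f (g \<omega>1)"
  proof -
    obtain L where "(f has_derivative L) (at (g \<omega>1))" "\<forall>c w. L (c *s w) = c * L w"
      using bspec[OF f(1)[unfolded holomorphic_on_n_def] gP(2)[OF \<omega>1B]] by (elim exE conjE)
    from this(1) show ?thesis by (rule has_derivative_continuous)
  qed
  ultimately have fg: "isCont (\<lambda>\<omega>. f (g \<omega>)) \<omega>1" by (rule isCont_o2)
  have sh: "((\<lambda>\<epsilon>. of_real \<epsilon> + \<omega>1) \<longlongrightarrow> \<omega>1) (at_right (0::real))"
  proof -
    have "((\<lambda>\<epsilon>. of_real \<epsilon> + \<omega>1) \<longlongrightarrow> of_real 0 + \<omega>1) (at_right (0::real))"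
      by (intro tendsto_intros)
    then show ?thesis by simp
  qed
  have "((\<lambda>\<epsilon>. norm (f (g (of_real \<epsilon> + \<omega>1)))) \<longlongrightarrow> norm (f (g \<omega>1))) (at_right (0::real))"
    by (rule tendsto_norm[OF isCont_tendsto_compose[OF fg sh]])
  then have ev1: "\<forall>\<^sub>F \<epsilon> in at_right (0::real). norm (f (g (of_real \<epsilon> + \<omega>1))) < norm (f (g \<omega>1)) + 1"
    by (rule order_tendstoD) simp
  have ev2: "\<forall>\<^sub>F \<epsilon> in at_right (0::real). of_real \<epsilon> + \<omega>1 \<in> B"
    using topological_tendstoD[OF sh oB \<omega>1B] .
  have ev3: "\<forall>\<^sub>F \<epsilon> in at_right (0::real). 0 < \<epsilon>" by (rule eventually_at_right_less)
  have ev4: "\<forall>\<^sub>F \<epsilon> in at_right (0::real). norm (f (g \<omega>1)) + 1 < norm (lac K (of_real \<epsilon> + \<omega>1))"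
    unfolding \<omega>1_def by (rule lac_blowup[OF ab(1)])
  have "\<forall>\<^sub>F \<epsilon> in at_right (0::real). False"
    using ev1 ev2 ev3 ev4
  proof eventually_elim
    fix \<epsilon> :: real
    assume 1: "norm (f (g (of_real \<epsilon> + \<omega>1))) < norm (f (g \<omega>1)) + 1" "of_real \<epsilon> + \<omega>1 \<in> B" "0 < \<epsilon>"
      "norm (f (g \<omega>1)) + 1 < norm (lac K (of_real \<epsilon> + \<omega>1))"
    have "of_real \<epsilon> + \<omega>1 \<in> H" using 1 by (simp add: H_def \<omega>1)
    from fl[OF this] 1 show False by simp
  qed
  then show False by simp
qed

section \<open>Points outside the closure of \<open>E_dom \<Omega>\<close>\<close>

text \<open>If there is no such y0, the closed ball around Re p of radius |Im p| lies in the closure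
  of \<Omega>. A Lipschitz boundary has exterior points arbitrarily near each frontier point (a slit
  would break this), so the open ball lies in \<Omega> itself. Then |Im p| is at most the distance
  from Re p to the frontier, and shrinking Im p slightly yields points of \<open>E_dom\<close> near
  p.\<close>

lemma exterior_point:
  fixes \<Omega> :: "(real^'n::finite) set"
  assumes \<Omega>: "bounded_lipschitz_domain \<Omega>" and p: "p \<notin> closure (E_dom \<Omega>)"
  shows "\<exists>y0. y0 \<notin> closure \<Omega> \<and> Re (qf y0 p) \<le> 0"
proof (rule ccontr)
  assume "\<not> ?thesis"
  then have H: "y \<in> closure \<Omega>" if "Re (qf y p) \<le> 0" for y using that by blast
  obtain a b where ab: "p = cvec a b" by (rule cvec_cases)
  have H': "y \<in> closure \<Omega>" if "norm (a - y) \<le> norm b" for y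
    by (rule H) (use that in \<open>simp add: ab qf_cvec power_mono\<close>)
  have o: "open \<Omega>" and ne: "\<Omega> \<noteq> {}" and bd: "bounded \<Omega>" using \<Omega> by (auto simp: bounded_lipschitz_domain_def)
  have loc: "\<forall>x\<in>frontier \<Omega>. \<exists>V e L. \<exists>g :: real^'n \<Rightarrow> real.
        open V \<and> x \<in> V \<and> norm e = 1 \<and> L-lipschitz_on {y. y \<bullet> e = 0} g \<and>
        \<Omega> \<inter> V = {y \<in> V. g (y - (y \<bullet> e) *\<^sub>R e) < y \<bullet> e} \<and>
        frontier \<Omega> \<inter> V = {y \<in> V. y \<bullet> e = g (y - (y \<bullet> e) *\<^sub>R e)}"
    using \<Omega> unfolding bounded_lipschitz_domain_def by auto
  have fne: "frontier \<Omega> \<noteq> {}"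
    by (rule frontier_not_empty[OF ne]) (use bd not_bounded_UNIV in auto)
  have E: "cvec x y \<in> E_dom \<Omega>" if "x \<in> \<Omega>" "norm y < infdist x (frontier \<Omega>)" for x y
    using that unfolding E_dom_def by blast
  have "p \<in> closure (E_dom \<Omega>)"
  proof (cases "b = 0")
    \<comment> \<open>The ball degenerates to a point, so Re p itself is approximated from
      \<Omega>.\<close>
    case True
    have "a \<in> closure \<Omega>" by (rule H') simp
    show ?thesis unfolding closure_approachable
    proof (intro allI impI)
      fix e :: real assume "e > 0"
      then obtain x where x: "x \<in> \<Omega>" "dist x a < e" using \<open>a \<in> closure \<Omega>\<close> unfolding closure_approachable by blast
      have "x \<notin> frontier \<Omega>" using x(1) o by (simp add: frontier_def interior_open)
      then have "infdist x (frontier \<Omega>) > 0" using fne by (simp add: infdist_pos_not_in_closed)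
      then have "cvec x 0 \<in> E_dom \<Omega>" using x(1) by (intro E) auto
      moreover have "dist (cvec x 0) p < e" using x(2) by (simp add: ab True dist_norm cvec_diff norm_cvec)
      ultimately show "\<exists>y\<in>E_dom \<Omega>. dist y p < e" by blast
    qed
  next
    case False
    have ball: "ball a (norm b) \<subseteq> \<Omega>"
    proof
      fix y assume y: "y \<in> ball a (norm b)"
      show "y \<in> \<Omega>"
      proof (rule ccontr)
        assume "y \<notin> \<Omega>"
        moreover have "y \<in> closure \<Omega>" using y by (intro H') (simp add: dist_norm)
        ultimately have "y \<in> frontier \<Omega>" using o by (simp add: frontier_def interior_open)
        from bspec[OF loc this] obtain V n L g where V': "open V" "y \<in> V" "norm n = 1" "L-lipschitz_on {y. y \<bullet> n = 0} g"
          "\<Omega> \<inter> V = {y \<in> V. g (y - (y \<bullet> n) *\<^sub>R n) < y \<bullet> n}"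
          "frontier \<Omega> \<inter> V = {y \<in> V. y \<bullet> n = g (y - (y \<bullet> n) *\<^sub>R n)}"
          by (elim exE conjE)
        note V = V'(1-3,5,6) and yfr = \<open>y \<in> frontier \<Omega>\<close>
        have nn: "n \<bullet> n = 1" using V(3) by (simp add: dot_square_norm)
        have "open (V \<inter> ball a (norm b))" using V(1) by blast
        moreover have "y \<in> V \<inter> ball a (norm b)" using V(2) y by simp
        ultimately obtain r where r: "r > 0" "ball y r \<subseteq> V \<inter> ball a (norm b)" by (meson openE)
        \<comment> \<open>A step along - n keeps the projection and goes strictly below the graph,
          to a point of neither \<Omega> nor its frontier, hence outside the closure.\<close>
        define z where "z = y - (r / 2) *\<^sub>R n"
        have "z \<in> ball y r" using r(1) V(3) by (simp add: z_def dist_norm)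
        then have z: "z \<in> V" "z \<in> ball a (norm b)" using r(2) by auto
        have pr: "z - (z \<bullet> n) *\<^sub>R n = y - (y \<bullet> n) *\<^sub>R n" "z \<bullet> n = y \<bullet> n - r / 2"
          by (simp_all add: z_def nn inner_diff_left algebra_simps)
        have "y \<bullet> n = g (y - (y \<bullet> n) *\<^sub>R n)" using V(5) V(2) yfr by blast
        then have "\<not> g (z - (z \<bullet> n) *\<^sub>R n) < z \<bullet> n" "z \<bullet> n \<noteq> g (z - (z \<bullet> n) *\<^sub>R n)"
          using r(1) pr(2) unfolding pr(1) by simp_all
        then have "z \<notin> \<Omega>" "z \<notin> frontier \<Omega>" using V(4,5) z(1) by blast+
        moreover have "z \<in> closure \<Omega>" using z(2) by (intro H') (simp add: dist_norm)
        ultimately show False using o by (simp add: frontier_def interior_open)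
      qed
    qed
    have "norm b \<le> infdist a (frontier \<Omega>)"
      unfolding infdist_notempty[OF fne]
    proof (rule cINF_greatest[OF fne])
      fix y assume "y \<in> frontier \<Omega>"
      then have "y \<notin> \<Omega>" using o by (simp add: frontier_def interior_open)
      then show "norm b \<le> dist a y" using ball by (force simp: not_less)
    qed
    have "a \<in> \<Omega>" using ball False by auto
    show ?thesis unfolding closure_approachable
    proof (intro allI impI)
      fix e :: real assume e: "e > 0"
      define s where "s = min (1/2) (e / (2 * norm b))"
      have s: "s > 0" "s < 1" "s * norm b < e" using e False by (auto simp: s_def min_def field_simps)
      have "norm ((1 - s) *\<^sub>R b) < norm b" using s False by simp
      then have "cvec a ((1 - s) *\<^sub>R b) \<in> E_dom \<Omega>" using \<open>norm b \<le> infdist a _\<close> \<open>a \<in> \<Omega>\<close> by (intro E) auto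
      moreover have "cvec a ((1 - s) *\<^sub>R b) - p = cvec 0 (- s *\<^sub>R b)" by (simp add: ab cvec_diff algebra_simps)
      then have "dist (cvec a ((1 - s) *\<^sub>R b)) p < e" using s by (simp add: dist_norm norm_cvec)
      ultimately show "\<exists>y\<in>E_dom \<Omega>. dist y p < e" by blast
    qed
  qed
  then show False using p by simp
qed

section \<open>Representation of the solution at time \<open>T\<close>\<close>

definition cut_off :: "real \<Rightarrow> (real^'n::finite) set \<Rightarrow> (real \<times> (real^'n) \<Rightarrow> complex) \<Rightarrow> real \<times> (real^'n) \<Rightarrow> complex" where
  "cut_off T \<Omega> u z = (if z \<in> cyl T \<Omega> then u z else 0)"

lemma open_cyl: "open \<Omega> \<Longrightarrow> open (cyl T \<Omega>)"
  unfolding cyl_def by (intro open_Times) auto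

lemma cut_off_measurable:
  assumes "open \<Omega>" "continuous_on ({0<..T} \<times> \<Omega>) u"
  shows "cut_off T \<Omega> u \<in> borel_measurable borel"
proof -
  have "continuous_on (cyl T \<Omega>) u" by (rule continuous_on_subset[OF assms(2)]) (auto simp: cyl_def)
  then have "(\<lambda>z. if z \<in> cyl T \<Omega> then u z else 0) \<in> borel_measurable borel"
    by (intro borel_measurable_continuous_on_if borel_open open_cyl assms(1) continuous_on_const)
  then show ?thesis by (simp add: cut_off_def[abs_def])
qed

text \<open>Finiteness of the \<open>H1s_Q\<close> norm provides an extension w with finite L^2
  norm, and on a bounded cylinder |w| \<le> 1 + |w|^2 passes from L^2 to L^1.\<close>

lemma cut_off_integrable:
  fixes \<Omega> :: "(real^'n::finite) set"
  assumes \<Omega>: "open \<Omega>" "bounded \<Omega>" and u: "continuous_on ({0<..T} \<times> \<Omega>) u" "u \<in> H1s_Q (1/2) T \<Omega>"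
  shows "integrable lborel (cut_off T \<Omega> u)"
proof -
  note meas = cut_off_measurable[OF \<Omega>(1) u(1)]
  have cyl: "cyl T \<Omega> \<in> sets borel" by (intro borel_open open_cyl \<Omega>(1))
  have fin: "emeasure lborel (cyl T \<Omega>) < \<infinity>"
    unfolding cyl_def by (intro emeasure_bounded_finite bounded_Times \<Omega>(2)) auto
  have "H1s_Q_sq (1/2) T \<Omega> u < \<infinity>" using u(2) by (simp add: H1s_Q_def)
  then obtain w where w: "w \<in> borel_measurable borel" "AE z in lborel. z \<in> cyl T \<Omega> \<longrightarrow> w z = u z" "H1s_sq (1/2) w < \<infinity>"
    unfolding H1s_Q_sq_def INF_less_iff by auto
  have "(\<integral>\<^sup>+t. \<integral>\<^sup>+x. ennreal ((cmod (w (t, x)))\<^sup>2) \<partial>lborel \<partial>lborel) \<le> H1s_sq (1/2) w"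
    unfolding H1s_sq_def Hs_L2_sq_def by (simp add: add.commute add.left_commute add_increasing)
  also have "(\<integral>\<^sup>+t. \<integral>\<^sup>+x. ennreal ((cmod (w (t, x)))\<^sup>2) \<partial>lborel \<partial>lborel) = (\<integral>\<^sup>+z. ennreal ((cmod (w z))\<^sup>2) \<partial>(lborel \<Otimes>\<^sub>M lborel))"
    by (rule lborel.nn_integral_fst) (use w(1) in \<open>simp add: lborel_prod\<close>)
  finally have L2: "(\<integral>\<^sup>+z. ennreal ((cmod (w z))\<^sup>2) \<partial>lborel) < \<infinity>" using w(3) by (simp add: lborel_prod)
  have "(\<integral>\<^sup>+z. ennreal (norm (cut_off T \<Omega> u z)) \<partial>lborel) \<le> (\<integral>\<^sup>+z. indicator (cyl T \<Omega>) z + ennreal ((cmod (w z))\<^sup>2) \<partial>lborel)"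
  proof (rule nn_integral_mono_AE, use w(2) in eventually_elim)
    fix z assume z: "z \<in> cyl T \<Omega> \<longrightarrow> w z = u z"
    have "cmod (w z) \<le> 1 + (cmod (w z))\<^sup>2"
      using zero_le_power2[of "cmod (w z) - 1/2"] by (simp add: power2_eq_square algebra_simps)
    then have "ennreal (cmod (w z)) \<le> 1 + ennreal ((cmod (w z))\<^sup>2)"
      by (metis ennreal_1 ennreal_leI ennreal_plus zero_le_one zero_le_power2)
    then show "ennreal (norm (cut_off T \<Omega> u z)) \<le> indicator (cyl T \<Omega>) z + ennreal ((cmod (w z))\<^sup>2)"
      using z by (auto simp: cut_off_def)
  qed
  also have "\<dots> = emeasure lborel (cyl T \<Omega>) + (\<integral>\<^sup>+z. ennreal ((cmod (w z))\<^sup>2) \<partial>lborel)"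
    using cyl w(1) by (simp add: nn_integral_add)
  also have "\<dots> < \<infinity>" using fin L2 by (simp add: ennreal_add_less_top)
  finally show ?thesis using meas by (simp add: integrable_iff_bounded)
qed

section \<open>The total mass of the Gaussian\<close>

lemma integrable_gauss: "integrable lborel (\<lambda>x::'a::euclidean_space. exp (- (x \<bullet> x) / 4))"
proof -
  have 1: "(\<integral>\<^sup>+r. ennreal (exp (- (r\<^sup>2) / 4)) \<partial>lborel) < \<infinity>"
  proof -
    have le: "exp (- (r\<^sup>2) / 4) \<le> 4 * (if \<bar>r\<bar> \<le> 1 then 1 else \<bar>r\<bar> powr - 2)" for r :: real
    proof (cases "\<bar>r\<bar> \<le> 1")
      case True
      have "exp (- (r\<^sup>2) / 4) \<le> 1" by simp
      then have "exp (- (r\<^sup>2) / 4) \<le> 4" by linarith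
      then show ?thesis using True by simp
    next
      case False
      then have r: "r\<^sup>2 > 0" by auto
      have "r\<^sup>2 / 4 \<le> exp (r\<^sup>2 / 4)" using exp_ge_add_one_self[of "r\<^sup>2 / 4"] by linarith
      then have "exp (- (r\<^sup>2) / 4) \<le> 4 / r\<^sup>2" using r by (simp add: exp_minus field_simps)
      also have "\<dots> = 4 * \<bar>r\<bar> powr - 2" using False by (simp add: powr_minus powr_numeral divide_inverse)
      finally show ?thesis using False by simp
    qed
    have "(\<integral>\<^sup>+r. ennreal (exp (- (r\<^sup>2) / 4)) \<partial>lborel) \<le> (\<integral>\<^sup>+r. 4 * ennreal (if \<bar>r\<bar> \<le> 1 then 1 else \<bar>r\<bar> powr - 2) \<partial>lborel)"
    proof (rule nn_integral_mono)
      fix r :: real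
      have "ennreal (exp (- (r\<^sup>2) / 4)) \<le> ennreal (4 * (if \<bar>r\<bar> \<le> 1 then 1 else \<bar>r\<bar> powr - 2))" by (rule ennreal_leI[OF le])
      also have "\<dots> = 4 * ennreal (if \<bar>r\<bar> \<le> 1 then 1 else \<bar>r\<bar> powr - 2)" by (subst ennreal_mult) auto
      finally show "ennreal (exp (- (r\<^sup>2) / 4)) \<le> 4 * ennreal (if \<bar>r\<bar> \<le> 1 then 1 else \<bar>r\<bar> powr - 2)" .
    qed
    also have "\<dots> = 4 * (\<integral>\<^sup>+r. ennreal (if \<bar>r\<bar> \<le> 1 then 1 else \<bar>r\<bar> powr - 2) \<partial>lborel)"
      by (rule nn_integral_cmult) measurable
    also have "\<dots> < \<infinity>" using nn_integral_powr_tail[of 2] by (simp add: ennreal_mult_less_top)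
    finally show ?thesis .
  qed
  have "ennreal (exp (- (x \<bullet> x) / 4)) = (\<Prod>b\<in>Basis. ennreal (exp (- ((x \<bullet> b)\<^sup>2) / 4)))" for x :: 'a
  proof -
    have "- (x \<bullet> x) / 4 = (\<Sum>b\<in>Basis. - ((x \<bullet> b)\<^sup>2) / 4)"
      by (subst euclidean_inner) (simp add: power2_eq_square sum_negf sum_divide_distrib)
    then show ?thesis by (simp add: exp_sum prod_ennreal)
  qed
  then have "(\<integral>\<^sup>+x. ennreal (exp (- (x \<bullet> x) / 4)) \<partial>(lborel :: 'a measure)) = (\<Prod>b\<in>(Basis::'a set). \<integral>\<^sup>+r. ennreal (exp (- (r\<^sup>2) / 4)) \<partial>lborel)"
    by (simp only:) (rule nn_integral_lborel_prod; simp)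
  also have "\<dots> < \<infinity>" using 1 by (simp add: power_less_top_ennreal)
  finally show ?thesis by (intro integrableI_bounded) auto
qed

text \<open>Equal to (4 \<pi>)^(d/2), the normalising factor left out of \<open>hk (d/2)\<close>.
  The representation formula is divided by it, so it has to be nonzero.\<close>

definition gauss_mass :: "'a::euclidean_space itself \<Rightarrow> real" where
  "gauss_mass _ = (\<integral>x. exp (- (x \<bullet> x) / 4) \<partial>(lborel :: 'a measure))"

lemma gauss_mass_pos: "gauss_mass TYPE('a::euclidean_space) \<noteq> 0"
proof
  assume "gauss_mass TYPE('a) = 0"
  then have "AE x in (lborel :: 'a measure). exp (- (x \<bullet> x) / 4) = 0"
    unfolding gauss_mass_def by (subst (asm) integral_nonneg_eq_0_iff_AE) (use integrable_gauss in simp_all)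
  then have "AE x in (lborel :: 'a measure). False" by simp
  then have "emeasure lborel (UNIV :: 'a set) = 0" by (subst (asm) AE_iff_measurable[OF _ refl]) auto
  then show False by (simp add: emeasure_lborel_UNIV)
qed

section \<open>Testing the equation with the truncated backward kernel\<close>

lemma Ck_on_fst_snd:
  fixes \<eta> :: "real \<Rightarrow> real" and \<psi> :: "'a::euclidean_space \<Rightarrow> real"
  assumes "\<And>k. Ck_on k UNIV \<eta>" "\<And>k. Ck_on k UNIV \<psi>"
  shows "Ck_on k UNIV (\<lambda>z. \<eta> (fst z) * \<psi> (snd z))"
proof -
  have "Ck_on k UNIV (fst :: real \<times> 'a \<Rightarrow> real)" "Ck_on k UNIV (snd :: real \<times> 'a \<Rightarrow> 'a)"
    by (intro Ck_on_bounded_linear bounded_linear_fst bounded_linear_snd open_UNIV)+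
  then show ?thesis
    by (intro Ck_on_mult open_UNIV Ck_on_compose[OF open_UNIV open_UNIV subset_UNIV assms(1)]
        Ck_on_compose[OF open_UNIV open_UNIV subset_UNIV assms(2)])
qed

lemma Ck_on_hk_shift:
  fixes x :: "'a::euclidean_space"
  shows "Ck_on k (- {(T, x)}) (\<lambda>z. hk a (T - fst z, snd z - x))"
proof (rule Ck_on_compose[where V="- {0}", OF _ _ _ Ck_on_hk])
  have "Ck_on k (- {(T, x)}) (\<lambda>z. (T, - x) + (- fst z, snd z))"
    by (intro Ck_on_affine bounded_linear_Pair bounded_linear_minus bounded_linear_fst bounded_linear_snd) auto
  then show "Ck_on k (- {(T, x)}) (\<lambda>z. (T - fst z, snd z - x))" by simp
  show "(\<lambda>z. (T - fst z, snd z - x)) ` (- {(T, x)}) \<subseteq> - {0}" by (auto simp: prod_eq_iff)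
qed auto

text \<open>The kernel is singular only at (T, x), and \<beta> < T makes \<eta> vanish for all times
  after \<beta>; smoothness is patched from the complement of the singular point and the region
  where \<eta> is zero.\<close>

lemma test_function_hk:
  fixes \<eta> :: "real \<Rightarrow> real" and \<psi> :: "'a::euclidean_space \<Rightarrow> real"
  assumes \<eta>: "\<And>k. Ck_on k UNIV \<eta>" "\<And>s. s \<notin> {\<alpha>..\<beta>} \<Longrightarrow> \<eta> s = 0" and \<beta>: "\<beta> < T"
    and \<psi>: "\<And>k. Ck_on k UNIV \<psi>" "\<And>y. y \<notin> K \<Longrightarrow> \<psi> y = 0" and K: "compact K" "{\<alpha>..\<beta>} \<times> K \<subseteq> U"
  shows "test_function U (\<lambda>z. complex_of_real (\<eta> (fst z) * \<psi> (snd z) * hk a (T - fst z, snd z - x)))"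
proof (rule test_functionI[where K="{\<alpha>..\<beta>} \<times> K"])
  fix k
  let ?F = "\<lambda>z::real \<times> 'a. \<eta> (fst z) * \<psi> (snd z) * hk a (T - fst z, snd z - x)"
  let ?V = "- {(T, x)}" and ?W = "{z::real \<times> 'a. \<beta> < fst z}"
  have o: "open ?V" "open ?W" by (auto intro!: open_Collect_less continuous_intros)
  have "Ck_on k ?V ?F"
    by (intro Ck_on_mult o Ck_on_hk_shift Ck_on_subset[OF Ck_on_fst_snd[OF \<eta>(1) \<psi>(1)]]) auto
  moreover have "Ck_on k ?W ?F"
    using Ck_on_cong[OF o(2), of ?F "\<lambda>_. 0" k] Ck_on_const[OF o(2), of k 0] \<eta>(2) by simp
  ultimately have "Ck_on k (?V \<union> ?W) ?F" by (rule Ck_on_Un[OF o])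
  moreover have "?V \<union> ?W = UNIV" using \<beta> by auto
  ultimately have "Ck_on k UNIV ?F" by simp
  then show "Ck_on k UNIV (\<lambda>z. complex_of_real (?F z))"
    by (rule Ck_on_linear_comp[OF bounded_linear_of_real open_UNIV])
next
  show "complex_of_real (\<eta> (fst z) * \<psi> (snd z) * hk a (T - fst z, snd z - x)) = 0" if "z \<notin> {\<alpha>..\<beta>} \<times> K" for z
    using that \<eta>(2)[of "fst z"] \<psi>(2)[of "snd z"] by (cases z) auto
qed (use K in \<open>auto intro: compact_Times\<close>)

lemma integrable_cut_off_mult:
  assumes U: "integrable lborel U" and f: "test_function S f"
  shows "integrable lborel (\<lambda>z. U z * f z)"
proof -
  obtain M where M: "M > 0" "\<And>x. cmod (f x) \<le> M" using test_function_bounded[OF f] by blast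
  have fm: "f \<in> borel_measurable lborel" using test_function_measurable[OF f] by simp
  show ?thesis
  proof (rule Bochner_Integration.integrable_bound[where f="\<lambda>z. M *\<^sub>R U z"])
    show "AE z in lborel. norm (U z * f z) \<le> norm (M *\<^sub>R U z)"
    proof (rule AE_I2)
      fix z
      have "norm (U z) * norm (f z) \<le> norm (U z) * M" by (intro mult_left_mono M) simp
      then show "norm (U z * f z) \<le> norm (M *\<^sub>R U z)" using M(1) by (simp add: norm_mult mult.commute)
    qed
  qed (use U fm in auto)
qed

lemma heat_equation_cut_off:
  fixes u :: "real \<times> (real^'n::finite) \<Rightarrow> complex"
  assumes heat: "heat_equation T \<Omega> u" and \<Omega>: "open \<Omega>" and u: "continuous_on ({0<..T} \<times> \<Omega>) u"
    and int: "integrable lborel (cut_off T \<Omega> u)" and \<phi>: "test_function (cyl T \<Omega>) \<phi>"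
  shows "(\<integral>z. cut_off T \<Omega> u z * (dderiv (1, 0) \<phi> z + (\<Sum>i\<in>UNIV. dderiv (0, axis i 1) (dderiv (0, axis i 1) \<phi>) z)) \<partial>lborel) = 0"
proof -
  let ?U = "cut_off T \<Omega> u"
  let ?L = "\<lambda>z. \<Sum>i\<in>UNIV. dderiv (0, axis i 1) (dderiv (0, axis i 1) \<phi>) z"
  note Um = cut_off_measurable[OF \<Omega> u]
  have tr: "(LINT z:cyl T \<Omega>|lebesgue. u z * g z) = (\<integral>z. ?U z * g z \<partial>lborel)" if "g \<in> borel_measurable borel" for g
  proof -
    have "(LINT z:cyl T \<Omega>|lebesgue. u z * g z) = (\<integral>z. ?U z * g z \<partial>lebesgue)"
      unfolding set_lebesgue_integral_def
      by (intro Bochner_Integration.integral_cong) (auto simp: cut_off_def split: split_indicator)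
    then show ?thesis using that Um by (simp add: integral_completion)
  qed
  note d1 = test_function_dderiv[OF \<phi>] and d2 = test_function_dderiv[OF test_function_dderiv[OF \<phi>]]
  have Lm: "?L \<in> borel_measurable borel" by (intro borel_measurable_sum test_function_measurable[OF d2])
  have "(\<integral>z. ?U z * - dderiv (1, 0) \<phi> z \<partial>lborel) = (\<integral>z. ?U z * ?L z \<partial>lborel)"
    using heat \<phi> tr[OF borel_measurable_uminus[OF test_function_measurable[OF d1]], of "(1, 0)"] tr[OF Lm]
    unfolding heat_equation_def by simp
  moreover have "integrable lborel (\<lambda>z. ?U z * ?L z)"
    unfolding sum_distrib_left by (intro Bochner_Integration.integrable_sum integrable_cut_off_mult[OF int d2])
  moreover note integrable_cut_off_mult[OF int d1, of "(1, 0)"]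
  ultimately show ?thesis by (simp add: distrib_left neg_eq_iff_add_eq_0)
qed

text \<open>
  The backward heat operator in \<open>(s, y)\<close> applied to \<open>\<psi> y * hk (d/2) (T - s, y - x)\<close>: the kernel
  is annihilated, which leaves the terms with derivatives of \<open>\<psi>\<close>.
\<close>

definition kap :: "(real^'n::finite \<Rightarrow> real) \<Rightarrow> real \<Rightarrow> real^'n \<Rightarrow> real \<times> (real^'n) \<Rightarrow> real" where
  "kap \<psi> T x z =
     (\<Sum>i\<in>UNIV. dderiv (axis i 1) (dderiv (axis i 1) \<psi>) (snd z)) * hk (real CARD('n) / 2) (T - fst z, snd z - x)
     - (\<Sum>i\<in>UNIV. dderiv (axis i 1) \<psi> (snd z) * (snd z - x) $ i) * hk (real CARD('n) / 2 + 1) (T - fst z, snd z - x)"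

lemma hk_shift_has_derivative:
  fixes z :: "real \<times> 'a::euclidean_space"
  assumes "fst z < T"
  shows "((\<lambda>z. hk a (T - fst z, snd z - x)) has_derivative (\<lambda>v. hk_deriv a (T - fst z, snd z - x) (- fst v, snd v))) (at z)"
proof (rule has_derivative_compose[where g="hk a"])
  show "((\<lambda>z. (T - fst z, snd z - x)) has_derivative (\<lambda>v. (- fst v, snd v))) (at z)"
    by (auto intro!: derivative_eq_intros)
  show "(hk a has_derivative hk_deriv a (T - fst z, snd z - x)) (at (T - fst z, snd z - x))"
    by (rule hk_has_derivative) (use assms in \<open>auto simp: prod_eq_iff\<close>)
qed

lemma dderiv_real_scale:
  fixes f :: "real \<Rightarrow> real"
  assumes "f differentiable (at s)" shows "dderiv v f s = v * dderiv 1 f s"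
proof -
  have "linear (\<lambda>v. dderiv v f s)"
    by (rule bounded_linear.linear[OF has_derivative_bounded_linear[OF dderiv_has_derivative[OF assms]]])
  from linear_scale[OF this, of v 1] show ?thesis by simp
qed

lemma product_has_derivative:
  fixes \<psi> :: "'a::euclidean_space \<Rightarrow> real"
  assumes \<eta>: "\<eta> differentiable (at (fst z))" and \<psi>: "\<psi> differentiable (at (snd z))" and z: "fst z < T"
  shows "((\<lambda>z. \<eta> (fst z) * \<psi> (snd z) * hk a (T - fst z, snd z - x)) has_derivative
    (\<lambda>v. \<eta> (fst z) * \<psi> (snd z) * hk_deriv a (T - fst z, snd z - x) (- fst v, snd v) +
      (\<eta> (fst z) * dderiv (snd v) \<psi> (snd z) + fst v * dderiv 1 \<eta> (fst z) * \<psi> (snd z)) * hk a (T - fst z, snd z - x))) (at z)"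
proof -
  have e: "((\<lambda>z. \<eta> (fst z)) has_derivative (\<lambda>v. fst v * dderiv 1 \<eta> (fst z))) (at z)"
    using has_derivative_compose[OF has_derivative_fst[OF has_derivative_ident] dderiv_has_derivative[OF \<eta>]]
    by (simp add: dderiv_real_scale[OF \<eta>, symmetric])
  have p: "((\<lambda>z. \<psi> (snd z)) has_derivative (\<lambda>v. dderiv (snd v) \<psi> (snd z))) (at z)"
    by (rule has_derivative_compose[OF has_derivative_snd[OF has_derivative_ident] dderiv_has_derivative[OF \<psi>]])
  show ?thesis
    by (rule has_derivative_mult[OF has_derivative_mult[OF e p] hk_shift_has_derivative[OF z]])
qed

text \<open>The equation is tested with \<eta>(s) \<psi>(y) times the backward kernel. As the kernel
  solves the backward equation, the adjoint operator leaves only the derivative of \<eta> times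
  \<psi> times the kernel, and \<eta> times \<open>kap\<close>.\<close>

lemma weak_identity:
  fixes u :: "real \<times> (real^'n::finite) \<Rightarrow> complex" and \<psi> :: "real^'n \<Rightarrow> real"
  assumes heat: "heat_equation T \<Omega> u" and \<Omega>: "open \<Omega>" and u: "continuous_on ({0<..T} \<times> \<Omega>) u"
    and int: "integrable lborel (cut_off T \<Omega> u)"
    and \<eta>: "\<And>k. Ck_on k UNIV \<eta>" "\<And>s. s \<notin> {\<alpha>..\<beta>} \<Longrightarrow> \<eta> s = 0" and \<alpha>\<beta>: "0 < \<alpha>" "\<beta> < T"
    and \<psi>: "\<And>k. Ck_on k UNIV \<psi>" "\<And>y. y \<notin> K \<Longrightarrow> \<psi> y = 0" and K: "compact K" "K \<subseteq> \<Omega>"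
  shows "(\<integral>z. cut_off T \<Omega> u z * of_real (dderiv 1 \<eta> (fst z) * \<psi> (snd z) * hk (real CARD('n) / 2) (T - fst z, snd z - x)) \<partial>lborel)
     + (\<integral>z. cut_off T \<Omega> u z * of_real (\<eta> (fst z) * kap \<psi> T x z) \<partial>lborel) = 0"
proof -
  define d where "d = real CARD('n) / 2"
  let ?U = "cut_off T \<Omega> u"
  let ?A = "\<lambda>z. (T - fst z, snd z - x)"
  let ?D = "{z::real \<times> (real^'n). fst z < T}"
  have oD: "open ?D" by (intro open_Collect_less continuous_intros)
  have sub: "{\<alpha>..\<beta>} \<times> K \<subseteq> cyl T \<Omega>" using \<alpha>\<beta> K by (auto simp: cyl_def)
  have \<eta>d: "\<eta> differentiable (at s)" for s by (rule Ck_on_Suc_dest(1)[OF \<eta>(1)]) simp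
  have \<psi>d: "\<psi> differentiable (at y)" for y by (rule Ck_on_Suc_dest(1)[OF \<psi>(1)]) simp
  define \<psi>1 where "\<psi>1 i = dderiv (axis i 1) \<psi>" for i :: 'n
  have \<psi>1: "Ck_on k UNIV (\<psi>1 i)" for k i unfolding \<psi>1_def by (rule Ck_on_dderiv[OF open_UNIV \<psi>(1)])
  have \<psi>1d: "\<psi>1 i differentiable (at y)" for i y by (rule Ck_on_Suc_dest(1)[OF \<psi>1]) simp
  define F where "F z = \<eta> (fst z) * \<psi> (snd z) * hk d (?A z)" for z
  define \<phi> where "\<phi> z = complex_of_real (F z)" for z
  have \<phi>: "test_function (cyl T \<Omega>) \<phi>"
    unfolding \<phi>_def F_def by (rule test_function_hk[OF \<eta> \<alpha>\<beta>(2) \<psi> K(1) sub])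
  \<comment> \<open>The coefficient of \<open>hk (d + 1)\<close> in the first space derivative of F.
    As a function of y alone it can be put in the place of \<psi>, so that the second derivative
    follows from the same rule \<open>d1\<close>, with exponent d + 1.\<close>
  define q where "q i y = \<psi> y * ((- 1 / 2) * ((y - x) \<bullet> axis i 1))" for i y
  have qd: "(q i has_derivative (\<lambda>v. \<psi> y * ((- 1 / 2) * (v \<bullet> axis i 1)) + dderiv v \<psi> y * ((- 1 / 2) * ((y - x) \<bullet> axis i 1)))) (at y)" for i y
    unfolding q_def
    by (rule has_derivative_mult[OF dderiv_has_derivative[OF \<psi>d]]) (auto intro!: derivative_eq_intros)
  have q1: "dderiv (axis i 1) (q i) y = - \<psi> y / 2 - \<psi>1 i y * (y - x) $ i / 2" for i y
    unfolding dderiv_eq[OF qd] by (simp add: \<psi>1_def inner_axis)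
  have d1: "dderiv (0, axis i 1) (\<lambda>z. \<eta> (fst z) * f (snd z) * hk a (?A z)) z =
      \<eta> (fst z) * dderiv (axis i 1) f (snd z) * hk a (?A z) + \<eta> (fst z) * f (snd z) * (- (snd z - x) $ i / 2) * hk (a + 1) (?A z)"
    if "z \<in> ?D" "\<And>y. f differentiable (at y)" for z f a i
    by (subst dderiv_eq[OF product_has_derivative[OF \<eta>d that(2)]]) (use that in \<open>auto simp: hk_deriv_def inner_axis, simp add: algebra_simps\<close>)
  have F1: "dderiv (0, axis i 1) F z = \<eta> (fst z) * \<psi>1 i (snd z) * hk d (?A z) + \<eta> (fst z) * q i (snd z) * hk (d + 1) (?A z)"
    if "z \<in> ?D" for z i
    unfolding F_def by (subst d1[OF that \<psi>d]) (simp add: \<psi>1_def q_def inner_axis field_simps)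
  have hd: "(\<lambda>z. \<eta> (fst z) * f (snd z) * hk a (?A z)) differentiable (at z)"
    if "z \<in> ?D" "\<And>y. f differentiable (at y)" for z f a
    by (rule differentiableI, rule product_has_derivative[OF \<eta>d that(2)]) (use that(1) in simp)
  have qdiff: "q i differentiable (at y)" for i y by (rule differentiableI[OF qd])
  have F2: "dderiv (0, axis i 1) (dderiv (0, axis i 1) F) z = \<eta> (fst z) *
      (dderiv (axis i 1) (\<psi>1 i) (snd z) * hk d (?A z) - (\<psi>1 i (snd z) * (snd z - x) $ i + \<psi> (snd z) / 2) * hk (d + 1) (?A z)
        + \<psi> (snd z) * ((snd z - x) $ i)\<^sup>2 / 4 * hk (d + 2) (?A z))"
    if z: "z \<in> ?D" for z i
  proof -
    have "dderiv (0, axis i 1) (dderiv (0, axis i 1) F) z = dderiv (0, axis i 1)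
        (\<lambda>z. \<eta> (fst z) * \<psi>1 i (snd z) * hk d (?A z) + \<eta> (fst z) * q i (snd z) * hk (d + 1) (?A z)) z"
      by (rule dderiv_cong_open[OF oD z F1])
    also have "\<dots> = dderiv (0, axis i 1) (\<lambda>z. \<eta> (fst z) * \<psi>1 i (snd z) * hk d (?A z)) z
        + dderiv (0, axis i 1) (\<lambda>z. \<eta> (fst z) * q i (snd z) * hk (d + 1) (?A z)) z"
      by (rule dderiv_eq, rule has_derivative_add; rule dderiv_has_derivative, rule hd[OF z]) (rule \<psi>1d qdiff)+
    also have "\<dots> = (\<eta> (fst z) * dderiv (axis i 1) (\<psi>1 i) (snd z) * hk d (?A z) + \<eta> (fst z) * \<psi>1 i (snd z) * (- (snd z - x) $ i / 2) * hk (d + 1) (?A z))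
        + (\<eta> (fst z) * (- \<psi> (snd z) / 2 - \<psi>1 i (snd z) * (snd z - x) $ i / 2) * hk (d + 1) (?A z)
          + \<eta> (fst z) * (\<psi> (snd z) * ((- 1 / 2) * ((snd z - x) $ i))) * (- (snd z - x) $ i / 2) * hk (d + 2) (?A z))"
    proof -
      have "d + 1 + 1 = d + 2" by simp
      moreover have "q i (snd z) = \<psi> (snd z) * ((- 1 / 2) * ((snd z - x) $ i))" by (simp add: q_def inner_axis)
      ultimately show ?thesis by (simp only: d1[OF z \<psi>1d] d1[OF z qdiff] q1)
    qed
    also have "\<dots> = \<eta> (fst z) *
      (dderiv (axis i 1) (\<psi>1 i) (snd z) * hk d (?A z) - (\<psi>1 i (snd z) * (snd z - x) $ i + \<psi> (snd z) / 2) * hk (d + 1) (?A z)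
        + \<psi> (snd z) * ((snd z - x) $ i)\<^sup>2 / 4 * hk (d + 2) (?A z))"
    proof -
      have "e * a * h0 + e * p1 * (- t / 2) * h1 + (e * (- p / 2 - p1 * t / 2) * h1 + e * (p * ((- 1 / 2) * t)) * (- t / 2) * h2)
        = e * (a * h0 - (p1 * t + p / 2) * h1 + p * t\<^sup>2 / 4 * h2)" for e a h0 p1 t h1 p h2 :: real
        by (simp add: field_simps power2_eq_square)
      then show ?thesis .
    qed
    finally show ?thesis .
  qed
  \<comment> \<open>Time enters the kernel as T - s, hence the reversed signs; the terms with
    undifferentiated \<eta> and \<psi> cancel against those of the Laplacian.\<close>
  have Ft: "dderiv (1, 0) F z = dderiv 1 \<eta> (fst z) * \<psi> (snd z) * hk d (?A z)
      + \<eta> (fst z) * (\<psi> (snd z) * (d * hk (d + 1) (?A z) - ((snd z - x) \<bullet> (snd z - x)) / 4 * hk (d + 2) (?A z)))"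
    if "z \<in> ?D" for z
  proof -
    have "dderiv 0 \<psi> (snd z) = 0"
      using linear_0[OF bounded_linear.linear[OF has_derivative_bounded_linear[OF dderiv_has_derivative[OF \<psi>d]]]] .
    then show ?thesis unfolding F_def
      by (subst dderiv_eq[OF product_has_derivative[OF \<eta>d \<psi>d]]) (use that in \<open>simp_all add: hk_deriv_def field_simps\<close>)
  qed
  have tot: "dderiv (1, 0) F z + (\<Sum>i\<in>UNIV. dderiv (0, axis i 1) (dderiv (0, axis i 1) F) z)
      = dderiv 1 \<eta> (fst z) * \<psi> (snd z) * hk d (?A z) + \<eta> (fst z) * kap \<psi> T x z" if z: "z \<in> ?D" for z
  proof -
    have "(\<Sum>i\<in>UNIV. dderiv (0, axis i 1) (dderiv (0, axis i 1) F) z) = \<eta> (fst z) *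
      ((\<Sum>i\<in>UNIV. dderiv (axis i 1) (\<psi>1 i) (snd z)) * hk d (?A z) - ((\<Sum>i\<in>UNIV. \<psi>1 i (snd z) * (snd z - x) $ i) + d * \<psi> (snd z)) * hk (d + 1) (?A z)
        + \<psi> (snd z) * ((snd z - x) \<bullet> (snd z - x)) / 4 * hk (d + 2) (?A z))"
      by (simp add: F2[OF z] sum_distrib_left[symmetric] sum.distrib sum_subtractf sum_distrib_right[symmetric]
          sum_divide_distrib[symmetric] d_def inner_vec_def power2_eq_square)
    then show ?thesis unfolding Ft[OF z] kap_def d_def[symmetric] \<psi>1_def by (simp add: algebra_simps)
  qed
  have CF: "Ck_on k ?D F" for k
    unfolding F_def
    by (intro Ck_on_mult oD Ck_on_subset[OF Ck_on_hk_shift] Ck_on_subset[OF Ck_on_fst_snd[OF \<eta>(1) \<psi>(1)]]) auto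
  have \<phi>tot: "dderiv (1, 0) \<phi> z + (\<Sum>i\<in>UNIV. dderiv (0, axis i 1) (dderiv (0, axis i 1) \<phi>) z)
     = of_real (dderiv 1 \<eta> (fst z) * \<psi> (snd z) * hk d (?A z)) + of_real (\<eta> (fst z) * kap \<psi> T x z)" if z: "z \<in> ?D" for z
  proof -
    have "dderiv (1, 0) \<phi> z = of_real (dderiv (1, 0) F z)"
      unfolding \<phi>_def by (rule dderiv_of_real, rule Ck_on_Suc_dest(1)[OF CF z])
    moreover have "dderiv (0, axis i 1) (dderiv (0, axis i 1) \<phi>) z = of_real (dderiv (0, axis i 1) (dderiv (0, axis i 1) F) z)" for i
      unfolding \<phi>_def by (rule dderiv_of_real2[OF oD z CF])
    ultimately have "dderiv (1, 0) \<phi> z + (\<Sum>i\<in>UNIV. dderiv (0, axis i 1) (dderiv (0, axis i 1) \<phi>) z)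
      = of_real (dderiv (1, 0) F z + (\<Sum>i\<in>UNIV. dderiv (0, axis i 1) (dderiv (0, axis i 1) F) z))" by simp
    then show ?thesis unfolding tot[OF z] by simp
  qed
  let ?P = "\<lambda>z. of_real (dderiv 1 \<eta> (fst z) * \<psi> (snd z) * hk d (?A z)) :: complex"
  let ?Q = "\<lambda>z. of_real (\<eta> (fst z) * kap \<psi> T x z) :: complex"
  let ?S = "\<lambda>z. dderiv (1, 0) \<phi> z + (\<Sum>i\<in>UNIV. dderiv (0, axis i 1) (dderiv (0, axis i 1) \<phi>) z)"
  \<comment> \<open>The pointwise identity is available for s < T; outside the cylinder the cut-off
    solution is zero.\<close>
  have eq: "?U z * ?S z = ?U z * ?P z + ?U z * ?Q z" for z
  proof (cases "z \<in> cyl T \<Omega>")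
    case True
    then have "z \<in> ?D" by (auto simp: cyl_def)
    then show ?thesis by (subst \<phi>tot) (auto simp only: distrib_left)
  qed (simp add: cut_off_def)
  have P: "integrable lborel (\<lambda>z. ?U z * ?P z)"
  proof (rule integrable_cut_off_mult[OF int], rule test_function_hk[OF _ _ \<alpha>\<beta>(2) \<psi> K(1) sub])
    show "Ck_on k UNIV (dderiv 1 \<eta>)" for k by (rule Ck_on_dderiv[OF open_UNIV \<eta>(1)])
    show "dderiv 1 \<eta> s = 0" if "s \<notin> {\<alpha>..\<beta>}" for s
      by (rule dderiv_zero_open[of "- {\<alpha>..\<beta>}"]) (use that \<eta>(2) in auto)
  qed
  have "integrable lborel (\<lambda>z. ?U z * ?S z)"
    unfolding distrib_left sum_distrib_left
    by (intro Bochner_Integration.integrable_add Bochner_Integration.integrable_sum integrable_cut_off_mult[OF int test_function_dderiv[OF \<phi>]]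
        integrable_cut_off_mult[OF int test_function_dderiv[OF test_function_dderiv[OF \<phi>]]])
  from Bochner_Integration.integrable_diff[OF this P] have Q: "integrable lborel (\<lambda>z. ?U z * ?Q z)"
    by (simp only: eq add_diff_cancel_left')
  have "0 = (\<integral>z. ?U z * ?S z \<partial>lborel)" by (rule heat_equation_cut_off[OF heat \<Omega> u int \<phi>, symmetric])
  also have "\<dots> = (\<integral>z. ?U z * ?P z \<partial>lborel) + (\<integral>z. ?U z * ?Q z \<partial>lborel)"
    unfolding eq by (rule Bochner_Integration.integral_add[OF P Q])
  finally show ?thesis by (simp add: d_def)
qed

text \<open>The derivatives of \<psi> live on the closed annulus, and x is strictly inside its inner
  radius. So the kernel stays away from its singularity, even at s = T, and continuity on a compact
  set gives the bound.\<close>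

lemma kap_bounded:
  fixes \<psi> :: "real^'n::finite \<Rightarrow> real"
  assumes \<psi>: "\<And>k. Ck_on k UNIV \<psi>" "\<And>y. norm (y - x0) < \<rho>1 \<Longrightarrow> \<psi> y = 1" "\<And>y. \<rho>2 < norm (y - x0) \<Longrightarrow> \<psi> y = 0"
    and x: "norm (x - x0) < \<rho>1" and T: "T > 0"
  obtains M where "M \<ge> 0" "\<And>z. 0 \<le> fst z \<Longrightarrow> fst z \<le> T \<Longrightarrow> \<bar>kap \<psi> T x z\<bar> \<le> M"
proof -
  let ?C = "{0..T} \<times> {y. \<rho>1 \<le> norm (y - x0) \<and> norm (y - x0) \<le> \<rho>2}"
  have "compact ?C"
  proof (intro compact_Times)
    have "closed {y. \<rho>1 \<le> norm (y - x0)}" by (intro closed_Collect_le continuous_intros)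
    moreover have "{y. \<rho>1 \<le> norm (y - x0) \<and> norm (y - x0) \<le> \<rho>2} = {y. \<rho>1 \<le> norm (y - x0)} \<inter> cball x0 \<rho>2"
      by (auto simp: dist_norm norm_minus_commute)
    ultimately show "compact {y. \<rho>1 \<le> norm (y - x0) \<and> norm (y - x0) \<le> \<rho>2}" by (simp add: closed_Int_compact)
  qed auto
  have cd: "continuous_on S (dderiv v \<psi>)" "continuous_on S (dderiv w (dderiv v \<psi>))" for S v w
    using Ck_on_continuous[OF Ck_on_dderiv[OF open_UNIV \<psi>(1)]]
      Ck_on_continuous[OF Ck_on_dderiv[OF open_UNIV Ck_on_dderiv[OF open_UNIV \<psi>(1)]]] by (auto intro: continuous_on_subset)
  have ch: "continuous_on ?C (\<lambda>z. hk a (T - fst z, snd z - x))" for a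
    by (rule continuous_on_subset[OF Ck_on_continuous[OF Ck_on_hk_shift[of 0]]]) (use x in auto)
  have "continuous_on ?C (kap \<psi> T x)"
    unfolding kap_def[abs_def]
    by (intro continuous_intros ch continuous_on_compose2[OF cd(1)[of UNIV]] continuous_on_compose2[OF cd(2)[of UNIV]]) auto
  then have "bounded (kap \<psi> T x ` ?C)" using compact_imp_bounded[OF compact_continuous_image[OF _ \<open>compact ?C\<close>]] by simp
  then obtain M where M: "M > 0" "\<forall>y\<in>kap \<psi> T x ` ?C. norm y \<le> M" using bounded_pos by blast
  have "\<bar>kap \<psi> T x z\<bar> \<le> M" if z: "0 \<le> fst z" "fst z \<le> T" for z
  proof (cases "z \<in> ?C")
    case True then show ?thesis using M(2)[rule_format, OF imageI] by simp
  next
    case False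
    then consider "norm (snd z - x0) < \<rho>1" | "\<rho>2 < norm (snd z - x0)" using z by (cases z) auto
    then obtain V c where V: "open V" "snd z \<in> V" "\<And>y. y \<in> V \<Longrightarrow> \<psi> y = c"
    proof cases
      case 1
      have "open {y. norm (y - x0) < \<rho>1}" by (intro open_Collect_less continuous_intros)
      then show thesis by (rule that[of _ 1]) (use 1 \<psi>(2) in simp_all)
    next
      case 2
      have "open {y. \<rho>2 < norm (y - x0)}" by (intro open_Collect_less continuous_intros)
      then show thesis by (rule that[of _ 0]) (use 2 \<psi>(3) in simp_all)
    qed
    have d0: "dderiv v \<psi> y = 0" if "y \<in> V" for v y by (rule dderiv_zero_open[OF V(1) that V(3)])
    have "dderiv w (dderiv v \<psi>) (snd z) = 0" for v w by (rule dderiv_zero_open[OF V(1,2) d0])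
    then show ?thesis using d0[OF V(2)] M(1) by (simp add: kap_def)
  qed
  then show thesis using that[of M] M(1) by simp
qed

section \<open>Time averages and time slices of the pairing with the kernel\<close>

lemma hk_measurable [measurable]: "hk a \<in> borel_measurable borel"
  unfolding hk_def[abs_def] borel_prod[symmetric] by measurable

lemma kap_measurable:
  fixes \<psi> :: "real^'n::finite \<Rightarrow> real"
  assumes "\<And>k. Ck_on k UNIV \<psi>" shows "kap \<psi> T x \<in> borel_measurable borel"
proof -
  have [measurable]: "dderiv v \<psi> \<in> borel_measurable borel" "dderiv w (dderiv v \<psi>) \<in> borel_measurable borel" for v w
    by (intro borel_measurable_continuous_onI Ck_on_continuous[where k=0] Ck_on_dderiv open_UNIV assms)+
  have [measurable]: "(\<lambda>z::real \<times> (real^'n). (snd z - x) $ i) \<in> borel_measurable borel" for i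
    by (intro borel_measurable_continuous_onI continuous_intros)
  have [measurable]: "(\<lambda>z::real \<times> (real^'n). (T - fst z, snd z - x)) \<in> borel_measurable borel"
    by (intro borel_measurable_continuous_onI continuous_intros)
  have [measurable]: "(snd :: real \<times> (real^'n) \<Rightarrow> real^'n) \<in> borel_measurable borel"
    by (intro borel_measurable_continuous_onI continuous_intros)
  show ?thesis unfolding kap_def[abs_def] by measurable
qed

text \<open>If f is not integrable, its Bochner integral is 0 by convention, and the right-hand side
  is nonnegative because g dominates a norm.\<close>

lemma norm_integral_le:
  fixes f :: "'a \<Rightarrow> complex"
  assumes g: "integrable M g" and le: "AE x in M. norm (f x) \<le> g x"
  shows "norm (\<integral>x. f x \<partial>M) \<le> (\<integral>x. g x \<partial>M)"
proof (cases "integrable M f")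
  case True
  have "(\<integral>x. norm (f x) \<partial>M) \<le> (\<integral>x. g x \<partial>M)"
    by (rule integral_mono_AE[OF integrable_norm[OF True] g le])
  then show ?thesis using integral_norm_bound[of M f] by linarith
next
  case False
  have "AE x in M. 0 \<le> g x" using le by eventually_elim (rule order_trans[OF norm_ge_zero])
  then show ?thesis using False by (simp add: not_integrable_integral_eq integral_nonneg_AE)
qed

text \<open>Applied with weights of size proportional to n on windows of length 1 / n, so that the
  bound does not depend on n.\<close>

lemma weighted_average_small:
  fixes F :: "real \<Rightarrow> complex"
  assumes E: "\<And>s. \<bar>E s\<bar> \<le> c * indicator {p..q} s" and F: "AE s in lborel. s \<in> {p..q} \<longrightarrow> norm (F s) \<le> \<epsilon>"
    and pq: "p \<le> q"
  shows "norm (\<integral>s. of_real (E s) * F s \<partial>lborel) \<le> c * \<epsilon> * (q - p)"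
proof -
  have "norm (\<integral>s. of_real (E s) * F s \<partial>lborel) \<le> (\<integral>s. (c * \<epsilon>) * indicator {p..q} s \<partial>lborel)"
  proof (rule norm_integral_le)
    show "integrable lborel (\<lambda>s. (c * \<epsilon>) * indicator {p..q} s)"
      by (intro integrable_mult_right integrable_real_indicator emeasure_bounded_finite) auto
    show "AE s in lborel. norm (of_real (E s) * F s) \<le> (c * \<epsilon>) * indicator {p..q} s"
      using F
    proof eventually_elim
      fix s assume s: "s \<in> {p..q} \<longrightarrow> norm (F s) \<le> \<epsilon>"
      show "norm (of_real (E s) * F s) \<le> (c * \<epsilon>) * indicator {p..q} s"
      proof (cases "s \<in> {p..q}")
        case True
        have "\<bar>E s\<bar> * norm (F s) \<le> c * \<epsilon>"
          using E[of s] s True by (intro mult_mono) (auto intro: order_trans[OF abs_ge_zero])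
        then show ?thesis using True by (simp add: norm_mult)
      next
        case False
        then show ?thesis using E[of s] by simp
      qed
    qed
  qed
  also have "\<dots> = c * \<epsilon> * (q - p)" using pq by simp
  finally show ?thesis .
qed

lemma lborel_integral_affine:
  fixes f :: "'a::euclidean_space \<Rightarrow> complex"
  assumes f: "f \<in> borel_measurable borel" and c: "c \<noteq> 0"
  shows "(\<integral>y. f y \<partial>lborel) = \<bar>c\<bar> ^ DIM('a) *\<^sub>R (\<integral>\<xi>. f (x + c *\<^sub>R \<xi>) \<partial>lborel)"
  using f by (subst lborel_affine[OF c, of x]) (simp add: integral_density integral_distr)

text \<open>The pairing of u at time s with the truncated kernel of pole (T, x). Its behaviour as s
  tends to 0 and to T yields the two end terms of the representation formula.\<close>

definition slice :: "real \<Rightarrow> (real^'n::finite) set \<Rightarrow> (real \<times> (real^'n) \<Rightarrow> complex) \<Rightarrow> (real^'n \<Rightarrow> real) \<Rightarrow> real^'n \<Rightarrow> real \<Rightarrow> complex" where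
  "slice T \<Omega> u \<psi> x s = (\<integral>y. cut_off T \<Omega> u (s, y) * of_real (\<psi> y * hk (real CARD('n) / 2) (T - s, y - x)) \<partial>lborel)"

text \<open>
  The pairing with a fixed test function tends to 0 because \<open>u\<close> tends to 0 in \<open>H\<^sup>-\<^sup>1\<close>; the dependence of
  the kernel on \<open>s\<close> is harmless, since it stays bounded in \<open>H\<^sup>1\<close> near \<open>s = 0\<close>.
\<close>

lemma slice_small:
  fixes u :: "real \<times> (real^'n::finite) \<Rightarrow> complex"
  assumes init: "initial_value \<Omega> u (\<lambda>x. 0)" and \<Omega>: "open \<Omega>" and u: "continuous_on ({0<..T} \<times> \<Omega>) u"
    and \<psi>: "\<And>k. Ck_on k UNIV \<psi>" "\<And>y. y \<notin> K \<Longrightarrow> \<psi> y = 0" and K: "compact K" "K \<subseteq> \<Omega>"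
    and T: "T > 0" and \<epsilon>: "\<epsilon> > 0"
  shows "\<exists>\<delta>>0. AE s in lborel. 0 < s \<and> s < \<delta> \<longrightarrow> norm (slice T \<Omega> u \<psi> x s) \<le> \<epsilon>"
proof -
  define d where "d = real CARD('n) / 2"
  \<comment> \<open>Equal to 1 at the times in question and zero before the kernel becomes singular;
    it turns the whole family of kernels into slices of a single test function, hence uniformly
    bounded in H^1.\<close>
  obtain \<eta> :: "real \<Rightarrow> real" where \<eta>: "\<And>k. Ck_on k UNIV \<eta>" "\<And>s. \<bar>s\<bar> \<le> T / 2 \<Longrightarrow> \<eta> s = 1" "\<And>s. 3 * T / 4 \<le> \<bar>s\<bar> \<Longrightarrow> \<eta> s = 0"
    using smooth_bump[of "T / 2" "3 * T / 4" "0::real", unfolded diff_zero real_norm_def] T by auto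
  define \<Phi> where "\<Phi> z = complex_of_real (\<eta> (fst z) * \<psi> (snd z) * hk d (T - fst z, snd z - x))" for z
  have \<Phi>: "test_function UNIV \<Phi>"
    unfolding \<Phi>_def
    by (rule test_function_hk[where \<alpha>="- (3 * T / 4)" and \<beta>="3 * T / 4", OF \<eta>(1) \<eta>(3) _ \<psi> K(1)]) (use T in auto)
  obtain M R where MR: "M > 0" "R > 0"
    "\<And>t x. cmod (\<Phi> (t, x)) \<le> M * indicator {-R..R} t * indicator (cball 0 R) x"
    "\<And>t x i. cmod (dderiv (axis i 1) (\<lambda>x. \<Phi> (t, x)) x) \<le> M * indicator {-R..R} t * indicator (cball 0 R) x"
    using test_function_boxE[OF \<Phi>] by metis
  define b where "b = measure lborel (cball (0::real^'n) R)"
  have b: "emeasure lborel (cball (0::real^'n) R) = ennreal b" "b \<ge> 0"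
    unfolding b_def using emeasure_bounded_finite[of "cball (0::real^'n) R"] by (simp_all add: emeasure_eq_ennreal_measure)
  define B where "B = (M\<^sup>2 + (real CARD('n) * M)\<^sup>2) * b"
  have B: "B \<ge> 0" using b by (simp add: B_def)
  \<comment> \<open>B bounds the squared H^1 norm of every slice. Dividing the slice by C = 1 + B
    brings this to B / C^2 \<le> 1, which makes it admissible in \<open>Hm1_norm\<close>.\<close>
  define C where "C = 1 + B"
  have C: "C \<ge> 1" using B by (simp add: C_def)
  have eC: "\<epsilon> / C > 0" using \<epsilon> C by simp
  from mp[OF spec[OF init[unfolded initial_value_def]] eC]
  obtain \<delta>0 where \<delta>0: "\<delta>0 > 0" "AE t in lborel. 0 < t \<and> t < \<delta>0 \<longrightarrow> Hm1_norm \<Omega> (\<lambda>x. u (t, x) - 0) \<le> ennreal (\<epsilon> / C)"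
    by (elim exE conjE)
  define \<delta> where "\<delta> = min \<delta>0 (T / 2)"
  have key: "norm (slice T \<Omega> u \<psi> x s) \<le> \<epsilon>" if s: "0 < s" "s < \<delta>" and Hm: "Hm1_norm \<Omega> (\<lambda>x. u (s, x) - 0) \<le> ennreal (\<epsilon> / C)" for s
  proof -
    define \<phi> where "\<phi> y = \<Phi> (s, y) * of_real (1 / C)" for y
    have s1: "\<eta> s = 1" using s by (intro \<eta>(2)) (auto simp: \<delta>_def)
    have \<phi>eq: "\<phi> y = of_real (1 / C) * of_real (\<psi> y * hk d (T - s, y - x))" for y
      by (simp add: \<phi>_def \<Phi>_def s1)
    note sl = test_function_slice[OF \<Phi>, of s]
    have tf: "test_function \<Omega> \<phi>"
    proof (rule test_functionI[OF _ K])
      show "Ck_on k UNIV \<phi>" for k unfolding \<phi>_def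
        by (intro Ck_on_mult Ck_on_const test_function_Ck[OF sl] open_UNIV)
      show "\<phi> y = 0" if "y \<notin> K" for y using \<psi>(2)[OF that] by (simp add: \<phi>eq)
    qed
    have "test_function UNIV \<phi>" using tf by (auto simp: test_function_def)
    then have "H1_sq \<phi> \<le> ennreal ((M / C)\<^sup>2 + (real CARD('n) * (M / C))\<^sup>2) * emeasure lborel (cball (0::real^'n) R)"
    proof (rule H1_sq_bound)
      show "cmod (\<phi> y) \<le> M / C * indicator (cball 0 R) y" for y
      proof -
        have "cmod (\<Phi> (s, y)) \<le> M * indicator (cball 0 R) y"
          by (rule order_trans[OF MR(3)]) (use MR(1) in \<open>simp split: split_indicator\<close>)
        then show ?thesis using C by (simp add: \<phi>_def norm_mult norm_divide divide_right_mono)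
      qed
      show "cmod (dderiv (axis i 1) \<phi> y) \<le> M / C * indicator (cball 0 R) y" for i y
      proof -
        have "dderiv (axis i 1) \<phi> y = dderiv (axis i 1) (\<lambda>y. \<Phi> (s, y)) y * of_real (1 / C)"
          unfolding \<phi>_def by (rule dderiv_eq) (rule has_derivative_mult_left[OF test_function_has_derivative[OF sl]])
        moreover have "cmod (dderiv (axis i 1) (\<lambda>y. \<Phi> (s, y)) y) \<le> M * indicator (cball 0 R) y"
          by (rule order_trans[OF MR(4)]) (use MR(1) in \<open>simp split: split_indicator\<close>)
        ultimately show ?thesis using C by (simp add: norm_mult norm_divide divide_right_mono)
      qed
    qed simp
    also have "\<dots> = ennreal (B / C\<^sup>2)"
      unfolding b(1) B_def by (subst ennreal_mult'[symmetric]) (simp_all add: power_divide power_mult_distrib add_divide_distrib algebra_simps)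
    also have "\<dots> \<le> 1"
    proof -
      have "B \<le> C * 1" by (simp add: C_def)
      also have "\<dots> \<le> C * C" using C by (intro mult_left_mono) auto
      finally show ?thesis using C by (simp add: power2_eq_square field_simps)
    qed
    finally have H1: "H1_sq \<phi> \<le> 1" .
    have "ennreal (cmod (LINT y:\<Omega>|lebesgue. (u (s, y) - 0) * \<phi> y)) \<le> Hm1_norm \<Omega> (\<lambda>x. u (s, x) - 0)"
      unfolding Hm1_norm_def by (rule SUP_upper2[of \<phi>]) (use tf H1 in auto)
    from order_trans[OF this Hm] have 1: "cmod (LINT y:\<Omega>|lebesgue. u (s, y) * \<phi> y) \<le> \<epsilon> / C"
      using eC by (simp add: ennreal_le_iff)
    have meas: "(\<lambda>y. cut_off T \<Omega> u (s, y) * \<phi> y) \<in> borel_measurable borel"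
    proof (intro borel_measurable_times test_function_measurable[OF tf])
      have "(\<lambda>y. (s, y)) \<in> borel \<rightarrow>\<^sub>M borel" by (intro borel_measurable_continuous_onI continuous_intros)
      then show "(\<lambda>y. cut_off T \<Omega> u (s, y)) \<in> borel_measurable borel"
        by (rule measurable_compose[OF _ cut_off_measurable[OF \<Omega> u]])
    qed
    have "(LINT y:\<Omega>|lebesgue. u (s, y) * \<phi> y) = (\<integral>y. cut_off T \<Omega> u (s, y) * \<phi> y \<partial>lebesgue)"
      unfolding set_lebesgue_integral_def
      by (intro Bochner_Integration.integral_cong) (use s T in \<open>auto simp: cut_off_def cyl_def \<delta>_def split: split_indicator\<close>)
    also have "\<dots> = (\<integral>y. cut_off T \<Omega> u (s, y) * \<phi> y \<partial>lborel)" using meas by (simp add: integral_completion)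
    also have "\<dots> = (\<integral>y. of_real (1 / C) * (cut_off T \<Omega> u (s, y) * of_real (\<psi> y * hk d (T - s, y - x))) \<partial>lborel)"
      by (simp only: \<phi>eq mult.left_commute)
    also have "\<dots> = of_real (1 / C) * slice T \<Omega> u \<psi> x s"
      unfolding slice_def d_def by (rule Bochner_Integration.integral_mult_right_zero)
    finally have "cmod (of_real (1 / C) * slice T \<Omega> u \<psi> x s) \<le> \<epsilon> / C" using 1 by simp
    then have "cmod (slice T \<Omega> u \<psi> x s) / C \<le> \<epsilon> / C" using C by (simp add: norm_mult norm_divide)
    then show ?thesis using C by (simp add: divide_le_cancel)
  qed
  have "AE s in lborel. 0 < s \<and> s < \<delta> \<longrightarrow> norm (slice T \<Omega> u \<psi> x s) \<le> \<epsilon>"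
    using \<delta>0(2) by eventually_elim (use key in \<open>auto simp: \<delta>_def\<close>)
  then show ?thesis using \<delta>0(1) T by (intro exI[of _ \<delta>]) (auto simp: \<delta>_def)
qed

text \<open>The substitution y = x + sqrt (T - s) \<xi> turns the kernel into the fixed Gaussian exp
  (- |\<xi>|^2 / 4), because the Jacobian cancels the prefactor (T - s)^(- d/2). Dominated
  convergence then uses continuity of u up to time T.\<close>

lemma slice_limit:
  fixes u :: "real \<times> (real^'n::finite) \<Rightarrow> complex"
  assumes \<Omega>: "open \<Omega>" and u: "continuous_on ({0<..T} \<times> \<Omega>) u"
    and \<psi>: "\<And>k. Ck_on k UNIV \<psi>" "\<And>y. y \<notin> K \<Longrightarrow> \<psi> y = 0" and K: "compact K" "K \<subseteq> \<Omega>"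
    and T: "T > 0" and x: "x \<in> \<Omega>" "\<psi> x = 1"
  shows "(slice T \<Omega> u \<psi> x \<longlongrightarrow> of_real (gauss_mass TYPE(real^'n)) * u (T, x)) (at_left T)"
proof (rule tendsto_at_left_sequentially[of "T / 2"])
  show "T / 2 < T" using T by simp
  fix S assume S: "\<And>n. S n < T" "\<And>n. T / 2 < S n" "S \<longlonglongrightarrow> T"
  define d where "d = real CARD('n) / 2"
  define v where "v z = cut_off T \<Omega> u z * of_real (\<psi> (snd z))" for z
  have \<psi>c: "continuous_on A \<psi>" for A using Ck_on_continuous[OF \<psi>(1)] continuous_on_subset by blast
  have um: "cut_off T \<Omega> u \<in> borel_measurable borel" by (rule cut_off_measurable[OF \<Omega> u])
  have Pm: "(\<lambda>y. (s, g y)) \<in> borel \<rightarrow>\<^sub>M borel" if "continuous_on UNIV g" for s :: real and g :: "real^'n \<Rightarrow> real^'n"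
    by (intro borel_measurable_continuous_onI continuous_intros that)
  have vm: "v \<in> borel_measurable borel"
    unfolding v_def
    by (intro borel_measurable_times um borel_measurable_continuous_onI continuous_intros continuous_on_compose2[OF \<psi>c[of UNIV]]) auto
  \<comment> \<open>u is continuous on the compact product of the time interval from T / 2 to T,
    both ends included, with K; this provides the majorant.\<close>
  obtain Mu where Mu: "\<And>s y. T / 2 \<le> s \<Longrightarrow> norm (v (s, y)) \<le> Mu"
  proof -
    let ?C = "{T / 2..T} \<times> K"
    have "?C \<subseteq> {0<..T} \<times> \<Omega>" using T K by auto
    then have "continuous_on ?C (\<lambda>z. u z * of_real (\<psi> (snd z)))"
      by (intro continuous_intros continuous_on_subset[OF u] continuous_on_compose2[OF \<psi>c[of UNIV]]) auto
    then have "bounded ((\<lambda>z. u z * of_real (\<psi> (snd z))) ` ?C)"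
      by (intro compact_imp_bounded compact_continuous_image compact_Times K) auto
    then obtain m where m: "m > 0" "\<forall>y\<in>(\<lambda>z. u z * of_real (\<psi> (snd z))) ` ?C. norm y \<le> m" unfolding bounded_pos by blast
    have "norm (v (s, y)) \<le> m" if "T / 2 \<le> s" for s y
    proof (cases "(s, y) \<in> cyl T \<Omega> \<and> y \<in> K")
      case True
      then have "(s, y) \<in> ?C" using that by (auto simp: cyl_def)
      from m(2)[rule_format, OF imageI[OF this]] show ?thesis using True by (simp add: v_def cut_off_def)
    next
      case False
      then have "v (s, y) = 0" using \<psi>(2)[of y] by (auto simp: v_def cut_off_def)
      then show ?thesis using m(1) by simp
    qed
    then show thesis by (rule that)
  qed
  have sl: "slice T \<Omega> u \<psi> x s = (\<integral>\<xi>. v (s, x + sqrt (T - s) *\<^sub>R \<xi>) * of_real (exp (- (\<xi> \<bullet> \<xi>) / 4)) \<partial>lborel)" if s: "s < T" for s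
  proof -
    define \<sigma> where "\<sigma> = T - s"
    have \<sigma>: "\<sigma> > 0" using s by (simp add: \<sigma>_def)
    let ?f = "\<lambda>y. v (s, y) * of_real (hk d (\<sigma>, y - x))"
    have fm: "?f \<in> borel_measurable borel"
    proof -
      have "(\<lambda>y. v (s, y)) \<in> borel_measurable borel" by (rule measurable_compose[OF Pm vm]) (intro continuous_intros)
      moreover have "(\<lambda>y. hk d (\<sigma>, y - x)) \<in> borel_measurable borel" by (rule measurable_compose[OF Pm hk_measurable]) (intro continuous_intros)
      ultimately show ?thesis by simp
    qed
    have "slice T \<Omega> u \<psi> x s = (\<integral>y. ?f y \<partial>lborel)"
      unfolding slice_def by (simp add: v_def d_def \<sigma>_def mult_ac)
    also have "\<dots> = \<bar>sqrt \<sigma>\<bar> ^ DIM(real^'n) *\<^sub>R (\<integral>\<xi>. ?f (x + sqrt \<sigma> *\<^sub>R \<xi>) \<partial>lborel)"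
      by (rule lborel_integral_affine[OF fm]) (use \<sigma> in simp)
    also have "\<dots> = (\<integral>\<xi>. \<bar>sqrt \<sigma>\<bar> ^ DIM(real^'n) *\<^sub>R ?f (x + sqrt \<sigma> *\<^sub>R \<xi>) \<partial>lborel)"
      by (rule integral_scaleR_right[symmetric])
    also have "\<dots> = (\<integral>\<xi>. v (s, x + sqrt \<sigma> *\<^sub>R \<xi>) * of_real (exp (- (\<xi> \<bullet> \<xi>) / 4)) \<partial>lborel)"
    proof (intro Bochner_Integration.integral_cong refl)
      fix \<xi> :: "real^'n"
      have "\<bar>sqrt \<sigma>\<bar> ^ DIM(real^'n) = \<sigma> powr d"
        using \<sigma> by (simp add: powr_realpow[symmetric] powr_half_sqrt[symmetric] powr_powr d_def)
      moreover have "(sqrt \<sigma> *\<^sub>R \<xi>) \<bullet> (sqrt \<sigma> *\<^sub>R \<xi>) = \<sigma> * (\<xi> \<bullet> \<xi>)" using \<sigma> by (simp flip: mult.assoc)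
      then have "- ((sqrt \<sigma> *\<^sub>R \<xi>) \<bullet> (sqrt \<sigma> *\<^sub>R \<xi>)) / (4 * \<sigma>) = - (\<xi> \<bullet> \<xi>) / 4" using \<sigma> by (simp only:) simp
      then have "hk d (\<sigma>, x + sqrt \<sigma> *\<^sub>R \<xi> - x) = \<sigma> powr - d * exp (- (\<xi> \<bullet> \<xi>) / 4)"
        using \<sigma> by (simp only: hk_def add_diff_cancel_left' fst_conv snd_conv if_True)
      ultimately have "\<bar>sqrt \<sigma>\<bar> ^ DIM(real^'n) * hk d (\<sigma>, x + sqrt \<sigma> *\<^sub>R \<xi> - x) = exp (- (\<xi> \<bullet> \<xi>) / 4)"
        using \<sigma> by (simp only: mult.assoc[symmetric] powr_add[symmetric]) simp
      then show "\<bar>sqrt \<sigma>\<bar> ^ DIM(real^'n) *\<^sub>R ?f (x + sqrt \<sigma> *\<^sub>R \<xi>) = v (s, x + sqrt \<sigma> *\<^sub>R \<xi>) * of_real (exp (- (\<xi> \<bullet> \<xi>) / 4))"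
        unfolding scaleR_conv_of_real mult.left_commute[of "of_real _"] of_real_mult[symmetric] by (simp only:)
    qed
    finally show ?thesis by (simp add: \<sigma>_def)
  qed
  have "(\<lambda>n. \<integral>\<xi>. v (S n, x + sqrt (T - S n) *\<^sub>R \<xi>) * of_real (exp (- (\<xi> \<bullet> \<xi>) / 4)) \<partial>lborel)
      \<longlonglongrightarrow> (\<integral>\<xi>. u (T, x) * of_real (exp (- (\<xi> \<bullet> \<xi>) / 4)) \<partial>(lborel :: (real^'n) measure))"
  proof (rule integral_dominated_convergence[where w="\<lambda>\<xi>. Mu * exp (- (\<xi> \<bullet> \<xi>) / 4)"])
    have gm: "(\<lambda>\<xi>::real^'n. complex_of_real (exp (- (\<xi> \<bullet> \<xi>) / 4))) \<in> borel_measurable lborel"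
      by simp
    show "(\<lambda>\<xi>::real^'n. u (T, x) * complex_of_real (exp (- (\<xi> \<bullet> \<xi>) / 4))) \<in> borel_measurable lborel"
      by (intro borel_measurable_times gm) simp
    show "(\<lambda>\<xi>. v (S n, x + sqrt (T - S n) *\<^sub>R \<xi>) * complex_of_real (exp (- (\<xi> \<bullet> \<xi>) / 4))) \<in> borel_measurable lborel" for n
    proof (intro borel_measurable_times gm)
      have "(\<lambda>\<xi>. v (S n, x + sqrt (T - S n) *\<^sub>R \<xi>)) \<in> borel_measurable borel"
        by (intro measurable_compose[OF Pm vm] continuous_intros)
      then show "(\<lambda>\<xi>. v (S n, x + sqrt (T - S n) *\<^sub>R \<xi>)) \<in> borel_measurable lborel" by simp
    qed
    show "integrable lborel (\<lambda>\<xi>::real^'n. Mu * exp (- (\<xi> \<bullet> \<xi>) / 4))" by (intro integrable_mult_right integrable_gauss)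
    show "AE \<xi> in lborel. norm (v (S n, x + sqrt (T - S n) *\<^sub>R \<xi>) * complex_of_real (exp (- (\<xi> \<bullet> \<xi>) / 4))) \<le> Mu * exp (- (\<xi> \<bullet> \<xi>) / 4)" for n
    proof (rule AE_I2)
      fix \<xi> :: "real^'n"
      show "norm (v (S n, x + sqrt (T - S n) *\<^sub>R \<xi>) * complex_of_real (exp (- (\<xi> \<bullet> \<xi>) / 4))) \<le> Mu * exp (- (\<xi> \<bullet> \<xi>) / 4)"
        unfolding norm_mult norm_of_real abs_exp_cancel
        by (rule mult_right_mono[OF Mu]) (use S(2)[of n] in auto)
    qed
    show "AE \<xi> in lborel. (\<lambda>n. v (S n, x + sqrt (T - S n) *\<^sub>R \<xi>) * complex_of_real (exp (- (\<xi> \<bullet> \<xi>) / 4)))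
        \<longlonglongrightarrow> u (T, x) * complex_of_real (exp (- (\<xi> \<bullet> \<xi>) / 4))"
    proof (intro AE_I2 tendsto_mult tendsto_const)
      fix \<xi> :: "real^'n"
      let ?z = "\<lambda>n. (S n, x + sqrt (T - S n) *\<^sub>R \<xi>)"
      have "?z \<longlonglongrightarrow> (T, x + sqrt (T - T) *\<^sub>R \<xi>)" by (intro tendsto_intros S(3))
      then have zl: "?z \<longlonglongrightarrow> (T, x)" by simp
      have "(\<lambda>n. snd (?z n)) \<longlonglongrightarrow> x" using tendsto_snd[OF zl] by simp
      then have ev\<Omega>: "\<forall>\<^sub>F n in sequentially. snd (?z n) \<in> \<Omega>" using topological_tendstoD[OF _ \<Omega> x(1)] by blast
      have Spos: "0 < S n" for n using S(2)[of n] T by linarith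
      have "(\<lambda>n. u (?z n) * of_real (\<psi> (snd (?z n)))) \<longlonglongrightarrow> u (T, x) * of_real (\<psi> x)"
      proof (intro tendsto_mult tendsto_of_real)
        show "(\<lambda>n. u (?z n)) \<longlonglongrightarrow> u (T, x)"
        proof (rule continuous_on_tendsto_compose[OF u zl])
          show "(T, x) \<in> {0<..T} \<times> \<Omega>" using T x by auto
          show "\<forall>\<^sub>F n in sequentially. ?z n \<in> {0<..T} \<times> \<Omega>"
            using ev\<Omega> by eventually_elim (use Spos S(1) in \<open>auto intro: less_imp_le\<close>)
        qed
        show "(\<lambda>n. \<psi> (snd (?z n))) \<longlonglongrightarrow> \<psi> x"
          using continuous_on_tendsto_compose[OF \<psi>c[of UNIV] \<open>(\<lambda>n. snd (?z n)) \<longlonglongrightarrow> x\<close>] by simp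
      qed
      then have lim: "(\<lambda>n. u (?z n) * of_real (\<psi> (snd (?z n)))) \<longlonglongrightarrow> u (T, x)" using x(2) by simp
      show "(\<lambda>n. v (?z n)) \<longlonglongrightarrow> u (T, x)"
      proof (rule Lim_transform_eventually[OF lim])
        show "\<forall>\<^sub>F n in sequentially. u (?z n) * of_real (\<psi> (snd (?z n))) = v (?z n)"
          using ev\<Omega> by eventually_elim (use Spos S(1) in \<open>simp add: v_def cut_off_def cyl_def\<close>)
      qed
    qed
  qed
  also have "(\<integral>\<xi>. u (T, x) * of_real (exp (- (\<xi> \<bullet> \<xi>) / 4)) \<partial>(lborel :: (real^'n) measure)) = of_real (gauss_mass TYPE(real^'n)) * u (T, x)"
  proof -
    have "(\<integral>\<xi>. complex_of_real (exp (- (\<xi> \<bullet> \<xi>) / 4)) \<partial>(lborel :: (real^'n) measure)) = of_real (gauss_mass TYPE(real^'n))"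
      unfolding gauss_mass_def by (rule integral_complex_of_real)
    then show ?thesis by (simp only: Bochner_Integration.integral_mult_right_zero mult.commute)
  qed
  finally show "(\<lambda>n. slice T \<Omega> u \<psi> x (S n)) \<longlonglongrightarrow> of_real (gauss_mass TYPE(real^'n)) * u (T, x)"
    using sl[OF S(1)] by simp
qed

lemma fubini_slice:
  fixes u :: "real \<times> (real^'n::finite) \<Rightarrow> complex"
  assumes "integrable lborel (\<lambda>z. cut_off T \<Omega> u z * of_real (e (fst z) * \<psi> (snd z) * hk (real CARD('n) / 2) (T - fst z, snd z - x)))"
  shows "(\<integral>z. cut_off T \<Omega> u z * of_real (e (fst z) * \<psi> (snd z) * hk (real CARD('n) / 2) (T - fst z, snd z - x)) \<partial>lborel)
      = (\<integral>s. of_real (e s) * slice T \<Omega> u \<psi> x s \<partial>lborel)" (is "?A = ?B")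
    and "integrable lborel (\<lambda>s. of_real (e s) * slice T \<Omega> u \<psi> x s)"
proof -
  let ?f = "\<lambda>z. cut_off T \<Omega> u z * of_real (e (fst z) * \<psi> (snd z) * hk (real CARD('n) / 2) (T - fst z, snd z - x))"
  have int: "integrable (lborel \<Otimes>\<^sub>M lborel) ?f" using assms by (simp only: lborel_prod)
  have sl: "(\<integral>y. ?f (s, y) \<partial>lborel) = of_real (e s) * slice T \<Omega> u \<psi> x s" for s
  proof -
    have "(\<integral>y. ?f (s, y) \<partial>lborel) = (\<integral>y. of_real (e s) * (cut_off T \<Omega> u (s, y) * of_real (\<psi> y * hk (real CARD('n) / 2) (T - s, y - x))) \<partial>lborel)"
      by (simp add: mult_ac)
    also have "\<dots> = of_real (e s) * slice T \<Omega> u \<psi> x s"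
      unfolding slice_def by (rule Bochner_Integration.integral_mult_right_zero)
    finally show ?thesis .
  qed
  have "?A = (\<integral>s. (\<integral>y. ?f (s, y) \<partial>lborel) \<partial>lborel)"
    using lborel_pair.integral_fst'[OF int] by (simp only: lborel_prod)
  then show "?A = ?B" by (simp only: sl)
  show "integrable lborel (\<lambda>s. of_real (e s) * slice T \<Omega> u \<psi> x s)"
    using lborel_pair.integrable_fst'[OF int] by (simp only: sl)
qed

text \<open>Admissible test functions vanish near s = 0 and s = T. The plateau
  \<open>\<eta> n\<close> has derivative \<open>e1 n - e2 n\<close>, two spikes of height of order n
  on windows of length 1 / n near the two ends. \<open>slice_small\<close> kills the spike at 0,
  \<open>slice_limit\<close> evaluates the one at T, and the \<open>kap\<close> term converges by
  domination.\<close>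

lemma heat_representation:
  fixes u :: "real \<times> (real^'n::finite) \<Rightarrow> complex"
  assumes \<Omega>: "open \<Omega>" and u: "continuous_on ({0<..T} \<times> \<Omega>) u" and int: "integrable lborel (cut_off T \<Omega> u)"
    and heat: "heat_equation T \<Omega> u" and init: "initial_value \<Omega> u (\<lambda>x. 0)" and T: "T > 0"
    and \<psi>: "\<And>k. Ck_on k UNIV \<psi>" "\<And>y. norm (y - x0) < \<rho>1 \<Longrightarrow> \<psi> y = 1" "\<And>y. \<rho>2 < norm (y - x0) \<Longrightarrow> \<psi> y = 0"
    and \<rho>: "cball x0 \<rho>2 \<subseteq> \<Omega>" and x: "norm (x - x0) < \<rho>1" "x \<in> \<Omega>"
  shows "of_real (gauss_mass TYPE(real^'n)) * u (T, x) = (\<integral>z. cut_off T \<Omega> u z * of_real (kap \<psi> T x z) \<partial>lborel)"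
proof -
  let ?U = "cut_off T \<Omega> u"
  let ?m = "slice T \<Omega> u \<psi> x"
  define lim where "lim = of_real (gauss_mass TYPE(real^'n)) * u (T, x)"
  define K where "K = cball x0 \<rho>2"
  have K: "compact K" "K \<subseteq> \<Omega>" using \<rho> by (auto simp: K_def)
  have \<psi>K: "\<psi> y = 0" if "y \<notin> K" for y using \<psi>(3)[of y] that by (simp add: K_def dist_norm norm_minus_commute)
  have \<psi>x: "\<psi> x = 1" by (rule \<psi>(2)[OF x(1)])
  obtain \<theta> :: "real \<Rightarrow> real" where \<theta>: "\<And>k. Ck_on k UNIV \<theta>" "\<And>s. s \<le> 0 \<Longrightarrow> \<theta> s = 0" "\<And>s. 1 \<le> s \<Longrightarrow> \<theta> s = 1"
    "\<And>s. 0 \<le> \<theta> s" "\<And>s. \<theta> s \<le> 1" using smooth_step by blast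
  define \<theta>' where "\<theta>' = dderiv 1 \<theta>"
  have \<theta>': "Ck_on k UNIV \<theta>'" for k unfolding \<theta>'_def by (rule Ck_on_dderiv[OF open_UNIV \<theta>(1)])
  have \<theta>'0: "\<theta>' r = 0" if "r \<notin> {0..1}" for r
  proof (cases "r < 0")
    case True
    show ?thesis unfolding \<theta>'_def by (rule dderiv_zero_open[of "{..<0}"]) (use True \<theta>(2) in auto)
  next
    case False
    show ?thesis unfolding \<theta>'_def by (rule dderiv_zero_open[of "{1<..}"]) (use False that \<theta>(3) in auto)
  qed
  have \<theta>d: "(\<theta> has_real_derivative \<theta>' s) (at s)" for s
  proof -
    have df: "\<theta> differentiable (at s)" by (rule Ck_on_Suc_dest(1)[OF \<theta>(1)]) simp
    have "(\<lambda>v. dderiv v \<theta> s) = (*) (\<theta>' s)"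
      unfolding \<theta>'_def by (rule ext, subst dderiv_real_scale[OF df], rule mult.commute)
    then show ?thesis using dderiv_has_derivative[OF df] by (simp add: has_field_derivative_def)
  qed
  have "bounded (\<theta>' ` {0..1})"
    by (intro compact_imp_bounded compact_continuous_image continuous_on_subset[OF Ck_on_continuous[OF \<theta>']]) auto
  then obtain Mt where Mt: "Mt > 0" "\<forall>y\<in>\<theta>' ` {0..1}. norm y \<le> Mt" unfolding bounded_pos by blast
  have \<theta>'M: "\<bar>\<theta>' r\<bar> \<le> Mt" for r using Mt \<theta>'0[of r] by (cases "r \<in> {0..1}") auto
  have aff: "Ck_on k UNIV (\<lambda>s. f (c + m * s))" if "\<And>k. Ck_on k UNIV f" for f :: "real \<Rightarrow> real" and c m k
    by (rule Ck_on_compose[OF open_UNIV open_UNIV subset_UNIV that Ck_on_affine[OF open_UNIV bounded_linear_mult_right]])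
  define e1 where "e1 n s = real n * \<theta>' (-1 + real n * s)" for n s
  define e2 where "e2 n s = real n * \<theta>' ((real n * T - 1) + (- real n) * s)" for n s
  define \<eta> where "\<eta> n s = \<theta> (-1 + real n * s) * \<theta> ((real n * T - 1) + (- real n) * s)" for n s
  \<comment> \<open>n T > 4 keeps the windows [1/n, 2/n] and [T - 2/n, T - 1/n] disjoint.\<close>
  obtain N :: nat where N: "4 / T < real N" using reals_Archimedean2 by blast
  have nT: "n > 0" "4 < real n * T" "1 / real n < T - 1 / real n" "2 / real n < T - 2 / real n" if "n \<ge> N" for n
  proof -
    have "4 / T < real n" using N that by (meson less_le_trans of_nat_le_iff)
    then show 1: "4 < real n * T" using T by (simp add: field_simps)
    then show n: "n > 0" by (cases n) auto
    show "1 / real n < T - 1 / real n" "2 / real n < T - 2 / real n" using 1 n by (simp_all add: field_simps)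
  qed
  have e1s: "e1 n s = 0" if "n \<ge> N" "s \<notin> {1 / real n..2 / real n}" for n s
  proof -
    have "-1 + real n * s \<notin> {0..1}" using that nT(1)[OF that(1)] by (auto simp: field_simps)
    then show ?thesis by (simp add: e1_def \<theta>'0)
  qed
  have e2s: "e2 n s = 0" if "n \<ge> N" "s \<notin> {T - 2 / real n..T - 1 / real n}" for n s
  proof -
    have "(real n * T - 1) + (- real n) * s \<notin> {0..1}" using that nT(1)[OF that(1)] by (auto simp: field_simps)
    then show ?thesis by (simp add: e2_def \<theta>'0)
  qed
  have \<eta>s: "\<eta> n s = 0" if "n \<ge> N" "s \<notin> {1 / real n..T - 1 / real n}" for n s
  proof -
    have "-1 + real n * s \<le> 0 \<or> (real n * T - 1) + (- real n) * s \<le> 0" using that nT(1)[OF that(1)] by (auto simp: field_simps)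
    then show ?thesis using \<theta>(2) by (auto simp: \<eta>_def)
  qed
  have \<eta>C: "Ck_on k UNIV (\<eta> n)" for k n unfolding \<eta>_def by (intro Ck_on_mult open_UNIV aff \<theta>(1))
  have e1C: "Ck_on k UNIV (e1 n)" for k n unfolding e1_def by (intro Ck_on_mult Ck_on_const open_UNIV aff \<theta>')
  have e2C: "Ck_on k UNIV (e2 n)" for k n unfolding e2_def by (intro Ck_on_mult Ck_on_const open_UNIV aff \<theta>')
  \<comment> \<open>Product rule; on the window where one factor varies, the other factor is already
    1.\<close>
  have d\<eta>: "dderiv 1 (\<eta> n) s = e1 n s - e2 n s" if n: "n \<ge> N" for n s
  proof -
    have hd: "(\<eta> n has_real_derivative (\<theta>' (-1 + real n * s) * real n) * \<theta> ((real n * T - 1) + (- real n) * s)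
        + (\<theta>' ((real n * T - 1) + (- real n) * s) * (- real n)) * \<theta> (-1 + real n * s)) (at s)"
      unfolding \<eta>_def
      by (rule DERIV_mult; rule DERIV_chain2[OF \<theta>d]; auto intro!: derivative_eq_intros)
    have "dderiv 1 (\<eta> n) s = e1 n s * \<theta> ((real n * T - 1) + (- real n) * s) - e2 n s * \<theta> (-1 + real n * s)"
      unfolding dderiv_eq[OF hd[unfolded has_field_derivative_def]] e1_def e2_def by (simp add: algebra_simps)
    moreover have "e1 n s * \<theta> ((real n * T - 1) + (- real n) * s) = e1 n s"
    proof (cases "s \<in> {1 / real n..2 / real n}")
      case True
      have "real n * s \<le> 2" using True nT(1)[OF n] by (auto simp: field_simps)
      then have "1 \<le> (real n * T - 1) + (- real n) * s" using nT(2)[OF n] by simp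
      then show ?thesis using \<theta>(3) by simp
    qed (simp add: e1s[OF n])
    moreover have "e2 n s * \<theta> (-1 + real n * s) = e2 n s"
    proof (cases "s \<in> {T - 2 / real n..T - 1 / real n}")
      case True
      have "real n * T - 2 \<le> real n * s" using True nT(1)[OF n] by (auto simp: field_simps)
      then have "1 \<le> -1 + real n * s" using nT(2)[OF n] by simp
      then show ?thesis using \<theta>(3) by simp
    qed (simp add: e2s[OF n])
    ultimately show ?thesis by (simp only:)
  qed
  let ?G = "\<lambda>z. hk (real CARD('n) / 2) (T - fst z, snd z - x)"
  have int1: "integrable lborel (\<lambda>z. ?U z * of_real (e1 n (fst z) * \<psi> (snd z) * ?G z))" if n: "n \<ge> N" for n
    by (rule integrable_cut_off_mult[OF int test_function_hk[where U=UNIV and \<alpha>="1 / real n" and \<beta>="2 / real n", OF e1C e1s[OF n] _ \<psi>(1) \<psi>K K(1)]])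
       (use nT[OF n] T in auto)
  have int2: "integrable lborel (\<lambda>z. ?U z * of_real (e2 n (fst z) * \<psi> (snd z) * ?G z))" if n: "n \<ge> N" for n
    by (rule integrable_cut_off_mult[OF int test_function_hk[where U=UNIV and \<alpha>="T - 2 / real n" and \<beta>="T - 1 / real n", OF e2C e2s[OF n] _ \<psi>(1) \<psi>K K(1)]])
       (use nT[OF n] in auto)
  let ?J = "\<lambda>n. \<integral>z. ?U z * of_real (\<eta> n (fst z) * kap \<psi> T x z) \<partial>lborel"
  have main: "(\<integral>s. of_real (e2 n s) * ?m s \<partial>lborel) = (\<integral>s. of_real (e1 n s) * ?m s \<partial>lborel) + ?J n" if n: "n \<ge> N" for n
  proof -
    have "(\<integral>z. ?U z * of_real (dderiv 1 (\<eta> n) (fst z) * \<psi> (snd z) * ?G z) \<partial>lborel) + ?J n = 0"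
      by (rule weak_identity[where \<alpha>="1 / real n" and \<beta>="T - 1 / real n", OF heat \<Omega> u int \<eta>C \<eta>s[OF n] _ _ \<psi>(1) \<psi>K K]) (use nT[OF n] in auto)
    moreover have "(\<integral>z. ?U z * of_real (dderiv 1 (\<eta> n) (fst z) * \<psi> (snd z) * ?G z) \<partial>lborel)
       = (\<integral>z. ?U z * of_real (e1 n (fst z) * \<psi> (snd z) * ?G z) - ?U z * of_real (e2 n (fst z) * \<psi> (snd z) * ?G z) \<partial>lborel)"
      by (simp only: d\<eta>[OF n] left_diff_distrib of_real_diff right_diff_distrib)
    moreover have "\<dots> = (\<integral>s. of_real (e1 n s) * ?m s \<partial>lborel) - (\<integral>s. of_real (e2 n s) * ?m s \<partial>lborel)"
      by (simp only: Bochner_Integration.integral_diff[OF int1[OF n] int2[OF n]] fubini_slice(1)[OF int1[OF n]] fubini_slice(1)[OF int2[OF n]])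
    moreover have "Q = P + J" if "X + J = 0" "X = Y" "Y = P - Q" for X Y J P Q :: complex
      using that by algebra
    ultimately show ?thesis by blast
  qed
  have e1b: "\<bar>e1 n s\<bar> \<le> real n * Mt * indicator {1 / real n..2 / real n} s" if "n \<ge> N" for n s
    using e1s[OF that, of s] \<theta>'M by (cases "s \<in> {1 / real n..2 / real n}") (auto simp: e1_def abs_mult mult_left_mono)
  have e2b: "\<bar>e2 n s\<bar> \<le> real n * Mt * indicator {T - 2 / real n..T - 1 / real n} s" if "n \<ge> N" for n s
    using e2s[OF that, of s] \<theta>'M by (cases "s \<in> {T - 2 / real n..T - 1 / real n}") (auto simp: e2_def abs_mult mult_left_mono)
  have two: "\<forall>\<^sub>F n in sequentially. 2 / real n < \<delta>" if "\<delta> > 0" for \<delta> :: real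
    using that by real_asymp
  have L1: "(\<lambda>n. \<integral>s. of_real (e1 n s) * ?m s \<partial>lborel) \<longlonglongrightarrow> 0"
    unfolding tendsto_iff dist_norm diff_zero
  proof (intro allI impI)
    fix \<epsilon> :: real assume \<epsilon>: "\<epsilon> > 0"
    then have e': "\<epsilon> / (2 * Mt) > 0" using Mt by simp
    have "\<exists>\<delta>>0. AE s in lborel. 0 < s \<and> s < \<delta> \<longrightarrow> norm (?m s) \<le> \<epsilon> / (2 * Mt)"
      by (rule slice_small[OF init \<Omega> u \<psi>(1) \<psi>K K T e'])
    then obtain \<delta> where \<delta>: "\<delta> > 0" "AE s in lborel. 0 < s \<and> s < \<delta> \<longrightarrow> norm (?m s) \<le> \<epsilon> / (2 * Mt)" by (elim exE conjE)
    show "\<forall>\<^sub>F n in sequentially. norm (\<integral>s. of_real (e1 n s) * ?m s \<partial>lborel) < \<epsilon>"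
      using two[OF \<delta>(1)] eventually_ge_at_top[of N]
    proof eventually_elim
      fix n assume n: "2 / real n < \<delta>" "N \<le> n"
      have "norm (\<integral>s. of_real (e1 n s) * ?m s \<partial>lborel) \<le> (real n * Mt) * (\<epsilon> / (2 * Mt)) * (2 / real n - 1 / real n)"
      proof (rule weighted_average_small[OF e1b[OF n(2)]])
        show "AE s in lborel. s \<in> {1 / real n..2 / real n} \<longrightarrow> norm (?m s) \<le> \<epsilon> / (2 * Mt)"
          using \<delta>(2) by eventually_elim (use n nT(1)[OF n(2)] in \<open>auto intro: less_le_trans[of _ "1 / real n"]\<close>)
      qed (use nT(1)[OF n(2)] in \<open>simp add: divide_right_mono\<close>)
      also have "\<dots> = \<epsilon> / 2" using Mt nT(1)[OF n(2)] by (simp add: field_simps)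
      finally show "norm (\<integral>s. of_real (e1 n s) * ?m s \<partial>lborel) < \<epsilon>" using \<epsilon> by linarith
    qed
  qed
  \<comment> \<open>\<open>e2 n\<close> is the derivative of - \<theta> (n T - 1 - n s), which goes
    from - 1 to 0 over the window; so its integral is 1 and it averages near T.\<close>
  have e2i: "integrable lborel (e2 n)" "(\<integral>s. e2 n s \<partial>lborel) = 1" if n: "n \<ge> N" for n
  proof -
    let ?I = "{T - 2 / real n..T - 1 / real n}"
    have "has_bochner_integral lborel (\<lambda>s. e2 n s * indicator ?I s)
      (- \<theta> ((real n * T - 1) + (- real n) * (T - 1 / real n)) - (- \<theta> ((real n * T - 1) + (- real n) * (T - 2 / real n))))"
    proof (rule has_bochner_integral_FTC_Icc_real)
      show "T - 2 / real n \<le> T - 1 / real n" by (simp add: divide_right_mono)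
      show "((\<lambda>s. - \<theta> ((real n * T - 1) + (- real n) * s)) has_real_derivative e2 n s) (at s)" for s
      proof -
        have "((\<lambda>s. \<theta> ((real n * T - 1) + (- real n) * s)) has_real_derivative \<theta>' ((real n * T - 1) + (- real n) * s) * (- real n)) (at s)"
          by (rule DERIV_chain2[OF \<theta>d]) (auto intro!: derivative_eq_intros)
        from DERIV_minus[OF this] show ?thesis by (simp add: e2_def mult.commute)
      qed
      show "isCont (e2 n) s" for s
        using Ck_on_continuous[OF e2C[of 0 n]] by (simp add: continuous_on_eq_continuous_at)
    qed
    moreover have "(\<lambda>s. e2 n s * indicator ?I s) = e2 n"
    proof (rule ext)
      fix s show "e2 n s * indicator ?I s = e2 n s" using e2s[OF n, of s] by (cases "s \<in> ?I") auto
    qed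
    moreover have "(real n * T - 1) + (- real n) * (T - 1 / real n) = 0" "(real n * T - 1) + (- real n) * (T - 2 / real n) = 1"
      using nT(1)[OF n] by (simp_all add: field_simps)
    ultimately have "has_bochner_integral lborel (e2 n) 1" using \<theta>(2)[of 0] \<theta>(3)[of 1] by simp
    then show "integrable lborel (e2 n)" "(\<integral>s. e2 n s \<partial>lborel) = 1"
      by (auto simp: has_bochner_integral_iff)
  qed
  have L2: "(\<lambda>n. \<integral>s. of_real (e2 n s) * ?m s \<partial>lborel) \<longlonglongrightarrow> lim"
    unfolding tendsto_iff dist_norm
  proof (intro allI impI)
    fix \<epsilon> :: real assume \<epsilon>: "\<epsilon> > 0"
    then have e': "\<epsilon> / (2 * Mt) > 0" using Mt by simp
    have "(?m \<longlongrightarrow> lim) (at_left T)" unfolding lim_def by (rule slice_limit[OF \<Omega> u \<psi>(1) \<psi>K K T x(2) \<psi>x])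
    from tendstoD[OF this e'] obtain b where b: "b < T" "\<And>s. b < s \<Longrightarrow> s < T \<Longrightarrow> norm (?m s - lim) < \<epsilon> / (2 * Mt)"
      unfolding eventually_at_left_field dist_norm by blast
    have "T - b > 0" using b by simp
    show "\<forall>\<^sub>F n in sequentially. norm ((\<integral>s. of_real (e2 n s) * ?m s \<partial>lborel) - lim) < \<epsilon>"
      using two[OF \<open>T - b > 0\<close>] eventually_ge_at_top[of N]
    proof eventually_elim
      fix n assume n: "2 / real n < T - b" "N \<le> n"
      have i1: "integrable lborel (\<lambda>s. complex_of_real (e2 n s) * lim)"
        by (intro integrable_mult_left integrable_of_real e2i(1)[OF n(2)])
      have "(\<integral>s. complex_of_real (e2 n s) * lim \<partial>lborel) = lim"
        using e2i(2)[OF n(2)] by (simp add: integral_complex_of_real)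
      then have "(\<integral>s. of_real (e2 n s) * ?m s \<partial>lborel) - lim = (\<integral>s. of_real (e2 n s) * ?m s \<partial>lborel) - (\<integral>s. complex_of_real (e2 n s) * lim \<partial>lborel)"
        by simp
      also have "\<dots> = (\<integral>s. of_real (e2 n s) * (?m s - lim) \<partial>lborel)"
        unfolding right_diff_distrib by (rule Bochner_Integration.integral_diff[OF fubini_slice(2)[OF int2[OF n(2)]] i1, symmetric])
      finally have "norm ((\<integral>s. of_real (e2 n s) * ?m s \<partial>lborel) - lim) = norm (\<integral>s. of_real (e2 n s) * (?m s - lim) \<partial>lborel)" by simp
      also have "\<dots> \<le> (real n * Mt) * (\<epsilon> / (2 * Mt)) * ((T - 1 / real n) - (T - 2 / real n))"
      proof (rule weighted_average_small[OF e2b[OF n(2)]])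
        show "AE s in lborel. s \<in> {T - 2 / real n..T - 1 / real n} \<longrightarrow> norm (?m s - lim) \<le> \<epsilon> / (2 * Mt)"
        proof (intro AE_I2 impI)
          fix s assume s: "s \<in> {T - 2 / real n..T - 1 / real n}"
          have "1 / real n > 0" using nT(1)[OF n(2)] by simp
          then have "b < s" "s < T" using s n(1) unfolding atLeastAtMost_iff by linarith+
          then show "norm (?m s - lim) \<le> \<epsilon> / (2 * Mt)" using b(2) by (simp add: less_imp_le)
        qed
      qed (simp add: divide_right_mono)
      also have "\<dots> = \<epsilon> / 2" using Mt nT(1)[OF n(2)] by (simp add: field_simps)
      finally show "norm ((\<integral>s. of_real (e2 n s) * ?m s \<partial>lborel) - lim) < \<epsilon>" using \<epsilon> by linarith
    qed
  qed
  obtain Mk where Mk: "Mk \<ge> 0" "\<And>z. 0 \<le> fst z \<Longrightarrow> fst z \<le> T \<Longrightarrow> \<bar>kap \<psi> T x z\<bar> \<le> Mk"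
    using kap_bounded[OF \<psi> x(1) T] by blast
  \<comment> \<open>The plateaus are bounded by 1 and eventually equal to 1 at each time strictly
    between 0 and T; the majorant comes from the bound on \<open>kap\<close>.\<close>
  have L3: "?J \<longlonglongrightarrow> (\<integral>z. ?U z * of_real (kap \<psi> T x z) \<partial>lborel)"
  proof (rule integral_dominated_convergence[where w="\<lambda>z. Mk * norm (?U z)"])
    have km: "(\<lambda>z. complex_of_real (kap \<psi> T x z)) \<in> borel_measurable borel"
      by (rule measurable_compose[OF kap_measurable[OF \<psi>(1)] borel_measurable_of_real])
    have Um: "?U \<in> borel_measurable borel" by (rule cut_off_measurable[OF \<Omega> u])
    show "(\<lambda>z. ?U z * of_real (kap \<psi> T x z)) \<in> borel_measurable lborel"
      using borel_measurable_times[OF Um km] by simp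
    show "(\<lambda>z. ?U z * of_real (\<eta> n (fst z) * kap \<psi> T x z)) \<in> borel_measurable lborel" for n
    proof -
      have "(\<lambda>z::real \<times> (real^'n). \<eta> n (fst z)) \<in> borel_measurable borel"
        by (intro borel_measurable_continuous_onI continuous_on_compose2[OF Ck_on_continuous[OF \<eta>C[of 0 n]]] continuous_intros) auto
      then have "(\<lambda>z. ?U z * of_real (\<eta> n (fst z) * kap \<psi> T x z)) \<in> borel_measurable borel"
        by (intro borel_measurable_times Um measurable_compose[OF borel_measurable_times[OF _ kap_measurable[OF \<psi>(1)]] borel_measurable_of_real])
      then show ?thesis by simp
    qed
    show "integrable lborel (\<lambda>z. Mk * norm (?U z))" by (intro integrable_mult_right integrable_norm int)
    have \<eta>1: "\<bar>\<eta> n s\<bar> \<le> 1" for n s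
      using \<theta>(4,5) by (auto simp: \<eta>_def abs_mult intro!: mult_le_one)
    show "AE z in lborel. norm (?U z * of_real (\<eta> n (fst z) * kap \<psi> T x z)) \<le> Mk * norm (?U z)" for n
    proof (rule AE_I2)
      fix z
      show "norm (?U z * of_real (\<eta> n (fst z) * kap \<psi> T x z)) \<le> Mk * norm (?U z)"
      proof (cases "z \<in> cyl T \<Omega>")
        case True
        then have "\<bar>kap \<psi> T x z\<bar> \<le> Mk" by (intro Mk(2)) (auto simp: cyl_def)
        then have "\<bar>\<eta> n (fst z)\<bar> * \<bar>kap \<psi> T x z\<bar> \<le> 1 * Mk" using \<eta>1 Mk(1) by (intro mult_mono) auto
        then have "norm (?U z) * (\<bar>\<eta> n (fst z)\<bar> * \<bar>kap \<psi> T x z\<bar>) \<le> norm (?U z) * (1 * Mk)" by (intro mult_left_mono) auto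
        then show ?thesis by (simp add: norm_mult abs_mult mult.commute)
      qed (simp add: cut_off_def Mk(1))
    qed
    show "AE z in lborel. (\<lambda>n. ?U z * of_real (\<eta> n (fst z) * kap \<psi> T x z)) \<longlonglongrightarrow> ?U z * of_real (kap \<psi> T x z)"
    proof (rule AE_I2)
      fix z :: "real \<times> (real^'n)"
      show "(\<lambda>n. ?U z * of_real (\<eta> n (fst z) * kap \<psi> T x z)) \<longlonglongrightarrow> ?U z * of_real (kap \<psi> T x z)"
      proof (cases "z \<in> cyl T \<Omega>")
        case True
        then have s: "0 < fst z" "fst z < T" by (auto simp: cyl_def)
        show ?thesis
        proof (rule tendsto_eventually)
          have "0 < min (fst z) (T - fst z)" using s by simp
          from two[OF this] eventually_ge_at_top[of N]
          show "\<forall>\<^sub>F n in sequentially. ?U z * of_real (\<eta> n (fst z) * kap \<psi> T x z) = ?U z * of_real (kap \<psi> T x z)"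
          proof eventually_elim
            fix n assume n: "2 / real n < min (fst z) (T - fst z)" "N \<le> n"
            have "1 \<le> -1 + real n * fst z" "1 \<le> (real n * T - 1) + (- real n) * fst z"
              using n(1) nT(1)[OF n(2)] by (auto simp: field_simps)
            then have "\<eta> n (fst z) = 1" using \<theta>(3) by (simp add: \<eta>_def)
            then show "?U z * of_real (\<eta> n (fst z) * kap \<psi> T x z) = ?U z * of_real (kap \<psi> T x z)" by simp
          qed
        qed
      qed (simp add: cut_off_def)
    qed
  qed
  have "(\<lambda>n. (\<integral>s. of_real (e1 n s) * ?m s \<partial>lborel) + ?J n) \<longlonglongrightarrow> 0 + (\<integral>z. ?U z * of_real (kap \<psi> T x z) \<partial>lborel)"
    by (rule tendsto_add[OF L1 L3])
  moreover have "(\<lambda>n. (\<integral>s. of_real (e1 n s) * ?m s \<partial>lborel) + ?J n) \<longlonglongrightarrow> lim"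
    by (rule Lim_transform_eventually[OF L2 eventually_mono[OF eventually_ge_at_top[of N] main]])
  ultimately show ?thesis using LIMSEQ_unique unfolding lim_def by fastforce
qed

section \<open>Holomorphic extension\<close>

lemma dderiv_plateau:
  fixes \<psi> :: "real^'n::finite \<Rightarrow> real"
  assumes \<psi>: "\<And>y. norm (y - x0) < \<rho>1 \<Longrightarrow> \<psi> y = 1" "\<And>y. \<rho>2 < norm (y - x0) \<Longrightarrow> \<psi> y = 0"
    and y: "norm (y - x0) < \<rho>1 \<or> \<rho>2 < norm (y - x0)"
  shows "dderiv v \<psi> y = 0" "dderiv w (dderiv v \<psi>) y = 0"
proof -
  obtain V c where V: "open V" "y \<in> V" "\<And>y. y \<in> V \<Longrightarrow> \<psi> y = c"
    using y
  proof
    assume 1: "norm (y - x0) < \<rho>1"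
    have "open {y. norm (y - x0) < \<rho>1}" by (intro open_Collect_less continuous_intros)
    then show thesis by (rule that[of _ 1]) (use 1 \<psi>(1) in simp_all)
  next
    assume 2: "\<rho>2 < norm (y - x0)"
    have "open {y. \<rho>2 < norm (y - x0)}" by (intro open_Collect_less continuous_intros)
    then show thesis by (rule that[of _ 0]) (use 2 \<psi>(2) in simp_all)
  qed
  have d0: "dderiv v \<psi> y = 0" if "y \<in> V" for y by (rule dderiv_zero_open[OF V(1) that V(3)])
  show "dderiv v \<psi> y = 0" by (rule d0[OF V(2)])
  show "dderiv w (dderiv v \<psi>) y = 0" by (rule dderiv_zero_open[OF V(1,2) d0])
qed

definition lapl :: "(real^'n::finite \<Rightarrow> real) \<Rightarrow> real^'n \<Rightarrow> real" where
  "lapl \<psi> y = (\<Sum>i\<in>UNIV. dderiv (axis i 1) (dderiv (axis i 1) \<psi>) y)"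

text \<open>
  \<open>kap \<psi> T x\<close> with the real point \<open>x\<close> replaced by a complex one; meaningful only for \<open>fst p < T\<close>.
\<close>

definition kapC :: "(real^'n::finite \<Rightarrow> real) \<Rightarrow> real \<Rightarrow> complex^'n \<Rightarrow> real \<times> (real^'n) \<Rightarrow> complex" where
  "kapC \<psi> T z p =
     of_real ((T - fst p) powr - (real CARD('n) / 2)) * exp (- qf (snd p) z / of_real (4 * (T - fst p))) *
     (of_real (lapl \<psi> (snd p))
       - (\<Sum>i\<in>UNIV. of_real (dderiv (axis i 1) \<psi> (snd p)) * (of_real (snd p $ i) - z $ i)) / of_real (T - fst p))"

text \<open>The product rule in z: the first summand differentiates the bracket of
  \<open>kapC\<close>, the second its exponential. It is spelled out because the estimates and the
  complex linearity in v are read off from it.\<close>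

definition kapC_deriv :: "(real^'n::finite \<Rightarrow> real) \<Rightarrow> real \<Rightarrow> complex^'n \<Rightarrow> real \<times> (real^'n) \<Rightarrow> complex^'n \<Rightarrow> complex" where
  "kapC_deriv \<psi> T z p v =
     of_real ((T - fst p) powr - (real CARD('n) / 2)) * exp (- qf (snd p) z / of_real (4 * (T - fst p))) *
     ((\<Sum>i\<in>UNIV. of_real (dderiv (axis i 1) \<psi> (snd p)) * v $ i) / of_real (T - fst p)) +
     of_real ((T - fst p) powr - (real CARD('n) / 2)) * (exp (- qf (snd p) z / of_real (4 * (T - fst p))) *
       (- (\<Sum>i\<in>UNIV. 2 * (z $ i - of_real (snd p $ i)) * v $ i) / of_real (4 * (T - fst p)))) *
     (of_real (lapl \<psi> (snd p))
       - (\<Sum>i\<in>UNIV. of_real (dderiv (axis i 1) \<psi> (snd p)) * (of_real (snd p $ i) - z $ i)) / of_real (T - fst p))"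

lemma has_derivative_qf:
  "(qf y has_derivative (\<lambda>v. \<Sum>i\<in>UNIV. 2 * (z $ i - of_real (y $ i)) * v $ i)) (at z)"
proof -
  have n: "((\<lambda>z. z $ i - c) has_derivative (\<lambda>v. v $ i)) (at z)" for i and c :: complex
    by (rule has_derivative_diff[OF bounded_linear_imp_has_derivative[OF bounded_linear_vec_nth] has_derivative_const, simplified])
  have "((\<lambda>z. \<Sum>i\<in>UNIV. (z $ i - of_real (y $ i)) * (z $ i - of_real (y $ i))) has_derivative
      (\<lambda>v. \<Sum>i\<in>UNIV. (z $ i - of_real (y $ i)) * v $ i + v $ i * (z $ i - of_real (y $ i)))) (at z)"
    by (intro has_derivative_sum has_derivative_mult n)
  moreover have "(\<lambda>z. \<Sum>i\<in>UNIV. (z $ i - of_real (y $ i)) * (z $ i - of_real (y $ i))) = qf y"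
    by (simp add: qf_def fun_eq_iff power2_eq_square)
  moreover have "(z $ i - of_real (y $ i)) * v $ i + v $ i * (z $ i - of_real (y $ i)) = 2 * (z $ i - of_real (y $ i)) * v $ i" for i v
    by (simp add: algebra_simps)
  ultimately show ?thesis by simp
qed

lemma has_derivative_exp_complex:
  fixes g :: "'a::real_normed_vector \<Rightarrow> complex"
  assumes "(g has_derivative g') (at z)"
  shows "((\<lambda>z. exp (g z)) has_derivative (\<lambda>v. exp (g z) * g' v)) (at z)"
  by (rule has_derivative_compose[OF assms DERIV_exp[unfolded has_field_derivative_def]])

lemma has_derivative_divide_const:
  fixes f :: "'a::real_normed_vector \<Rightarrow> complex"
  shows "(f has_derivative f') F \<Longrightarrow> ((\<lambda>x. f x / c) has_derivative (\<lambda>x. f' x / c)) F"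
  by (rule bounded_linear.has_derivative[OF bounded_linear_divide])

lemma kapC_has_derivative:
  "((\<lambda>z. kapC \<psi> T z p) has_derivative kapC_deriv \<psi> T z p) (at z)"
proof -
  let ?\<sigma> = "T - fst p" and ?y = "snd p"
  let ?S = "\<lambda>z. \<Sum>i\<in>UNIV. of_real (dderiv (axis i 1) \<psi> ?y) * (of_real (?y $ i) - z $ i)"
  have S: "(?S has_derivative (\<lambda>v. \<Sum>i\<in>UNIV. of_real (dderiv (axis i 1) \<psi> ?y) * (0 - v $ i))) (at z)"
    by (intro has_derivative_sum has_derivative_mult_right has_derivative_diff has_derivative_const
        bounded_linear_imp_has_derivative[OF bounded_linear_vec_nth])
  have "((\<lambda>z. of_real (lapl \<psi> ?y) - ?S z / of_real ?\<sigma>) has_derivative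
      (\<lambda>v. 0 - (\<Sum>i\<in>UNIV. of_real (dderiv (axis i 1) \<psi> ?y) * (0 - v $ i)) / of_real ?\<sigma>)) (at z)"
    by (intro has_derivative_diff has_derivative_const has_derivative_divide_const S)
  moreover have "0 - (\<Sum>i\<in>UNIV. of_real (dderiv (axis i 1) \<psi> ?y) * (0 - v $ i)) / of_real ?\<sigma>
      = (\<Sum>i\<in>UNIV. of_real (dderiv (axis i 1) \<psi> ?y) * v $ i) / of_real ?\<sigma>" for v :: "complex^'a"
    by (simp add: sum_negf)
  ultimately have 1: "((\<lambda>z. of_real (lapl \<psi> ?y) - ?S z / of_real ?\<sigma>) has_derivative
      (\<lambda>v. (\<Sum>i\<in>UNIV. of_real (dderiv (axis i 1) \<psi> ?y) * v $ i) / of_real ?\<sigma>)) (at z)" by simp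
  have 2: "((\<lambda>z. of_real (?\<sigma> powr - (real CARD('a) / 2)) * exp (- qf ?y z / of_real (4 * ?\<sigma>))) has_derivative
     (\<lambda>v. of_real (?\<sigma> powr - (real CARD('a) / 2)) * (exp (- qf ?y z / of_real (4 * ?\<sigma>)) * (- (\<Sum>i\<in>UNIV. 2 * (z $ i - of_real (?y $ i)) * v $ i) / of_real (4 * ?\<sigma>))))) (at z)"
    by (intro has_derivative_mult_right has_derivative_exp_complex has_derivative_divide_const has_derivative_minus has_derivative_qf)
  show ?thesis
    unfolding kapC_def kapC_deriv_def by (rule has_derivative_mult[OF 2 1])
qed

lemma powr_minus_shift:
  fixes \<sigma> d :: real
  assumes "\<sigma> > 0"
  shows "\<sigma> powr - (d + 1) = \<sigma> powr - d / \<sigma>" "\<sigma> powr - (d + 2) = \<sigma> powr - d / \<sigma>\<^sup>2"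
proof -
  have 1: "- (d + 1) = - d - 1" and 2: "- (d + 2) = - d - 2" by simp_all
  show "\<sigma> powr - (d + 1) = \<sigma> powr - d / \<sigma>"
    unfolding 1 powr_diff using assms by simp
  show "\<sigma> powr - (d + 2) = \<sigma> powr - d / \<sigma>\<^sup>2"
    unfolding 2 powr_diff using assms by (simp add: powr_numeral)
qed

lemma kapC_real:
  fixes \<psi> :: "real^'n::finite \<Rightarrow> real"
  assumes p: "fst p < T"
  shows "kapC \<psi> T (cvec x 0) p = of_real (kap \<psi> T x p)"
proof -
  define \<sigma> where "\<sigma> = T - fst p"
  define d where "d = real CARD('n) / 2"
  define y where "y = snd p"
  have \<sigma>: "\<sigma> > 0" using p by (simp add: \<sigma>_def)
  define e where "e = exp (- ((y - x) \<bullet> (y - x)) / (4 * \<sigma>))"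
  have h: "hk d (\<sigma>, y - x) = \<sigma> powr - d * e" "hk (d + 1) (\<sigma>, y - x) = \<sigma> powr - d * e / \<sigma>"
    using \<sigma> by (simp_all only: hk_def e_def powr_minus_shift[OF \<sigma>] fst_conv snd_conv if_True times_divide_eq_left)
  have "exp (- qf y (cvec x 0) / of_real (4 * \<sigma>)) = of_real e"
    unfolding qf_real e_def dot_square_norm exp_of_real[symmetric] norm_minus_commute[of y x] by simp
  moreover have "(\<Sum>i\<in>UNIV. of_real (dderiv (axis i 1) \<psi> y) * (of_real (y $ i) - cvec x 0 $ i))
      = complex_of_real (\<Sum>i\<in>UNIV. dderiv (axis i 1) \<psi> y * (y - x) $ i)"
  proof -
    have "cvec x 0 $ i = of_real (x $ i)" for i by (simp add: cvec_def complex_eq_iff)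
    then show ?thesis by simp
  qed
  ultimately have "kapC \<psi> T (cvec x 0) p = of_real (\<sigma> powr - d * e * (lapl \<psi> y - (\<Sum>i\<in>UNIV. dderiv (axis i 1) \<psi> y * (y - x) $ i) / \<sigma>))"
    unfolding kapC_def y_def[symmetric] \<sigma>_def[symmetric] d_def[symmetric] by (simp only: of_real_mult of_real_diff of_real_divide)
  also have "\<sigma> powr - d * e * (lapl \<psi> y - (\<Sum>i\<in>UNIV. dderiv (axis i 1) \<psi> y * (y - x) $ i) / \<sigma>) = kap \<psi> T x p"
    unfolding kap_def y_def[symmetric] \<sigma>_def[symmetric] d_def[symmetric] lapl_def[symmetric] h by (simp add: right_diff_distrib mult_ac)
  finally show ?thesis .
qed

lemma kapC_measurable:
  fixes \<psi> :: "real^'n::finite \<Rightarrow> real"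
  assumes \<psi>: "\<And>k. Ck_on k UNIV \<psi>" shows "kapC \<psi> T z \<in> borel_measurable borel"
proof -
  have d: "continuous_on UNIV (\<lambda>p::real \<times> (real^'n). dderiv v \<psi> (snd p))" "continuous_on UNIV (\<lambda>p::real \<times> (real^'n). dderiv w (dderiv v \<psi>) (snd p))" for v w
    by (auto intro!: continuous_on_compose2[OF Ck_on_continuous[OF Ck_on_dderiv[OF open_UNIV \<psi>]]]
        continuous_on_compose2[OF Ck_on_continuous[OF Ck_on_dderiv[OF open_UNIV Ck_on_dderiv[OF open_UNIV \<psi>]]]] continuous_intros)
  have 1: "(\<lambda>p::real \<times> (real^'n). complex_of_real (lapl \<psi> (snd p))) \<in> borel_measurable borel"
    unfolding lapl_def by (intro borel_measurable_continuous_onI continuous_intros d)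
  have 2: "(\<lambda>p::real \<times> (real^'n). \<Sum>i\<in>UNIV. of_real (dderiv (axis i 1) \<psi> (snd p)) * (of_real (snd p $ i) - z $ i)) \<in> borel_measurable borel"
    by (intro borel_measurable_continuous_onI continuous_intros d)
  have 3: "(\<lambda>p::real \<times> (real^'n). - qf (snd p) z) \<in> borel_measurable borel"
    unfolding qf_def by (intro borel_measurable_continuous_onI continuous_intros)
  have 4: "(\<lambda>p::real \<times> (real^'n). T - fst p) \<in> borel_measurable borel"
    by (intro borel_measurable_continuous_onI continuous_intros)
  show ?thesis
    unfolding kapC_def[abs_def] using 1 2 3 4 by measurable
qed

text \<open>The expression is the kernel \<open>hk a (\<sigma>, \<epsilon>)\<close> in one space
  dimension. It is continuous on the compact segment 0 \<le> \<sigma> \<le> T at fixed \<epsilon> >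
  0, since that segment avoids the origin.\<close>

lemma hk_line_bound:
  fixes \<epsilon> :: real assumes "\<epsilon> > 0"
  obtains C where "C \<ge> 0" "\<And>\<sigma>. 0 < \<sigma> \<Longrightarrow> \<sigma> \<le> T \<Longrightarrow> \<sigma> powr - a * exp (- (\<epsilon>\<^sup>2) / (4 * \<sigma>)) \<le> C"
proof -
  have "continuous_on {0..T} (\<lambda>\<sigma>. hk a (\<sigma>, \<epsilon>))"
    by (rule continuous_on_compose2[OF Ck_on_continuous[OF Ck_on_hk[of 0]]])
       (use assms in \<open>auto intro!: continuous_intros simp: zero_prod_def\<close>)
  then have "bounded ((\<lambda>\<sigma>. hk a (\<sigma>, \<epsilon>)) ` {0..T})" by (intro compact_imp_bounded compact_continuous_image) auto
  then obtain C where C: "C > 0" "\<forall>y\<in>(\<lambda>\<sigma>. hk a (\<sigma>, \<epsilon>)) ` {0..T}. norm y \<le> C" unfolding bounded_pos by blast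
  have "\<sigma> powr - a * exp (- (\<epsilon>\<^sup>2) / (4 * \<sigma>)) \<le> C" if \<sigma>: "0 < \<sigma>" "\<sigma> \<le> T" for \<sigma>
  proof -
    have "norm (hk a (\<sigma>, \<epsilon>)) \<le> C" using C(2)[rule_format, OF imageI] \<sigma> by auto
    then show ?thesis using \<sigma> by (simp add: hk_def power2_eq_square)
  qed
  then show thesis using that[of C] C(1) by simp
qed

text \<open>The lower bound on Re \<open>qf\<close> gives the decay exp (- \<epsilon>^2 / (4
  \<sigma>)) with \<sigma> = T - s. Division by \<sigma>, once in \<open>kapC\<close> and up to
  twice in its derivative, raises the exponent of the kernel by j \<le> 2, hence the three bounds
  collected in C.\<close>

lemma kapC_bounds:
  fixes \<psi> :: "real^'n::finite \<Rightarrow> real" and y :: "real^'n" and z v :: "complex^'n"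
  assumes M: "\<bar>lapl \<psi> y\<bar> \<le> M" "\<And>i. \<bar>dderiv (axis i 1) \<psi> y\<bar> \<le> M" "M \<ge> 0"
    and R: "\<And>i. cmod (of_real (y $ i) - z $ i) \<le> R" "R \<ge> 0"
    and q: "\<epsilon>\<^sup>2 \<le> Re (qf y z)" and s: "s < T"
    and C: "\<And>j. j \<in> {0,1,2} \<Longrightarrow> (T - s) powr - (real CARD('n) / 2 + real j) * exp (- (\<epsilon>\<^sup>2) / (4 * (T - s))) \<le> C" "C \<ge> 0"
  shows "cmod (kapC \<psi> T z (s, y)) \<le> C * M + C * (real CARD('n) * (M * R))"
    and "cmod (kapC_deriv \<psi> T z (s, y) v) \<le>
      (C * (real CARD('n) * M) + C * (real CARD('n) * R) * M + C * (real CARD('n) * R) * (real CARD('n) * (M * R))) * norm v"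
proof -
  define \<sigma> where "\<sigma> = T - s"
  have \<sigma>: "\<sigma> > 0" using s by (simp add: \<sigma>_def)
  define d where "d = real CARD('n) / 2"
  define n where "n = real CARD('n)"
  have n: "n \<ge> 0" by (simp add: n_def)
  define E where "E = exp (- (\<epsilon>\<^sup>2) / (4 * \<sigma>))"
  have C0: "\<sigma> powr - d * E \<le> C" using C(1)[of 0] by (simp add: \<sigma>_def d_def E_def)
  have C1: "\<sigma> powr - d * E / \<sigma> \<le> C"
    using C(1)[of 1] unfolding \<sigma>_def[symmetric] d_def[symmetric] E_def[symmetric] of_nat_1 powr_minus_shift[OF \<sigma>] by simp
  have C2: "\<sigma> powr - d * E / \<sigma>\<^sup>2 \<le> C"
    using C(1)[of 2] unfolding \<sigma>_def[symmetric] d_def[symmetric] E_def[symmetric] of_nat_numeral powr_minus_shift[OF \<sigma>] by simp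
  have P: "\<sigma> powr - d * E \<ge> 0" by (simp add: E_def)
  have ex: "cmod (exp (- qf y z / of_real (4 * \<sigma>))) \<le> E"
    using q \<sigma> by (simp add: E_def Re_divide_of_real divide_right_mono)
  define A where "A = of_real (\<sigma> powr - d) * exp (- qf y z / of_real (4 * \<sigma>))"
  have A: "cmod A \<le> \<sigma> powr - d * E" unfolding A_def norm_mult using ex by (simp add: mult_left_mono)
  define S where "S = (\<Sum>i\<in>UNIV. of_real (dderiv (axis i 1) \<psi> y) * (of_real (y $ i) - z $ i))"
  define S1 where "S1 = (\<Sum>i\<in>UNIV. of_real (dderiv (axis i 1) \<psi> y) * v $ i)"
  define Q1 where "Q1 = (\<Sum>i\<in>UNIV. 2 * (z $ i - of_real (y $ i)) * v $ i)"
  have S: "cmod S \<le> n * (M * R)" unfolding S_def n_def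
    by (rule order_trans[OF norm_sum], rule sum_bounded_above) (use M R in \<open>auto simp: norm_mult intro!: mult_mono\<close>)
  have S1: "cmod S1 \<le> n * (M * norm v)" unfolding S1_def n_def
    by (rule order_trans[OF norm_sum], rule sum_bounded_above) (use M in \<open>auto simp: norm_mult intro!: mult_mono Finite_Cartesian_Product.norm_nth_le\<close>)
  have Q1: "cmod Q1 \<le> n * (2 * R * norm v)" unfolding Q1_def n_def
  proof (rule order_trans[OF norm_sum], rule sum_bounded_above)
    fix i :: 'n
    have "cmod (2 * (z $ i - of_real (y $ i)) * v $ i) = 2 * cmod (of_real (y $ i) - z $ i) * cmod (v $ i)"
      by (simp only: norm_mult norm_minus_commute[of "z $ i"] norm_numeral)
    also have "\<dots> \<le> 2 * R * norm v"
      using R by (intro mult_mono Finite_Cartesian_Product.norm_nth_le) auto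
    finally show "cmod (2 * (z $ i - of_real (y $ i)) * v $ i) \<le> 2 * R * norm v" .
  qed
  have "kapC \<psi> T z (s, y) = A * (of_real (lapl \<psi> y) - S / of_real \<sigma>)"
    by (simp add: kapC_def A_def S_def \<sigma>_def d_def)
  then have "cmod (kapC \<psi> T z (s, y)) = cmod A * cmod (of_real (lapl \<psi> y) - S / of_real \<sigma>)" by (simp add: norm_mult)
  also have "\<dots> \<le> cmod A * (M + n * (M * R) / \<sigma>)"
  proof (intro mult_left_mono order_trans[OF norm_triangle_ineq4] add_mono)
    show "cmod (S / of_real \<sigma>) \<le> n * (M * R) / \<sigma>" using S \<sigma> by (simp add: norm_divide divide_right_mono)
  qed (use M in auto)
  also have "\<dots> \<le> (\<sigma> powr - d * E) * (M + n * (M * R) / \<sigma>)"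
    using A M R n \<sigma> by (intro mult_right_mono) auto
  also have "\<dots> = (\<sigma> powr - d * E) * M + (\<sigma> powr - d * E / \<sigma>) * (n * (M * R))" by (simp add: distrib_left)
  also have "\<dots> \<le> C * M + C * (n * (M * R))"
    using M R n by (intro add_mono mult_right_mono C0 C1) auto
  finally show "cmod (kapC \<psi> T z (s, y)) \<le> C * M + C * (real CARD('n) * (M * R))" by (simp add: n_def)
  have "kapC_deriv \<psi> T z (s, y) v = A * (S1 / of_real \<sigma>) + A * (- Q1 / of_real (4 * \<sigma>)) * (of_real (lapl \<psi> y) - S / of_real \<sigma>)"
    by (simp add: kapC_deriv_def A_def S_def S1_def Q1_def \<sigma>_def d_def mult.assoc)
  also have "cmod \<dots> \<le> cmod A * (n * (M * norm v) / \<sigma>) + cmod A * (n * (2 * R * norm v) / (4 * \<sigma>)) * (M + n * (M * R) / \<sigma>)"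
  proof (rule order_trans[OF norm_triangle_ineq add_mono])
    show "cmod (A * (S1 / of_real \<sigma>)) \<le> cmod A * (n * (M * norm v) / \<sigma>)"
      unfolding norm_mult using S1 \<sigma> by (intro mult_left_mono) (auto simp: norm_divide divide_right_mono)
    show "cmod (A * (- Q1 / of_real (4 * \<sigma>)) * (of_real (lapl \<psi> y) - S / of_real \<sigma>)) \<le> cmod A * (n * (2 * R * norm v) / (4 * \<sigma>)) * (M + n * (M * R) / \<sigma>)"
      unfolding norm_mult
    proof (intro mult_mono mult_nonneg_nonneg)
      show "cmod (- Q1 / of_real (4 * \<sigma>)) \<le> n * (2 * R * norm v) / (4 * \<sigma>)" 
      proof -
        have eqn: "cmod (- Q1 / of_real (4 * \<sigma>)) = cmod Q1 / (4 * \<sigma>)" using \<sigma> by (simp add: norm_divide)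
        show ?thesis unfolding eqn by (rule divide_right_mono[OF Q1]) (use \<sigma> in simp)
      qed
      show "cmod (of_real (lapl \<psi> y) - S / of_real \<sigma>) \<le> M + n * (M * R) / \<sigma>"
        by (rule order_trans[OF norm_triangle_ineq4 add_mono]) (use S M \<sigma> in \<open>auto simp: norm_divide divide_right_mono\<close>)
    qed (use n R \<sigma> in auto)
  qed
  also have "\<dots> = cmod A * ((n * (M * norm v) / \<sigma>) + (n * (2 * R * norm v) / (4 * \<sigma>)) * (M + n * (M * R) / \<sigma>))"
    by (simp add: distrib_left mult.assoc)
  also have "\<dots> \<le> (\<sigma> powr - d * E) * ((n * (M * norm v) / \<sigma>) + (n * (2 * R * norm v) / (4 * \<sigma>)) * (M + n * (M * R) / \<sigma>))"
    using A M R n \<sigma> by (intro mult_right_mono) (auto intro!: add_nonneg_nonneg mult_nonneg_nonneg)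
  also have "\<dots> = (\<sigma> powr - d * E / \<sigma>) * (n * M) * norm v + (\<sigma> powr - d * E / \<sigma>) * (n * R / 2) * M * norm v + (\<sigma> powr - d * E / \<sigma>\<^sup>2) * (n * R / 2) * (n * (M * R)) * norm v"
    using \<sigma> by (simp add: field_simps power2_eq_square)
  also have "\<dots> \<le> C * (n * M) * norm v + C * (n * R) * M * norm v + C * (n * R) * (n * (M * R)) * norm v"
    using M R n C(2) by (intro add_mono mult_right_mono mult_mono C1 C2) (auto intro!: mult_nonneg_nonneg)
  finally show "cmod (kapC_deriv \<psi> T z (s, y) v) \<le>
      (C * (real CARD('n) * M) + C * (real CARD('n) * R) * M + C * (real CARD('n) * R) * (real CARD('n) * (M * R))) * norm v"
    by (simp add: n_def algebra_simps)
qed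

text \<open>The convex set over the real ball of radius \<rho> on which a single cutoff gives an
  extension. Convexity makes intersections of two such sets connected, as gluing by the identity
  theorem requires.\<close>

definition E_ball :: "real^'n::finite \<Rightarrow> real \<Rightarrow> (complex^'n) set" where
  "E_ball x0 \<rho> = {z. norm ((\<chi> i. Re (z $ i)) - x0) + norm ((\<chi> i. Im (z $ i)) :: real^'n) < \<rho>}"

lemma cvec_in_E_ball: "cvec x y \<in> E_ball x0 \<rho> \<longleftrightarrow> norm (x - x0) + norm y < \<rho>"
  by (simp add: E_ball_def cvec_def)

lemma open_E_ball: "open (E_ball x0 \<rho>)"
proof -
  have "continuous_on UNIV (\<lambda>z::complex^'a. (\<chi> i. Re (z $ i)) :: real^'a)" "continuous_on UNIV (\<lambda>z::complex^'a. (\<chi> i. Im (z $ i)) :: real^'a)"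
    by (intro continuous_on_vec_lambda continuous_intros)+
  then show ?thesis unfolding E_ball_def by (intro open_Collect_less continuous_intros)
qed

lemma convex_E_ball: "convex (E_ball x0 \<rho>)"
  unfolding convex_alt
proof (intro ballI allI impI)
  fix z w and u :: real assume zw: "z \<in> E_ball x0 \<rho>" "w \<in> E_ball x0 \<rho>" "0 \<le> u \<and> u \<le> 1"
  obtain a b where z: "z = cvec a b" by (rule cvec_cases)
  obtain a' b' where w: "w = cvec a' b'" by (rule cvec_cases)
  have eq: "(1 - u) *\<^sub>R z + u *\<^sub>R w = cvec ((1 - u) *\<^sub>R a + u *\<^sub>R a') ((1 - u) *\<^sub>R b + u *\<^sub>R b')"
    by (simp add: z w cvec_def vec_eq_iff complex_eq_iff)
  have "(1 - u) *\<^sub>R a + u *\<^sub>R a' - x0 = (1 - u) *\<^sub>R (a - x0) + u *\<^sub>R (a' - x0)" by (simp add: algebra_simps)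
  then have 1: "norm ((1 - u) *\<^sub>R a + u *\<^sub>R a' - x0) \<le> (1 - u) * norm (a - x0) + u * norm (a' - x0)"
    using norm_triangle_ineq[of "(1 - u) *\<^sub>R (a - x0)" "u *\<^sub>R (a' - x0)"] zw(3) by simp
  have 2: "norm ((1 - u) *\<^sub>R b + u *\<^sub>R b') \<le> (1 - u) * norm b + u * norm b'"
    using norm_triangle_ineq[of "(1 - u) *\<^sub>R b" "u *\<^sub>R b'"] zw(3) by simp
  have 3: "norm (a - x0) + norm b < \<rho>" "norm (a' - x0) + norm b' < \<rho>" using zw by (simp_all add: z w cvec_in_E_ball)
  have "(1 - u) * (norm (a - x0) + norm b) + u * (norm (a' - x0) + norm b') < \<rho>"
    by (rule convex_bound_lt[OF 3]) (use zw(3) in auto)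
  then have "norm ((1 - u) *\<^sub>R a + u *\<^sub>R a' - x0) + norm ((1 - u) *\<^sub>R b + u *\<^sub>R b') < \<rho>"
    using 1 2 by (simp add: distrib_left)
  then show "(1 - u) *\<^sub>R z + u *\<^sub>R w \<in> E_ball x0 \<rho>" by (simp add: eq cvec_in_E_ball)
qed

text \<open>F is the representation formula with x replaced by z. It is differentiated under the
  integral with a constant multiple of |u| as majorant, and complex linearity of the derivative is
  inherited from the integrand.\<close>

lemma local_extension:
  fixes u :: "real \<times> (real^'n::finite) \<Rightarrow> complex"
  assumes \<Omega>: "open \<Omega>" and u: "continuous_on ({0<..T} \<times> \<Omega>) u" and int: "integrable lborel (cut_off T \<Omega> u)"
    and heat: "heat_equation T \<Omega> u" and init: "initial_value \<Omega> u (\<lambda>x. 0)" and T: "T > 0"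
    and \<rho>: "0 < \<rho>1" "\<rho>1 < \<rho>2" "cball x0 \<rho>2 \<subseteq> \<Omega>"
  shows "\<exists>F. holomorphic_on_n F (E_ball x0 \<rho>1) \<and> (\<forall>x. norm (x - x0) < \<rho>1 \<longrightarrow> F (cvec x 0) = u (T, x))"
proof -
  let ?U = "cut_off T \<Omega> u"
  obtain \<psi> :: "real^'n \<Rightarrow> real" where \<psi>0: "\<And>k. Ck_on k UNIV \<psi>" "\<And>y. norm (y - x0) \<le> \<rho>1 \<Longrightarrow> \<psi> y = 1" "\<And>y. \<rho>2 \<le> norm (y - x0) \<Longrightarrow> \<psi> y = 0"
    using smooth_bump[of \<rho>1 \<rho>2 x0] \<rho> by auto
  have \<psi>1: "\<psi> y = 1" if "norm (y - x0) < \<rho>1" for y using \<psi>0(2) that by simp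
  have \<psi>2: "\<psi> y = 0" if "\<rho>2 < norm (y - x0)" for y using \<psi>0(3) that by simp
  note pl = dderiv_plateau[OF \<psi>1 \<psi>2]
  define \<kappa>0 where "\<kappa>0 = complex_of_real (gauss_mass TYPE(real^'n))"
  have \<kappa>0: "\<kappa>0 \<noteq> 0" using gauss_mass_pos by (simp add: \<kappa>0_def)
  define F where "F z = (\<integral>p. ?U p * kapC \<psi> T z p \<partial>lborel) / \<kappa>0" for z
  have real: "F (cvec x 0) = u (T, x)" if x: "norm (x - x0) < \<rho>1" for x
  proof -
    have x\<Omega>: "x \<in> \<Omega>" using x \<rho>(2,3) by (auto simp: dist_norm norm_minus_commute subset_iff)
    have "(\<integral>p. ?U p * kapC \<psi> T (cvec x 0) p \<partial>lborel) = (\<integral>p. ?U p * of_real (kap \<psi> T x p) \<partial>lborel)"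
      by (intro Bochner_Integration.integral_cong refl) (auto simp: cut_off_def cyl_def kapC_real)
    also have "\<dots> = \<kappa>0 * u (T, x)"
      unfolding \<kappa>0_def by (rule heat_representation[OF \<Omega> u int heat init T \<psi>0(1) \<psi>1 \<psi>2 \<rho>(3) x x\<Omega>, symmetric])
    finally show ?thesis using \<kappa>0 by (simp add: F_def)
  qed
  obtain M where M: "M \<ge> 0" "\<And>y. \<bar>lapl \<psi> y\<bar> \<le> M" "\<And>y i. \<bar>dderiv (axis i 1) \<psi> y\<bar> \<le> M"
  proof -
    have d: "continuous_on S (dderiv v \<psi>)" "continuous_on S (dderiv w (dderiv v \<psi>))" for S v w
      by (rule continuous_on_subset[OF Ck_on_continuous[OF Ck_on_dderiv[OF open_UNIV \<psi>0(1)]] subset_UNIV],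
          rule continuous_on_subset[OF Ck_on_continuous[OF Ck_on_dderiv[OF open_UNIV Ck_on_dderiv[OF open_UNIV \<psi>0(1)]]] subset_UNIV])
    have bnd: "\<exists>m>0. \<forall>y. \<bar>f y\<bar> \<le> m" if f: "continuous_on (cball x0 \<rho>2) f" "\<And>y. \<rho>2 < norm (y - x0) \<Longrightarrow> f y = 0" for f :: "real^'n \<Rightarrow> real"
    proof -
      have "bounded (f ` cball x0 \<rho>2)" by (intro compact_imp_bounded compact_continuous_image f compact_cball)
      then obtain m where m: "m > 0" "\<forall>y\<in>f ` cball x0 \<rho>2. norm y \<le> m" unfolding bounded_pos by blast
      have "\<bar>f y\<bar> \<le> m" for y
      proof (cases "y \<in> cball x0 \<rho>2")
        case True then show ?thesis using m(2)[rule_format, OF imageI[OF True]] by simp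
      next
        case False then show ?thesis using f(2)[of y] m(1) by (simp add: dist_norm norm_minus_commute)
      qed
      then show ?thesis using m(1) by blast
    qed
    have "continuous_on (cball x0 \<rho>2) (lapl \<psi>)"
      unfolding lapl_def[abs_def] by (intro continuous_on_sum d(2))
    moreover have "lapl \<psi> y = 0" if "\<rho>2 < norm (y - x0)" for y
      unfolding lapl_def using that by (simp add: pl(2))
    ultimately have "\<exists>m>0. \<forall>y. \<bar>lapl \<psi> y\<bar> \<le> m" by (rule bnd)
    then obtain m1 where m1: "m1 > 0" "\<forall>y. \<bar>lapl \<psi> y\<bar> \<le> m1" by (elim exE conjE)
    have "\<forall>i. \<exists>m>0. \<forall>y. \<bar>dderiv (axis i 1) \<psi> y\<bar> \<le> m" by (intro allI bnd d pl(1)) auto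
    then obtain m2 where m2: "\<And>i. m2 i > 0" "\<And>i y. \<bar>dderiv (axis i 1) \<psi> y\<bar> \<le> m2 i" by metis
    have "\<bar>dderiv (axis i 1) \<psi> y\<bar> \<le> m1 + (\<Sum>i\<in>UNIV. m2 i)" for i y
    proof -
      have "m2 i \<le> (\<Sum>i\<in>UNIV. m2 i)" by (rule member_le_sum) (auto intro: less_imp_le m2(1))
      then show ?thesis using m2(2)[of i y] m1(1) by linarith
    qed
    moreover have "0 \<le> (\<Sum>i\<in>UNIV. m2 i)" by (intro sum_nonneg less_imp_le m2(1))
    then have "\<bar>lapl \<psi> y\<bar> \<le> m1 + (\<Sum>i\<in>UNIV. m2 i)" for y using m1(2)[rule_format, of y] by linarith
    ultimately show thesis using that[of "m1 + (\<Sum>i\<in>UNIV. m2 i)"] m1(1) \<open>0 \<le> (\<Sum>i\<in>UNIV. m2 i)\<close> by simp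
  qed
  have der: "\<exists>L. ((\<lambda>z. \<integral>p. ?U p * kapC \<psi> T z p \<partial>lborel) has_derivative L) (at z0) \<and> (\<forall>c w. L (c *s w) = c * L w)"
    if z0: "z0 \<in> E_ball x0 \<rho>1" for z0
  proof -
    obtain a b where ab: "z0 = cvec a b" by (rule cvec_cases)
    have ab\<rho>: "norm (a - x0) + norm b < \<rho>1" using z0 by (simp add: ab cvec_in_E_ball)
    \<comment> \<open>A third of the slack: the real and imaginary parts of z each move by less than
      \<epsilon>, and the remaining \<epsilon> separates |Re z - y| from |Im z| for y in the
      annulus.\<close>
    define \<epsilon> where "\<epsilon> = (\<rho>1 - norm (a - x0) - norm b) / 3"
    have \<epsilon>: "\<epsilon> > 0" using ab\<rho> by (simp add: \<epsilon>_def)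
    obtain C0 where C0: "C0 \<ge> 0" "\<And>\<sigma>. 0 < \<sigma> \<Longrightarrow> \<sigma> \<le> T \<Longrightarrow> \<sigma> powr - (real CARD('n) / 2 + real 0) * exp (- (\<epsilon>\<^sup>2) / (4 * \<sigma>)) \<le> C0"
      using hk_line_bound[OF \<epsilon>, of T "real CARD('n) / 2 + real 0"] by blast
    obtain C1 where C1: "C1 \<ge> 0" "\<And>\<sigma>. 0 < \<sigma> \<Longrightarrow> \<sigma> \<le> T \<Longrightarrow> \<sigma> powr - (real CARD('n) / 2 + real 1) * exp (- (\<epsilon>\<^sup>2) / (4 * \<sigma>)) \<le> C1"
      using hk_line_bound[OF \<epsilon>, of T "real CARD('n) / 2 + real 1"] by blast
    obtain C2 where C2: "C2 \<ge> 0" "\<And>\<sigma>. 0 < \<sigma> \<Longrightarrow> \<sigma> \<le> T \<Longrightarrow> \<sigma> powr - (real CARD('n) / 2 + real 2) * exp (- (\<epsilon>\<^sup>2) / (4 * \<sigma>)) \<le> C2"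
      using hk_line_bound[OF \<epsilon>, of T "real CARD('n) / 2 + real 2"] by blast
    define C where "C = C0 + C1 + C2"
    have Cge: "C \<ge> 0" "C0 \<le> C" "C1 \<le> C" "C2 \<le> C" using C0(1) C1(1) C2(1) by (auto simp: C_def)
    have C: "\<sigma> powr - (real CARD('n) / 2 + real j) * exp (- (\<epsilon>\<^sup>2) / (4 * \<sigma>)) \<le> C" if "0 < \<sigma>" "\<sigma> \<le> T" "j \<in> {0,1,2}" for \<sigma> j
    proof -
      note cs = order_trans[OF C0(2)[OF that(1,2)] Cge(2)] order_trans[OF C1(2)[OF that(1,2)] Cge(3)] order_trans[OF C2(2)[OF that(1,2)] Cge(4)]
      from that(3) have "j = 0 \<or> j = 1 \<or> j = 2" by auto
      then show ?thesis
      proof (elim disjE)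
        assume "j = 0" then show ?thesis using cs(1) by (simp only:)
      next
        assume "j = 1" then show ?thesis using cs(2) by (simp only:)
      next
        assume "j = 2" then show ?thesis using cs(3) by (simp only:)
      qed
    qed
    define R where "R = norm x0 + \<rho>2 + norm z0 + \<epsilon>"
    have R: "R \<ge> 0" using \<rho> \<epsilon> by (simp add: R_def)
    define n where "n = real CARD('n)"
    define B1 where "B1 = C * M + C * (n * (M * R))"
    define B2 where "B2 = C * (n * M) + C * (n * R) * M + C * (n * R) * (n * (M * R))"
    have B0: "B1 \<ge> 0" "B2 \<ge> 0" using Cge(1) M(1) R by (auto simp: B1_def B2_def n_def intro!: add_nonneg_nonneg mult_nonneg_nonneg)
    have bounds: "cmod (kapC \<psi> T z (s, y)) \<le> B1 \<and> cmod (kapC_deriv \<psi> T z (s, y) v) \<le> B2 * norm v"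
      if z: "z \<in> ball z0 \<epsilon>" and s: "0 < s" "s < T" for z s y v
    proof (cases "norm (y - x0) < \<rho>1 \<or> \<rho>2 < norm (y - x0)")
      case True
      have "lapl \<psi> y = 0" unfolding lapl_def by (simp add: pl(2)[OF _ _ True])
      then have "kapC \<psi> T z (s, y) = 0" "kapC_deriv \<psi> T z (s, y) v = 0"
        by (simp_all add: kapC_def kapC_deriv_def pl(1)[OF _ _ True])
      then show ?thesis using B0 by simp
    next
      case False
      then have y: "\<rho>1 \<le> norm (y - x0)" "norm (y - x0) \<le> \<rho>2" by auto
      obtain a' b' where ab': "z = cvec a' b'" by (rule cvec_cases)
      have nd: "norm (cvec (a - a') (b - b')) < \<epsilon>" using z by (simp add: ab ab' dist_norm cvec_diff)
      have d: "norm (a - a') < \<epsilon>" "norm (b - b') < \<epsilon>"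
        using norm_cvec_ge(1)[of "a - a'" "b - b'"] norm_cvec_ge(2)[of "b - b'" "a - a'"] nd by linarith+
      have "norm (y - x0) \<le> norm (a' - y) + norm (a - a') + norm (a - x0)"
      proof -
        have "norm (y - x0) \<le> norm (y - a') + norm (a' - x0)" using norm_triangle_ineq[of "y - a'" "a' - x0"] by simp
        moreover have "norm (a' - x0) \<le> norm (a' - a) + norm (a - x0)" using norm_triangle_ineq[of "a' - a" "a - x0"] by simp
        ultimately show ?thesis using norm_minus_commute[of y a'] norm_minus_commute[of a a'] by linarith
      qed
      moreover have "norm b' \<le> norm b + norm (b - b')" using norm_triangle_ineq4[of b "b - b'"] by simp
      moreover have "3 * \<epsilon> = \<rho>1 - norm (a - x0) - norm b" by (simp add: \<epsilon>_def)
      \<comment> \<open>Hence Re \<open>qf\<close>, which is |Re z - y|^2 - |Im z|^2, is at least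
        \<epsilon>^2: the decay hypothesis of \<open>kapC_bounds\<close>.\<close>
      ultimately have "norm b' + \<epsilon> \<le> norm (a' - y)" using y(1) d by linarith
      then have "(norm b' + \<epsilon>)\<^sup>2 \<le> (norm (a' - y))\<^sup>2" using \<epsilon> by (intro power_mono) auto
      moreover have "(norm b')\<^sup>2 + \<epsilon>\<^sup>2 \<le> (norm b' + \<epsilon>)\<^sup>2" using \<epsilon> by (simp add: power2_sum)
      ultimately have q: "\<epsilon>\<^sup>2 \<le> Re (qf y z)" by (simp add: ab' qf_cvec)
      have Ri: "cmod (of_real (y $ i) - z $ i) \<le> R" for i
      proof -
        have "\<bar>y $ i\<bar> \<le> norm y" by (rule component_le_norm_cart)
        moreover have "norm y \<le> norm (y - x0) + norm x0" using norm_triangle_ineq[of "y - x0" x0] by simp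
        moreover have "cmod (z $ i) \<le> norm z" by (rule Finite_Cartesian_Product.norm_nth_le)
        moreover have "norm z \<le> norm z0 + norm (z0 - z)" using norm_triangle_ineq4[of z0 "z0 - z"] by simp
        moreover have "norm (z0 - z) < \<epsilon>" using z by (simp add: dist_norm)
        moreover have "cmod (of_real (y $ i) - z $ i) \<le> \<bar>y $ i\<bar> + cmod (z $ i)"
          using norm_triangle_ineq4[of "complex_of_real (y $ i)" "z $ i"] by simp
        ultimately show ?thesis using y(2) unfolding R_def by linarith
      qed
      have Cs: "(T - s) powr - (real CARD('n) / 2 + real j) * exp (- (\<epsilon>\<^sup>2) / (4 * (T - s))) \<le> C" if "j \<in> {0,1,2}" for j
        by (rule C) (use s that in auto)
      show ?thesis
        unfolding B1_def B2_def n_def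
        using kapC_bounds[OF M(2,3,1) Ri R q s(2) Cs Cge(1)] by blast
    qed
    have Um: "?U \<in> borel_measurable borel" by (rule cut_off_measurable[OF \<Omega> u])
    note hd = has_derivative_integral[where r=\<epsilon> and ?x0.0=z0 and M=lborel and k="\<lambda>z p. ?U p * kapC \<psi> T z p"
        and k'="\<lambda>z p v. ?U p * kapC_deriv \<psi> T z p v" and B="\<lambda>p. norm (?U p) * B2"]
    have "((\<lambda>z. \<integral>p. ?U p * kapC \<psi> T z p \<partial>lborel) has_derivative (\<lambda>v. \<integral>p. ?U p * kapC_deriv \<psi> T z0 p v \<partial>lborel)) (at z0)"
    proof (rule hd(1)[OF \<epsilon>])
      show "integrable lborel (\<lambda>p. norm (?U p) * B2)" by (intro integrable_mult_left integrable_norm int)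
      fix z assume z: "z \<in> ball z0 \<epsilon>"
      show "integrable lborel (\<lambda>p. ?U p * kapC \<psi> T z p)"
      proof (rule Bochner_Integration.integrable_bound[where f="\<lambda>p. norm (?U p) * B1"])
        show "integrable lborel (\<lambda>p. norm (?U p) * B1)" by (intro integrable_mult_left integrable_norm int)
        show "(\<lambda>p. ?U p * kapC \<psi> T z p) \<in> borel_measurable lborel"
          using borel_measurable_times[OF Um kapC_measurable[OF \<psi>0(1)]] by simp
        show "AE p in lborel. norm (?U p * kapC \<psi> T z p) \<le> norm (norm (?U p) * B1)"
        proof (rule AE_I2)
          fix p :: "real \<times> (real^'n)"
          show "norm (?U p * kapC \<psi> T z p) \<le> norm (norm (?U p) * B1)"
          proof (cases "p \<in> cyl T \<Omega>")
            case True
            obtain s y where p: "p = (s, y)" by fastforce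
            have "cmod (kapC \<psi> T z p) \<le> B1" unfolding p using bounds[OF z] True by (auto simp: p cyl_def)
            then show ?thesis using B0 by (simp add: norm_mult mult_left_mono)
          qed (simp add: cut_off_def)
        qed
      qed
      fix p :: "real \<times> (real^'n)"
      show "((\<lambda>z. ?U p * kapC \<psi> T z p) has_derivative (\<lambda>v. ?U p * kapC_deriv \<psi> T z p v)) (at z)"
        by (rule has_derivative_mult_right[OF kapC_has_derivative])
      fix v
      show "norm (?U p * kapC_deriv \<psi> T z p v) \<le> norm (?U p) * B2 * norm v"
      proof (cases "p \<in> cyl T \<Omega>")
        case True
        obtain s y where p: "p = (s, y)" by fastforce
        have "cmod (kapC_deriv \<psi> T z p v) \<le> B2 * norm v" unfolding p using bounds[OF z] True by (auto simp: p cyl_def)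
        then show ?thesis by (simp add: norm_mult mult.assoc mult_left_mono)
      qed (simp add: cut_off_def)
    qed
    moreover have "(\<integral>p. ?U p * kapC_deriv \<psi> T z0 p (c *s w) \<partial>lborel) = c * (\<integral>p. ?U p * kapC_deriv \<psi> T z0 p w \<partial>lborel)" for c w
    proof -
      have s1: "(\<Sum>i\<in>UNIV. f i * (c *s w) $ i) = c * (\<Sum>i\<in>UNIV. f i * w $ i)" for f :: "'n \<Rightarrow> complex"
        by (simp add: sum_distrib_left mult.left_commute)
      have "kapC_deriv \<psi> T z0 p (c *s w) = c * kapC_deriv \<psi> T z0 p w" for p
        unfolding kapC_deriv_def s1 by (simp add: algebra_simps)
      then have "?U p * kapC_deriv \<psi> T z0 p (c *s w) = c * (?U p * kapC_deriv \<psi> T z0 p w)" for p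
        by (simp add: mult.left_commute)
      then show ?thesis by (simp only: Bochner_Integration.integral_mult_right_zero)
    qed
    ultimately show ?thesis by (intro exI conjI allI)
  qed
  have "holomorphic_on_n F (E_ball x0 \<rho>1)"
    unfolding holomorphic_on_n_def
  proof
    fix z0 assume z0: "z0 \<in> E_ball x0 \<rho>1"
    from der[OF z0] obtain L where L: "((\<lambda>z. \<integral>p. ?U p * kapC \<psi> T z p \<partial>lborel) has_derivative L) (at z0)"
      "\<forall>c w. L (c *s w) = c * L w" by (elim exE conjE)
    have "(F has_derivative (\<lambda>v. L v / \<kappa>0)) (at z0)"
      unfolding F_def[abs_def] by (rule has_derivative_divide_const[OF L(1)])
    moreover have "\<forall>c w. L (c *s w) / \<kappa>0 = c * (L w / \<kappa>0)" using L(2) by simp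
    ultimately show "\<exists>L. (F has_derivative L) (at z0) \<and> (\<forall>c w. L (c *s w) = c * L w)" by (intro exI[of _ "\<lambda>v. L v / \<kappa>0"] conjI)
  qed
  then show ?thesis using real by (intro exI[of _ F] conjI allI impI)
qed

text \<open>A ball is connected; if it met both \<Omega> and the complement, it would contain a
  frontier point closer than the infimum allows.\<close>

lemma ball_infdist_subset:
  fixes \<Omega> :: "'a::real_normed_vector set"
  assumes "x \<in> \<Omega>" shows "ball x (infdist x (frontier \<Omega>)) \<subseteq> \<Omega>"
proof (rule ccontr)
  assume "\<not> ?thesis"
  then have r: "ball x (infdist x (frontier \<Omega>)) - \<Omega> \<noteq> {}" by blast
  then have "ball x (infdist x (frontier \<Omega>)) \<noteq> {}" by blast
  then have "0 < infdist x (frontier \<Omega>)" unfolding ball_eq_empty by simp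
  then have "x \<in> ball x (infdist x (frontier \<Omega>))" by simp
  then have "ball x (infdist x (frontier \<Omega>)) \<inter> \<Omega> \<noteq> {}" using assms by blast
  from connected_Int_frontier[OF convex_connected[OF convex_ball] this r]
  obtain y where "y \<in> frontier \<Omega>" "dist x y < infdist x (frontier \<Omega>)" by auto
  then show False using infdist_le[of y "frontier \<Omega>" x] by simp
qed

text \<open>\<open>infdist\<close> is 1-Lipschitz: passing from x0 to a costs at most |a - x0| of
  the distance to the frontier, and |a - x0| + |b| < \<rho>.\<close>

lemma E_ball_subset_E_dom:
  assumes "x0 \<in> \<Omega>" "\<rho> \<le> infdist x0 (frontier \<Omega>)"
  shows "E_ball x0 \<rho> \<subseteq> E_dom \<Omega>"
proof
  fix z assume z: "z \<in> E_ball x0 \<rho>"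
  obtain a b where ab: "z = cvec a b" by (rule cvec_cases)
  have n: "norm (a - x0) + norm b < \<rho>" using z by (simp add: ab cvec_in_E_ball)
  have "a \<in> ball x0 (infdist x0 (frontier \<Omega>))"
    using n assms(2) norm_ge_zero[of b] unfolding mem_ball dist_norm norm_minus_commute[of x0] by linarith
  then have "a \<in> \<Omega>" using ball_infdist_subset[OF assms(1)] by blast
  moreover have "norm b < infdist a (frontier \<Omega>)"
    using infdist_triangle[of x0 "frontier \<Omega>" a] n assms(2) unfolding dist_norm norm_minus_commute[of x0] by linarith
  ultimately show "z \<in> E_dom \<Omega>" unfolding E_dom_def ab by blast
qed

text \<open>Each z uses the local extension centred at its own real part, with radius halfway
  between |Im z| and the distance to the frontier. Two such extensions agree on the intersection of
  their domains: it is convex, and with each point it contains the real part of that point, while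
  both functions equal v at real points.\<close>

lemma holomorphic_on_n_glue:
  assumes \<Omega>: "open \<Omega>"
    and loc: "\<And>x0 \<rho>. x0 \<in> \<Omega> \<Longrightarrow> 0 < \<rho> \<Longrightarrow> \<rho> < infdist x0 (frontier \<Omega>) \<Longrightarrow>
      holomorphic_on_n (F x0 \<rho>) (E_ball x0 \<rho>) \<and> (\<forall>x. norm (x - x0) < \<rho> \<longrightarrow> F x0 \<rho> (cvec x 0) = v x)"
    and fr: "frontier \<Omega> \<noteq> {}"
  shows "\<exists>f. holomorphic_on_n f (E_dom \<Omega>) \<and> (\<forall>x\<in>\<Omega>. f (cvec x 0) = v x)"
proof -
  define X where "X z = (\<chi> i. Re (z $ i))" for z :: "complex^'a"
  define Y where "Y z = (\<chi> i. Im (z $ i))" for z :: "complex^'a"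
  have XY: "X (cvec a b) = a" "Y (cvec a b) = b" for a b by (simp_all add: X_def Y_def cvec_def vec_eq_iff)
  have zXY: "z = cvec (X z) (Y z)" for z unfolding X_def Y_def by (rule cvec_Re_Im)
  define r where "r z = (norm (Y z) + infdist (X z) (frontier \<Omega>)) / 2" for z
  define f where "f z = F (X z) (r z) z" for z
  have E: "X z \<in> \<Omega>" "norm (Y z) < infdist (X z) (frontier \<Omega>)" if "z \<in> E_dom \<Omega>" for z
    using that unfolding E_dom_def by (auto simp: XY)
  have r: "0 < r z" "norm (Y z) < r z" "r z < infdist (X z) (frontier \<Omega>)" if "z \<in> E_dom \<Omega>" for z
  proof -
    have "0 < (a + b) / 2 \<and> a < (a + b) / 2 \<and> (a + b) / 2 < b" if "0 \<le> a" "a < b" for a b :: real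
      using that by simp
    from this[OF norm_ge_zero E(2)[OF that], folded r_def]
    show "0 < r z" "norm (Y z) < r z" "r z < infdist (X z) (frontier \<Omega>)" by simp_all
  qed
  have zin: "z \<in> E_ball (X z) (r z)" if "z \<in> E_dom \<Omega>" for z
    using r(2)[OF that] by (subst zXY) (simp only: cvec_in_E_ball XY, simp)
  have agree: "f w = F (X z) (r z) w" if z: "z \<in> E_dom \<Omega>" and w: "w \<in> E_ball (X z) (r z)" for z w
  proof -
    have wE: "w \<in> E_dom \<Omega>" using E_ball_subset_E_dom[OF E(1)[OF z] less_imp_le[OF r(3)[OF z]]] w by blast
    let ?C = "E_ball (X z) (r z) \<inter> E_ball (X w) (r w)"
    have lz: "holomorphic_on_n (F (X z) (r z)) (E_ball (X z) (r z))" "\<And>x. norm (x - X z) < r z \<Longrightarrow> F (X z) (r z) (cvec x 0) = v x"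
      using loc[OF E(1)[OF z] r(1,3)[OF z]] by auto
    have lw: "holomorphic_on_n (F (X w) (r w)) (E_ball (X w) (r w))" "\<And>x. norm (x - X w) < r w \<Longrightarrow> F (X w) (r w) (cvec x 0) = v x"
      using loc[OF E(1)[OF wE] r(1,3)[OF wE]] by auto
    have "F (X w) (r w) (cvec (X w) (Y w)) = F (X z) (r z) (cvec (X w) (Y w))"
    proof (rule identity_real_points[of ?C])
      show "convex ?C" "open ?C" by (intro convex_Int convex_E_ball open_Int open_E_ball)+
      show "line_holo (F (X w) (r w)) ?C" by (rule line_holo_subset[OF line_holo_holomorphic[OF lw(1)]]) blast
      show "line_holo (F (X z) (r z)) ?C" by (rule line_holo_subset[OF line_holo_holomorphic[OF lz(1)]]) blast
      show "F (X w) (r w) (cvec x 0) = F (X z) (r z) (cvec x 0)" if "cvec x 0 \<in> ?C" for x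
        using that lw(2)[of x] lz(2)[of x] by (simp add: cvec_in_E_ball)
      show "cvec (X w) (Y w) \<in> ?C" using w zin[OF wE] unfolding zXY[of w, symmetric] by blast
      then show "cvec (X w) 0 \<in> ?C"
        using norm_ge_zero[of "Y w"] r(1)[OF wE] unfolding Int_iff cvec_in_E_ball norm_zero
          by simp (use norm_ge_zero[of "Y w"] in linarith)
    qed
    then show ?thesis unfolding f_def zXY[of w, symmetric] .
  qed
  have "holomorphic_on_n f (E_dom \<Omega>)"
    unfolding holomorphic_on_n_def
  proof
    fix z assume z: "z \<in> E_dom \<Omega>"
    have "holomorphic_on_n (F (X z) (r z)) (E_ball (X z) (r z))" using loc[OF E(1)[OF z] r(1,3)[OF z]] by blast
    from bspec[OF this[unfolded holomorphic_on_n_def] zin[OF z]]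
    obtain L where L: "(F (X z) (r z) has_derivative L) (at z)" "\<forall>c w. L (c *s w) = c * L w" by (elim exE conjE)
    have "(f has_derivative L) (at z)"
      using has_derivative_cong_open[where f=f and g="F (X z) (r z)", OF open_E_ball zin[OF z] agree[OF z]] L(1) by simp
    then show "\<exists>L. (f has_derivative L) (at z) \<and> (\<forall>c w. L (c *s w) = c * L w)" using L(2) by (intro exI conjI)
  qed
  moreover have "f (cvec x 0) = v x" if x: "x \<in> \<Omega>" for x
  proof -
    have "x \<notin> frontier \<Omega>" using x \<Omega> by (simp add: frontier_def interior_open)
    then have d: "infdist x (frontier \<Omega>) > 0" using fr by (simp add: infdist_pos_not_in_closed)
    then have rr: "0 < r (cvec x 0)" "r (cvec x 0) < infdist x (frontier \<Omega>)" by (simp_all add: r_def XY)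
    show ?thesis using loc[OF x rr] rr(1) by (simp add: f_def XY)
  qed
  ultimately show ?thesis by (intro exI[of _ f] conjI ballI)
qed

text \<open>Smoothness of u on (0, T] \<times> \<Omega> enters as continuity up to time T; the local
  extensions then exist around every point of \<Omega>, for every radius below its distance to the
  frontier.\<close>

lemma reachable_holomorphic:
  fixes \<Omega> :: "(real^'n::finite) set"
  assumes \<Omega>: "bounded_lipschitz_domain \<Omega>" and T: "0 < T" and v: "v \<in> reachable_set T \<Omega>"
  shows "v \<in> holo_restrictions \<Omega> (E_dom \<Omega>)"
proof -
  have o: "open \<Omega>" and b: "bounded \<Omega>" and ne: "\<Omega> \<noteq> {}" using \<Omega> by (auto simp: bounded_lipschitz_domain_def)
  obtain h u where hu: "heat_solution T \<Omega> (\<lambda>x. 0) h u" "smooth_on ({0<..T} \<times> \<Omega>) u" "\<forall>x\<in>\<Omega>. v x = u (T, x)"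
    using v unfolding reachable_set_def reachable_from_def mem_Collect_eq by (elim exE bexE conjE)
  have cont: "continuous_on ({0<..T} \<times> \<Omega>) u"
  proof -
    obtain W g where W: "open W" "{0<..T} \<times> \<Omega> \<subseteq> W" "\<forall>k. Ck_on k W g" "\<forall>x\<in>{0<..T} \<times> \<Omega>. g x = u x"
      using hu(2) unfolding smooth_on_def by (elim exE conjE)
    have "continuous_on ({0<..T} \<times> \<Omega>) g"
      by (rule continuous_on_subset[OF Ck_on_continuous[OF W(3)[rule_format, of 0]] W(2)])
    then show ?thesis using W(4) by (simp cong: continuous_on_cong)
  qed
  have int: "integrable lborel (cut_off T \<Omega> u)"
    using hu(1) by (intro cut_off_integrable o b cont) (simp add: heat_solution_def)
  have heat: "heat_equation T \<Omega> u" and init: "initial_value \<Omega> u (\<lambda>x. 0)"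
    using hu(1) by (simp_all add: heat_solution_def)
  have "\<exists>F. holomorphic_on_n F (E_ball x0 \<rho>) \<and> (\<forall>x. norm (x - x0) < \<rho> \<longrightarrow> F (cvec x 0) = u (T, x))"
    if x0: "x0 \<in> \<Omega>" and \<rho>: "0 < \<rho>" "\<rho> < infdist x0 (frontier \<Omega>)" for x0 \<rho>
  proof -
    \<comment> \<open>Leaves room outside the radius \<rho> for the cutoff to decay inside
      \<Omega>.\<close>
    obtain \<rho>2 where \<rho>2: "\<rho> < \<rho>2" "\<rho>2 < infdist x0 (frontier \<Omega>)" using dense[OF \<rho>(2)] by blast
    have "cball x0 \<rho>2 \<subseteq> ball x0 (infdist x0 (frontier \<Omega>))" using \<rho>2(2) by auto
    then have "cball x0 \<rho>2 \<subseteq> \<Omega>" using ball_infdist_subset[OF x0] by blast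
    then show ?thesis by (rule local_extension[OF o cont int heat init T \<rho>(1) \<rho>2(1)])
  qed
  note ex = this
  define F where "F x0 \<rho> = (SOME F. holomorphic_on_n F (E_ball x0 \<rho>) \<and>
    (\<forall>x. norm (x - x0) < \<rho> \<longrightarrow> F (cvec x 0) = u (T, x)))" for x0 \<rho>
  have F: "holomorphic_on_n (F x0 \<rho>) (E_ball x0 \<rho>) \<and> (\<forall>x. norm (x - x0) < \<rho> \<longrightarrow> F x0 \<rho> (cvec x 0) = u (T, x))"
    if "x0 \<in> \<Omega>" "0 < \<rho>" "\<rho> < infdist x0 (frontier \<Omega>)" for x0 \<rho>
    unfolding F_def by (rule someI_ex[OF ex[OF that]])
  have fr: "frontier \<Omega> \<noteq> {}"
    by (rule frontier_not_empty[OF ne]) (use b not_bounded_UNIV in auto)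
  have "\<exists>f. holomorphic_on_n f (E_dom \<Omega>) \<and> (\<forall>x\<in>\<Omega>. f (cvec x 0) = u (T, x))"
    by (rule holomorphic_on_n_glue[where F=F, OF o F fr])
  then obtain f where "holomorphic_on_n f (E_dom \<Omega>)" "\<forall>x\<in>\<Omega>. f (cvec x 0) = u (T, x)"
    by (elim exE conjE)
  with hu(3) have "holomorphic_on_n f (E_dom \<Omega>) \<and> (\<forall>x\<in>\<Omega>. v x = f (cvec x 0))" by simp
  then show ?thesis unfolding holo_restrictions_def mem_Collect_eq by (intro exI[where x=f])
qed

theorem proposition1:
  fixes \<Omega> :: "(real^'n::finite) set" and T :: real
  assumes "bounded_lipschitz_domain \<Omega>" and "0 < T"
  shows "reachable_set T \<Omega> \<subseteq> holo_restrictions \<Omega> (E_dom \<Omega>) \<and>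
    (\<forall>p. p \<notin> closure (E_dom \<Omega>) \<longrightarrow>
       (\<exists>u\<in>reachable_set T \<Omega>.
          \<forall>W. open W \<and> connected W \<and> p \<in> W \<and> (\<lambda>x. cvec x 0) ` \<Omega> \<subseteq> W \<longrightarrow>
              u \<notin> holo_restrictions \<Omega> W))"
proof (intro conjI allI impI subsetI)
  fix v assume "v \<in> reachable_set T \<Omega>"
  then show "v \<in> holo_restrictions \<Omega> (E_dom \<Omega>)" by (rule reachable_holomorphic[OF assms])
next
  fix p assume "p \<notin> closure (E_dom \<Omega>)"
  from exterior_point[OF assms(1) this] obtain y0 where y0: "y0 \<notin> closure \<Omega>" "Re (qf y0 p) \<le> 0" by (elim exE conjE)
  obtain K :: nat where K: "(\<lambda>x. \<Sum>j. exp (- (fact (j + K) * of_real ((norm (x - y0))\<^sup>2)))) \<in> reachable_set T \<Omega>"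
    by (rule reachable_lacunary[OF assms y0(1)])
  have o: "open \<Omega>" "\<Omega> \<noteq> {}" using assms(1) by (auto simp: bounded_lipschitz_domain_def)
  have y0': "y0 \<notin> \<Omega>" using y0(1) closure_subset by blast
  show "\<exists>u\<in>reachable_set T \<Omega>. \<forall>W. open W \<and> connected W \<and> p \<in> W \<and> (\<lambda>x. cvec x 0) ` \<Omega> \<subseteq> W \<longrightarrow>
              u \<notin> holo_restrictions \<Omega> W"
  proof (intro bexI[OF _ K] allI impI notI)
    fix W assume W: "open W \<and> connected W \<and> p \<in> W \<and> (\<lambda>x. cvec x 0) ` \<Omega> \<subseteq> W"
      and "(\<lambda>x. \<Sum>j. exp (- (fact (j + K) * of_real ((norm (x - y0))\<^sup>2)))) \<in> holo_restrictions \<Omega> W"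
    from this(2) obtain f where f: "holomorphic_on_n f W"
      "\<forall>x\<in>\<Omega>. (\<Sum>j. exp (- (fact (j + K) * of_real ((norm (x - y0))\<^sup>2)))) = f (cvec x 0)"
      unfolding holo_restrictions_def mem_Collect_eq by (elim exE conjE)
    have fx: "f (cvec x 0) = lac K (of_real ((norm (x - y0))\<^sup>2))" if "x \<in> \<Omega>" for x
      using bspec[OF f(2) that] unfolding lac_def by (rule sym)
    show False
      by (rule no_extension_across_cone[OF o y0' _ _ _ _ y0(2) f(1) fx]) (use W in auto)
  qed
qed

end
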